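(* Let $d\ge 1$ and let $(X_k)_{k\ge 0}$ be a stationary sequence of bounded $\mathbb{R}^d$-valued random variables with expectation $0$, defined on a probability space $(\Omega,\mathcal F,\nu)$. Put $S_0=0$ and $S_n=\sum_{k=1}^n X_k$ for $n\ge 1$. Suppose that there exist two real numbers $C\ge 1$ and $M\ge \max(1,\|X_0\|_\infty)$, an integer $r\ge 0$ and a family of real numbers $(\varphi_{p,l})_{p,l\ge 0}$ bounded by $1$ with $$\sum_{p\ge 1} p\max_{l=0,\dots,\lfloor p/(r+1)\rfloor}\varphi_{p,l}<+\infty,$$ such that: for all integers $a,b,c\ge 0$ with $1\le a+b+c\le 3$, all integers $i,j,k,p,q,l$ with $1\le i\le j\le k\le k+p\le k+p+q\le k+p+l$, all $i_1,i_2,i_3\in\{1,\dots,d\}$, and every bounded differentiable function $F:\mathbb{R}^d\times([-M;M]^d)^3\to\mathbb{R}$ with bounded differential, one has $$\left|\mathrm{Cov}_\nu\left(F(S_{i-1},X_i,X_j,X_k),\,(X_{k+p}^{(i_1)})^a(X_{k+p+q}^{(i_2)})^b(X_{k+p+l}^{(i_3)})^c\right)\right|\le C\left(\|F\|_{L^\infty}+\||DF|_\infty\|_{L^\infty}\right)\varphi_{p,l}.$$ Then the limit $$\Sigma^2:=\lim_{n\to+\infty}\frac1n\,\mathbb{E}_\nu[S_n^{\otimes 2}]$$ exists. If $\Sigma^2=0$, then the sequence $(S_n)_n$ is bounded in $L^2$. Otherwise, the sequence $\left(\frac{S_n}{\sqrt n}\right)_{n\ge1}$ converges in distribution to a Gaussian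 random variable $N$ with expectation $0$ and covariance matrix $\Sigma^2$, and there exists a real number $B>0$ such that, for every integer $n\ge 1$ and every Lipschitz continuous function $\phi:\mathbb{R}^d\to\mathbb{R}$, $$\left|\mathbb{E}_\nu\left[\phi\left(\frac{S_n}{\sqrt n}\right)\right]-\mathbb{E}[\phi(N)]\right|\le\frac{B\,L_\phi}{\sqrt n}.$$
   Context: $\mathbb{R}^d$ is endowed with the supremum norm $|\cdot|_\infty$, and for $\phi:\mathbb{R}^d\to\mathbb{R}$, $L_\phi:=\sup_{x\ne y}\frac{|\phi(x)-\phi(y)|}{|x-y|_\infty}$ is its Lipschitz constant. $X_m^{(s)}$ is the $s$-th coordinate of $X_m$; $\|X_0\|_\infty$ is the essential supremum of $|X_0|_\infty$. $\mathrm{Cov}_\nu(f,g)=\mathbb{E}_\nu[fg]-\mathbb{E}_\nu[f]\mathbb{E}_\nu[g]$. $DF$ is the Jacobian matrix of $F$ and $|DF|_\infty$ is the maximum of the absolute values of its entries. For $A=(a_1,\dots,a_d)\in\mathbb{R}^d$, $A^{\otimes 2}$ is the $d\times d$ matrix $(a_ia_j)_{i,j}$; expectations of matrices are taken entrywise. A Gaussian random variable in $\mathbb{R}^d$ is one for which $\langle\beta,N\rangle$ is, for every $\beta\in\mathbb{R}^d$, either normal or has a Dirac distribution (so degenerate covariance matrices are allowed). *)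

theory Defs
  imports "HOL-Probability.Probability"
begin

text \<open>
  \<^term>\<open>infnorm\<close> is the supremum norm on \<^typ>\<open>real ^ 'd\<close>; the dimension is \<^term>\<open>CARD('d)\<close>.
\<close>

definition stationary :: "'w measure \<Rightarrow> (nat \<Rightarrow> 'w \<Rightarrow> real ^ 'd) \<Rightarrow> bool" where
  "stationary \<nu> X \<longleftrightarrow>
     (\<forall>m. distr \<nu> (PiM UNIV (\<lambda>_. borel)) (\<lambda>\<omega> k. X (k + m) \<omega>)
        = distr \<nu> (PiM UNIV (\<lambda>_. borel)) (\<lambda>\<omega> k. X k \<omega>))"

definition partial_sum :: "(nat \<Rightarrow> 'w \<Rightarrow> real ^ 'd) \<Rightarrow> nat \<Rightarrow> 'w \<Rightarrow> real ^ 'd" where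
  "partial_sum X n \<omega> = (\<Sum>k = 1..n. X k \<omega>)"

definition cov :: "'w measure \<Rightarrow> ('w \<Rightarrow> real) \<Rightarrow> ('w \<Rightarrow> real) \<Rightarrow> real" where
  "cov \<nu> f g = (\<integral>\<omega>. f \<omega> * g \<omega> \<partial>\<nu>) - (\<integral>\<omega>. f \<omega> \<partial>\<nu>) * (\<integral>\<omega>. g \<omega> \<partial>\<nu>)"

definition outer_square :: "real ^ 'd \<Rightarrow> real ^ 'd ^ 'd" where
  "outer_square a = (\<chi> i j. a $ i * a $ j)"

definition matrix_expectation :: "'w measure \<Rightarrow> ('w \<Rightarrow> real ^ 'd ^ 'd) \<Rightarrow> real ^ 'd ^ 'd" where
  "matrix_expectation \<nu> A = (\<chi> i j. \<integral>\<omega>. A \<omega> $ i $ j \<partial>\<nu>)"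

definition covariance_matrix :: "'w measure \<Rightarrow> ('w \<Rightarrow> real ^ 'd) \<Rightarrow> real ^ 'd ^ 'd" where
  "covariance_matrix \<nu> Y = (\<chi> i j. cov \<nu> (\<lambda>\<omega>. Y \<omega> $ i) (\<lambda>\<omega>. Y \<omega> $ j))"

definition L2_bounded :: "'w measure \<Rightarrow> (nat \<Rightarrow> 'w \<Rightarrow> real ^ 'd) \<Rightarrow> bool" where
  "L2_bounded \<nu> Y \<longleftrightarrow>
     (\<exists>K. \<forall>n. integrable \<nu> (\<lambda>\<omega>. (infnorm (Y n \<omega>))\<^sup>2) \<and>
               sqrt (\<integral>\<omega>. (infnorm (Y n \<omega>))\<^sup>2 \<partial>\<nu>) \<le> K)"

definition cube :: "real \<Rightarrow> (real ^ 'd) set" where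
  "cube M = cbox (\<chi> s. - M) (\<chi> s. M)"

definition test_domain :: "real \<Rightarrow> ((real ^ 'd) \<times> (real ^ 'd) \<times> (real ^ 'd) \<times> (real ^ 'd)) set" where
  "test_domain M = UNIV \<times> cube M \<times> cube M \<times> cube M"

text \<open>
  The entries of the Jacobian of a real-valued \<open>F\<close> are the values of its derivative on the
  canonical basis. On a domain such as \<^term>\<open>test_domain M\<close> with \<open>M > 0\<close>, which has boundary points,
  the derivative is taken within the domain; it is unique there.
\<close>

definition jacobian_max :: "('a::euclidean_space \<Rightarrow> real) \<Rightarrow> 'a set \<Rightarrow> 'a \<Rightarrow> real" where
  "jacobian_max F D x = Max ((\<lambda>b. \<bar>frechet_derivative F (at x within D) b\<bar>) ` Basis)"

definition sup_norm_on :: "'a set \<Rightarrow> ('a \<Rightarrow> real) \<Rightarrow> real" where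
  "sup_norm_on D f = (SUP x\<in>D. \<bar>f x\<bar>)"

definition admissible_test :: "real \<Rightarrow> ((real ^ 'd) \<times> (real ^ 'd) \<times> (real ^ 'd) \<times> (real ^ 'd) \<Rightarrow> real) \<Rightarrow> bool" where
  "admissible_test M F \<longleftrightarrow>
     bounded (F ` test_domain M) \<and>
     F differentiable_on test_domain M \<and>
     bounded (jacobian_max F (test_domain M) ` test_domain M)"

text \<open>
  A test function is only given on its domain \<open>D\<close>, where its argument lies almost surely. Extending
  by zero makes the composition measurable and independent of the junk values of \<open>F\<close> off \<open>D\<close>.
\<close>

definition zero_off :: "'a set \<Rightarrow> ('a \<Rightarrow> real) \<Rightarrow> 'a \<Rightarrow> real" where
  "zero_off D F x = (if x \<in> D then F x else 0)"

definition gaussian_rv :: "'w measure \<Rightarrow> ('w \<Rightarrow> real ^ 'd) \<Rightarrow> bool" where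
  "gaussian_rv P N \<longleftrightarrow>
     N \<in> borel_measurable P \<and>
     (\<forall>\<beta>. (\<exists>m \<sigma>. 0 < \<sigma> \<and> distributed P lborel (\<lambda>\<omega>. \<beta> \<bullet> N \<omega>) (\<lambda>x. ennreal (normal_density m \<sigma> x))) \<or>
          (\<exists>m. distr P borel (\<lambda>\<omega>. \<beta> \<bullet> N \<omega>) = return borel m))"

text \<open>The library's \<^term>\<open>weak_conv_m\<close> only covers measures on the real line.\<close>

definition converges_in_distribution ::
  "'w measure \<Rightarrow> (nat \<Rightarrow> 'w \<Rightarrow> real ^ 'd) \<Rightarrow> 'v measure \<Rightarrow> ('v \<Rightarrow> real ^ 'd) \<Rightarrow> bool" where
  "converges_in_distribution \<nu> Y P N \<longleftrightarrow>
     (\<forall>f :: real ^ 'd \<Rightarrow> real. continuous_on UNIV f \<longrightarrow> bounded (range f) \<longrightarrow>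
        (\<lambda>n. \<integral>\<omega>. f (Y n \<omega>) \<partial>\<nu>) \<longlonglongrightarrow> (\<integral>\<omega>. f (N \<omega>) \<partial>P))"

definition lipschitz_infnorm :: "(real ^ 'd \<Rightarrow> real) \<Rightarrow> bool" where
  "lipschitz_infnorm \<phi> \<longleftrightarrow> (\<exists>L. \<forall>x y. \<bar>\<phi> x - \<phi> y\<bar> \<le> L * infnorm (x - y))"

definition lipschitz_constant :: "(real ^ 'd \<Rightarrow> real) \<Rightarrow> real" where
  "lipschitz_constant \<phi> = Sup {\<bar>\<phi> x - \<phi> y\<bar> / infnorm (x - y) | x y. x \<noteq> y}"

end

theory Submission
  imports Defs "HOL-Library.Discrete_Functions"
begin

text \<open>
  Lindeberg's method. A Lipschitz function \<open>\<phi>\<close> is smoothed by Gaussian vectors with the limiting covariance,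
  \<open>f\<^sub>m(x) = E \<phi>(x + (m + t\<^sup>2)\<^sup>1\<^sup>/\<^sup>2 N)\<close>, and \<open>E f\<^sub>0(S\<^sub>n) - f\<^sub>n(0)\<close> is telescoped into the steps
  \<open>E f\<^sub>m(S\<^sub>k) - E f\<^sub>m\<^sub>+\<^sub>1(S\<^sub>k\<^sub>-\<^sub>1)\<close> with \<open>m = n - k\<close>. The \<open>j\<close>-th derivatives of \<open>f\<^sub>m\<close> have size \<open>m\<^sup>(\<^sup>1\<^sup>-\<^sup>j\<^sup>)\<^sup>/\<^sup>2\<close>.
  Every step is expanded to fourth order; the past sum is moved away from the later variables by
  telescoping, but only within a window of length \<open>m\<^sup>1\<^sup>/\<^sup>2\<close>, beyond which decorrelation alone suffices. This
  is why the first moment of the mixing coefficients is enough. The second-order terms cancel against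
  the Gaussian ones. The remaining third-order terms \<open>E D\<^sup>3f\<^sub>m(S\<^sub>k\<^sub>-\<^sub>1)\<close> are compared with their Gaussian
  counterparts, of size \<open>1/n\<close>, by induction on \<open>n\<close>, because \<open>D\<^sup>3f\<^sub>m\<close> is itself Lipschitz with constant \<open>m\<^sup>-\<^sup>3\<^sup>/\<^sup>2\<close>.
\<close>

section \<open>Gaussian smoothing\<close>

text \<open>The bound is proved for the unnormalised sums: the laws of \<open>S n\<close> and of
  sqrt(n) N stay within a fixed Wasserstein distance, and rescaling the test function turns this
  into the rate. In this form the claim for shorter sums applies to every Lipschitz function, in
  particular to third derivatives of smoothed test functions. The induction closes because the
  initial variance \<open>t0\<^sup>2\<close> is free. The Lipschitz constants of those third
  derivatives, summed from \<open>t0\<^sup>2\<close> on, are of order 1/t0, so the unknown constant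
  comes back with a factor at most 1/2 once t0 is large, while smoothing at scale t0 costs a fixed
  multiple of t0. Decorrelation requires the gap before the future variables to be R times their
  spread. Decoupling one, two and three variables in turn therefore takes nested windows t, R t and
  R (R + 1) t. A degenerate covariance allows smoothing only along its range. The second moments of
  S n differ from n times the limit by a bounded matrix, so the component of S n off the range is
  bounded in mean and may be projected away.\<close>

definition gk :: "real \<Rightarrow> 'a::euclidean_space \<Rightarrow> real" where
  "gk s z = (\<Prod>b\<in>Basis. normal_density 0 s (z \<bullet> b))"

definition gauss :: "real \<Rightarrow> 'a::euclidean_space measure" where
  "gauss s = density lborel (\<lambda>z. ennreal (gk s z))"

lemma gk_nonneg [simp]: "0 \<le> gk s z"
  by (simp add: gk_def prod_nonneg)

lemma gk_measurable [measurable]: "gk s \<in> borel_measurable borel"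
  unfolding gk_def by measurable

lemma sets_gauss [simp, measurable_cong]: "sets (gauss s) = sets borel"
  and space_gauss [simp]: "space (gauss s) = UNIV"
  by (simp_all add: gauss_def)

lemma nn_integral_gauss:
  "f \<in> borel_measurable borel \<Longrightarrow>
    (\<integral>\<^sup>+z. f z \<partial>gauss s) = (\<integral>\<^sup>+z. ennreal (gk s z) * f z \<partial>lborel)"
  unfolding gauss_def by (subst nn_integral_density) auto

text \<open>The density is a product over the coordinates, so Tonelli factorizes the integral. Total
  mass, mass of boxes, marginals and exponential moments are all read off from this.\<close>

lemma nn_integral_gauss_prod:
  fixes f :: "'a::euclidean_space \<Rightarrow> real \<Rightarrow> ennreal"
  assumes [measurable]: "\<And>b. b \<in> Basis \<Longrightarrow> f b \<in> borel_measurable borel"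
  shows "(\<integral>\<^sup>+z. (\<Prod>b\<in>Basis. f b (z \<bullet> b)) \<partial>gauss s) =
    (\<Prod>b\<in>Basis. \<integral>\<^sup>+x. ennreal (normal_density 0 s x) * f b x \<partial>lborel)"
proof -
  have "(\<integral>\<^sup>+z. (\<Prod>b\<in>Basis. f b (z \<bullet> b)) \<partial>gauss s) =
      (\<integral>\<^sup>+z. (\<Prod>b\<in>Basis. ennreal (normal_density 0 s (z \<bullet> b)) * f b (z \<bullet> b)) \<partial>lborel)"
    by (subst nn_integral_gauss)
      (auto simp: gk_def prod.distrib prod_ennreal[symmetric] intro!: nn_integral_cong)
  also have "\<dots> = (\<Prod>b\<in>Basis. \<integral>\<^sup>+x. ennreal (normal_density 0 s x) * f b x \<partial>lborel)"
    by (subst nn_integral_lborel_prod) auto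
  finally show ?thesis .
qed

lemma nn_integral_normal_density:
  "0 < s \<Longrightarrow> (\<integral>\<^sup>+x. ennreal (normal_density m s x) \<partial>lborel) = 1"
  using prob_space.emeasure_space_1[OF prob_space_normal_density, of s m]
  by (simp add: emeasure_density)

lemma prob_space_gauss: "0 < s \<Longrightarrow> prob_space (gauss s :: 'a::euclidean_space measure)"
proof
  assume s: "0 < s"
  have "emeasure (gauss s) (space (gauss s :: 'a measure)) = (\<integral>\<^sup>+z. (\<Prod>b\<in>(Basis :: 'a set). 1) \<partial>(gauss s :: 'a measure))"
    by simp
  also have "\<dots> = 1"
    by (subst nn_integral_gauss_prod) (auto simp: nn_integral_normal_density[OF s])
  finally show "emeasure (gauss s) (space (gauss s :: 'a measure)) = 1" .
qed

lemma emeasure_gauss_box: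
  fixes A :: "'a::euclidean_space \<Rightarrow> real set"
  assumes [measurable]: "\<And>b. b \<in> Basis \<Longrightarrow> A b \<in> sets borel"
  shows "emeasure (gauss s) {z. \<forall>b\<in>Basis. z \<bullet> b \<in> A b} =
    (\<Prod>b\<in>Basis. \<integral>\<^sup>+x. ennreal (normal_density 0 s x) * indicator (A b) x \<partial>lborel)"
proof -
  have "{z. \<forall>b\<in>Basis. z \<bullet> b \<in> A b} = {z \<in> space borel. \<forall>b\<in>Basis. z \<bullet> b \<in> A b}" by simp
  also have "\<dots> \<in> sets borel" by measurable
  finally have "emeasure (gauss s) {z. \<forall>b\<in>Basis. z \<bullet> b \<in> A b} =
      (\<integral>\<^sup>+z. indicator {z. \<forall>b\<in>Basis. z \<bullet> b \<in> A b} z \<partial>gauss s)"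
    by simp
  also have "\<dots> = (\<integral>\<^sup>+z. (\<Prod>b\<in>Basis. indicator (A b) (z \<bullet> b)) \<partial>gauss s)"
    by (intro nn_integral_cong) (auto simp: indicator_def prod_zero_iff)
  also have "\<dots> = (\<Prod>b\<in>Basis. \<integral>\<^sup>+x. ennreal (normal_density 0 s x) * indicator (A b) x \<partial>lborel)"
    by (subst nn_integral_gauss_prod) auto
  finally show ?thesis .
qed

lemma emeasure_gauss_coord:
  fixes b :: "'a::euclidean_space"
  assumes s: "0 < s" and b: "b \<in> Basis" and [measurable]: "A \<in> sets borel"
  shows "emeasure (gauss s) {z. z \<bullet> b \<in> A} = (\<integral>\<^sup>+x. ennreal (normal_density 0 s x) * indicator A x \<partial>lborel)"
proof -
  have "{z. z \<bullet> b \<in> A} = {z. \<forall>c\<in>Basis. z \<bullet> c \<in> (if c = b then A else UNIV)}"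
    using b by auto
  then have "emeasure (gauss s) {z. z \<bullet> b \<in> A} = (\<Prod>c\<in>Basis. \<integral>\<^sup>+x. ennreal (normal_density 0 s x) * indicator (if c = b then A else UNIV) x \<partial>lborel)"
    by (simp only:) (rule emeasure_gauss_box, auto)
  also have "\<dots> = (\<Prod>c\<in>Basis. if c = b then \<integral>\<^sup>+x. ennreal (normal_density 0 s x) * indicator A x \<partial>lborel else 1)"
    by (intro prod.cong) (auto simp: nn_integral_normal_density[OF s])
  also have "\<dots> = (\<integral>\<^sup>+x. ennreal (normal_density 0 s x) * indicator A x \<partial>lborel)"
    using b by simp
  finally show ?thesis .
qed

lemma distributed_gauss_coord:
  fixes b :: "'a::euclidean_space"
  assumes s: "0 < s" and b: "b \<in> Basis"
  shows "distributed (gauss s) lborel (\<lambda>z. z \<bullet> b) (\<lambda>x. ennreal (normal_density 0 s x))"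
  unfolding distributed_def
proof safe
  show "distr (gauss s) lborel (\<lambda>z. z \<bullet> b) = density lborel (\<lambda>x. ennreal (normal_density 0 s x))"
  proof (rule measure_eqI)
    fix A assume "A \<in> sets (distr (gauss s) lborel (\<lambda>z. z \<bullet> b))"
    then have [measurable]: "A \<in> sets borel" by simp
    have "emeasure (distr (gauss s) lborel (\<lambda>z. z \<bullet> b)) A = emeasure (gauss s) {z. z \<bullet> b \<in> A}"
      by (subst emeasure_distr) (auto simp: vimage_def)
    then show "emeasure (distr (gauss s) lborel (\<lambda>z. z \<bullet> b)) A =
        emeasure (density lborel (\<lambda>x. ennreal (normal_density 0 s x))) A"
      by (simp add: emeasure_gauss_coord[OF s b] emeasure_density)
  qed simp
qed auto

text \<open>Independence is equality of the joint law with the product of the marginals. Both are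
  compared on boxes, where the mass factorizes.\<close>

lemma indep_gauss_coord:
  assumes s: "0 < s"
  shows "prob_space.indep_vars (gauss s) (\<lambda>_. borel) (\<lambda>b z. z \<bullet> b) (Basis :: 'a::euclidean_space set)"
proof -
  interpret prob_space "gauss s :: 'a measure" by (rule prob_space_gauss[OF s])
  interpret P: product_sigma_finite "\<lambda>b::'a. distr (gauss s) borel (\<lambda>z::'a. z \<bullet> b)"
    unfolding product_sigma_finite_def
    by (auto intro!: prob_space_imp_sigma_finite prob_space_distr)
  have "distr (gauss s) (PiM Basis (\<lambda>_. borel)) (\<lambda>z. \<lambda>b\<in>Basis. z \<bullet> b) =
     PiM Basis (\<lambda>b::'a. distr (gauss s) borel (\<lambda>z. z \<bullet> b))"
  proof (rule P.PiM_eqI)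
    show "finite (Basis::'a set)" by simp
    fix A :: "'a \<Rightarrow> real set" assume "\<And>b. b \<in> Basis \<Longrightarrow> A b \<in> sets (distr (gauss s) borel (\<lambda>z. z \<bullet> b))"
    then have A[measurable]: "\<And>b. b \<in> Basis \<Longrightarrow> A b \<in> sets borel" by simp
    have "emeasure (distr (gauss s) (PiM Basis (\<lambda>_. borel)) (\<lambda>z. \<lambda>b\<in>Basis. z \<bullet> b)) (Pi\<^sub>E Basis A) =
      emeasure (gauss s) {z::'a. \<forall>b\<in>Basis. z \<bullet> b \<in> A b}"
      by (subst emeasure_distr) (auto intro!: sets_PiM_I_finite arg_cong[where f="emeasure _"] A simp: PiE_iff vimage_def)
    also have "\<dots> = (\<Prod>b\<in>Basis. emeasure (gauss s) {z::'a. z \<bullet> b \<in> A b})"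
      by (simp add: emeasure_gauss_box emeasure_gauss_coord[OF s])
    also have "\<dots> = (\<Prod>b\<in>Basis. emeasure (distr (gauss s) borel (\<lambda>z::'a. z \<bullet> b)) (A b))"
      by (intro prod.cong refl) (auto simp: emeasure_distr vimage_def)
    finally show "emeasure (distr (gauss s) (PiM Basis (\<lambda>_. borel)) (\<lambda>z. \<lambda>b\<in>Basis. z \<bullet> b)) (Pi\<^sub>E Basis A) = (\<Prod>b\<in>Basis. emeasure (distr (gauss s) borel (\<lambda>z::'a. z \<bullet> b)) (A b))" .
  qed (auto intro!: sets_PiM_cong)
  then show ?thesis
    by (subst indep_vars_iff_distr_eq_PiM) auto
qed

text \<open>A linear form is a sum of independent centred normals, and their variances add up to
  \<open>s\<^sup>2\<close> times the squared length of v.\<close>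

lemma distributed_gauss_inner:
  fixes v :: "'a::euclidean_space"
  assumes s: "0 < s" and v: "v \<noteq> 0"
  shows "distributed (gauss s) lborel (\<lambda>z. v \<bullet> z) (\<lambda>x. ennreal (normal_density 0 (s * norm v) x))"
proof -
  interpret prob_space "gauss s :: 'a measure" by (rule prob_space_gauss[OF s])
  \<comment> \<open>Coordinates with coefficient 0 would contribute Dirac laws, which have no normal
    density, so they are left out of the sum.\<close>
  define I where "I = {b\<in>Basis. v \<bullet> b \<noteq> 0}"
  have I: "finite I" "I \<noteq> {}" "I \<subseteq> Basis"
    using v euclidean_all_zero_iff[of v] by (auto simp: I_def)
  have ind: "indep_vars (\<lambda>_. borel) (\<lambda>b z. (v \<bullet> b) * (z \<bullet> b)) I"
    using indep_vars_compose2[OF indep_vars_subset[OF indep_gauss_coord[OF s] I(3)],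
        of "\<lambda>b x. (v \<bullet> b) * x" "\<lambda>_. borel"] by simp
  have "distributed (gauss s) lborel (\<lambda>z. \<Sum>b\<in>I. (v \<bullet> b) * (z \<bullet> b))
      (normal_density (\<Sum>b\<in>I. 0) (sqrt (\<Sum>b\<in>I. (\<bar>v \<bullet> b\<bar> * s)\<^sup>2)))"
  proof (rule sum_indep_normal[OF I(1,2) ind])
    fix b assume b: "b \<in> I"
    then show "0 < \<bar>v \<bullet> b\<bar> * s" using s by (simp add: I_def)
    have "distributed (gauss s) lborel (\<lambda>z. 0 + (v \<bullet> b) * (z \<bullet> b)) (normal_density (0 + (v \<bullet> b) * 0) (\<bar>v \<bullet> b\<bar> * s))"
      by (rule normal_density_affine) (use b s distributed_gauss_coord[OF s] in \<open>auto simp: I_def\<close>)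
    then show "distributed (gauss s) lborel (\<lambda>z. (v \<bullet> b) * (z \<bullet> b)) (normal_density 0 (\<bar>v \<bullet> b\<bar> * s))" by simp
  qed
  moreover have "(\<Sum>b\<in>I. (v \<bullet> b) * (z \<bullet> b)) = v \<bullet> z" for z
    by (subst euclidean_inner) (auto simp: I_def intro!: sum.mono_neutral_left)
  moreover have "sqrt (\<Sum>b\<in>I. (\<bar>v \<bullet> b\<bar> * s)\<^sup>2) = s * norm v"
  proof -
    have "(\<Sum>b\<in>I. (\<bar>v \<bullet> b\<bar> * s)\<^sup>2) = s\<^sup>2 * (\<Sum>b\<in>Basis. (v \<bullet> b) * (v \<bullet> b))"
      unfolding sum_distrib_left I_def by (intro sum.mono_neutral_cong_left) (auto simp: power2_eq_square algebra_simps)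
    also have "\<dots> = (s * norm v)\<^sup>2"
      by (simp add: euclidean_inner[symmetric] power_mult_distrib power2_norm_eq_inner)
    finally show ?thesis using s by simp
  qed
  ultimately show ?thesis by simp
qed

text \<open>Semigroup property at the level of measures: after a translation and Tonelli, the
  convolution of the densities factorizes over the coordinates and reduces to dimension one.\<close>

lemma gauss_conv:
  fixes f :: "'a::euclidean_space \<Rightarrow> ennreal"
  assumes st: "0 < s" "0 < t" and [measurable]: "f \<in> borel_measurable borel"
  shows "(\<integral>\<^sup>+z. \<integral>\<^sup>+w. f (z + w) \<partial>gauss s \<partial>gauss t) = (\<integral>\<^sup>+z. f z \<partial>gauss (sqrt (s\<^sup>2 + t\<^sup>2)))"
proof -
  have shift: "(\<integral>\<^sup>+w. g w \<partial>lborel) = (\<integral>\<^sup>+w. g (w - z) \<partial>lborel)"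
    if [measurable]: "g \<in> borel_measurable borel" for g :: "'a \<Rightarrow> ennreal" and z
  proof -
    have "(\<integral>\<^sup>+w. g w \<partial>lborel) = (\<integral>\<^sup>+w. g w \<partial>distr lborel borel ((+) (-z)))"
      by (simp only: lborel_distr_plus)
    also have "\<dots> = (\<integral>\<^sup>+w. g (w - z) \<partial>lborel)"
      by (subst nn_integral_distr) auto
    finally show ?thesis .
  qed
  have conv: "(\<integral>\<^sup>+z. ennreal (gk t z) * ennreal (gk s (w - z)) \<partial>lborel) = ennreal (gk (sqrt (s\<^sup>2 + t\<^sup>2)) w)" for w :: 'a
  proof -
    have "(\<integral>\<^sup>+z. ennreal (gk t z) * ennreal (gk s (w - z)) \<partial>lborel) =
      (\<integral>\<^sup>+z. (\<Prod>b\<in>Basis. ennreal (normal_density 0 s (w \<bullet> b - z \<bullet> b) * normal_density 0 t (z \<bullet> b))) \<partial>lborel)"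
      by (intro nn_integral_cong)
        (simp add: gk_def prod_ennreal ennreal_mult[symmetric] prod_nonneg prod.distrib inner_diff_left mult.commute)
    also have "\<dots> = (\<Prod>b\<in>Basis. \<integral>\<^sup>+y. ennreal (normal_density 0 s (w \<bullet> b - y) * normal_density 0 t y) \<partial>lborel)"
      by (subst nn_integral_lborel_prod) auto
    also have "\<dots> = (\<Prod>b\<in>Basis. ennreal (normal_density 0 (sqrt (s\<^sup>2 + t\<^sup>2)) (w \<bullet> b)))"
      by (intro prod.cong refl) (simp add: conv_normal_density_zero_mean[OF st, THEN fun_cong])
    finally show ?thesis by (simp add: gk_def prod_ennreal)
  qed
  have "(\<integral>\<^sup>+z. \<integral>\<^sup>+w. f (z + w) \<partial>gauss s \<partial>gauss t) =
    (\<integral>\<^sup>+z. ennreal (gk t z) * (\<integral>\<^sup>+w. ennreal (gk s w) * f (z + w) \<partial>lborel) \<partial>lborel)"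
    by (subst nn_integral_gauss, simp, measurable) (auto intro!: nn_integral_cong simp: nn_integral_gauss)
  also have "\<dots> = (\<integral>\<^sup>+z. (\<integral>\<^sup>+w. ennreal (gk t z) * (ennreal (gk s (w - z)) * f w) \<partial>lborel) \<partial>lborel)"
  proof (intro nn_integral_cong)
    fix z :: 'a
    have "(\<integral>\<^sup>+w. ennreal (gk s w) * f (z + w) \<partial>lborel) = (\<integral>\<^sup>+w. ennreal (gk s (w - z)) * f w \<partial>lborel)"
      by (subst shift[of _ z]) auto
    then show "ennreal (gk t z) * (\<integral>\<^sup>+w. ennreal (gk s w) * f (z + w) \<partial>lborel) =
       (\<integral>\<^sup>+w. ennreal (gk t z) * (ennreal (gk s (w - z)) * f w) \<partial>lborel)"
      by (simp add: nn_integral_cmult)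
  qed
  also have "\<dots> = (\<integral>\<^sup>+w. (\<integral>\<^sup>+z. ennreal (gk t z) * (ennreal (gk s (w - z)) * f w) \<partial>lborel) \<partial>lborel)"
    by (subst lborel_pair.Fubini') auto
  also have "\<dots> = (\<integral>\<^sup>+w. (\<integral>\<^sup>+z. ennreal (gk t z) * ennreal (gk s (w - z)) \<partial>lborel) * f w \<partial>lborel)"
    by (intro nn_integral_cong) (simp add: nn_integral_multc[symmetric] mult.assoc)
  also have "\<dots> = (\<integral>\<^sup>+z. f z \<partial>gauss (sqrt (s\<^sup>2 + t\<^sup>2)))"
    by (simp add: conv nn_integral_gauss)
  finally show ?thesis .
qed

lemma normal_density_times_exp:
  "0 < s \<Longrightarrow> normal_density 0 s x * exp (a * x) = exp (a\<^sup>2 * s\<^sup>2 / 2) * normal_density (a * s\<^sup>2) s x"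
  by (simp add: normal_density_def exp_add[symmetric] field_simps power2_eq_square)

text \<open>The Euclidean norm is at most the sum of the coordinates in absolute value, so the
  integrand is dominated by a product, and in dimension one exp (a |x|) <= exp (a x) + exp (- a x)
  only shifts the mean. Every integrability claim against a Gaussian measure below goes back to
  this.\<close>

lemma integrable_gauss_exp_norm:
  fixes c :: real
  assumes s: "0 < s"
  shows "integrable (gauss s) (\<lambda>z::'a::euclidean_space. exp (c * norm z))"
proof (rule integrableI_bounded)
  have 1: "(\<integral>\<^sup>+x. ennreal (normal_density 0 s x) * ennreal (exp (a * \<bar>x\<bar>)) \<partial>lborel) < \<infinity>" if a: "0 \<le> a" for a :: real
  proof -
    have half: "(\<integral>\<^sup>+x. ennreal (normal_density 0 s x * exp (a * x)) \<partial>lborel) < \<infinity>" for a :: real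
      by (simp add: normal_density_times_exp[OF s] ennreal_mult nn_integral_cmult nn_integral_normal_density[OF s])
    have "(\<integral>\<^sup>+x. ennreal (normal_density 0 s x) * ennreal (exp (a * \<bar>x\<bar>)) \<partial>lborel) \<le>
       (\<integral>\<^sup>+x. ennreal (normal_density 0 s x * exp (a * x)) + ennreal (normal_density 0 s x * exp ((-a) * x)) \<partial>lborel)"
      by (intro nn_integral_mono)
        (auto simp: ennreal_mult[symmetric] ennreal_plus[symmetric] abs_if distrib_left[symmetric] simp del: ennreal_plus intro!: ennreal_leI mult_left_mono)
    also have "\<dots> < \<infinity>"
      using half[of a] half[of "-a"] by (subst nn_integral_add) auto
    finally show ?thesis .
  qed
  have "(\<integral>\<^sup>+z. ennreal (norm (exp (c * norm z))) \<partial>(gauss s :: 'a measure)) \<le>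
      (\<integral>\<^sup>+z. (\<Prod>b\<in>Basis. ennreal (exp (\<bar>c\<bar> * \<bar>z \<bullet> b\<bar>))) \<partial>(gauss s :: 'a measure))"
  proof (intro nn_integral_mono)
    fix z :: 'a
    have "c * norm z \<le> \<bar>c\<bar> * (\<Sum>b\<in>Basis. \<bar>z \<bullet> b\<bar>)"
      by (intro mult_mono norm_le_l1) auto
    then show "ennreal (norm (exp (c * norm z))) \<le> (\<Prod>b\<in>Basis. ennreal (exp (\<bar>c\<bar> * \<bar>z \<bullet> b\<bar>)))"
      by (simp add: prod_ennreal exp_sum[symmetric] sum_distrib_left)
  qed
  also have "\<dots> = (\<Prod>b\<in>(Basis::'a set). \<integral>\<^sup>+x. ennreal (normal_density 0 s x) * ennreal (exp (\<bar>c\<bar> * \<bar>x\<bar>)) \<partial>lborel)"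
    by (subst nn_integral_gauss_prod) auto
  also have "\<dots> < \<infinity>"
    using 1[of "\<bar>c\<bar>"] by (auto simp: ennreal_prod_eq_top less_top[symmetric] power_eq_top_ennreal)
  finally show "(\<integral>\<^sup>+z. ennreal (norm (exp (c * norm z))) \<partial>(gauss s :: 'a measure)) < \<infinity>" .
qed simp

lemma integrable_gauss_bound:
  fixes f :: "'a::euclidean_space \<Rightarrow> real"
  assumes "0 < s" "f \<in> borel_measurable borel" "\<And>z. \<bar>f z\<bar> \<le> K * exp (c * norm z)"
  shows "integrable (gauss s) f"
  by (rule Bochner_Integration.integrable_bound[where f="\<lambda>z. K * exp (c * norm z)"])
    (use assms integrable_gauss_exp_norm[OF assms(1)] in \<open>auto intro!: order_trans[OF assms(3)]\<close>)

lemma norm_le_exp_norm: "norm z \<le> exp (norm z)" "1 \<le> exp (norm z)" "norm z ^ k \<le> exp (real k * norm z)"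
proof -
  show *: "norm z \<le> exp (norm z)" using exp_ge_add_one_self[of "norm z"] by linarith
  show "1 \<le> exp (norm z)" by simp
  show "norm z ^ k \<le> exp (real k * norm z)"
    using power_mono[OF *, of k] by (simp add: exp_of_nat_mult)
qed

lemma integrable_gauss_growth:
  fixes u :: "'a::euclidean_space \<Rightarrow> real"
  assumes "0 < s" "u \<in> borel_measurable borel" "\<And>z. \<bar>u z\<bar> \<le> a + b * norm z ^ k"
  shows "integrable (gauss s) u"
proof (rule integrable_gauss_bound[OF assms(1,2), of "\<bar>a\<bar> + \<bar>b\<bar>" "real k"])
  fix z :: 'a
  have "a + b * norm z ^ k \<le> \<bar>a\<bar> * exp (real k * norm z) + \<bar>b\<bar> * exp (real k * norm z)"
  proof (rule add_mono)
    have "\<bar>a\<bar> * 1 \<le> \<bar>a\<bar> * exp (real k * norm z)" by (intro mult_left_mono) auto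
    then show "a \<le> \<bar>a\<bar> * exp (real k * norm z)" by linarith
    have "b * norm z ^ k \<le> \<bar>b\<bar> * norm z ^ k" by (intro mult_right_mono) auto
    also have "\<dots> \<le> \<bar>b\<bar> * exp (real k * norm z)" by (intro mult_left_mono norm_le_exp_norm) auto
    finally show "b * norm z ^ k \<le> \<bar>b\<bar> * exp (real k * norm z)" .
  qed
  then show "\<bar>u z\<bar> \<le> (\<bar>a\<bar> + \<bar>b\<bar>) * exp (real k * norm z)"
    using assms(3)[of z] by (simp add: algebra_simps)
qed

lemma integrable_gauss_inner:
  assumes "0 < s"
  shows "integrable (gauss s) (\<lambda>z::'a::euclidean_space. v \<bullet> z)"
    "integrable (gauss s) (\<lambda>z::'a::euclidean_space. (v \<bullet> z) * (w \<bullet> z))"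
    "integrable (gauss s) (\<lambda>z::'a::euclidean_space. (v \<bullet> z) * (w \<bullet> z) * (x \<bullet> z))"
    "integrable (gauss s) (\<lambda>z::'a::euclidean_space. norm z)"
    "integrable (gauss s) (\<lambda>z::'a::euclidean_space. norm z ^ k)"
proof -
  have i: "\<bar>v \<bullet> z\<bar> \<le> norm v * norm z" for v z :: 'a by (rule Cauchy_Schwarz_ineq2)
  have i2: "\<bar>(v \<bullet> z) * (w \<bullet> z)\<bar> \<le> norm v * norm w * norm z ^ 2" for v w z :: 'a
    using mult_mono[OF i[of v z] i[of w z]] by (simp add: abs_mult power2_eq_square algebra_simps)
  have i3: "\<bar>(v \<bullet> z) * (w \<bullet> z) * (x \<bullet> z)\<bar> \<le> norm v * norm w * norm x * norm z ^ 3" for v w x z :: 'a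
    using mult_mono[OF i2[of v z w] i[of x z]] by (simp add: abs_mult power3_eq_cube power2_eq_square algebra_simps)
  show "integrable (gauss s) (\<lambda>z::'a. v \<bullet> z)"
    by (rule integrable_gauss_growth[OF assms, of _ 0 "norm v" 1]) (use i in auto)
  show "integrable (gauss s) (\<lambda>z::'a. (v \<bullet> z) * (w \<bullet> z))"
    by (rule integrable_gauss_growth[OF assms, of _ 0 "norm v * norm w" 2]) (use i2 in auto)
  show "integrable (gauss s) (\<lambda>z::'a. (v \<bullet> z) * (w \<bullet> z) * (x \<bullet> z))"
    by (rule integrable_gauss_growth[OF assms, of _ 0 "norm v * norm w * norm x" 3]) (use i3 in auto)
  show "integrable (gauss s) (\<lambda>z::'a. norm z)"
    by (rule integrable_gauss_growth[OF assms, of _ 0 1 1]) auto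
  show "integrable (gauss s) (\<lambda>z::'a. norm z ^ k)"
    by (rule integrable_gauss_growth[OF assms, of _ 0 1 k]) auto
qed

lemma gauss_uminus: "distr (gauss s) borel uminus = (gauss s :: 'a::euclidean_space measure)"
proof (rule measure_eqI)
  fix A :: "'a set" assume "A \<in> sets (distr (gauss s) borel uminus)"
  then have [measurable]: "A \<in> sets borel" by simp
  have l: "lborel = distr lborel borel (uminus :: 'a \<Rightarrow> 'a)"
    using lborel_affine[of "-1" "0::'a"] by (simp add: density_1)
  have "emeasure (distr (gauss s) borel uminus) A = (\<integral>\<^sup>+z. indicator A (- z) \<partial>gauss s)"
    by (subst nn_integral_indicator[symmetric], simp, subst nn_integral_distr) auto
  also have "\<dots> = (\<integral>\<^sup>+z. ennreal (gk s z) * indicator A (- z) \<partial>lborel)"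
    by (subst nn_integral_gauss) auto
  also have "\<dots> = (\<integral>\<^sup>+z. ennreal (gk s z) * indicator A (- z) \<partial>distr lborel borel uminus)"
    using l by simp
  also have "\<dots> = (\<integral>\<^sup>+z. ennreal (gk s z) * indicator A z \<partial>lborel)"
    by (subst nn_integral_distr) (auto simp: gk_def normal_density_def)
  also have "\<dots> = emeasure (gauss s) A"
    by (subst nn_integral_gauss[symmetric]) auto
  finally show "emeasure (distr (gauss s) borel uminus) A = emeasure (gauss s) A" .
qed simp

lemma gauss_odd:
  fixes f :: "'a::euclidean_space \<Rightarrow> real"
  assumes [measurable]: "f \<in> borel_measurable borel" and "\<And>z. f (- z) = - f z"
  shows "(\<integral>z. f z \<partial>gauss s) = 0"
proof -
  have "(\<integral>z. f z \<partial>gauss s) = (\<integral>z. f z \<partial>distr (gauss s) borel uminus)"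
    by (simp add: gauss_uminus)
  also have "\<dots> = (\<integral>z. - f z \<partial>gauss s)"
    by (subst integral_distr) (auto simp: assms(2))
  finally show ?thesis by simp
qed

text \<open>The case v = w is the variance of a normal variable; the general case follows by
  polarization.\<close>

lemma gauss_second_moment:
  assumes s: "0 < s"
  shows "(\<integral>z. (v \<bullet> z) * (w \<bullet> z) \<partial>gauss s) = s\<^sup>2 * (v \<bullet> (w::'a::euclidean_space))"
proof -
  interpret prob_space "gauss s :: 'a measure" by (rule prob_space_gauss[OF s])
  have sq: "(\<integral>z. (v \<bullet> z) * (v \<bullet> z) \<partial>gauss s) = s\<^sup>2 * (v \<bullet> v)" for v :: 'a
  proof (cases "v = 0")
    case False
    have E: "expectation (\<lambda>z. v \<bullet> z) = 0" by (rule gauss_odd) auto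
    have "variance (\<lambda>z. v \<bullet> z) = (s * norm v)\<^sup>2"
      by (rule normal_distributed_variance[OF _ distributed_gauss_inner[OF s False]]) (use s False in auto)
    then show ?thesis by (simp add: E power2_eq_square dot_square_norm algebra_simps)
  qed simp
  have "(\<integral>z. ((v + w) \<bullet> z) * ((v + w) \<bullet> z) \<partial>gauss s) =
     (\<integral>z. (v \<bullet> z) * (v \<bullet> z) + 2 * ((v \<bullet> z) * (w \<bullet> z)) + (w \<bullet> z) * (w \<bullet> z) \<partial>gauss s)"
    by (intro Bochner_Integration.integral_cong) (auto simp: inner_add_left algebra_simps)
  also have "\<dots> = (\<integral>z. (v \<bullet> z) * (v \<bullet> z) \<partial>gauss s) + 2 * (\<integral>z. (v \<bullet> z) * (w \<bullet> z) \<partial>gauss s) + (\<integral>z. (w \<bullet> z) * (w \<bullet> z) \<partial>gauss s)"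
    by (simp add: integrable_gauss_inner[OF s])
  finally show ?thesis
    unfolding sq by (simp add: inner_add_left inner_add_right inner_commute algebra_simps)
qed

text \<open>Integrates |x| <= x^2 / (2 q) + q / 2 at the optimal q, the standard deviation of the
  linear form.\<close>

lemma gauss_abs_moment:
  assumes s: "0 < s"
  shows "(\<integral>z. \<bar>v \<bullet> z\<bar> \<partial>gauss s) \<le> s * norm (v::'a::euclidean_space)"
proof (cases "v = 0")
  case False
  define q where "q = s * norm v"
  have q: "0 < q" using s False by (simp add: q_def)
  have "(\<integral>z. \<bar>v \<bullet> z\<bar> \<partial>gauss s) \<le> (\<integral>z. (1 / (2 * q)) * ((v \<bullet> z) * (v \<bullet> z)) + q / 2 \<partial>gauss s)"
  proof (rule integral_mono)
    interpret prob_space "gauss s :: 'a measure" by (rule prob_space_gauss[OF s])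
    show "integrable (gauss s) (\<lambda>z. (1 / (2 * q)) * ((v \<bullet> z) * (v \<bullet> z)) + q / 2)"
      by (intro Bochner_Integration.integrable_add integrable_mult_right integrable_gauss_inner[OF s]) auto
    fix z
    have "0 \<le> (\<bar>v \<bullet> z\<bar> - q)\<^sup>2 / (2 * q)" using q by simp
    also have "\<dots> = (1 / (2 * q)) * ((v \<bullet> z) * (v \<bullet> z)) + q / 2 - \<bar>v \<bullet> z\<bar>"
      using q by (simp add: field_simps power2_eq_square)
    finally show "\<bar>v \<bullet> z\<bar> \<le> (1 / (2 * q)) * ((v \<bullet> z) * (v \<bullet> z)) + q / 2" by simp
  qed (auto intro: integrable_gauss_inner[OF s])
  also have "\<dots> = q"
  proof -
    interpret prob_space "gauss s :: 'a measure" by (rule prob_space_gauss[OF s])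
    have "(\<integral>z. (1 / (2 * q)) * ((v \<bullet> z) * (v \<bullet> z)) + q / 2 \<partial>gauss s) = (1 / (2 * q)) * (s\<^sup>2 * (v \<bullet> v)) + q / 2"
      by (subst Bochner_Integration.integral_add)
        (auto intro!: integrable_mult_right integrable_divide integrable_gauss_inner[OF s] simp: gauss_second_moment[OF s] prob_space[unfolded space_gauss])
    also have "s\<^sup>2 * (v \<bullet> v) = q\<^sup>2" by (simp add: q_def power_mult_distrib power2_norm_eq_inner)
    finally show ?thesis using q by (simp add: power2_eq_square)
  qed
  finally show ?thesis by (simp add: q_def)
qed simp

lemma gauss_scale:
  assumes c: "0 < c" and s: "0 < s"
  shows "distr (gauss s) borel (\<lambda>z. c *\<^sub>R z) = (gauss (c * s) :: 'a::euclidean_space measure)"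
proof (rule measure_eqI)
  fix A :: "'a set" assume "A \<in> sets (distr (gauss s) borel (\<lambda>z. c *\<^sub>R z))"
  then have [measurable]: "A \<in> sets borel" by simp
  have n: "ennreal (\<bar>c\<bar> ^ DIM('a)) * ennreal (gk (c * s) (c *\<^sub>R z)) = ennreal (gk s z)" for z :: 'a
  proof -
    have "normal_density 0 s x = c * normal_density 0 (c * s) (c * x)" for x
      using c s by (simp add: normal_density_def real_sqrt_mult field_simps)
    then show ?thesis
      using c by (simp add: ennreal_mult[symmetric] gk_def prod.distrib prod_nonneg)
  qed
  have "emeasure (gauss (c * s)) A = (\<integral>\<^sup>+z. ennreal (gk (c * s) z) * indicator A z \<partial>lborel)"
    by (subst nn_integral_gauss[symmetric]) auto
  also have "\<dots> = (\<integral>\<^sup>+z. ennreal (\<bar>c\<bar> ^ DIM('a)) * (ennreal (gk (c * s) (c *\<^sub>R z)) * indicator A (c *\<^sub>R z)) \<partial>lborel)"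
  proof -
    have l: "lborel = density (distr lborel borel (\<lambda>x::'a. c *\<^sub>R x)) (\<lambda>_. ennreal (\<bar>c\<bar> ^ DIM('a)))"
      using lborel_affine[of c "0::'a"] c by simp
    have "(\<integral>\<^sup>+z. ennreal (gk (c * s) z) * indicator A z \<partial>lborel) =
      (\<integral>\<^sup>+z. ennreal (gk (c * s) z) * indicator A z \<partial>density (distr lborel borel (\<lambda>x::'a. c *\<^sub>R x)) (\<lambda>_. ennreal (\<bar>c\<bar> ^ DIM('a))))"
      using l by simp
    also have "\<dots> = (\<integral>\<^sup>+z. ennreal (\<bar>c\<bar> ^ DIM('a)) * (ennreal (gk (c * s) z) * indicator A z) \<partial>distr lborel borel (\<lambda>x::'a. c *\<^sub>R x))"
      by (rule nn_integral_density) measurable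
    also have "\<dots> = (\<integral>\<^sup>+z. ennreal (\<bar>c\<bar> ^ DIM('a)) * (ennreal (gk (c * s) (c *\<^sub>R z)) * indicator A (c *\<^sub>R z)) \<partial>lborel)"
      by (rule nn_integral_distr) measurable
    finally show ?thesis .
  qed
  also have "\<dots> = (\<integral>\<^sup>+z. ennreal (gk s z) * indicator A (c *\<^sub>R z) \<partial>lborel)"
    by (simp add: n mult.assoc[symmetric])
  also have "\<dots> = (\<integral>\<^sup>+z. indicator A (c *\<^sub>R z) \<partial>gauss s)"
    by (subst nn_integral_gauss) auto
  also have "\<dots> = emeasure (distr (gauss s) borel (\<lambda>z. c *\<^sub>R z)) A"
    by (subst nn_integral_indicator[symmetric], simp, subst nn_integral_distr) auto
  finally show "emeasure (distr (gauss s) borel (\<lambda>z. c *\<^sub>R z)) A = emeasure (gauss (c * s)) A" ..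
qed simp

section \<open>Smoothing operators and their derivatives\<close>

definition gsm :: "real \<Rightarrow> ('a::euclidean_space \<Rightarrow> real) \<Rightarrow> 'a \<Rightarrow> real" where
  "gsm s u x = (\<integral>z. u (x + z) \<partial>gauss s)"

text \<open>The derivative of \<open>gsm s u\<close> in direction v after integration by parts: it
  falls on the Gaussian density, so that u only has to be Lipschitz.\<close>

definition gdr :: "real \<Rightarrow> 'a::euclidean_space \<Rightarrow> ('a \<Rightarrow> real) \<Rightarrow> 'a \<Rightarrow> real" where
  "gdr s v u x = (\<integral>z. u (x + z) * (v \<bullet> z) \<partial>gauss s) / s\<^sup>2"

lemma lipschitz_measurable:
  "L-lipschitz_on UNIV u \<Longrightarrow> (u :: 'a::euclidean_space \<Rightarrow> real) \<in> borel_measurable borel"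
  by (rule borel_measurable_continuous_onI[OF lipschitz_on_continuous_on])

lemma lipschitz_onD': "L-lipschitz_on UNIV u \<Longrightarrow> \<bar>u x - u y\<bar> \<le> L * norm (x - y)"
  for u :: "'a::euclidean_space \<Rightarrow> real"
  using lipschitz_onD[of L UNIV u x y] by (simp add: dist_norm dist_real_def)

lemma lipschitz_onI': "(\<And>x y. \<bar>u x - u y\<bar> \<le> L * norm (x - y)) \<Longrightarrow> 0 \<le> L \<Longrightarrow> L-lipschitz_on UNIV u"
  for u :: "'a::euclidean_space \<Rightarrow> real"
  by (rule lipschitz_onI) (auto simp: dist_norm dist_real_def)

lemma lipschitz_growth:
  fixes u :: "'a::euclidean_space \<Rightarrow> real"
  assumes "L-lipschitz_on UNIV u"
  shows "\<bar>u (x + z)\<bar> \<le> \<bar>u x\<bar> + L * norm z"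
  using lipschitz_onD'[OF assms, of "x + z" x] by auto

lemma integrable_gauss_lipschitz:
  fixes u :: "'a::euclidean_space \<Rightarrow> real"
  assumes s: "0 < s" and u: "L-lipschitz_on UNIV u"
  shows "integrable (gauss s) (\<lambda>z. u (x + z))" "integrable (gauss s) (\<lambda>z. u (x + z) * (v \<bullet> z))"
proof -
  note [measurable] = lipschitz_measurable[OF u]
  have L: "0 \<le> L" using u by (rule lipschitz_on_nonneg)
  show "integrable (gauss s) (\<lambda>z. u (x + z))"
    by (rule integrable_gauss_growth[OF s, of _ "\<bar>u x\<bar>" L 1]) (use lipschitz_growth[OF u] in auto)
  show "integrable (gauss s) (\<lambda>z. u (x + z) * (v \<bullet> z))"
  proof (rule integrable_gauss_bound[OF s, of _ "(\<bar>u x\<bar> + L) * norm v" 2])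
    fix z
    have "\<bar>u (x + z)\<bar> \<le> \<bar>u x\<bar> + L * norm z" by (rule lipschitz_growth[OF u])
    also have "\<dots> \<le> \<bar>u x\<bar> * exp (norm z) + L * exp (norm z)"
    proof (rule add_mono)
      show "\<bar>u x\<bar> \<le> \<bar>u x\<bar> * exp (norm z)" using mult_left_mono[OF norm_le_exp_norm(2)[of z], of "\<bar>u x\<bar>"] by simp
      show "L * norm z \<le> L * exp (norm z)" by (intro mult_left_mono norm_le_exp_norm L)
    qed
    finally have 1: "\<bar>u (x + z)\<bar> \<le> (\<bar>u x\<bar> + L) * exp (norm z)" by (simp add: algebra_simps)
    have 2: "\<bar>v \<bullet> z\<bar> \<le> norm v * exp (norm z)"
      by (rule order_trans[OF Cauchy_Schwarz_ineq2]) (intro mult_left_mono norm_le_exp_norm, simp)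
    show "\<bar>u (x + z) * (v \<bullet> z)\<bar> \<le> (\<bar>u x\<bar> + L) * norm v * exp (2 * norm z)"
      using mult_mono[OF 1 2] L by (simp add: abs_mult exp_add[symmetric] mult.assoc mult.left_commute)
  qed measurable
qed

text \<open>Cameron-Martin formula: the ratio of two translates of the density is explicit in each
  coordinate, so a translation of the argument becomes an exponential weight.\<close>

lemma gauss_shift:
  fixes u :: "'a::euclidean_space \<Rightarrow> real"
  assumes s: "0 < s" and [measurable]: "u \<in> borel_measurable borel"
  shows "(\<integral>z. u (z + h) \<partial>gauss s) = (\<integral>z. u z * exp ((h \<bullet> z) / s\<^sup>2 - (norm h)\<^sup>2 / (2 * s\<^sup>2)) \<partial>gauss s)"
proof -
  have nd: "normal_density 0 s (y - k) = normal_density 0 s y * exp (k * y / s\<^sup>2 - k\<^sup>2 / (2 * s\<^sup>2))" for y k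
    using s by (simp add: normal_density_def exp_add[symmetric] field_simps power2_eq_square)
  have gk: "gk s (z - h) = gk s z * exp ((h \<bullet> z) / s\<^sup>2 - (norm h)\<^sup>2 / (2 * s\<^sup>2))" for z
  proof -
    have "(\<Sum>b\<in>Basis. (h \<bullet> b) * (z \<bullet> b) / s\<^sup>2 - (h \<bullet> b)\<^sup>2 / (2 * s\<^sup>2)) = (h \<bullet> z) / s\<^sup>2 - (norm h)\<^sup>2 / (2 * s\<^sup>2)"
      by (subst euclidean_inner[of h z], subst power2_norm_eq_inner, subst euclidean_inner[of h h])
        (simp add: sum_subtractf sum_divide_distrib power2_eq_square)
    then show ?thesis
      by (simp add: gk_def inner_diff_left nd prod.distrib exp_sum[symmetric])
  qed
  have "(\<integral>z. u (z + h) \<partial>gauss s) = (\<integral>z. gk s z * u (z + h) \<partial>lborel)"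
    unfolding gauss_def by (subst integral_density) auto
  also have "\<dots> = (\<integral>z. gk s z * u (z + h) \<partial>distr lborel borel ((+) (-h)))"
    by (simp only: lborel_distr_plus)
  also have "\<dots> = (\<integral>z. gk s (z - h) * u z \<partial>lborel)"
    by (subst integral_distr) auto
  also have "\<dots> = (\<integral>z. gk s z * (u z * exp ((h \<bullet> z) / s\<^sup>2 - (norm h)\<^sup>2 / (2 * s\<^sup>2))) \<partial>lborel)"
    by (simp add: gk mult_ac)
  also have "\<dots> = (\<integral>z. u z * exp ((h \<bullet> z) / s\<^sup>2 - (norm h)\<^sup>2 / (2 * s\<^sup>2)) \<partial>gauss s)"
    unfolding gauss_def by (subst integral_density) auto
  finally show ?thesis .
qed

lemma exp_quadratic_bound: "\<bar>exp t - 1 - t\<bar> \<le> t\<^sup>2 * exp \<bar>t\<bar>" for t :: real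
proof -
  have "\<bar>exp t - (\<Sum>i\<le>1. t ^ i / fact i)\<bar> \<le> exp \<bar>t\<bar> * (\<bar>t\<bar> ^ Suc 1) / fact 1"
    using Taylor_exp_field[of t 1] by simp
  moreover have "(\<Sum>i\<le>1. t ^ i / fact i) = 1 + t" by (simp add: atMost_Suc)
  ultimately show ?thesis by (simp add: power2_eq_square algebra_simps)
qed

lemma has_derivative_quadratic:
  fixes f :: "'a::real_normed_vector \<Rightarrow> real"
  assumes "bounded_linear f'" and bound: "\<And>h. norm h \<le> 1 \<Longrightarrow> \<bar>f (x + h) - f x - f' h\<bar> \<le> K * (norm h)\<^sup>2"
  shows "(f has_derivative f') (at x)"
  unfolding has_derivative_at
proof (intro conjI assms(1))
  show "(\<lambda>h. norm (f (x + h) - f x - f' h) / norm h) \<midarrow>0\<rightarrow> 0"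
  proof (rule Lim_null_comparison)
    show "\<forall>\<^sub>F h in at 0. norm (norm (f (x + h) - f x - f' h) / norm h) \<le> K * norm h"
      unfolding eventually_at
    proof (intro exI[of _ 1] conjI ballI impI)
      fix h :: 'a assume "h \<noteq> 0 \<and> dist h 0 < 1"
      then have "h \<noteq> 0" "norm h \<le> 1" by (auto simp: dist_norm)
      then show "norm (norm (f (x + h) - f x - f' h) / norm h) \<le> K * norm h"
        using bound[of h] by (simp add: divide_le_eq power2_eq_square mult.assoc)
    qed simp
    show "(\<lambda>h. K * norm h) \<midarrow>0\<rightarrow> 0"
      by (rule tendsto_eq_intros refl tendsto_norm_zero tendsto_ident_at | simp)+
  qed
qed

lemma lipschitz_gsm:
  fixes u :: "'a::euclidean_space \<Rightarrow> real"
  assumes s: "0 < s" and u: "L-lipschitz_on UNIV u"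
  shows "L-lipschitz_on UNIV (gsm s u)"
proof (rule lipschitz_onI')
  interpret prob_space "gauss s :: 'a measure" by (rule prob_space_gauss[OF s])
  fix x y
  note i = integrable_gauss_lipschitz(1)[OF s u]
  have "\<bar>gsm s u x - gsm s u y\<bar> = \<bar>\<integral>z. u (x + z) - u (y + z) \<partial>gauss s\<bar>"
    by (simp add: gsm_def i)
  also have "\<dots> \<le> (\<integral>z. \<bar>u (x + z) - u (y + z)\<bar> \<partial>gauss s)"
    by (rule integral_abs_bound)
  also have "\<dots> \<le> L * norm (x - y)"
  proof (rule integral_le_const)
    show "AE z in gauss s. \<bar>u (x + z) - u (y + z)\<bar> \<le> L * norm (x - y)"
      using lipschitz_onD'[OF u, of "x + z" "y + z" for z] by simp
  qed (use i in auto)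
  finally show "\<bar>gsm s u x - gsm s u y\<bar> \<le> L * norm (x - y)" .
qed (rule lipschitz_on_nonneg[OF u])

text \<open>By \<open>gauss_shift\<close> the increment h occurs only in the exponential weight. Its
  second-order remainder is at most |h|^2 times an exponential of |z|, which is integrable against
  the linear growth of u.\<close>

lemma gsm_has_derivative:
  fixes u :: "'a::euclidean_space \<Rightarrow> real"
  assumes s: "0 < s" and u: "L-lipschitz_on UNIV u"
  shows "(gsm s u has_derivative (\<lambda>v. gdr s v u x)) (at x)"
proof -
  note [measurable] = lipschitz_measurable[OF u]
  note i = integrable_gauss_lipschitz[OF s u]
  have L: "0 \<le> L" using u by (rule lipschitz_on_nonneg)
  define c where "c = 1 / s\<^sup>2"
  have c: "0 < c" using s by (simp add: c_def)
  \<comment> \<open>Dominates the second-order remainder of the weight, uniformly over increments of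
    norm at most 1.\<close>
  define W where "W z = (c + c\<^sup>2 * exp c) * exp ((c + 2) * norm z)" for z :: 'a
  define t where "t h z = (h \<bullet> z) / s\<^sup>2 - (norm h)\<^sup>2 / (2 * s\<^sup>2)" for h z :: 'a
  have tW: "\<bar>exp (t h z) - 1 - (h \<bullet> z) / s\<^sup>2\<bar> \<le> (norm h)\<^sup>2 * W z" if h: "norm h \<le> 1" for h z
  proof -
    have t: "t h z = c * (h \<bullet> z) - c * (norm h)\<^sup>2 / 2" by (simp add: t_def c_def)
    have h2: "(norm h)\<^sup>2 \<le> norm h" using h by (simp add: power2_eq_square mult_left_le)
    have "\<bar>t h z\<bar> \<le> c * \<bar>h \<bullet> z\<bar> + c * (norm h)\<^sup>2 / 2" unfolding t using c by (auto simp: abs_mult intro!: order_trans[OF abs_triangle_ineq4])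
    also have "\<dots> \<le> c * (norm h * norm z) + c * norm h"
    proof (rule add_mono)
      show "c * \<bar>h \<bullet> z\<bar> \<le> c * (norm h * norm z)"
        using c by (intro mult_left_mono Cauchy_Schwarz_ineq2) auto
      have "(norm h)\<^sup>2 / 2 \<le> norm h" using h2 norm_ge_zero[of h] by linarith
      then show "c * (norm h)\<^sup>2 / 2 \<le> c * norm h"
        using c mult_left_mono[of "(norm h)\<^sup>2 / 2" "norm h" c] by simp
    qed
    finally have t1: "\<bar>t h z\<bar> \<le> norm h * (c * (1 + norm z))" by (simp add: algebra_simps)
    also have "\<dots> \<le> 1 * (c * (1 + norm z))" using h c by (intro mult_right_mono) auto
    finally have t2: "\<bar>t h z\<bar> \<le> c * (1 + norm z)" by simp
    have t3: "(t h z)\<^sup>2 \<le> (norm h)\<^sup>2 * (c\<^sup>2 * (1 + norm z)\<^sup>2)"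
      using power_mono[OF t1, of 2] by (simp add: power_mult_distrib)
    have e: "(1 + norm z)\<^sup>2 \<le> exp (2 * norm z)"
      using power_mono[OF exp_ge_add_one_self[of "norm z"], of 2] by (simp add: power2_eq_square exp_add[symmetric])
    have "\<bar>exp (t h z) - 1 - t h z\<bar> \<le> (t h z)\<^sup>2 * exp \<bar>t h z\<bar>" by (rule exp_quadratic_bound)
    also have "\<dots> \<le> ((norm h)\<^sup>2 * (c\<^sup>2 * exp (2 * norm z))) * exp (c * (1 + norm z))"
    proof (rule mult_mono)
      show "(t h z)\<^sup>2 \<le> (norm h)\<^sup>2 * (c\<^sup>2 * exp (2 * norm z))"
        by (rule order_trans[OF t3]) (intro mult_left_mono e, auto)
    qed (use t2 in auto)
    also have "\<dots> = (norm h)\<^sup>2 * (c\<^sup>2 * exp c * exp ((c + 2) * norm z))"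
      by (simp add: exp_add[symmetric] algebra_simps)
    finally have 1: "\<bar>exp (t h z) - 1 - t h z\<bar> \<le> (norm h)\<^sup>2 * (c\<^sup>2 * exp c * exp ((c + 2) * norm z))" .
    have "\<bar>t h z - (h \<bullet> z) / s\<^sup>2\<bar> = (norm h)\<^sup>2 * (c / 2)" using c by (simp add: t c_def)
    also have "\<dots> \<le> (norm h)\<^sup>2 * (c * exp ((c + 2) * norm z))"
    proof (intro mult_left_mono)
      have "c / 2 \<le> c * 1" using c by simp
      also have "\<dots> \<le> c * exp ((c + 2) * norm z)" using c by (intro mult_left_mono) auto
      finally show "c / 2 \<le> c * exp ((c + 2) * norm z)" .
    qed auto
    finally have 2: "\<bar>t h z - (h \<bullet> z) / s\<^sup>2\<bar> \<le> (norm h)\<^sup>2 * (c * exp ((c + 2) * norm z))" .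
    have "(norm h)\<^sup>2 * W z = (norm h)\<^sup>2 * (c\<^sup>2 * exp c * exp ((c + 2) * norm z)) + (norm h)\<^sup>2 * (c * exp ((c + 2) * norm z))"
      by (simp add: W_def algebra_simps)
    then show ?thesis using 1 2 by linarith
  qed
  define K where "K = (\<integral>z. \<bar>u (x + z)\<bar> * W z \<partial>gauss s)"
  have iK: "integrable (gauss s) (\<lambda>z. \<bar>u (x + z)\<bar> * W z)"
  proof (rule integrable_gauss_bound[OF s, of _ "(\<bar>u x\<bar> + L) * (c + c\<^sup>2 * exp c)" "c + 3"])
    fix z
    have "\<bar>u (x + z)\<bar> \<le> \<bar>u x\<bar> * 1 + L * norm z" using lipschitz_growth[OF u, of x z] by simp
    also have "\<dots> \<le> \<bar>u x\<bar> * exp (norm z) + L * exp (norm z)"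
      by (intro add_mono mult_left_mono norm_le_exp_norm L) auto
    finally have 1: "\<bar>u (x + z)\<bar> \<le> (\<bar>u x\<bar> + L) * exp (norm z)" by (simp add: algebra_simps)
    have "\<bar>u (x + z)\<bar> * W z \<le> (\<bar>u x\<bar> + L) * exp (norm z) * W z"
      by (rule mult_right_mono[OF 1]) (use c in \<open>simp add: W_def\<close>)
    also have "\<dots> = (\<bar>u x\<bar> + L) * (c + c\<^sup>2 * exp c) * exp ((c + 3) * norm z)"
    proof -
      have "exp ((c + 3) * norm z) = exp (norm z) * exp ((c + 2) * norm z)"
        by (simp add: exp_add[symmetric] algebra_simps)
      then show ?thesis by (simp add: W_def)
    qed
    finally show "\<bar>\<bar>u (x + z)\<bar> * W z\<bar> \<le> (\<bar>u x\<bar> + L) * (c + c\<^sup>2 * exp c) * exp ((c + 3) * norm z)"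
      using c by (simp add: W_def abs_mult)
  qed (simp add: W_def)
  show ?thesis
  proof (rule has_derivative_quadratic)
    show "bounded_linear (\<lambda>v. gdr s v u x)"
    proof (rule linear_conv_bounded_linear[THEN iffD1], rule linearI)
      show "gdr s (v + w) u x = gdr s v u x + gdr s w u x" for v w
        unfolding gdr_def by (simp add: inner_add_left distrib_left i add_divide_distrib)
      show "gdr s (r *\<^sub>R v) u x = r *\<^sub>R gdr s v u x" for r v
        unfolding gdr_def by (simp add: mult.left_commute[of _ r])
    qed
    fix h :: 'a assume h: "norm h \<le> 1"
    have "(\<lambda>z. (x + h) + z) = (\<lambda>z. x + (z + h))" by (auto simp: algebra_simps)
    then have "gsm s u (x + h) = (\<integral>z. u (x + (z + h)) \<partial>gauss s)"
      unfolding gsm_def by (metis (no_types, lifting) add.assoc add.commute)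
    also have "\<dots> = (\<integral>z. u (x + z) * exp (t h z) \<partial>gauss s)"
      unfolding t_def by (rule gauss_shift[OF s, of "\<lambda>z. u (x + z)"]) measurable
    finally have e1: "gsm s u (x + h) = (\<integral>z. u (x + z) * exp (t h z) \<partial>gauss s)" .
    have p: "\<bar>u (x + z) * (exp (t h z) - 1 - (h \<bullet> z) / s\<^sup>2)\<bar> \<le> (norm h)\<^sup>2 * (\<bar>u (x + z)\<bar> * W z)" for z
      using mult_left_mono[OF tW[OF h, of z], of "\<bar>u (x + z)\<bar>"] by (simp add: abs_mult mult_ac)
    have i4: "integrable (gauss s) (\<lambda>z. u (x + z) * (exp (t h z) - 1 - (h \<bullet> z) / s\<^sup>2))"
    proof (rule Bochner_Integration.integrable_bound[OF integrable_mult_right[OF iK, of "(norm h)\<^sup>2"]])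
      show "AE z in gauss s. norm (u (x + z) * (exp (t h z) - 1 - (h \<bullet> z) / s\<^sup>2)) \<le> norm ((norm h)\<^sup>2 * (\<bar>u (x + z)\<bar> * W z))"
        using p by (auto intro!: always_eventually order_trans[OF p])
    qed (simp add: t_def)
    have "(\<lambda>z. u (x + z) * exp (t h z)) =
        (\<lambda>z. u (x + z) * (exp (t h z) - 1 - (h \<bullet> z) / s\<^sup>2) + u (x + z) + u (x + z) * (h \<bullet> z) / s\<^sup>2)"
      by (auto simp: algebra_simps)
    then have "gsm s u (x + h) = (\<integral>z. u (x + z) * (exp (t h z) - 1 - (h \<bullet> z) / s\<^sup>2) + u (x + z) + u (x + z) * (h \<bullet> z) / s\<^sup>2 \<partial>gauss s)"
      by (simp only: e1)
    also have "\<dots> = (\<integral>z. u (x + z) * (exp (t h z) - 1 - (h \<bullet> z) / s\<^sup>2) \<partial>gauss s) + gsm s u x + gdr s h u x"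
      using i i4 by (simp add: gsm_def gdr_def)
    finally have "\<bar>gsm s u (x + h) - gsm s u x - gdr s h u x\<bar> = \<bar>\<integral>z. u (x + z) * (exp (t h z) - 1 - (h \<bullet> z) / s\<^sup>2) \<partial>gauss s\<bar>"
      by simp
    also have "\<dots> \<le> (\<integral>z. \<bar>u (x + z) * (exp (t h z) - 1 - (h \<bullet> z) / s\<^sup>2)\<bar> \<partial>gauss s)"
      by (rule integral_abs_bound)
    also have "\<dots> \<le> (\<integral>z. (norm h)\<^sup>2 * (\<bar>u (x + z)\<bar> * W z) \<partial>gauss s)"
      by (rule integral_mono) (use i4 iK p in auto)
    also have "\<dots> = K * (norm h)\<^sup>2" by (simp add: K_def)
    finally show "\<bar>gsm s u (x + h) - gsm s u x - gdr s h u x\<bar> \<le> K * (norm h)\<^sup>2" .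
  qed
qed

text \<open>The factor v . z has absolute moment at most s |v|, and the formula divides by
  \<open>s\<^sup>2\<close>. One factor 1/s is left, the price of a derivative.\<close>

lemma lipschitz_gdr:
  fixes u :: "'a::euclidean_space \<Rightarrow> real"
  assumes s: "0 < s" and u: "L-lipschitz_on UNIV u"
  shows "(L * norm v / s)-lipschitz_on UNIV (gdr s v u)"
proof (rule lipschitz_onI')
  have L: "0 \<le> L" using u by (rule lipschitz_on_nonneg)
  then show "0 \<le> L * norm v / s" using s by simp
  fix x y
  note i = integrable_gauss_lipschitz[OF s u]
  have "\<bar>gdr s v u x - gdr s v u y\<bar> = \<bar>\<integral>z. (u (x + z) - u (y + z)) * (v \<bullet> z) \<partial>gauss s\<bar> / s\<^sup>2"
    using s by (simp add: gdr_def i left_diff_distrib diff_divide_distrib[symmetric] abs_divide)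
  also have "\<dots> \<le> (\<integral>z. \<bar>(u (x + z) - u (y + z)) * (v \<bullet> z)\<bar> \<partial>gauss s) / s\<^sup>2"
    by (intro divide_right_mono integral_abs_bound) simp
  also have "\<dots> \<le> (\<integral>z. L * norm (x - y) * \<bar>v \<bullet> z\<bar> \<partial>gauss s) / s\<^sup>2"
  proof (intro divide_right_mono integral_mono)
    show "\<bar>(u (x + z) - u (y + z)) * (v \<bullet> z)\<bar> \<le> L * norm (x - y) * \<bar>v \<bullet> z\<bar>" for z
      using lipschitz_onD'[OF u, of "x + z" "y + z"] by (auto simp: abs_mult intro!: mult_right_mono)
  qed (use i integrable_abs[OF integrable_gauss_inner(1)[OF s, of v]] in \<open>auto simp: left_diff_distrib\<close>)
  also have "\<dots> \<le> L * norm (x - y) * (s * norm v) / s\<^sup>2"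
    using gauss_abs_moment[OF s, of v] L by (auto intro!: divide_right_mono mult_left_mono)
  also have "\<dots> = L * norm v / s * norm (x - y)" using s by (simp add: power2_eq_square)
  finally show "\<bar>gdr s v u x - gdr s v u y\<bar> \<le> L * norm v / s * norm (x - y)" .
qed

lemma lipschitz_derivative_bound:
  fixes u :: "'a::euclidean_space \<Rightarrow> real"
  assumes u: "L-lipschitz_on UNIV u" and d: "(u has_derivative u') (at x)"
  shows "\<bar>u' v\<bar> \<le> L * norm v"
proof -
  have lin: "linear u'" using d by (rule has_derivative_linear)
  have "((\<lambda>t. u (x + t *\<^sub>R v)) has_real_derivative u' v) (at 0)"
    unfolding has_field_derivative_def
    by (rule has_derivative_eq_rhs, rule has_derivative_compose[of "\<lambda>t. x + t *\<^sub>R v" _ 0 UNIV u u', OF _ ])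
      (use d lin in \<open>auto intro!: derivative_eq_intros simp: linear_cmul\<close>)
  then have "((\<lambda>h. (u (x + (0 + h) *\<^sub>R v) - u (x + 0 *\<^sub>R v)) / h) \<longlongrightarrow> u' v) (at 0)"
    by (simp add: DERIV_def)
  then have "((\<lambda>h. \<bar>(u (x + h *\<^sub>R v) - u x) / h\<bar>) \<longlongrightarrow> \<bar>u' v\<bar>) (at 0)"
    using tendsto_rabs by fastforce
  moreover have "\<forall>\<^sub>F h in at 0. \<bar>(u (x + h *\<^sub>R v) - u x) / h\<bar> \<le> L * norm v"
    unfolding eventually_at
  proof (intro exI[of _ 1] conjI ballI impI)
    fix h :: real assume "h \<noteq> 0 \<and> dist h 0 < 1"
    then show "\<bar>(u (x + h *\<^sub>R v) - u x) / h\<bar> \<le> L * norm v"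
      using lipschitz_onD'[OF u, of "x + h *\<^sub>R v" x] by (auto simp: field_simps)
  qed simp
  ultimately show ?thesis
    by (intro tendsto_upperbound) auto
qed

lemma directional_mvt:
  fixes f :: "'a::euclidean_space \<Rightarrow> real"
  assumes "\<And>x. (f has_derivative (\<lambda>v. f' v x)) (at x)"
  obtains t where "0 < t" "t < 1" "f (x + v) - f x = f' v (x + t *\<^sub>R v)"
proof -
  have der: "((\<lambda>t. f (x + t *\<^sub>R v)) has_real_derivative f' v (x + t *\<^sub>R v)) (at t)" for t
    unfolding has_field_derivative_def
    by (rule has_derivative_eq_rhs, rule has_derivative_compose[of "\<lambda>t. x + t *\<^sub>R v" _ t UNIV f "\<lambda>w. f' w (x + t *\<^sub>R v)"])
      (use assms linear_cmul[OF has_derivative_linear[OF assms]] in \<open>auto intro!: derivative_eq_intros\<close>)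
  obtain t where "0 < t" "t < 1" "f (x + 1 *\<^sub>R v) - f (x + 0 *\<^sub>R v) = (1 - 0) * f' v (x + t *\<^sub>R v)"
    using MVT2[of 0 1 "\<lambda>t. f (x + t *\<^sub>R v)" "\<lambda>t. f' v (x + t *\<^sub>R v)"] der by auto
  then show ?thesis using that by simp
qed

text \<open>Differentiation under the integral for a function that already has Lipschitz
  derivatives. In contrast to \<open>gsm_has_derivative\<close> no factor 1/s is spent.\<close>

lemma gsm_has_derivative_inside:
  fixes u :: "'a::euclidean_space \<Rightarrow> real"
  assumes s: "0 < s" and u: "L-lipschitz_on UNIV u"
    and d: "\<And>x. (u has_derivative (\<lambda>v. u' v x)) (at x)"
    and u': "\<And>v. (K * norm v)-lipschitz_on UNIV (u' v)"
  shows "(gsm s u has_derivative (\<lambda>v. gsm s (u' v) x)) (at x)"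
proof (rule has_derivative_quadratic)
  interpret prob_space "gauss s :: 'a measure" by (rule prob_space_gauss[OF s])
  have lin: "linear (\<lambda>v. u' v x)" for x using d by (rule has_derivative_linear)
  note i = integrable_gauss_lipschitz(1)[OF s u]
  note i' = integrable_gauss_lipschitz(1)[OF s u']
  \<comment> \<open>The Lipschitz hypothesis at a unit vector yields the sign of K.\<close>
  have "0 \<le> K * norm (SOME b. b \<in> (Basis :: 'a set))" using u' by (rule lipschitz_on_nonneg)
  then have K: "0 \<le> K" by (simp add: SOME_Basis)
  show "bounded_linear (\<lambda>v. gsm s (u' v) x)"
  proof (rule linear_conv_bounded_linear[THEN iffD1], rule linearI)
    show "gsm s (u' (v + w)) x = gsm s (u' v) x + gsm s (u' w) x" for v w
      unfolding gsm_def linear_add[OF lin] by (simp add: i')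
    show "gsm s (u' (r *\<^sub>R v)) x = r *\<^sub>R gsm s (u' v) x" for r v
      unfolding gsm_def linear_cmul[OF lin] by simp
  qed
  have taylor: "\<bar>u (y + h) - u y - u' h y\<bar> \<le> K * (norm h)\<^sup>2" for y h
  proof -
    obtain t where t: "0 < t" "t < 1" "u (y + h) - u y = u' h (y + t *\<^sub>R h)"
      by (rule directional_mvt[OF d])
    then have "\<bar>u (y + h) - u y - u' h y\<bar> = \<bar>u' h (y + t *\<^sub>R h) - u' h y\<bar>" by simp
    also have "\<dots> \<le> K * norm h * norm (y + t *\<^sub>R h - y)" by (rule lipschitz_onD'[OF u'])
    also have "\<dots> \<le> K * norm h * norm h" using t K by (intro mult_left_mono) (auto intro: mult_left_le_one_le)
    finally show ?thesis by (simp add: power2_eq_square)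
  qed
  fix h :: 'a
  have "\<bar>gsm s u (x + h) - gsm s u x - gsm s (u' h) x\<bar> = \<bar>\<integral>z. u (x + z + h) - u (x + z) - u' h (x + z) \<partial>gauss s\<bar>"
  proof -
    have "u (x + h + z) = u (x + z + h)" for z by (simp add: add.commute add.left_commute)
    then have ih: "integrable (gauss s) (\<lambda>z. u (x + z + h))" and e: "gsm s u (x + h) = (\<integral>z. u (x + z + h) \<partial>gauss s)"
      using i[of "x + h"] by (simp_all add: gsm_def)
    show ?thesis unfolding e by (simp add: gsm_def ih i i')
  qed
  also have "\<dots> \<le> (\<integral>z. \<bar>u (x + z + h) - u (x + z) - u' h (x + z)\<bar> \<partial>gauss s)"
    by (rule integral_abs_bound)
  also have "\<dots> \<le> K * (norm h)\<^sup>2"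
  proof (rule integral_le_const)
    have "u (x + h + z) = u (x + z + h)" for z by (simp add: add.commute add.left_commute)
    then have "integrable (gauss s) (\<lambda>z. u (x + z + h))" using i[of "x + h"] by simp
    then show "integrable (gauss s) (\<lambda>z. \<bar>u (x + z + h) - u (x + z) - u' h (x + z)\<bar>)"
      using i i' by auto
    show "AE z in gauss s. \<bar>u (x + z + h) - u (x + z) - u' h (x + z)\<bar> \<le> K * (norm h)\<^sup>2"
      by (intro always_eventually allI taylor)
  qed
  finally show "\<bar>gsm s u (x + h) - gsm s u x - gsm s (u' h) x\<bar> \<le> K * (norm h)\<^sup>2" .
qed

lemma gauss_conv_distr:
  assumes "0 < s" "0 < t"
  shows "distr (gauss t \<Otimes>\<^sub>M gauss s) borel (\<lambda>(z, w). z + w) = (gauss (sqrt (s\<^sup>2 + t\<^sup>2)) :: 'a::euclidean_space measure)"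
proof (rule measure_eqI)
  interpret S: prob_space "gauss s :: 'a measure" by (rule prob_space_gauss) fact
  fix A :: "'a set" assume "A \<in> sets (distr (gauss t \<Otimes>\<^sub>M gauss s) borel (\<lambda>(z, w). z + w))"
  then have [measurable]: "A \<in> sets borel" by simp
  have "emeasure (distr (gauss t \<Otimes>\<^sub>M gauss s) borel (\<lambda>(z, w). z + w)) A = (\<integral>\<^sup>+p. indicator A (fst p + snd p) \<partial>(gauss t \<Otimes>\<^sub>M gauss s))"
    by (subst nn_integral_indicator[symmetric], simp, subst nn_integral_distr) (auto simp: case_prod_beta)
  also have "\<dots> = (\<integral>\<^sup>+z. \<integral>\<^sup>+w. indicator A (z + w) \<partial>gauss s \<partial>gauss t)"
    by (subst S.nn_integral_fst[symmetric]) auto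
  also have "\<dots> = emeasure (gauss (sqrt (s\<^sup>2 + t\<^sup>2))) A"
    by (subst gauss_conv[OF assms]) auto
  finally show "emeasure (distr (gauss t \<Otimes>\<^sub>M gauss s) borel (\<lambda>(z, w). z + w)) A = emeasure (gauss (sqrt (s\<^sup>2 + t\<^sup>2))) A" .
qed simp

lemma gsm_gsm:
  fixes u :: "'a::euclidean_space \<Rightarrow> real"
  assumes st: "0 < s" "0 < t" and u: "L-lipschitz_on UNIV u"
  shows "(\<integral>z. gsm s u (x + z) \<partial>gauss t) = gsm (sqrt (s\<^sup>2 + t\<^sup>2)) u x"
proof -
  interpret S: prob_space "gauss s :: 'a measure" by (rule prob_space_gauss) fact
  interpret T: prob_space "gauss t :: 'a measure" by (rule prob_space_gauss) fact
  interpret pair_sigma_finite "gauss t :: 'a measure" "gauss s :: 'a measure" ..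
  note [measurable] = lipschitz_measurable[OF u]
  have r: "0 < sqrt (s\<^sup>2 + t\<^sup>2)" using st by (simp add: add_pos_pos)
  \<comment> \<open>Joint integrability, which Fubini requires, is pulled back from the law of the
    sum.\<close>
  have i: "integrable (gauss t \<Otimes>\<^sub>M gauss s) (\<lambda>p. u (x + (fst p + snd p)))"
    using integrable_gauss_lipschitz(1)[OF r u, of x]
    unfolding gauss_conv_distr[OF st, symmetric] by (subst (asm) integrable_distr_eq) (auto simp: case_prod_beta)
  have "gsm (sqrt (s\<^sup>2 + t\<^sup>2)) u x = (\<integral>p. u (x + (fst p + snd p)) \<partial>(gauss t \<Otimes>\<^sub>M gauss s))"
    unfolding gsm_def gauss_conv_distr[OF st, symmetric] by (subst integral_distr) (auto simp: case_prod_beta)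
  also have "\<dots> = (\<integral>z. \<integral>w. u (x + (z + w)) \<partial>gauss s \<partial>gauss t)"
    using integral_fst[of "\<lambda>z w. u (x + (z + w))"] i unfolding case_prod_beta by simp
  finally show ?thesis by (simp add: gsm_def add.assoc)
qed

section \<open>Symmetry of second derivatives\<close>

lemma second_difference:
  fixes f :: "'a::euclidean_space \<Rightarrow> real"
  assumes 1: "\<And>x v. (f has_derivative (\<lambda>v. f' v x)) (at x)"
    and 2: "\<And>x v. (f' v has_derivative (\<lambda>w. f'' w v x)) (at x)"
  obtains a b where "0 < a" "a < 1" "0 < b" "b < (1::real)"
    "f (x + u + v) - f (x + u) - (f (x + v) - f x) = f'' u v (x + a *\<^sub>R u + b *\<^sub>R v)"
proof -
  have "((\<lambda>y. f (y + u) - f y) has_derivative (\<lambda>v. f' v (y + u) - f' v y)) (at y)" for y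
  proof -
    have "((\<lambda>y. f (y + u)) has_derivative (\<lambda>v. f' v (y + u))) (at y)"
      by (rule has_derivative_compose[of "\<lambda>y. y + u" "\<lambda>v. v" y UNIV f, simplified]) (auto intro!: derivative_eq_intros 1)
    then show ?thesis by (intro has_derivative_diff 1)
  qed
  then obtain b where b: "0 < b" "b < 1" "(f (x + v + u) - f (x + v)) - (f (x + u) - f x) = f' v (x + b *\<^sub>R v + u) - f' v (x + b *\<^sub>R v)"
    by (rule directional_mvt[of "\<lambda>y. f (y + u) - f y" "\<lambda>v y. f' v (y + u) - f' v y" x v]) auto
  obtain a where a: "0 < a" "a < 1" "f' v (x + b *\<^sub>R v + u) - f' v (x + b *\<^sub>R v) = f'' u v (x + b *\<^sub>R v + a *\<^sub>R u)"
    by (rule directional_mvt[OF 2])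
  show ?thesis
    by (rule that[of a b]) (use a b in \<open>auto simp: algebra_simps\<close>)
qed

text \<open>Schwarz's theorem: the second difference at scale r does not depend on the order of u
  and v, so \<open>f'' u v\<close> and \<open>f'' v u\<close> take equal values at two points whose
  distance from x is of order r. Lipschitz continuity lets r tend to 0.\<close>

lemma second_derivative_symmetric:
  fixes f :: "'a::euclidean_space \<Rightarrow> real"
  assumes 1: "\<And>x. (f has_derivative (\<lambda>v. f' v x)) (at x)"
    and 2: "\<And>x v. (f' v has_derivative (\<lambda>w. f'' w v x)) (at x)"
    and 3: "\<And>u v. (K * norm u * norm v)-lipschitz_on UNIV (f'' u v)"
  shows "f'' u v x = f'' v u x"
proof -
  have lin1: "f' (r *\<^sub>R v) = (\<lambda>x. r * f' v x)" for r v
    using linear_cmul[OF has_derivative_linear[OF 1]] by auto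
  have lin2: "f'' (r *\<^sub>R u) (r *\<^sub>R v) x = r\<^sup>2 * f'' u v x" for r u v x
  proof -
    have "(f' (r *\<^sub>R v) has_derivative (\<lambda>w. r * f'' w v x)) (at x)"
      unfolding lin1 by (rule has_derivative_mult_right[OF 2])
    then have "(\<lambda>w. f'' w (r *\<^sub>R v) x) = (\<lambda>w. r * f'' w v x)"
      by (rule has_derivative_unique[OF 2])
    then have "f'' (r *\<^sub>R u) (r *\<^sub>R v) x = r * f'' (r *\<^sub>R u) v x" by (rule fun_cong)
    then show ?thesis
      using linear_cmul[OF has_derivative_linear[OF 2]] by (simp add: power2_eq_square)
  qed
  define C where "C = 2 * K * norm u * norm v * (norm u + norm v)"
  have K: "0 \<le> K * norm u * norm v" for u v :: 'a using 3 by (rule lipschitz_on_nonneg)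
  have B: "\<bar>f'' u v x - f'' v u x\<bar> \<le> r * C" if r: "0 < r" for r
  proof -
    obtain a b where ab: "0 < a" "a < 1" "0 < b" "b < 1"
      "f (x + r *\<^sub>R u + r *\<^sub>R v) - f (x + r *\<^sub>R u) - (f (x + r *\<^sub>R v) - f x) = f'' (r *\<^sub>R u) (r *\<^sub>R v) (x + a *\<^sub>R r *\<^sub>R u + b *\<^sub>R r *\<^sub>R v)"
      by (rule second_difference[OF 1 2])
    obtain a' b' where ab': "0 < a'" "a' < 1" "0 < b'" "b' < 1"
      "f (x + r *\<^sub>R v + r *\<^sub>R u) - f (x + r *\<^sub>R v) - (f (x + r *\<^sub>R u) - f x) = f'' (r *\<^sub>R v) (r *\<^sub>R u) (x + a' *\<^sub>R r *\<^sub>R v + b' *\<^sub>R r *\<^sub>R u)"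
      by (rule second_difference[OF 1 2])
    let ?p = "x + a *\<^sub>R r *\<^sub>R u + b *\<^sub>R r *\<^sub>R v" and ?q = "x + a' *\<^sub>R r *\<^sub>R v + b' *\<^sub>R r *\<^sub>R u"
    have "f (x + r *\<^sub>R v + r *\<^sub>R u) = f (x + r *\<^sub>R u + r *\<^sub>R v)" by (simp add: algebra_simps)
    then have "r\<^sup>2 * f'' u v ?p = r\<^sup>2 * f'' v u ?q" using ab(5) ab'(5) unfolding lin2 by linarith
    then have eq: "f'' u v ?p = f'' v u ?q" using r by simp
    have n: "norm (c *\<^sub>R r *\<^sub>R y + d *\<^sub>R r *\<^sub>R z) \<le> r * (norm y + norm z)" if "0 < c" "c < 1" "0 < d" "d < 1" for c d and y z :: 'a
    proof -
      have "c * r \<le> r" "d * r \<le> r" using that r by auto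
      then have "c * r * norm y \<le> r * norm y" "d * r * norm z \<le> r * norm z" by (simp_all only: mult_right_mono norm_ge_zero)
      then have "norm (c *\<^sub>R r *\<^sub>R y) + norm (d *\<^sub>R r *\<^sub>R z) \<le> r * (norm y + norm z)"
        using that r by (simp only: norm_scaleR abs_of_pos distrib_left mult.assoc)
      then show ?thesis by (intro order_trans[OF norm_triangle_ineq])
    qed
    have nm: "norm (x - (x + y + z)) = norm (y + z)" for y z :: 'a
      using norm_minus_commute[of x "x + y + z"] by (simp add: add.assoc)
    have "\<bar>f'' u v x - f'' u v ?p\<bar> \<le> K * norm u * norm v * (r * (norm u + norm v))"
      by (rule order_trans[OF lipschitz_onD'[OF 3]], rule mult_left_mono[OF _ K])
        (use n[OF ab(1-4), of u v] in \<open>simp only: nm\<close>)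
    moreover have "\<bar>f'' v u x - f'' v u ?q\<bar> \<le> K * norm v * norm u * (r * (norm v + norm u))"
      by (rule order_trans[OF lipschitz_onD'[OF 3]], rule mult_left_mono[OF _ K])
        (use n[OF ab'(1-4), of v u] in \<open>simp only: nm\<close>)
    ultimately show ?thesis unfolding eq C_def by (simp add: algebra_simps)
  qed
  have "\<bar>f'' u v x - f'' v u x\<bar> \<le> 0 + e" if "0 < e" for e
  proof -
    have "e / (\<bar>C\<bar> + 1) * C \<le> e / (\<bar>C\<bar> + 1) * (\<bar>C\<bar> + 1)" using that by (intro mult_left_mono) auto
    then show ?thesis using B[of "e / (\<bar>C\<bar> + 1)"] that by simp
  qed
  then have "\<bar>f'' u v x - f'' v u x\<bar> \<le> 0" by (rule field_le_epsilon)
  then show ?thesis by simp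
qed

text \<open>\<open>gjet j s u vs\<close> is the derivative in the directions \<open>vs\<close> of the \<open>j\<close>-fold smoothing of \<open>u\<close> at scale \<open>s\<close>; it is
  meaningful for \<open>length vs \<le> j\<close> only. Each direction uses up one of the \<open>j\<close> smoothings, which costs a
  factor \<open>1 / s\<close>.\<close>

fun gjet :: "nat \<Rightarrow> real \<Rightarrow> ('a::euclidean_space \<Rightarrow> real) \<Rightarrow> 'a list \<Rightarrow> 'a \<Rightarrow> real" where
  "gjet 0 s u vs = u"
| "gjet (Suc j) s u vs =
    (if length vs \<le> j then gsm s (gjet j s u vs) else gdr s (hd vs) (gjet j s u (tl vs)))"

lemma gjet_lipschitz:
  assumes s: "0 < s" and u: "L-lipschitz_on UNIV u" and "length vs \<le> j"
  shows "(L * prod_list (map norm vs) / s ^ length vs)-lipschitz_on UNIV (gjet j s u vs)"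
  using assms(3)
proof (induction j arbitrary: vs)
  case 0
  then show ?case using u by simp
next
  case (Suc j)
  show ?case
  proof (cases "length vs \<le> j")
    case True
    then show ?thesis using lipschitz_gsm[OF s Suc.IH] by simp
  next
    case False
    with Suc.prems obtain v ws where vs: "vs = v # ws" "length ws = j" by (cases vs) auto
    have "(L * prod_list (map norm ws) / s ^ length ws * norm v / s)-lipschitz_on UNIV (gdr s v (gjet j s u ws))"
      by (rule lipschitz_gdr[OF s Suc.IH]) (simp add: vs)
    then show ?thesis using s by (simp add: vs field_simps)
  qed
qed

text \<open>As long as a smoothing remains unspent, the outermost one is a plain average and the
  derivative passes inside. Once the directions have used up all the inner smoothings, the outermost
  one turns into \<open>gdr\<close>.\<close>

lemma gjet_has_derivative:
  assumes s: "0 < s" and u: "L-lipschitz_on UNIV u" and "length vs < j"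
  shows "(gjet j s u vs has_derivative (\<lambda>v. gjet j s u (v # vs) x)) (at x)"
  using assms(3)
proof (induction j arbitrary: vs x)
  case (Suc j)
  show ?case
  proof (cases "length vs < j")
    case True
    have "(gsm s (gjet j s u vs) has_derivative (\<lambda>v. gsm s (gjet j s u (v # vs)) x)) (at x)"
    proof (rule gsm_has_derivative_inside[where u' = "\<lambda>v. gjet j s u (v # vs)"
          and K = "L * prod_list (map norm vs) / s ^ Suc (length vs)", OF s gjet_lipschitz[OF s u] Suc.IH])
      show "(L * prod_list (map norm vs) / s ^ Suc (length vs) * norm v)-lipschitz_on UNIV (gjet j s u (v # vs))" for v
        using gjet_lipschitz[OF s u, of "v # vs" j] True by (simp add: mult_ac)
    qed (use True in auto)
    then show ?thesis using True by simp
  next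
    case False
    then show ?thesis using Suc.prems gsm_has_derivative[OF s gjet_lipschitz[OF s u], of vs j x] by simp
  qed
qed simp

text \<open>Variances add, so the iterated smoothing is a single Gaussian smoothing, of scale
  sqrt(j) s.\<close>

lemma gjet_Nil:
  assumes s: "0 < s" and u: "L-lipschitz_on UNIV u" and "0 < j"
  shows "gjet j s u [] = gsm (sqrt (real j) * s) u"
  using assms(3)
proof (induction j)
  case (Suc j)
  show ?case
  proof (cases "j = 0")
    case False
    have "gjet (Suc j) s u [] = gsm s (gsm (sqrt (real j) * s) u)"
      using Suc.IH False by simp
    also have "\<dots> = gsm (sqrt ((sqrt (real j) * s)\<^sup>2 + s\<^sup>2)) u"
      using gsm_gsm[of "sqrt (real j) * s" s L u] s False u by (auto simp: gsm_def)
    also have "sqrt ((sqrt (real j) * s)\<^sup>2 + s\<^sup>2) = sqrt (real (Suc j)) * s"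
    proof -
      have "(sqrt (real j) * s)\<^sup>2 + s\<^sup>2 = (real (Suc j)) * s\<^sup>2" by (simp add: power_mult_distrib algebra_simps)
      then show ?thesis using s by (simp add: real_sqrt_mult)
    qed
    finally show ?thesis .
  qed simp
qed simp

text \<open>The last direction is paid for by the Lipschitz constant of the jet below it. A
  derivative of order k therefore costs only k - 1 factors 1/s, which is the gain from u being
  Lipschitz.\<close>

lemma gjet_bound:
  assumes s: "0 < s" and u: "L-lipschitz_on UNIV u" and "length vs < j"
  shows "\<bar>gjet j s u (v # vs) x\<bar> \<le> L * prod_list (map norm vs) / s ^ length vs * norm v"
  by (rule lipschitz_derivative_bound[OF gjet_lipschitz[OF s u] gjet_has_derivative[OF s u]])
    (use assms in auto)

lemma gjet_symmetric:
  assumes s: "0 < s" and u: "L-lipschitz_on UNIV u" and "length vs + 2 \<le> j"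
  shows "gjet j s u (v # w # vs) x = gjet j s u (w # v # vs) x"
proof (rule second_derivative_symmetric[where f = "gjet j s u vs" and f' = "\<lambda>v. gjet j s u (v # vs)"
      and f'' = "\<lambda>w v. gjet j s u (w # v # vs)"])
  show "(L * prod_list (map norm vs) / s ^ (length vs + 2) * norm w * norm v)-lipschitz_on UNIV (gjet j s u (w # v # vs))" for w v
    using gjet_lipschitz[OF s u, of "w # v # vs" j] assms(3) by (simp add: mult_ac)
qed (use assms gjet_has_derivative[OF s u] in auto)

section \<open>Covariance bounds under mixing\<close>

text \<open>Test functions of a past sum x and of the variable y that follows it; increments of
  smooth functions and their Taylor remainders are of this kind. The derivative exists everywhere,
  but bounds are asked on the cube only, because remainders grow with y.\<close>

definition tame :: "real \<Rightarrow> real \<Rightarrow> (real ^ 'd \<Rightarrow> real ^ 'd \<Rightarrow> real) \<Rightarrow> bool" where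
  "tame M K A \<longleftrightarrow> (\<exists>Ax Ay. (\<forall>x y. ((\<lambda>p. A (fst p) (snd p)) has_derivative
      (\<lambda>h. (\<Sum>c\<in>UNIV. fst h $ c * Ax c x y) + (\<Sum>c\<in>UNIV. snd h $ c * Ay c x y))) (at (x, y))) \<and>
    (\<forall>x y. y \<in> cube M \<longrightarrow> \<bar>A x y\<bar> \<le> K \<and> (\<forall>c. \<bar>Ax c x y\<bar> \<le> K \<and> \<bar>Ay c x y\<bar> \<le> K)))"

lemma tame_continuous:
  "tame M K A \<Longrightarrow> continuous_on UNIV (\<lambda>p. A (fst p) (snd p))"
proof -
  assume A: "tame M K A"
  have "isCont (\<lambda>p. A (fst p) (snd p)) p" for p
    using A unfolding tame_def by (cases p) (auto intro: has_derivative_continuous)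
  then show ?thesis by (simp add: continuous_on_eq_continuous_at)
qed

lemma mem_cube: "y \<in> cube M \<longleftrightarrow> (\<forall>c. \<bar>y $ c\<bar> \<le> M)"
  by (auto simp: cube_def mem_box_cart abs_le_iff minus_le_iff)

lemma tame_bound: "tame M K A \<Longrightarrow> (\<And>c. \<bar>y $ c\<bar> \<le> M) \<Longrightarrow> \<bar>A x y\<bar> \<le> K"
  by (auto simp: tame_def mem_cube)

lemma tame_const: "\<bar>a\<bar> \<le> K \<Longrightarrow> tame M K (\<lambda>x y. a)"
  unfolding tame_def by (intro exI[of _ "\<lambda>c x y. 0"]) auto

text \<open>\<open>ph\<close> dominates the mixing coefficients: the gap \<open>p\<close> between past and future must be at least
  \<open>R\<close> times the spread \<open>l\<close> of the future.\<close>

locale mixing = prob_space \<nu> for \<nu> :: "'w measure" +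
  fixes X :: "nat \<Rightarrow> 'w \<Rightarrow> real ^ 'd" and C M :: real and R :: nat and ph :: "nat \<Rightarrow> real"
  assumes X_meas [measurable]: "\<And>k. X k \<in> borel_measurable \<nu>"
    and X_bound: "\<And>k \<omega> a. \<bar>X k \<omega> $ a\<bar> \<le> M"
    and M_ge: "1 \<le> M" and C_ge: "1 \<le> C" and R_ge: "1 \<le> R"
    and EX: "\<And>k a. expectation (\<lambda>\<omega>. X k \<omega> $ a) = 0"
    and ph_nonneg: "\<And>p. 0 \<le> ph p" and ph_le: "\<And>p. ph p \<le> 1" and ph_0: "ph 0 = 1"
    and ph_summable: "summable (\<lambda>p. real p * ph p)"
    and stat: "\<And>u k m a b. expectation (\<lambda>\<omega>. X (u + m) \<omega> $ b * X (k + m) \<omega> $ a) =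
        expectation (\<lambda>\<omega>. X u \<omega> $ b * X k \<omega> $ a)"
    and mix: "\<And>K A i j k e e' p q l a b c i1 i2 i3 j1 j2. tame M K A \<Longrightarrow> 1 \<le> i \<Longrightarrow> i \<le> j \<Longrightarrow> j \<le> k \<Longrightarrow>
        R * l \<le> p \<Longrightarrow> q \<le> l \<Longrightarrow> 1 \<le> a + b + c \<Longrightarrow> a + b + c \<le> 3 \<Longrightarrow> e \<le> 1 \<Longrightarrow> e' \<le> 1 \<Longrightarrow>
        \<bar>cov \<nu> (\<lambda>\<omega>. A (partial_sum X (i - 1) \<omega>) (X i \<omega>) * (X j \<omega> $ j1) ^ e * (X k \<omega> $ j2) ^ e')
          (\<lambda>\<omega>. (X (k + p) \<omega> $ i1) ^ a * (X (k + p + q) \<omega> $ i2) ^ b * (X (k + p + l) \<omega> $ i3) ^ c)\<bar>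
        \<le> C * K * ph p"
begin

section \<open>Bounded measurable functions and telescoping of covariances\<close>

abbreviation S :: "nat \<Rightarrow> 'w \<Rightarrow> real ^ 'd" where "S \<equiv> partial_sum X"

lemma S_meas [measurable]: "S n \<in> borel_measurable \<nu>"
  unfolding partial_sum_def[abs_def] by measurable

lemma S_Suc: "S (Suc n) \<omega> = S n \<omega> + X (Suc n) \<omega>"
  by (simp add: partial_sum_def)

lemma S_pred: "1 \<le> v \<Longrightarrow> S v \<omega> = S (v - 1) \<omega> + X v \<omega>"
  using S_Suc[of "v - 1" \<omega>] by simp

lemma S_0 [simp]: "S 0 \<omega> = 0" by (simp add: partial_sum_def)

lemma norm_X: "norm (X k \<omega>) \<le> real CARD('d) * M"
proof -
  have "norm (X k \<omega>) \<le> (\<Sum>a\<in>UNIV. \<bar>X k \<omega> $ a\<bar>)" by (rule norm_le_l1_cart)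
  also have "\<dots> \<le> (\<Sum>a\<in>(UNIV :: 'd set). M)" by (intro sum_mono X_bound)
  finally show ?thesis by simp
qed

lemma norm_S: "norm (S n \<omega>) \<le> real n * (real CARD('d) * M)"
proof -
  have "norm (S n \<omega>) \<le> (\<Sum>k = 1..n. norm (X k \<omega>))" unfolding partial_sum_def by (rule norm_sum)
  also have "\<dots> \<le> (\<Sum>k = 1..n. real CARD('d) * M)" by (intro sum_mono norm_X)
  finally show ?thesis by simp
qed

text \<open>For fixed n the sum S n is bounded, so every function integrated below is of this kind,
  and integrability follows from closure under the algebraic operations. The bounds grow with n and
  never enter an estimate.\<close>

definition bm :: "('w \<Rightarrow> real) \<Rightarrow> bool" where
  "bm f \<longleftrightarrow> f \<in> borel_measurable \<nu> \<and> (\<exists>B. \<forall>\<omega>. \<bar>f \<omega>\<bar> \<le> B)"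

lemma bm_integrable: "bm f \<Longrightarrow> integrable \<nu> f"
  unfolding bm_def by (elim conjE exE, rule integrable_const_bound) auto

lemma bm_const: "bm (\<lambda>\<omega>. a)" by (auto simp: bm_def)

lemma bm_add: "bm f \<Longrightarrow> bm g \<Longrightarrow> bm (\<lambda>\<omega>. f \<omega> + g \<omega>)"
proof -
  assume "bm f" "bm g"
  then obtain A B where [measurable]: "f \<in> borel_measurable \<nu>" "g \<in> borel_measurable \<nu>"
    and b: "\<And>\<omega>. \<bar>f \<omega>\<bar> \<le> A" "\<And>\<omega>. \<bar>g \<omega>\<bar> \<le> B" by (auto simp: bm_def)
  have "\<bar>f \<omega> + g \<omega>\<bar> \<le> A + B" for \<omega> using b(1)[of \<omega>] b(2)[of \<omega>] by linarith
  then show ?thesis unfolding bm_def by auto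
qed

lemma bm_mult: "bm f \<Longrightarrow> bm g \<Longrightarrow> bm (\<lambda>\<omega>. f \<omega> * g \<omega>)"
proof -
  assume "bm f" "bm g"
  then obtain A B where [measurable]: "f \<in> borel_measurable \<nu>" "g \<in> borel_measurable \<nu>"
    and b: "\<And>\<omega>. \<bar>f \<omega>\<bar> \<le> A" "\<And>\<omega>. \<bar>g \<omega>\<bar> \<le> B" by (auto simp: bm_def)
  have "\<bar>f \<omega> * g \<omega>\<bar> \<le> A * B" for \<omega>
    unfolding abs_mult using b(1)[of \<omega>] b(2)[of \<omega>] by (intro mult_mono) auto
  then show ?thesis unfolding bm_def by auto
qed

lemma bm_diff: "bm f \<Longrightarrow> bm g \<Longrightarrow> bm (\<lambda>\<omega>. f \<omega> - g \<omega>)"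
  using bm_add[of f "\<lambda>\<omega>. (-1) * g \<omega>"] bm_mult[OF bm_const[of "-1"], of g] by simp

lemma bm_sum: "(\<And>i. i \<in> I \<Longrightarrow> bm (f i)) \<Longrightarrow> bm (\<lambda>\<omega>. \<Sum>i\<in>I. f i \<omega>)"
  by (induction I rule: infinite_finite_induct) (auto intro!: bm_const bm_add)

lemma bm_power: "bm f \<Longrightarrow> bm (\<lambda>\<omega>. f \<omega> ^ n)"
  by (induction n) (auto intro!: bm_const bm_mult)

lemma bm_X: "bm (\<lambda>\<omega>. X k \<omega> $ a)"
proof -
  have "(\<lambda>x :: real ^ 'd. x $ a) \<in> borel_measurable borel"
    by (intro borel_measurable_continuous_onI continuous_intros)
  then have "(\<lambda>\<omega>. X k \<omega> $ a) \<in> borel_measurable \<nu>"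
    by (rule measurable_compose[OF X_meas])
  then show ?thesis unfolding bm_def using X_bound by blast
qed

lemma bm_S: "continuous_on UNIV g \<Longrightarrow> bm (\<lambda>\<omega>. g (S n \<omega>))" for g :: "real ^ 'd \<Rightarrow> real"
proof -
  assume g: "continuous_on UNIV g"
  note [measurable] = borel_measurable_continuous_onI[OF g]
  have "bounded (g ` cball 0 (real n * (real CARD('d) * M)))"
    by (intro compact_imp_bounded compact_continuous_image continuous_on_subset[OF g]) auto
  then obtain B where B: "\<And>x. x \<in> cball 0 (real n * (real CARD('d) * M)) \<Longrightarrow> \<bar>g x\<bar> \<le> B"
    unfolding bounded_iff by (metis imageI real_norm_def)
  have "\<bar>g (S n \<omega>)\<bar> \<le> B" for \<omega> using B norm_S[of n \<omega>] by simp
  then show ?thesis unfolding bm_def by auto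
qed

lemma bm_SX:
  fixes A :: "real ^ 'd \<Rightarrow> real ^ 'd \<Rightarrow> real"
  assumes A: "continuous_on UNIV (\<lambda>p. A (fst p) (snd p))"
  shows "bm (\<lambda>\<omega>. A (S n \<omega>) (X k \<omega>))"
proof -
  note [measurable] = borel_measurable_continuous_onI[OF A]
  have m: "(\<lambda>\<omega>. (\<lambda>p. A (fst p) (snd p)) (S n \<omega>, X k \<omega>)) \<in> borel_measurable \<nu>"
    by (rule measurable_compose[OF borel_measurable_Pair]) auto
  have "bounded ((\<lambda>p. A (fst p) (snd p)) ` (cball 0 (real n * (real CARD('d) * M)) \<times> cball 0 (real CARD('d) * M)))"
    by (intro compact_imp_bounded compact_continuous_image continuous_on_subset[OF A] compact_Times) auto
  then obtain B where B: "\<And>x y. x \<in> cball 0 (real n * (real CARD('d) * M)) \<Longrightarrow> y \<in> cball 0 (real CARD('d) * M) \<Longrightarrow> \<bar>A x y\<bar> \<le> B"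
    by (fastforce simp: bounded_iff)
  have "\<bar>A (S n \<omega>) (X k \<omega>)\<bar> \<le> B" for \<omega> using B norm_S[of n \<omega>] norm_X[of k \<omega>] by simp
  with m show ?thesis unfolding bm_def by auto
qed

lemmas bm_intros = bm_const bm_add bm_mult bm_diff bm_sum bm_power bm_X

lemma bm_tame: "tame M K A \<Longrightarrow> bm (\<lambda>\<omega>. A (S n \<omega>) (X k \<omega>))"
  by (rule bm_SX[OF tame_continuous])

text \<open>A function that is not integrable has integral 0, which obeys the bound too because B is
  nonnegative.\<close>

lemma abs_expectation_le:
  fixes f :: "'w \<Rightarrow> real"
  shows "(\<And>\<omega>. \<bar>f \<omega>\<bar> \<le> B) \<Longrightarrow> \<bar>expectation f\<bar> \<le> B"
proof -
  assume f: "\<And>\<omega>. \<bar>f \<omega>\<bar> \<le> B"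
  have B: "0 \<le> B" using f[of undefined] by linarith
  show ?thesis
  proof (cases "integrable \<nu> f")
    case True
    then have "\<bar>expectation f\<bar> \<le> expectation (\<lambda>\<omega>. \<bar>f \<omega>\<bar>)" by (intro integral_abs_bound)
    also have "\<dots> \<le> B" using True f by (intro integral_le_const) auto
    finally show ?thesis .
  qed (simp add: not_integrable_integral_eq B)
qed

lemma cov_add_left:
  "bm f \<Longrightarrow> bm g \<Longrightarrow> bm h \<Longrightarrow> cov \<nu> (\<lambda>\<omega>. f \<omega> + g \<omega>) h = cov \<nu> f h + cov \<nu> g h"
  by (simp add: cov_def distrib_right bm_integrable bm_mult)

lemma cov_sum_left:
  "finite I \<Longrightarrow> (\<And>i. i \<in> I \<Longrightarrow> bm (f i)) \<Longrightarrow> bm h \<Longrightarrow> cov \<nu> (\<lambda>\<omega>. \<Sum>i\<in>I. f i \<omega>) h = (\<Sum>i\<in>I. cov \<nu> (f i) h)"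
  by (induction I rule: finite_induct) (auto simp: cov_add_left bm_sum, simp add: cov_def)

lemma cov_diff_left:
  "bm f \<Longrightarrow> bm g \<Longrightarrow> bm h \<Longrightarrow> cov \<nu> (\<lambda>\<omega>. f \<omega> - g \<omega>) h = cov \<nu> f h - cov \<nu> g h"
  by (simp add: cov_def left_diff_distrib bm_integrable bm_mult)

lemma cov_const_left: "cov \<nu> (\<lambda>\<omega>. a) h = 0"
  by (simp add: cov_def prob_space)

lemma cov_mean_zero: "expectation h = 0 \<Longrightarrow> cov \<nu> f h = expectation (\<lambda>\<omega>. f \<omega> * h \<omega>)"
  by (simp add: cov_def)

text \<open>Truncated subtraction stops the index at 0, so the identity also holds for n beyond v:
  the additional increments vanish.\<close>

lemma telescope_sum:
  assumes g: "continuous_on UNIV g" and W: "bm W"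
  shows "cov \<nu> (\<lambda>\<omega>. g (S (v - 1) \<omega>)) W =
     (\<Sum>q = 1..n. cov \<nu> (\<lambda>\<omega>. g (S (v - q) \<omega>) - g (S (v - q - 1) \<omega>)) W) + cov \<nu> (\<lambda>\<omega>. g (S (v - n - 1) \<omega>)) W"
proof -
  have bg: "bm (\<lambda>\<omega>. g (S n \<omega>))" for n by (rule bm_S[OF g])
  show ?thesis by (induction n) (auto simp: cov_diff_left bg W)
qed

text \<open>The past sum is pulled away from W step by step. An increment depends on an earlier sum
  and one single variable, hence is decorrelated from W over a gap of its own. Beyond the window J
  the remaining covariance is estimated at once; if time 0 is reached before, what remains is
  constant and has covariance 0.\<close>

lemma telescope:
  assumes g: "continuous_on UNIV g" and W: "bm W" and B: "\<And>q. 0 \<le> B q" and T: "0 \<le> T"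
    and step: "\<And>q. 1 \<le> q \<Longrightarrow> q \<le> J \<Longrightarrow> q < v \<Longrightarrow> \<bar>cov \<nu> (\<lambda>\<omega>. g (S (v - q) \<omega>) - g (S (v - q - 1) \<omega>)) W\<bar> \<le> B q"
    and last: "\<And>i. i + J = v \<Longrightarrow> 1 \<le> i \<Longrightarrow> \<bar>cov \<nu> (\<lambda>\<omega>. g (S (i - 1) \<omega>)) W\<bar> \<le> T"
    and v: "1 \<le> v"
  shows "\<bar>cov \<nu> (\<lambda>\<omega>. g (S (v - 1) \<omega>)) W\<bar> \<le> (\<Sum>q = 1..J. B q) + T"
proof -
  note tel = telescope_sum[OF g W, of v]
  show ?thesis
  proof (cases "J < v")
    case True
    have "\<bar>cov \<nu> (\<lambda>\<omega>. g (S (v - J - 1) \<omega>)) W\<bar> \<le> T" using last[of "v - J"] True by simp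
    moreover have "\<bar>\<Sum>q = 1..J. cov \<nu> (\<lambda>\<omega>. g (S (v - q) \<omega>) - g (S (v - q - 1) \<omega>)) W\<bar> \<le> (\<Sum>q = 1..J. B q)"
      using True by (intro order_trans[OF sum_abs] sum_mono step) auto
    ultimately show ?thesis using tel[of J] by linarith
  next
    case False
    have "\<bar>cov \<nu> (\<lambda>\<omega>. g (S (v - 1) \<omega>)) W\<bar> = \<bar>\<Sum>q = 1..v-1. cov \<nu> (\<lambda>\<omega>. g (S (v - q) \<omega>) - g (S (v - q - 1) \<omega>)) W\<bar>"
      using tel[of "v - 1"] v by (simp add: cov_const_left)
    also have "\<dots> \<le> (\<Sum>q = 1..v-1. B q)"
      using False by (intro order_trans[OF sum_abs] sum_mono step) auto
    also have "\<dots> \<le> (\<Sum>q = 1..J. B q)" using False B by (intro sum_mono2) auto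
    finally show ?thesis using T by linarith
  qed
qed

text \<open>\<open>mix1\<close>, \<open>mix2\<close> and \<open>mix3\<close> are the cases of one,
  two and three future variables. A single one has spread 0, so the gap is free; otherwise it must
  be R times the spread.\<close>

lemma mix1:
  assumes "tame M K A" "1 \<le> i" "i \<le> v" "v \<le> u" "u \<le> k" "e \<le> 1" "e' \<le> 1"
  shows "\<bar>cov \<nu> (\<lambda>\<omega>. A (S (i - 1) \<omega>) (X i \<omega>) * (X v \<omega> $ c) ^ e * (X u \<omega> $ b) ^ e') (\<lambda>\<omega>. X k \<omega> $ a)\<bar> \<le> C * K * ph (k - u)"
  using mix[OF assms(1-4), of 0 "k - u" 0 1 0 0 e e' c b a a a] assms by simp

lemma mix2:
  assumes "tame M K A" "1 \<le> i" "i \<le> v" "v \<le> u" "u \<le> k" "R * (k - u) \<le> u - v" "e \<le> 1"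
  shows "\<bar>cov \<nu> (\<lambda>\<omega>. A (S (i - 1) \<omega>) (X i \<omega>) * (X v \<omega> $ c) ^ e) (\<lambda>\<omega>. X u \<omega> $ b * X k \<omega> $ a)\<bar> \<le> C * K * ph (u - v)"
  using mix[OF assms(1-3) order_refl, of "k - u" "u - v" "k - u" 1 1 0 e 0 c c b a a] assms by simp

lemma mix3:
  assumes "tame M K A" "1 \<le> i" "i \<le> v" "v \<le> u" "u \<le> k" "R * (k - v) \<le> v - i"
  shows "\<bar>cov \<nu> (\<lambda>\<omega>. A (S (i - 1) \<omega>) (X i \<omega>)) (\<lambda>\<omega>. X v \<omega> $ c * (X u \<omega> $ b * X k \<omega> $ a))\<bar> \<le> C * K * ph (v - i)"
  using mix[OF assms(1,2) order_refl order_refl, of "k - v" "v - i" "u - v" 1 1 1 0 0 c c c b a] assms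
  by (simp add: mult.assoc)

section \<open>Decay of pair and triple moments\<close>

definition gam :: "'d \<Rightarrow> 'd \<Rightarrow> nat \<Rightarrow> nat \<Rightarrow> real" where
  "gam b a u k = expectation (\<lambda>\<omega>. X u \<omega> $ b * X k \<omega> $ a)"

definition kap :: "'d \<Rightarrow> 'd \<Rightarrow> 'd \<Rightarrow> nat \<Rightarrow> nat \<Rightarrow> nat \<Rightarrow> real" where
  "kap c b a i u k = expectation (\<lambda>\<omega>. X i \<omega> $ c * (X u \<omega> $ b * X k \<omega> $ a))"

definition Zc :: "'d \<Rightarrow> 'd \<Rightarrow> nat \<Rightarrow> nat \<Rightarrow> 'w \<Rightarrow> real" where
  "Zc b a u k \<omega> = X u \<omega> $ b * X k \<omega> $ a - gam b a u k"

text \<open>For times \<open>i' \<le> i \<le> u \<le> k\<close> with gaps \<open>q\<close>, \<open>j\<close>, \<open>p\<close>, past and future are separated at the leftmost gap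
  that is \<open>R\<close> times as long as everything to its right; \<open>psi\<close> and \<open>psi3\<close> are the resulting decay rates.\<close>

definition psi :: "nat \<Rightarrow> nat \<Rightarrow> real" where
  "psi j p = (if R * p \<le> j then ph j else ph p)"

definition psi3 :: "nat \<Rightarrow> nat \<Rightarrow> nat \<Rightarrow> real" where
  "psi3 q j p = (if R * (j + p) \<le> q then ph q else psi j p)"

lemma psi_nonneg: "0 \<le> psi j p" "0 \<le> psi3 q j p"
  by (simp_all add: psi_def psi3_def ph_nonneg)

lemma bm_Zc: "bm (Zc b a u k)"
  unfolding Zc_def[abs_def] by (intro bm_intros)

lemma gam_bound:
  assumes "1 \<le> u" "u \<le> k"
  shows "\<bar>gam b a u k\<bar> \<le> C * ph (k - u)"
proof -
  have "gam b a u k = cov \<nu> (\<lambda>\<omega>. 1 * (X u \<omega> $ b) ^ 1 * (X u \<omega> $ b) ^ 0) (\<lambda>\<omega>. X k \<omega> $ a)"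
    by (simp add: gam_def cov_def EX)
  also have "\<bar>\<dots>\<bar> \<le> C * 1 * ph (k - u)"
    by (rule mix1[where A = "\<lambda>x y. 1"]) (use assms in \<open>auto intro!: tame_const\<close>)
  finally show ?thesis by simp
qed

lemma gam_bound': "1 \<le> u \<Longrightarrow> u \<le> k \<Longrightarrow> \<bar>gam b a u k\<bar> \<le> C"
  using gam_bound[of u k b a] mult_left_mono[OF ph_le[of "k - u"], of C] C_ge by linarith

text \<open>Cut at the earlier gap if it is long enough compared with the later one, otherwise at
  the later gap, where a single future variable remains. In both cases one side of the cut is a
  single centred variable, so the moment is a covariance.\<close>

lemma kap_bound:
  assumes "1 \<le> i" "i \<le> u" "u \<le> k"
  shows "\<bar>kap c b a i u k\<bar> \<le> C * psi (u - i) (k - u)"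
proof (cases "R * (k - u) \<le> u - i")
  case True
  have "kap c b a i u k = cov \<nu> (\<lambda>\<omega>. 1 * (X i \<omega> $ c) ^ 1) (\<lambda>\<omega>. X u \<omega> $ b * X k \<omega> $ a)"
    by (simp add: kap_def cov_def EX)
  also have "\<bar>\<dots>\<bar> \<le> C * 1 * ph (u - i)"
    by (rule mix2[where A = "\<lambda>x y. 1"]) (use assms True in \<open>auto intro!: tame_const\<close>)
  finally show ?thesis using True by (simp add: psi_def)
next
  case False
  have "kap c b a i u k = cov \<nu> (\<lambda>\<omega>. 1 * (X i \<omega> $ c) ^ 1 * (X u \<omega> $ b) ^ 1) (\<lambda>\<omega>. X k \<omega> $ a)"
    by (simp add: kap_def cov_def EX mult.assoc)
  also have "\<bar>\<dots>\<bar> \<le> C * 1 * ph (k - u)"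
    by (rule mix1[where A = "\<lambda>x y. 1"]) (use assms in \<open>auto intro!: tame_const\<close>)
  finally show ?thesis using False by (simp add: psi_def)
qed

text \<open>Same choice of the cut as in \<open>kap_bound\<close>. At the later gap the covariance
  splits into a covariance with X k alone and the product of a mean with a pair moment; both decay
  with this gap, whence the factor 2.\<close>

lemma cov_pair_bound:
  assumes A: "tame M K A" and o: "1 \<le> i" "i \<le> u" "u \<le> k" and K: "0 \<le> K"
  shows "\<bar>cov \<nu> (\<lambda>\<omega>. A (S (i - 1) \<omega>) (X i \<omega>)) (\<lambda>\<omega>. X u \<omega> $ b * X k \<omega> $ a)\<bar> \<le> 2 * C * K * psi (u - i) (k - u)"
proof (cases "R * (k - u) \<le> u - i")
  case True
  have "\<bar>cov \<nu> (\<lambda>\<omega>. A (S (i - 1) \<omega>) (X i \<omega>) * (X i \<omega> $ b) ^ 0) (\<lambda>\<omega>. X u \<omega> $ b * X k \<omega> $ a)\<bar> \<le> C * K * ph (u - i)"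
    by (rule mix2[OF A]) (use o True in auto)
  moreover have "C * K * ph (u - i) \<le> 2 * C * K * ph (u - i)"
    using C_ge K ph_nonneg[of "u - i"] by simp
  ultimately show ?thesis using True by (simp add: psi_def)
next
  case False
  let ?A = "\<lambda>\<omega>. A (S (i - 1) \<omega>) (X i \<omega>)"
  have e: "cov \<nu> ?A (\<lambda>\<omega>. X u \<omega> $ b * X k \<omega> $ a) =
     cov \<nu> (\<lambda>\<omega>. ?A \<omega> * (X u \<omega> $ b) ^ 1 * (X u \<omega> $ b) ^ 0) (\<lambda>\<omega>. X k \<omega> $ a) - expectation ?A * gam b a u k"
    by (simp add: cov_def EX gam_def mult.assoc)
  have "\<bar>cov \<nu> (\<lambda>\<omega>. ?A \<omega> * (X u \<omega> $ b) ^ 1 * (X u \<omega> $ b) ^ 0) (\<lambda>\<omega>. X k \<omega> $ a)\<bar> \<le> C * K * ph (k - u)"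
    by (rule mix1[OF A]) (use o in auto)
  moreover have "\<bar>expectation ?A * gam b a u k\<bar> \<le> K * (C * ph (k - u))"
    unfolding abs_mult
    by (intro mult_mono abs_expectation_le tame_bound[OF A] X_bound gam_bound) (use o K in auto)
  moreover have "psi (u - i) (k - u) = ph (k - u)" using False by (simp add: psi_def)
  ultimately show ?thesis unfolding e by (simp only: mult_ac) linarith
qed

text \<open>Centring the product \<open>X u * X k\<close> matters: otherwise the cut at the middle gap would leave the product of
  two pair covariances, which is not summable at the required rate.\<close>

lemma cov_triple_bound:
  assumes A: "tame M K A" and o: "1 \<le> i'" "i' \<le> i" "i \<le> u" "u \<le> k" and K: "0 \<le> K"
  shows "\<bar>cov \<nu> (\<lambda>\<omega>. A (S (i' - 1) \<omega>) (X i' \<omega>)) (\<lambda>\<omega>. X i \<omega> $ c * Zc b a u k \<omega>)\<bar> \<le>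
    C * (3 + C + M) * K * psi3 (i - i') (u - i) (k - u)"
proof -
  let ?A = "\<lambda>\<omega>. A (S (i' - 1) \<omega>) (X i' \<omega>)"
  let ?g = "gam b a u k"
  have bA: "bm ?A" by (rule bm_tame[OF A])
  have C0: "0 \<le> C" using C_ge by simp
  note I = bm_integrable bm_intros bA bA[simplified]
  have EA: "\<bar>expectation ?A\<bar> \<le> K" by (intro abs_expectation_le tame_bound[OF A] X_bound)
  have EAX: "\<bar>expectation (\<lambda>\<omega>. ?A \<omega> * X i \<omega> $ c)\<bar> \<le> K * M"
    by (intro abs_expectation_le, subst abs_mult) (intro mult_mono tame_bound[OF A] X_bound, auto simp: K)
  have w: "(\<integral>\<omega>. X i \<omega> $ c * Zc b a u k \<omega> \<partial>\<nu>) = kap c b a i u k"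
    by (simp add: Zc_def right_diff_distrib I kap_def EX)
  have e0: "cov \<nu> ?A (\<lambda>\<omega>. X i \<omega> $ c * Zc b a u k \<omega>) =
      expectation (\<lambda>\<omega>. ?A \<omega> * X i \<omega> $ c * (X u \<omega> $ b * X k \<omega> $ a)) - expectation (\<lambda>\<omega>. ?A \<omega> * X i \<omega> $ c) * ?g
        - expectation ?A * kap c b a i u k"
  proof -
    have "(\<integral>\<omega>. ?A \<omega> * (X i \<omega> $ c * Zc b a u k \<omega>) \<partial>\<nu>) =
      (\<integral>\<omega>. ?A \<omega> * X i \<omega> $ c * (X u \<omega> $ b * X k \<omega> $ a) - ?A \<omega> * X i \<omega> $ c * ?g \<partial>\<nu>)"
      by (intro Bochner_Integration.integral_cong) (auto simp: Zc_def algebra_simps)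
    also have "\<dots> = expectation (\<lambda>\<omega>. ?A \<omega> * X i \<omega> $ c * (X u \<omega> $ b * X k \<omega> $ a)) - expectation (\<lambda>\<omega>. ?A \<omega> * X i \<omega> $ c) * ?g"
      by (subst Bochner_Integration.integral_diff) (auto intro!: I)
    finally show ?thesis by (simp add: cov_def w)
  qed
  \<comment> \<open>The three cuts produce the factors 1 + C, 2 and 2 + M; one constant dominates
    them all.\<close>
  have fin: "x \<le> C * (3 + C + M) * K * y" if "x \<le> C * K * y * z" "0 \<le> y" "z \<le> 3 + C + M" for x y z
  proof -
    have "C * K * y * z \<le> C * K * y * (3 + C + M)" using that K C0 by (intro mult_left_mono) auto
    then show ?thesis using that(1) by (simp add: mult_ac)
  qed
  consider "R * (k - i) \<le> i - i'" | "\<not> R * (k - i) \<le> i - i'" "R * (k - u) \<le> u - i"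
    | "\<not> R * (k - i) \<le> i - i'" "\<not> R * (k - u) \<le> u - i" by blast
  then show ?thesis
  proof cases
    case 1
    \<comment> \<open>The whole triple lies after the cut, and centring only subtracts a bounded
      multiple of a covariance with X i.\<close>
    have "cov \<nu> ?A (\<lambda>\<omega>. X i \<omega> $ c * Zc b a u k \<omega>) =
      cov \<nu> ?A (\<lambda>\<omega>. X i \<omega> $ c * (X u \<omega> $ b * X k \<omega> $ a)) - cov \<nu> (\<lambda>\<omega>. ?A \<omega> * (X i \<omega> $ c) ^ 0 * (X i \<omega> $ c) ^ 0) (\<lambda>\<omega>. X i \<omega> $ c) * ?g"
      unfolding e0 by (simp add: cov_def kap_def EX mult.assoc algebra_simps)
    moreover have "\<bar>cov \<nu> ?A (\<lambda>\<omega>. X i \<omega> $ c * (X u \<omega> $ b * X k \<omega> $ a))\<bar> \<le> C * K * ph (i - i')"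
      by (rule mix3[OF A]) (use o 1 in auto)
    moreover have "\<bar>cov \<nu> (\<lambda>\<omega>. ?A \<omega> * (X i \<omega> $ c) ^ 0 * (X i \<omega> $ c) ^ 0) (\<lambda>\<omega>. X i \<omega> $ c) * ?g\<bar> \<le> C * K * ph (i - i') * C"
    proof -
      have "cov \<nu> (\<lambda>\<omega>. ?A \<omega> * (X i \<omega> $ c) ^ 0 * (X i \<omega> $ c) ^ 0) (\<lambda>\<omega>. X i \<omega> $ c) =
        cov \<nu> (\<lambda>\<omega>. ?A \<omega> * (X i' \<omega> $ c) ^ 0 * (X i' \<omega> $ c) ^ 0) (\<lambda>\<omega>. X i \<omega> $ c)" by simp
      also have "\<bar>\<dots>\<bar> \<le> C * K * ph (i - i')"
        by (rule mix1[OF A]) (use o in auto)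
      finally show ?thesis unfolding abs_mult using o K C0 ph_nonneg[of "i - i'"]
        by (intro mult_mono gam_bound') auto
    qed
    ultimately have "\<bar>cov \<nu> ?A (\<lambda>\<omega>. X i \<omega> $ c * Zc b a u k \<omega>)\<bar> \<le> C * K * ph (i - i') * (1 + C)"
      unfolding distrib_left mult_1_right by linarith
    moreover have "psi3 (i - i') (u - i) (k - u) = ph (i - i')" using 1 o by (simp add: psi3_def)
    ultimately show ?thesis using M_ge C_ge by (intro fin[OF _ psi_nonneg(2)]) auto
  next
    case 2
    have "cov \<nu> ?A (\<lambda>\<omega>. X i \<omega> $ c * Zc b a u k \<omega>) =
      cov \<nu> (\<lambda>\<omega>. ?A \<omega> * (X i \<omega> $ c) ^ 1) (\<lambda>\<omega>. X u \<omega> $ b * X k \<omega> $ a) - expectation ?A * kap c b a i u k"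
      unfolding e0 by (simp add: cov_def gam_def)
    moreover have "\<bar>cov \<nu> (\<lambda>\<omega>. ?A \<omega> * (X i \<omega> $ c) ^ 1) (\<lambda>\<omega>. X u \<omega> $ b * X k \<omega> $ a)\<bar> \<le> C * K * ph (u - i)"
      by (rule mix2[OF A]) (use o 2 in auto)
    moreover have "\<bar>expectation ?A * kap c b a i u k\<bar> \<le> K * (C * psi (u - i) (k - u))"
      unfolding abs_mult using o K by (intro mult_mono EA kap_bound) auto
    moreover have "psi (u - i) (k - u) = ph (u - i)" using 2 o by (simp add: psi_def)
    moreover from this have "C * K * ph (u - i) * 2 = C * K * ph (u - i) + K * (C * psi (u - i) (k - u))" by simp
    ultimately have "\<bar>cov \<nu> ?A (\<lambda>\<omega>. X i \<omega> $ c * Zc b a u k \<omega>)\<bar> \<le> C * K * ph (u - i) * 2"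
      by linarith
    moreover have "psi3 (i - i') (u - i) (k - u) = ph (u - i)" using 2 o by (simp add: psi3_def psi_def)
    ultimately show ?thesis using M_ge C_ge by (intro fin[OF _ psi_nonneg(2)]) auto
  next
    case 3
    \<comment> \<open>Only X k lies after the cut, and each of the three terms is small by
      itself.\<close>
    have "cov \<nu> ?A (\<lambda>\<omega>. X i \<omega> $ c * Zc b a u k \<omega>) =
      cov \<nu> (\<lambda>\<omega>. ?A \<omega> * (X i \<omega> $ c) ^ 1 * (X u \<omega> $ b) ^ 1) (\<lambda>\<omega>. X k \<omega> $ a)
        - expectation (\<lambda>\<omega>. ?A \<omega> * X i \<omega> $ c) * ?g - expectation ?A * kap c b a i u k"
      unfolding e0 by (simp add: cov_def EX mult.assoc)
    moreover have "\<bar>cov \<nu> (\<lambda>\<omega>. ?A \<omega> * (X i \<omega> $ c) ^ 1 * (X u \<omega> $ b) ^ 1) (\<lambda>\<omega>. X k \<omega> $ a)\<bar> \<le> C * K * ph (k - u)"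
      by (rule mix1[OF A]) (use o in auto)
    moreover have "\<bar>expectation (\<lambda>\<omega>. ?A \<omega> * X i \<omega> $ c) * ?g\<bar> \<le> (K * M) * (C * ph (k - u))"
      unfolding abs_mult using o K M_ge by (intro mult_mono EAX gam_bound) auto
    moreover have "\<bar>expectation ?A * kap c b a i u k\<bar> \<le> K * (C * psi (u - i) (k - u))"
      unfolding abs_mult using o K by (intro mult_mono EA kap_bound) auto
    moreover have "psi (u - i) (k - u) = ph (k - u)" using 3 o by (simp add: psi_def)
    moreover from this have "C * K * ph (k - u) * (2 + M) = C * K * ph (k - u) + (K * M) * (C * ph (k - u)) + K * (C * psi (u - i) (k - u))"
      by (simp add: algebra_simps)
    ultimately have "\<bar>cov \<nu> ?A (\<lambda>\<omega>. X i \<omega> $ c * Zc b a u k \<omega>)\<bar> \<le> C * K * ph (k - u) * (2 + M)"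
      by linarith
    moreover have "psi3 (i - i') (u - i) (k - u) = ph (k - u)" using 3 o by (simp add: psi3_def psi_def)
    ultimately show ?thesis using M_ge C_ge by (intro fin[OF _ psi_nonneg(2)]) auto
  qed
qed

end

section \<open>Taylor remainders of smooth functions\<close>

text \<open>\<open>D cs\<close> is the iterated partial derivative of \<open>D []\<close> in the coordinates \<open>cs\<close>. The function \<open>D []\<close> itself
  need not be bounded.\<close>

definition cjet :: "real \<Rightarrow> real \<Rightarrow> ('d::finite list \<Rightarrow> real ^ 'd \<Rightarrow> real) \<Rightarrow> bool" where
  "cjet K \<delta> D \<longleftrightarrow> 0 \<le> K \<and> 0 < \<delta> \<and> \<delta> \<le> 1 \<and>
    (\<forall>cs x. length cs \<le> 4 \<longrightarrow> (D cs has_derivative (\<lambda>h. \<Sum>c\<in>UNIV. h $ c * D (c # cs) x)) (at x)) \<and>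
    (\<forall>cs x. 1 \<le> length cs \<and> length cs \<le> 5 \<longrightarrow> \<bar>D cs x\<bar> \<le> K * \<delta> ^ (length cs - 1)) \<and>
    (\<forall>c d cs x. length cs \<le> 3 \<longrightarrow> D (c # d # cs) x = D (d # c # cs) x)"

text \<open>Taylor remainders in y of D cs (x + y) after one to four terms. They are formed for
  every list cs so that partial derivatives of remainders are remainders again.\<close>

definition rem1 :: "('d list \<Rightarrow> real ^ 'd \<Rightarrow> real) \<Rightarrow> 'd list \<Rightarrow> real ^ 'd \<Rightarrow> real ^ 'd \<Rightarrow> real" where
  "rem1 D cs x y = D cs (x + y) - D cs x"

definition rem2 :: "('d list \<Rightarrow> real ^ 'd \<Rightarrow> real) \<Rightarrow> 'd list \<Rightarrow> real ^ 'd \<Rightarrow> real ^ 'd \<Rightarrow> real" where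
  "rem2 D cs x y = rem1 D cs x y - (\<Sum>c\<in>UNIV. y $ c * D (c # cs) x)"

definition rem3 :: "('d list \<Rightarrow> real ^ 'd \<Rightarrow> real) \<Rightarrow> 'd list \<Rightarrow> real ^ 'd \<Rightarrow> real ^ 'd \<Rightarrow> real" where
  "rem3 D cs x y = rem2 D cs x y - (\<Sum>c\<in>UNIV. \<Sum>d\<in>UNIV. y $ c * y $ d * D (d # c # cs) x) / 2"

definition rem4 :: "('d list \<Rightarrow> real ^ 'd \<Rightarrow> real) \<Rightarrow> 'd list \<Rightarrow> real ^ 'd \<Rightarrow> real ^ 'd \<Rightarrow> real" where
  "rem4 D cs x y = rem3 D cs x y -
    (\<Sum>c\<in>UNIV. \<Sum>d\<in>UNIV. \<Sum>e\<in>UNIV. y $ c * y $ d * y $ e * D (e # d # c # cs) x) / 6"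

context
  fixes K \<delta> :: real and D :: "'d::finite list \<Rightarrow> real ^ 'd \<Rightarrow> real"
  assumes jet: "cjet K \<delta> D"
begin

lemma cjet_pos: "0 \<le> K" "0 < \<delta>" "\<delta> \<le> 1"
  using jet by (auto simp: cjet_def)

lemma cjet_deriv: "length cs \<le> 4 \<Longrightarrow> (D cs has_derivative (\<lambda>h. \<Sum>c\<in>UNIV. h $ c * D (c # cs) x)) (at x)"
  using jet by (auto simp: cjet_def)

lemma cjet_bound: "1 \<le> length cs \<Longrightarrow> length cs \<le> 5 \<Longrightarrow> \<bar>D cs x\<bar> \<le> K * \<delta> ^ (length cs - 1)"
  using jet by (auto simp: cjet_def)

lemma cjet_sym: "length cs \<le> 3 \<Longrightarrow> D (c # d # cs) x = D (d # c # cs) x"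
  using jet by (auto simp: cjet_def)

text \<open>Differentiating the symmetry in the two outer directions gives the symmetry one place
  further in. Together with \<open>cjet_sym\<close> this yields the rotation of three directions in
  \<open>deriv_quad\<close>.\<close>

lemma cjet_sym2: 
  assumes "length cs \<le> 2"
  shows "D (e # c # d # cs) x = D (e # d # c # cs) x"
proof -
  have eq: "D (c # d # cs) = D (d # c # cs)" using assms cjet_sym[of cs c d] by auto
  have "(\<lambda>h. \<Sum>a\<in>UNIV. h $ a * D (a # c # d # cs) x) = (\<lambda>h. \<Sum>a\<in>UNIV. h $ a * D (a # d # c # cs) x)"
  proof (rule has_derivative_unique)
    show "(D (c # d # cs) has_derivative (\<lambda>h. \<Sum>a\<in>UNIV. h $ a * D (a # c # d # cs) x)) (at x)"
      by (rule cjet_deriv) (use assms in simp)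
    show "(D (c # d # cs) has_derivative (\<lambda>h. \<Sum>a\<in>UNIV. h $ a * D (a # d # c # cs) x)) (at x)"
      unfolding eq by (rule cjet_deriv) (use assms in simp)
  qed
  then have "(\<Sum>a\<in>UNIV. axis e (1::real) $ a * D (a # c # d # cs) x) = (\<Sum>a\<in>UNIV. axis e 1 $ a * D (a # d # c # cs) x)"
    by (rule fun_cong)
  moreover have "(\<Sum>a\<in>UNIV. axis e (1::real) $ a * f a) = f e" for f :: "'d \<Rightarrow> real"
  proof -
    have "(\<Sum>a\<in>UNIV. axis e (1::real) $ a * f a) = (\<Sum>a\<in>UNIV. if a = e then f a else 0)"
      by (intro sum.cong) (auto simp: axis_def)
    then show ?thesis by simp
  qed
  ultimately show ?thesis by simp
qed

lemma cjet_cont: "length cs \<le> 4 \<Longrightarrow> continuous_on UNIV (D cs)"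
  using has_derivative_continuous[OF cjet_deriv] by (simp add: continuous_on_eq_continuous_at)

lemma segment_derivative:
  assumes "length cs \<le> 4"
  shows "((\<lambda>t. D cs (x + t *\<^sub>R y)) has_real_derivative (\<Sum>c\<in>UNIV. y $ c * D (c # cs) (x + t *\<^sub>R y))) (at t)"
  unfolding has_field_derivative_def
  by (rule has_derivative_eq_rhs, rule has_derivative_compose[of "\<lambda>t. x + t *\<^sub>R y" _ t UNIV "D cs"])
    (use cjet_deriv[OF assms] in \<open>auto intro!: derivative_eq_intros simp: sum_distrib_left mult_ac\<close>)

text \<open>Along the segment from x to x + y a remainder differentiates to y applied to the
  remainders one order lower of the next derivatives. The mean value theorem thus gains a factor d M
  and a derivative at each order; the factorials are given away.\<close>

lemma segment_bound:
  assumes der: "\<And>t. (f has_real_derivative (\<Sum>c\<in>UNIV. (y :: real ^ 'd) $ c * g c t)) (at t)" and 0: "f 0 = 0"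
    and B: "\<And>c t. 0 < t \<Longrightarrow> t < 1 \<Longrightarrow> \<bar>g c t\<bar> \<le> B" and y: "\<And>c. \<bar>y $ c\<bar> \<le> M"
  shows "\<bar>f (1::real)\<bar> \<le> real CARD('d) * M * B"
proof -
  obtain t where t: "0 < t" "t < 1" "f 1 - f 0 = (1 - 0) * (\<Sum>c\<in>UNIV. y $ c * g c t)"
    using MVT2[of 0 1 f "\<lambda>t. \<Sum>c\<in>UNIV. y $ c * g c t"] der by auto
  have "\<bar>\<Sum>c\<in>UNIV. y $ c * g c t\<bar> \<le> (\<Sum>c\<in>(UNIV :: 'd set). M * B)"
    by (intro order_trans[OF sum_abs] sum_mono, subst abs_mult)
      (intro mult_mono y B t order_trans[OF abs_ge_zero y] abs_ge_zero)
  then show ?thesis using t 0 by simp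
qed

lemma rem1_bound:
  assumes cs: "length cs \<le> 4" and y: "\<And>c. \<bar>y $ c\<bar> \<le> M"
  shows "\<bar>rem1 D cs x y\<bar> \<le> real CARD('d) * M * (K * \<delta> ^ length cs)"
proof -
  have "\<bar>rem1 D cs x (1 *\<^sub>R y)\<bar> \<le> real CARD('d) * M * (K * \<delta> ^ length cs)"
  proof (rule segment_bound[where f = "\<lambda>t. rem1 D cs x (t *\<^sub>R y)" and g = "\<lambda>c t. D (c # cs) (x + t *\<^sub>R y)" and y = y])
    show "((\<lambda>t. rem1 D cs x (t *\<^sub>R y)) has_real_derivative (\<Sum>c\<in>UNIV. y $ c * D (c # cs) (x + t *\<^sub>R y))) (at t)" for t
      unfolding rem1_def by (rule DERIV_cong[OF DERIV_diff[OF segment_derivative[OF cs] DERIV_const]]) simp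
    show "\<bar>D (c # cs) (x + t *\<^sub>R y)\<bar> \<le> K * \<delta> ^ length cs" for c t
      using cjet_bound[of "c # cs"] cs by simp
  qed (use y in \<open>simp_all add: rem1_def\<close>)
  then show ?thesis by simp
qed

lemma rem2_bound:
  assumes cs: "length cs \<le> 3" and y: "\<And>c. \<bar>y $ c\<bar> \<le> M" and M: "0 \<le> M"
  shows "\<bar>rem2 D cs x y\<bar> \<le> (real CARD('d) * M) ^ 2 * (K * \<delta> ^ (length cs + 1))"
proof -
  have "\<bar>rem2 D cs x (1 *\<^sub>R y)\<bar> \<le> real CARD('d) * M * (real CARD('d) * M * (K * \<delta> ^ (length cs + 1)))"
  proof (rule segment_bound[where f = "\<lambda>t. rem2 D cs x (t *\<^sub>R y)" and g = "\<lambda>c t. rem1 D (c # cs) x (t *\<^sub>R y)" and y = y])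
    show "((\<lambda>t. rem2 D cs x (t *\<^sub>R y)) has_real_derivative (\<Sum>c\<in>UNIV. y $ c * rem1 D (c # cs) x (t *\<^sub>R y))) (at t)" for t
      unfolding rem2_def rem1_def using cs
      by (auto intro!: derivative_eq_intros segment_derivative sum.cong simp: sum_subtractf[symmetric] algebra_simps)
    show "\<bar>rem1 D (c # cs) x (t *\<^sub>R y)\<bar> \<le> real CARD('d) * M * (K * \<delta> ^ (length cs + 1))" if "0 < t" "t < 1" for c t
    proof -
      have "\<bar>(t *\<^sub>R y) $ a\<bar> \<le> M" for a
        using y[of a] that M mult_mono[of t 1 "\<bar>y $ a\<bar>" M] by (simp add: abs_mult)
      then show ?thesis using rem1_bound[of "c # cs" "t *\<^sub>R y"] cs by simp
    qed
  qed (use y in \<open>simp_all add: rem1_def rem2_def\<close>)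
  then show ?thesis by (simp add: power2_eq_square mult.assoc)
qed

lemma rem3_bound:
  assumes cs: "length cs \<le> 2" and y: "\<And>c. \<bar>y $ c\<bar> \<le> M" and M: "0 \<le> M"
  shows "\<bar>rem3 D cs x y\<bar> \<le> (real CARD('d) * M) ^ 3 * (K * \<delta> ^ (length cs + 2))"
proof -
  have "\<bar>rem3 D cs x (1 *\<^sub>R y)\<bar> \<le> real CARD('d) * M * ((real CARD('d) * M) ^ 2 * (K * \<delta> ^ (length cs + 2)))"
  proof (rule segment_bound[where f = "\<lambda>t. rem3 D cs x (t *\<^sub>R y)" and g = "\<lambda>c t. rem2 D (c # cs) x (t *\<^sub>R y)" and y = y])
    show "((\<lambda>t. rem3 D cs x (t *\<^sub>R y)) has_real_derivative (\<Sum>c\<in>UNIV. y $ c * rem2 D (c # cs) x (t *\<^sub>R y))) (at t)" for t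
      unfolding rem3_def rem2_def rem1_def using cs
      by (auto intro!: derivative_eq_intros segment_derivative sum.cong
          simp: sum_subtractf sum.distrib sum_divide_distrib sum_distrib_left sum_distrib_right algebra_simps)
    show "\<bar>rem2 D (c # cs) x (t *\<^sub>R y)\<bar> \<le> (real CARD('d) * M) ^ 2 * (K * \<delta> ^ (length cs + 2))" if "0 < t" "t < 1" for c t
    proof -
      have "\<bar>(t *\<^sub>R y) $ a\<bar> \<le> M" for a
        using y[of a] that M mult_mono[of t 1 "\<bar>y $ a\<bar>" M] by (simp add: abs_mult)
      then show ?thesis using rem2_bound[of "c # cs" "t *\<^sub>R y" M] cs M by simp
    qed
  qed (use y in \<open>simp_all add: rem1_def rem2_def rem3_def\<close>)
  then show ?thesis by (simp add: power2_eq_square power3_eq_cube mult.assoc)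
qed

lemma rem4_bound:
  assumes cs: "length cs \<le> 1" and y: "\<And>c. \<bar>y $ c\<bar> \<le> M" and M: "0 \<le> M"
  shows "\<bar>rem4 D cs x y\<bar> \<le> (real CARD('d) * M) ^ 4 * (K * \<delta> ^ (length cs + 3))"
proof -
  have "\<bar>rem4 D cs x (1 *\<^sub>R y)\<bar> \<le> real CARD('d) * M * ((real CARD('d) * M) ^ 3 * (K * \<delta> ^ (length cs + 3)))"
  proof (rule segment_bound[where f = "\<lambda>t. rem4 D cs x (t *\<^sub>R y)" and g = "\<lambda>c t. rem3 D (c # cs) x (t *\<^sub>R y)" and y = y])
    show "((\<lambda>t. rem4 D cs x (t *\<^sub>R y)) has_real_derivative (\<Sum>c\<in>UNIV. y $ c * rem3 D (c # cs) x (t *\<^sub>R y))) (at t)" for t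
      unfolding rem4_def rem3_def rem2_def rem1_def using cs
      by (auto intro!: derivative_eq_intros segment_derivative sum.cong
          simp: sum_subtractf sum.distrib sum_divide_distrib sum_distrib_left sum_distrib_right algebra_simps power2_eq_square)
    show "\<bar>rem3 D (c # cs) x (t *\<^sub>R y)\<bar> \<le> (real CARD('d) * M) ^ 3 * (K * \<delta> ^ (length cs + 3))" if "0 < t" "t < 1" for c t
    proof -
      have "\<bar>(t *\<^sub>R y) $ a\<bar> \<le> M" for a
        using y[of a] that M mult_mono[of t 1 "\<bar>y $ a\<bar>" M] by (simp add: abs_mult)
      then show ?thesis using rem3_bound[of "c # cs" "t *\<^sub>R y" M] cs M by (simp add: numeral_3_eq_3)
    qed
  qed (use y in \<open>simp_all add: rem1_def rem2_def rem3_def rem4_def\<close>)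
  then show ?thesis by (simp add: power4_eq_xxxx power3_eq_cube mult.assoc)
qed

section \<open>Partial derivatives of the remainders\<close>

lemma deriv_fst:
  "length cs \<le> 4 \<Longrightarrow> ((\<lambda>p. D cs (fst p)) has_derivative (\<lambda>h. \<Sum>c\<in>UNIV. fst h $ c * D (c # cs) x)) (at (x, y :: real ^ 'd))"
  by (rule has_derivative_compose[of fst fst "(x, y)" UNIV "D cs"]) (auto intro!: derivative_eq_intros cjet_deriv)

lemma deriv_shift:
  "length cs \<le> 4 \<Longrightarrow> ((\<lambda>p. D cs (fst p + snd p)) has_derivative
    (\<lambda>h. (\<Sum>c\<in>UNIV. fst h $ c * D (c # cs) (x + y)) + (\<Sum>c\<in>UNIV. snd h $ c * D (c # cs) (x + y)))) (at (x, y))"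
  by (rule has_derivative_eq_rhs, rule has_derivative_compose[of "\<lambda>p. fst p + snd p" _ "(x, y)" UNIV "D cs"])
    (auto intro!: derivative_eq_intros cjet_deriv simp: algebra_simps sum.distrib)

lemma deriv_snd: "((\<lambda>p. snd p $ c) has_derivative (\<lambda>h. snd h $ c)) (at (p :: (real ^ 'd) \<times> (real ^ 'd)))"
  by (intro bounded_linear_imp_has_derivative bounded_linear_compose[OF bounded_linear_vec_nth bounded_linear_snd])

text \<open>Symmetry brings the x-derivative into the form of the linear term of D (c # cs), and the
  y-derivative is the term of order 0 of D (c # cs). So remainders differentiate to
  remainders.\<close>

lemma deriv_lin:
  assumes "length cs \<le> 3"
  shows "((\<lambda>p. \<Sum>d\<in>UNIV. snd p $ d * D (d # cs) (fst p)) has_derivative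
    (\<lambda>h. (\<Sum>c\<in>UNIV. fst h $ c * (\<Sum>d\<in>UNIV. y $ d * D (d # c # cs) x)) + (\<Sum>c\<in>UNIV. snd h $ c * D (c # cs) x))) (at (x, y))"
proof -
  have "((\<lambda>p. \<Sum>d\<in>UNIV. snd p $ d * D (d # cs) (fst p)) has_derivative
    (\<lambda>h. \<Sum>d\<in>UNIV. y $ d * (\<Sum>c\<in>UNIV. fst h $ c * D (c # d # cs) x) + snd h $ d * D (d # cs) x)) (at (x, y))"
    using assms by (auto intro!: derivative_eq_intros deriv_fst deriv_snd)
  also have "(\<lambda>h. \<Sum>d\<in>UNIV. y $ d * (\<Sum>c\<in>UNIV. fst h $ c * D (c # d # cs) x) + snd h $ d * D (d # cs) x) =
    (\<lambda>h. (\<Sum>c\<in>UNIV. fst h $ c * (\<Sum>d\<in>UNIV. y $ d * D (d # c # cs) x)) + (\<Sum>c\<in>UNIV. snd h $ c * D (c # cs) x))"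
    by (rule ext, unfold sum.distrib sum_distrib_left, subst sum.swap)
      (auto intro!: sum.cong simp: cjet_sym[OF assms] mult_ac)
  finally show ?thesis .
qed

text \<open>Differentiation in x puts the new direction e at the front of the list. It is carried
  past c and d to obtain the quadratic term of D (e # cs).\<close>

lemma deriv_quad:
  assumes "length cs \<le> 2"
  shows "((\<lambda>p. (\<Sum>c\<in>UNIV. \<Sum>d\<in>UNIV. snd p $ c * snd p $ d * D (d # c # cs) (fst p)) / 2) has_derivative
    (\<lambda>h. (\<Sum>e\<in>UNIV. fst h $ e * ((\<Sum>c\<in>UNIV. \<Sum>d\<in>UNIV. y $ c * y $ d * D (d # c # e # cs) x) / 2)) +
      (\<Sum>c\<in>UNIV. snd h $ c * (\<Sum>d\<in>UNIV. y $ d * D (d # c # cs) x)))) (at (x, y))"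
proof -
  have "((\<lambda>p. (\<Sum>c\<in>UNIV. \<Sum>d\<in>UNIV. snd p $ c * snd p $ d * D (d # c # cs) (fst p)) / 2) has_derivative
    (\<lambda>h. (\<Sum>c\<in>UNIV. \<Sum>d\<in>UNIV. y $ c * y $ d * (\<Sum>e\<in>UNIV. fst h $ e * D (e # d # c # cs) x)
       + (y $ c * snd h $ d + snd h $ c * y $ d) * D (d # c # cs) x) / 2)) (at (x, y))"
    using assms by (auto intro!: derivative_eq_intros deriv_fst deriv_snd)
  also have "(\<lambda>h. (\<Sum>c\<in>UNIV. \<Sum>d\<in>UNIV. y $ c * y $ d * (\<Sum>e\<in>UNIV. fst h $ e * D (e # d # c # cs) x)
       + (y $ c * snd h $ d + snd h $ c * y $ d) * D (d # c # cs) x) / 2) =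
    (\<lambda>h. (\<Sum>e\<in>UNIV. fst h $ e * ((\<Sum>c\<in>UNIV. \<Sum>d\<in>UNIV. y $ c * y $ d * D (d # c # e # cs) x) / 2)) +
      (\<Sum>c\<in>UNIV. snd h $ c * (\<Sum>d\<in>UNIV. y $ d * D (d # c # cs) x)))"
  proof
    fix h :: "(real ^ 'd) \<times> (real ^ 'd)"
    have perm: "D (e # d # c # cs) x = D (d # c # e # cs) x" for c d e
      using cjet_sym[of "c # cs" e d x] cjet_sym2[OF assms, of d e c x] assms by simp
    have 1: "(\<Sum>c\<in>UNIV. \<Sum>d\<in>UNIV. y $ c * y $ d * (\<Sum>e\<in>UNIV. fst h $ e * D (e # d # c # cs) x)) =
      (\<Sum>e\<in>UNIV. fst h $ e * (\<Sum>c\<in>UNIV. \<Sum>d\<in>UNIV. y $ c * y $ d * D (d # c # e # cs) x))"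
    proof -
      have "(\<Sum>c\<in>UNIV. \<Sum>d\<in>UNIV. y $ c * y $ d * (\<Sum>e\<in>UNIV. fst h $ e * D (e # d # c # cs) x)) =
        (\<Sum>c\<in>UNIV. \<Sum>e\<in>UNIV. \<Sum>d\<in>UNIV. fst h $ e * (y $ c * y $ d * D (d # c # e # cs) x))"
        unfolding sum_distrib_left by (rule sum.cong[OF refl], subst sum.swap) (simp add: perm mult_ac)
      also have "\<dots> = (\<Sum>e\<in>UNIV. \<Sum>c\<in>UNIV. \<Sum>d\<in>UNIV. fst h $ e * (y $ c * y $ d * D (d # c # e # cs) x))"
        by (rule sum.swap)
      finally show ?thesis by (simp add: sum_distrib_left)
    qed
    have 2: "(\<Sum>c\<in>UNIV. \<Sum>d\<in>UNIV. y $ c * snd h $ d * D (d # c # cs) x) = (\<Sum>c\<in>UNIV. snd h $ c * (\<Sum>d\<in>UNIV. y $ d * D (d # c # cs) x))"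
      unfolding sum_distrib_left using assms by (subst sum.swap) (auto intro!: sum.cong simp: cjet_sym mult_ac)
    have 3: "(\<Sum>c\<in>UNIV. \<Sum>d\<in>UNIV. snd h $ c * y $ d * D (d # c # cs) x) = (\<Sum>c\<in>UNIV. snd h $ c * (\<Sum>d\<in>UNIV. y $ d * D (d # c # cs) x))"
      unfolding sum_distrib_left by (simp add: mult_ac)
    show "(\<Sum>c\<in>UNIV. \<Sum>d\<in>UNIV. y $ c * y $ d * (\<Sum>e\<in>UNIV. fst h $ e * D (e # d # c # cs) x)
       + (y $ c * snd h $ d + snd h $ c * y $ d) * D (d # c # cs) x) / 2 =
      (\<Sum>e\<in>UNIV. fst h $ e * ((\<Sum>c\<in>UNIV. \<Sum>d\<in>UNIV. y $ c * y $ d * D (d # c # e # cs) x) / 2)) +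
      (\<Sum>c\<in>UNIV. snd h $ c * (\<Sum>d\<in>UNIV. y $ d * D (d # c # cs) x))"
      unfolding sum.distrib distrib_right 1 2 3 times_divide_eq_right sum_divide_distrib[symmetric] by simp
  qed
  finally show ?thesis .
qed

lemma power_delta_le: "m \<le> n \<Longrightarrow> K * \<delta> ^ n \<le> K * \<delta> ^ m"
  using cjet_pos by (intro mult_left_mono power_decreasing) auto

text \<open>The gradient has one more factor \<delta>, which is given up: the covariance bound sees
  only a common bound for a function and its gradient.\<close>

lemma tame_jet:
  assumes "1 \<le> length cs" "length cs \<le> 4"
  shows "tame M (K * \<delta> ^ (length cs - 1)) (\<lambda>x y. D cs x)"
  unfolding tame_def
proof (rule exI[of _ "\<lambda>c x y. D (c # cs) x"], rule exI[of _ "\<lambda>c x y. 0"], intro conjI allI impI)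
  show "((\<lambda>p. D cs (fst p)) has_derivative (\<lambda>h. (\<Sum>c\<in>UNIV. fst h $ c * D (c # cs) x) + (\<Sum>c\<in>UNIV. snd h $ c * 0))) (at (x, y))" for x y :: "real ^ 'd"
    using deriv_fst assms by simp
  show "\<bar>D cs x\<bar> \<le> K * \<delta> ^ (length cs - 1)" for x using cjet_bound assms by simp
  show "\<bar>D (c # cs) x\<bar> \<le> K * \<delta> ^ (length cs - 1)" for c x
    using cjet_bound[of "c # cs" x] power_delta_le[of "length cs - 1" "length cs"] assms by simp
  show "\<bar>0\<bar> \<le> K * \<delta> ^ (length cs - 1)" using cjet_pos by simp
qed

context
  fixes M :: real
  assumes M: "1 \<le> M"
begin

lemma card_M: "1 \<le> real CARD('d) * M"
proof -
  have "1 \<le> real CARD('d)" by (simp add: Suc_leI)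
  then show ?thesis using M mult_mono[of 1 "real CARD('d)" 1 M] by simp
qed

text \<open>The y-derivative of a remainder is the remainder one order lower of the next derivative.
  It has the same power of \<delta> and one factor d M less, which d M >= 1 makes up for.\<close>

lemma tame_rem1:
  assumes "length cs \<le> 3"
  shows "tame M (real CARD('d) * M * (K * \<delta> ^ length cs)) (rem1 D cs)"
  unfolding tame_def
proof (rule exI[of _ "\<lambda>c. rem1 D (c # cs)"], rule exI[of _ "\<lambda>c x y. D (c # cs) (x + y)"], intro conjI allI impI)
  show "((\<lambda>p. rem1 D cs (fst p) (snd p)) has_derivative
      (\<lambda>h. (\<Sum>c\<in>UNIV. fst h $ c * rem1 D (c # cs) x y) + (\<Sum>c\<in>UNIV. snd h $ c * D (c # cs) (x + y)))) (at (x, y))" for x y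
    unfolding rem1_def using assms
    by (intro has_derivative_eq_rhs[OF has_derivative_diff[OF deriv_shift deriv_fst]])
      (auto simp: right_diff_distrib sum_subtractf)
  fix x y :: "real ^ 'd" assume "y \<in> cube M"
  then have y: "\<bar>y $ c\<bar> \<le> M" for c by (simp add: mem_cube)
  show "\<bar>rem1 D cs x y\<bar> \<le> real CARD('d) * M * (K * \<delta> ^ length cs)"
    by (rule rem1_bound[OF _ y]) (use assms in auto)
  show "\<bar>rem1 D (c # cs) x y\<bar> \<le> real CARD('d) * M * (K * \<delta> ^ length cs)" for c
    by (rule order_trans[OF rem1_bound[OF _ y]])
      (use assms M power_delta_le[of "length cs" "Suc (length cs)"] in \<open>auto intro!: mult_left_mono\<close>)
  have "1 * (K * \<delta> ^ length cs) \<le> real CARD('d) * M * (K * \<delta> ^ length cs)"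
    using card_M cjet_pos by (intro mult_right_mono) auto
  then show "\<bar>D (c # cs) (x + y)\<bar> \<le> real CARD('d) * M * (K * \<delta> ^ length cs)" for c
    using cjet_bound[of "c # cs" "x + y"] assms by simp
qed

lemma tame_rem2:
  assumes "length cs \<le> 2"
  shows "tame M ((real CARD('d) * M) ^ 2 * (K * \<delta> ^ (length cs + 1))) (rem2 D cs)"
  unfolding tame_def
proof (rule exI[of _ "\<lambda>c. rem2 D (c # cs)"], rule exI[of _ "\<lambda>c. rem1 D (c # cs)"], intro conjI allI impI)
  show "((\<lambda>p. rem2 D cs (fst p) (snd p)) has_derivative
      (\<lambda>h. (\<Sum>c\<in>UNIV. fst h $ c * rem2 D (c # cs) x y) + (\<Sum>c\<in>UNIV. snd h $ c * rem1 D (c # cs) x y))) (at (x, y))" for x y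
    unfolding rem2_def rem1_def using assms
    by (intro has_derivative_eq_rhs[OF has_derivative_diff[OF has_derivative_diff[OF deriv_shift deriv_fst] deriv_lin]])
      (auto simp: right_diff_distrib sum_subtractf)
  fix x y :: "real ^ 'd" assume "y \<in> cube M"
  then have y: "\<bar>y $ c\<bar> \<le> M" for c by (simp add: mem_cube)
  show "\<bar>rem2 D cs x y\<bar> \<le> (real CARD('d) * M) ^ 2 * (K * \<delta> ^ (length cs + 1))"
    by (rule rem2_bound[OF _ y]) (use assms M in auto)
  show "\<bar>rem2 D (c # cs) x y\<bar> \<le> (real CARD('d) * M) ^ 2 * (K * \<delta> ^ (length cs + 1))" for c
    by (rule order_trans[OF rem2_bound[OF _ y]])
      (use assms M power_delta_le[of "length cs + 1" "length cs + 2"] in \<open>auto intro!: mult_left_mono\<close>)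
  have "\<bar>rem1 D (c # cs) x y\<bar> \<le> (real CARD('d) * M) ^ 1 * (K * \<delta> ^ (length cs + 1))" for c
    using rem1_bound[OF _ y, of "c # cs"] assms by simp
  also have "\<dots> \<le> (real CARD('d) * M) ^ 2 * (K * \<delta> ^ (length cs + 1))"
    using card_M cjet_pos by (intro mult_right_mono power_increasing) auto
  finally show "\<bar>rem1 D (c # cs) x y\<bar> \<le> (real CARD('d) * M) ^ 2 * (K * \<delta> ^ (length cs + 1))" for c .
qed

lemma tame_rem3:
  assumes "length cs \<le> 1"
  shows "tame M ((real CARD('d) * M) ^ 3 * (K * \<delta> ^ (length cs + 2))) (rem3 D cs)"
  unfolding tame_def
proof (rule exI[of _ "\<lambda>c. rem3 D (c # cs)"], rule exI[of _ "\<lambda>c. rem2 D (c # cs)"], intro conjI allI impI)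
  show "((\<lambda>p. rem3 D cs (fst p) (snd p)) has_derivative
      (\<lambda>h. (\<Sum>c\<in>UNIV. fst h $ c * rem3 D (c # cs) x y) + (\<Sum>c\<in>UNIV. snd h $ c * rem2 D (c # cs) x y))) (at (x, y))" for x y
    unfolding rem3_def rem2_def rem1_def using assms
    by (intro has_derivative_eq_rhs[OF has_derivative_diff[OF has_derivative_diff[OF has_derivative_diff[OF deriv_shift deriv_fst] deriv_lin] deriv_quad]])
      (auto simp: right_diff_distrib sum_subtractf)
  fix x y :: "real ^ 'd" assume "y \<in> cube M"
  then have y: "\<bar>y $ c\<bar> \<le> M" for c by (simp add: mem_cube)
  show "\<bar>rem3 D cs x y\<bar> \<le> (real CARD('d) * M) ^ 3 * (K * \<delta> ^ (length cs + 2))"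
    by (rule rem3_bound[OF _ y]) (use assms M in auto)
  show "\<bar>rem3 D (c # cs) x y\<bar> \<le> (real CARD('d) * M) ^ 3 * (K * \<delta> ^ (length cs + 2))" for c
    by (rule order_trans[OF rem3_bound[OF _ y]])
      (use assms M power_delta_le[of "length cs + 2" "length cs + 3"] in \<open>auto intro!: mult_left_mono simp: numeral_3_eq_3\<close>)
  have "\<bar>rem2 D (c # cs) x y\<bar> \<le> (real CARD('d) * M) ^ 2 * (K * \<delta> ^ (length cs + 2))" for c
    using rem2_bound[OF _ y, of "c # cs"] assms M by simp
  also have "\<dots> \<le> (real CARD('d) * M) ^ 3 * (K * \<delta> ^ (length cs + 2))"
    using card_M cjet_pos by (intro mult_right_mono power_increasing) auto
  finally show "\<bar>rem2 D (c # cs) x y\<bar> \<le> (real CARD('d) * M) ^ 3 * (K * \<delta> ^ (length cs + 2))" for c .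
qed

end

end

section \<open>One Lindeberg step\<close>

context mixing begin

text \<open>All constants depend on the dimension and on \<open>C\<close>, \<open>M\<close>, \<open>R\<close>, \<open>ph\<close> only.\<close>

definition eM :: real where "eM = real CARD('d) * M"
definition W0 :: real where "W0 = (\<Sum>p. (real p + 1) * ph p)"
definition cG :: real where "cG = C * (3 + C + M)"
definition c4 :: real where "c4 = C * eM * W0"
definition c5 :: real where "c5 = real CARD('d) * c4 + eM ^ 2"

lemma eM_ge: "1 \<le> eM"
proof -
  have "1 \<le> real CARD('d)" by (simp add: Suc_leI)
  then show ?thesis using M_ge mult_mono[of 1 "real CARD('d)" 1 M] by (simp add: eM_def)
qed

lemma summable_W0: "summable (\<lambda>p. (real p + 1) * ph p)"
proof -
  have "summable ph"
  proof (rule summable_comparison_test'[OF ph_summable, of 1])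
    fix p :: nat assume "1 \<le> p"
    then have "1 * ph p \<le> real p * ph p" by (intro mult_right_mono ph_nonneg) auto
    then show "norm (ph p) \<le> real p * ph p" using ph_nonneg[of p] by simp
  qed
  from summable_add[OF ph_summable this] show ?thesis by (simp add: algebra_simps)
qed

lemma sum_weighted_le: "finite I \<Longrightarrow> (\<Sum>p\<in>I. (real p + 1) * ph p) \<le> W0"
  unfolding W0_def by (intro sum_le_suminf summable_W0) (auto simp: ph_nonneg)

lemma sum_ph_le: "finite I \<Longrightarrow> (\<Sum>p\<in>I. ph p) \<le> W0"
  by (rule order_trans[OF sum_mono sum_weighted_le])
    (use ph_nonneg in \<open>auto simp: algebra_simps\<close>)

lemma W0_ge: "1 \<le> W0"
  using sum_weighted_le[of "{0}"] by (simp add: ph_0)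

lemma consts_nonneg: "0 \<le> C" "0 \<le> M" "0 \<le> eM" "0 \<le> W0" "0 \<le> cG" "0 \<le> c4" "0 \<le> c5"
  using C_ge M_ge eM_ge W0_ge by (auto simp: cG_def c4_def c5_def intro!: mult_nonneg_nonneg add_nonneg_nonneg)

lemma E_add: "bm f \<Longrightarrow> bm g \<Longrightarrow> expectation (\<lambda>\<omega>. f \<omega> + g \<omega>) = expectation f + expectation g"
  by (simp add: bm_integrable)

lemma E_diff: "bm f \<Longrightarrow> bm g \<Longrightarrow> expectation (\<lambda>\<omega>. f \<omega> - g \<omega>) = expectation f - expectation g"
  by (simp add: bm_integrable)

lemma E_sum: "(\<And>i. i \<in> I \<Longrightarrow> bm (f i)) \<Longrightarrow> expectation (\<lambda>\<omega>. \<Sum>i\<in>I. f i \<omega>) = (\<Sum>i\<in>I. expectation (f i))"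
  by (intro Bochner_Integration.integral_sum) (auto intro: bm_integrable)

lemma cov_single_bound:
  assumes "tame M K A" "1 \<le> i" "i \<le> k"
  shows "\<bar>cov \<nu> (\<lambda>\<omega>. A (S (i - 1) \<omega>) (X i \<omega>)) (\<lambda>\<omega>. X k \<omega> $ a)\<bar> \<le> C * K * ph (k - i)"
  using mix1[OF assms(1,2) order_refl order_refl assms(3), of 0 0 a a a] by simp

section \<open>Expectations of derivatives multiplied by past variables\<close>

context
  fixes K \<delta> :: real and D :: "'d list \<Rightarrow> real ^ 'd \<Rightarrow> real"
  assumes jet: "cjet K \<delta> D"
begin

lemma K_nonneg: "0 \<le> K * \<delta> ^ n"
  using cjet_pos[OF jet] by simp

lemma bm_jet: "length cs \<le> 4 \<Longrightarrow> bm (\<lambda>\<omega>. D cs (S n \<omega>))"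
  by (intro bm_S cjet_cont[OF jet])

lemma jet_increment: "1 \<le> v \<Longrightarrow> D cs (S v \<omega>) - D cs (S (v - 1) \<omega>) = rem1 D cs (S (v - 1) \<omega>) (X v \<omega>)"
  by (simp add: rem1_def S_pred)

lemma tame_jet': "length cs = Suc n \<Longrightarrow> n \<le> 3 \<Longrightarrow> tame M (K * \<delta> ^ n) (\<lambda>x y. D cs x)"
  using tame_jet[OF jet, of cs M] by simp

lemma tame_rem1': "length cs = n \<Longrightarrow> n \<le> 3 \<Longrightarrow> tame M (eM * (K * \<delta> ^ n)) (rem1 D cs)"
  using tame_rem1[OF jet M_ge, of cs] by (simp add: eM_def)

lemma tame_rem2': "length cs = 2 \<Longrightarrow> tame M (eM ^ 2 * (K * \<delta> ^ 3)) (rem2 D cs)"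
  using tame_rem2[OF jet M_ge, of cs] by (simp add: eM_def)

lemma tame_rem3': "length cs = 1 \<Longrightarrow> tame M (eM ^ 3 * (K * \<delta> ^ 3)) (rem3 D cs)"
  using tame_rem3[OF jet M_ge, of cs] by (simp add: eM_def numeral_3_eq_3)

lemma bm_rem: "length cs \<le> 3 \<Longrightarrow> bm (\<lambda>\<omega>. rem1 D cs (S n \<omega>) (X k \<omega>))"
    "length cs \<le> 2 \<Longrightarrow> bm (\<lambda>\<omega>. rem2 D cs (S n \<omega>) (X k \<omega>))"
    "length cs \<le> 1 \<Longrightarrow> bm (\<lambda>\<omega>. rem3 D cs (S n \<omega>) (X k \<omega>))"
  by (rule bm_tame[OF tame_rem1[OF jet M_ge]] bm_tame[OF tame_rem2[OF jet M_ge]] bm_tame[OF tame_rem3[OF jet M_ge]]; assumption)+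

text \<open>X v is centred, so the expectation is a covariance. Inside a window of length s each
  increment of a third derivative has size \<open>\<delta>^3\<close> and weight ph q; at its end the
  third derivative itself, of size \<open>\<delta>^2\<close>, is left with weight ph s.\<close>

lemma third_order_pair:
  assumes cs: "length cs = 3" and v: "1 \<le> v"
  shows "\<bar>expectation (\<lambda>\<omega>. D cs (S (v - 1) \<omega>) * X v \<omega> $ c)\<bar> \<le> c4 * (K * (\<delta> ^ 3 + \<delta> ^ 2 * ph s))"
proof -
  have "\<bar>cov \<nu> (\<lambda>\<omega>. D cs (S (v - 1) \<omega>)) (\<lambda>\<omega>. X v \<omega> $ c)\<bar> \<le> (\<Sum>q = 1..s. C * (eM * (K * \<delta> ^ 3)) * ph q) + C * (K * \<delta> ^ 2) * ph s"
  proof (rule telescope[OF _ _ _ _ _ _ v])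
    fix q assume q: "1 \<le> q" "q \<le> s" "q < v"
    have "\<bar>cov \<nu> (\<lambda>\<omega>. rem1 D cs (S (v - q - 1) \<omega>) (X (v - q) \<omega>)) (\<lambda>\<omega>. X v \<omega> $ c)\<bar> \<le> C * (eM * (K * \<delta> ^ 3)) * ph (v - (v - q))"
      by (rule cov_single_bound[OF tame_rem1']) (use cs q in auto)
    then show "\<bar>cov \<nu> (\<lambda>\<omega>. D cs (S (v - q) \<omega>) - D cs (S (v - q - 1) \<omega>)) (\<lambda>\<omega>. X v \<omega> $ c)\<bar> \<le> C * (eM * (K * \<delta> ^ 3)) * ph q"
      using q jet_increment[of "v - q" cs] by simp
  next
    fix i assume i: "i + s = v" "1 \<le> i"
    have "\<bar>cov \<nu> (\<lambda>\<omega>. (\<lambda>x y. D cs x) (S (i - 1) \<omega>) (X i \<omega>)) (\<lambda>\<omega>. X v \<omega> $ c)\<bar> \<le> C * (K * \<delta> ^ 2) * ph (v - i)"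
      by (rule cov_single_bound[OF tame_jet']) (use cs i in auto)
    then show "\<bar>cov \<nu> (\<lambda>\<omega>. D cs (S (i - 1) \<omega>)) (\<lambda>\<omega>. X v \<omega> $ c)\<bar> \<le> C * (K * \<delta> ^ 2) * ph s"
      using i(1) by auto
  qed (use cs K_nonneg consts_nonneg ph_nonneg in \<open>auto intro!: cjet_cont[OF jet] bm_X mult_nonneg_nonneg\<close>)
  also have "(\<Sum>q = 1..s. C * (eM * (K * \<delta> ^ 3)) * ph q) \<le> C * (eM * (K * \<delta> ^ 3)) * W0"
    unfolding sum_distrib_left[symmetric] using cjet_pos[OF jet] consts_nonneg
    by (intro mult_left_mono sum_ph_le mult_nonneg_nonneg) auto
  also have "C * (eM * (K * \<delta> ^ 3)) * W0 + C * (K * \<delta> ^ 2) * ph s \<le> c4 * (K * (\<delta> ^ 3 + \<delta> ^ 2 * ph s))"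
  proof -
    have "1 \<le> eM * W0" using mult_mono[OF eM_ge W0_ge] eM_ge by simp
    then have "1 * (C * (K * \<delta> ^ 2) * ph s) \<le> (eM * W0) * (C * (K * \<delta> ^ 2) * ph s)"
      using cjet_pos[OF jet] consts_nonneg ph_nonneg by (intro mult_right_mono mult_nonneg_nonneg) auto
    then show ?thesis by (simp add: c4_def algebra_simps)
  qed
  finally show ?thesis by (simp add: cov_mean_zero EX)
qed

text \<open>A plain Lipschitz bound would give \<open>\<delta>^2\<close>. Expanding to first order
  leaves a remainder of size \<open>\<delta>^3\<close> and terms in which X v is nearly decorrelated
  from the third derivative.\<close>

lemma second_order_increment:
  assumes cs: "length cs = 2" and v: "1 \<le> v"
  shows "\<bar>expectation (\<lambda>\<omega>. D cs (S v \<omega>)) - expectation (\<lambda>\<omega>. D cs (S (v - 1) \<omega>))\<bar> \<le> c5 * (K * (\<delta> ^ 3 + \<delta> ^ 2 * ph s))"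
proof -
  have "expectation (\<lambda>\<omega>. D cs (S v \<omega>)) - expectation (\<lambda>\<omega>. D cs (S (v - 1) \<omega>)) =
    expectation (\<lambda>\<omega>. D cs (S v \<omega>) - D cs (S (v - 1) \<omega>))"
    using cs by (simp add: E_diff bm_jet)
  also have "\<dots> = expectation (\<lambda>\<omega>. (\<Sum>c\<in>UNIV. D (c # cs) (S (v - 1) \<omega>) * X v \<omega> $ c) + rem2 D cs (S (v - 1) \<omega>) (X v \<omega>))"
    unfolding jet_increment[OF v] by (simp add: rem2_def mult.commute)
  also have "\<dots> = (\<Sum>c\<in>UNIV. expectation (\<lambda>\<omega>. D (c # cs) (S (v - 1) \<omega>) * X v \<omega> $ c)) + expectation (\<lambda>\<omega>. rem2 D cs (S (v - 1) \<omega>) (X v \<omega>))"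
    using cs by (subst E_add, auto intro!: bm_intros bm_jet bm_rem) (subst E_sum, auto intro!: bm_intros bm_jet)
  also have "\<bar>\<dots>\<bar> \<le> (\<Sum>c\<in>(UNIV :: 'd set). c4 * (K * (\<delta> ^ 3 + \<delta> ^ 2 * ph s))) + eM ^ 2 * (K * \<delta> ^ 3)"
    using cs v by (intro order_trans[OF abs_triangle_ineq] add_mono order_trans[OF sum_abs] sum_mono third_order_pair
        abs_expectation_le tame_bound[OF tame_rem2'] X_bound) auto
  also have "\<dots> \<le> c5 * (K * (\<delta> ^ 3 + \<delta> ^ 2 * ph s))"
  proof -
    have "eM ^ 2 * (K * \<delta> ^ 3) \<le> eM ^ 2 * (K * (\<delta> ^ 3 + \<delta> ^ 2 * ph s))"
      using cjet_pos[OF jet] ph_nonneg by (intro mult_left_mono) auto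
    then show ?thesis by (simp add: c5_def algebra_simps)
  qed
  finally show ?thesis .
qed

lemma second_order_increments:
  assumes cs: "length cs = 2"
  shows "\<bar>expectation (\<lambda>\<omega>. D cs (S (v + n) \<omega>)) - expectation (\<lambda>\<omega>. D cs (S v \<omega>))\<bar> \<le> real n * (c5 * (K * (\<delta> ^ 3 + \<delta> ^ 2 * ph s)))"
proof (induction n)
  case (Suc n)
  show ?case
    using Suc second_order_increment[OF cs, of "v + Suc n" s] by (simp add: algebra_simps)
qed simp

lemma third_order_increments:
  assumes cs: "length cs = 3"
  shows "\<bar>expectation (\<lambda>\<omega>. D cs (S (v + n) \<omega>)) - expectation (\<lambda>\<omega>. D cs (S v \<omega>))\<bar> \<le> real n * (eM * (K * \<delta> ^ 3))"
proof (induction n)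
  case (Suc n)
  have "expectation (\<lambda>\<omega>. D cs (S (v + Suc n) \<omega>)) - expectation (\<lambda>\<omega>. D cs (S (v + n) \<omega>)) =
      expectation (\<lambda>\<omega>. rem1 D cs (S (v + n) \<omega>) (X (v + Suc n) \<omega>))"
    using jet_increment[of "v + Suc n" cs] cs by (simp add: E_diff[symmetric] bm_jet)
  also have "\<bar>\<dots>\<bar> \<le> eM * (K * \<delta> ^ 3)"
    by (intro abs_expectation_le tame_bound[OF tame_rem1'] X_bound) (use cs in auto)
  finally show ?case using Suc by (simp add: algebra_simps)
qed simp

text \<open>Bound of \<open>third_order_triple\<close> for gaps j and p: increments inside the
  window Q, the covariance left at its end, and the mean of the third derivative times a triple
  moment.\<close>

definition S3B :: "real \<Rightarrow> nat \<Rightarrow> nat \<Rightarrow> nat \<Rightarrow> real" where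
  "S3B \<Theta> Q j p = cG * (eM * (K * \<delta> ^ 3)) * (\<Sum>q = 1..Q. psi3 q j p) + cG * (K * \<delta> ^ 2) * ph Q
    + (eM * (K * \<delta> ^ 3) * real (j + p) + \<Theta>) * (C * psi j p)"

lemma S3B_nonneg: "0 \<le> \<Theta> \<Longrightarrow> 0 \<le> S3B \<Theta> Q j p"
  unfolding S3B_def using cjet_pos[OF jet] consts_nonneg psi_nonneg ph_nonneg
  by (intro add_nonneg_nonneg mult_nonneg_nonneg sum_nonneg) auto

text \<open>The condition on Q makes the gap at the end of the window R times the spread of the
  triple, so that it decays like ph Q. In the product term the mean of the third derivative is moved
  from time i - 1 to k - 1, the time at which \<open>\<Theta>\<close> controls it.\<close>

lemma third_order_triple:
  assumes cs: "length cs = 3" and o: "1 \<le> i" "i \<le> u" "u \<le> k" and Q: "R * (k - i) \<le> Q"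
    and \<Theta>: "\<bar>expectation (\<lambda>\<omega>. D cs (S (k - 1) \<omega>))\<bar> \<le> \<Theta>"
  shows "\<bar>expectation (\<lambda>\<omega>. D cs (S (i - 1) \<omega>) * (X i \<omega> $ c * Zc b a u k \<omega>))\<bar> \<le> S3B \<Theta> Q (u - i) (k - u)"
proof -
  let ?W = "\<lambda>\<omega>. X i \<omega> $ c * Zc b a u k \<omega>"
  have ki: "k - i = (u - i) + (k - u)" using o by simp
  have bW: "bm ?W" by (intro bm_intros bm_Zc)
  have EW: "expectation ?W = kap c b a i u k"
    by (simp add: Zc_def right_diff_distrib bm_integrable bm_intros kap_def EX)
  have tel: "\<bar>cov \<nu> (\<lambda>\<omega>. D cs (S (i - 1) \<omega>)) ?W\<bar> \<le> (\<Sum>q = 1..Q. cG * (eM * (K * \<delta> ^ 3)) * psi3 q (u - i) (k - u)) + cG * (K * \<delta> ^ 2) * ph Q"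
  proof (rule telescope[OF _ bW _ _ _ _ o(1)])
    fix q assume q: "1 \<le> q" "q \<le> Q" "q < i"
    have "\<bar>cov \<nu> (\<lambda>\<omega>. rem1 D cs (S (i - q - 1) \<omega>) (X (i - q) \<omega>)) ?W\<bar> \<le> C * (3 + C + M) * (eM * (K * \<delta> ^ 3)) * psi3 (i - (i - q)) (u - i) (k - u)"
      by (rule cov_triple_bound[OF tame_rem1']) (use cs q o K_nonneg consts_nonneg in auto)
    then show "\<bar>cov \<nu> (\<lambda>\<omega>. D cs (S (i - q) \<omega>) - D cs (S (i - q - 1) \<omega>)) ?W\<bar> \<le> cG * (eM * (K * \<delta> ^ 3)) * psi3 q (u - i) (k - u)"
      using q jet_increment[of "i - q" cs] by (simp add: cG_def)
  next
    fix i' assume i: "i' + Q = i" "1 \<le> i'"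
    have "\<bar>cov \<nu> (\<lambda>\<omega>. (\<lambda>x y. D cs x) (S (i' - 1) \<omega>) (X i' \<omega>)) ?W\<bar> \<le> C * (3 + C + M) * (K * \<delta> ^ 2) * psi3 (i - i') (u - i) (k - u)"
      by (rule cov_triple_bound[OF tame_jet']) (use cs i o K_nonneg in auto)
    moreover have "psi3 (i - i') (u - i) (k - u) = ph Q"
      using i Q unfolding psi3_def ki by auto
    ultimately show "\<bar>cov \<nu> (\<lambda>\<omega>. D cs (S (i' - 1) \<omega>)) ?W\<bar> \<le> cG * (K * \<delta> ^ 2) * ph Q"
      by (simp add: cG_def)
  qed (use cs K_nonneg consts_nonneg ph_nonneg psi_nonneg in \<open>auto intro!: cjet_cont[OF jet] mult_nonneg_nonneg\<close>)
  have "\<bar>expectation (\<lambda>\<omega>. D cs (S (i - 1) \<omega>))\<bar> \<le> eM * (K * \<delta> ^ 3) * real (k - i) + \<Theta>"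
    using third_order_increments[OF cs, of "i - 1" "k - i"] \<Theta> o by (simp add: mult.commute)
  then have "\<bar>expectation (\<lambda>\<omega>. D cs (S (i - 1) \<omega>)) * kap c b a i u k\<bar> \<le> (eM * (K * \<delta> ^ 3) * real (k - i) + \<Theta>) * (C * psi (u - i) (k - u))"
    unfolding abs_mult using o by (intro mult_mono kap_bound) auto
  moreover have "expectation (\<lambda>\<omega>. D cs (S (i - 1) \<omega>) * ?W \<omega>) = cov \<nu> (\<lambda>\<omega>. D cs (S (i - 1) \<omega>)) ?W + expectation (\<lambda>\<omega>. D cs (S (i - 1) \<omega>)) * kap c b a i u k"
    by (simp add: cov_def EW)
  ultimately show ?thesis using tel unfolding S3B_def sum_distrib_left[symmetric] ki[symmetric] by linarith
qed

text \<open>The case i = u without centring: the subtracted pair moment returns multiplied by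
  E[D^3 X u], which \<open>third_order_pair\<close> makes small.\<close>

lemma third_order_diagonal:
  assumes cs: "length cs = 3" and o: "1 \<le> u" "u \<le> k" and Q: "R * (k - u) \<le> Q"
    and \<Theta>: "\<bar>expectation (\<lambda>\<omega>. D cs (S (k - 1) \<omega>))\<bar> \<le> \<Theta>"
  shows "\<bar>expectation (\<lambda>\<omega>. D cs (S (u - 1) \<omega>) * (X u \<omega> $ c * (X u \<omega> $ b * X k \<omega> $ a)))\<bar>
    \<le> S3B \<Theta> Q 0 (k - u) + C * c4 * (K * (\<delta> ^ 3 + \<delta> ^ 2 * ph s)) * ph (k - u)"
proof -
  have "expectation (\<lambda>\<omega>. D cs (S (u - 1) \<omega>) * (X u \<omega> $ c * (X u \<omega> $ b * X k \<omega> $ a))) =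
     expectation (\<lambda>\<omega>. D cs (S (u - 1) \<omega>) * (X u \<omega> $ c * Zc b a u k \<omega>) + (D cs (S (u - 1) \<omega>) * X u \<omega> $ c) * gam b a u k)"
    by (intro Bochner_Integration.integral_cong) (auto simp: Zc_def algebra_simps)
  also have "\<dots> = expectation (\<lambda>\<omega>. D cs (S (u - 1) \<omega>) * (X u \<omega> $ c * Zc b a u k \<omega>)) + expectation (\<lambda>\<omega>. D cs (S (u - 1) \<omega>) * X u \<omega> $ c) * gam b a u k"
    using cs by (subst E_add) (auto intro!: bm_intros bm_jet bm_Zc)
  also have "\<bar>\<dots>\<bar> \<le> S3B \<Theta> Q 0 (k - u) + (c4 * (K * (\<delta> ^ 3 + \<delta> ^ 2 * ph s))) * (C * ph (k - u))"
  proof (rule order_trans[OF abs_triangle_ineq add_mono])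
    show "\<bar>expectation (\<lambda>\<omega>. D cs (S (u - 1) \<omega>) * (X u \<omega> $ c * Zc b a u k \<omega>))\<bar> \<le> S3B \<Theta> Q 0 (k - u)"
      using third_order_triple[OF cs o(1) order_refl o(2) Q \<Theta>, of c b a] by simp
    show "\<bar>expectation (\<lambda>\<omega>. D cs (S (u - 1) \<omega>) * X u \<omega> $ c) * gam b a u k\<bar> \<le> (c4 * (K * (\<delta> ^ 3 + \<delta> ^ 2 * ph s))) * (C * ph (k - u))"
      unfolding abs_mult using o cs cjet_pos[OF jet] consts_nonneg ph_nonneg
      by (intro mult_mono third_order_pair gam_bound) auto
  qed
  finally show ?thesis by (simp add: mult_ac)
qed

text \<open>Two errors: decoupling D^2 from the product, and moving its mean from time u - 1 to k -
  1. The second costs k - u increments, paid by the first moment of ph. For the first, every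
  increment is expanded once more, its linear part being a third derivative times X i, as in
  \<open>third_order_triple\<close>.\<close>

lemma second_order_pair:
  assumes cs: "length cs = 2" and o: "1 \<le> u" "u \<le> k" and J: "R * (k - u) \<le> J" and Q: "R * (J + (k - u)) \<le> Q"
    and \<Theta>: "\<And>c. \<bar>expectation (\<lambda>\<omega>. D (c # cs) (S (k - 1) \<omega>))\<bar> \<le> \<Theta>"
  shows "\<bar>expectation (\<lambda>\<omega>. D cs (S (u - 1) \<omega>) * (X u \<omega> $ b * X k \<omega> $ a)) - expectation (\<lambda>\<omega>. D cs (S (k - 1) \<omega>)) * gam b a u k\<bar>
    \<le> C * c5 * (K * (\<delta> ^ 3 + \<delta> ^ 2 * ph s)) * (real (k - u) * ph (k - u))
      + (\<Sum>j = 1..J. real CARD('d) * S3B \<Theta> Q j (k - u) + 2 * C * (eM ^ 2 * (K * \<delta> ^ 3)) * psi j (k - u))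
      + 2 * C * (K * \<delta>) * ph J"
proof -
  let ?Z = "\<lambda>\<omega>. X u \<omega> $ b * X k \<omega> $ a"
  have bZ: "bm ?Z" by (intro bm_intros)
  have \<Theta>0: "0 \<le> \<Theta>" using \<Theta>[of a] by linarith
  have tel: "\<bar>cov \<nu> (\<lambda>\<omega>. D cs (S (u - 1) \<omega>)) ?Z\<bar> \<le>
     (\<Sum>j = 1..J. real CARD('d) * S3B \<Theta> Q j (k - u) + 2 * C * (eM ^ 2 * (K * \<delta> ^ 3)) * psi j (k - u)) + 2 * C * (K * \<delta>) * ph J"
  proof (rule telescope[OF _ bZ _ _ _ _ o(1)])
    fix j assume j: "1 \<le> j" "j \<le> J" "j < u"
    let ?i = "u - j"
    define f where "f c = cov \<nu> (\<lambda>\<omega>. D (c # cs) (S (?i - 1) \<omega>) * X ?i \<omega> $ c) ?Z" for c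
    define r where "r = cov \<nu> (\<lambda>\<omega>. rem2 D cs (S (?i - 1) \<omega>) (X ?i \<omega>)) ?Z"
    have "cov \<nu> (\<lambda>\<omega>. D cs (S ?i \<omega>) - D cs (S (?i - 1) \<omega>)) ?Z =
      cov \<nu> (\<lambda>\<omega>. (\<Sum>c\<in>UNIV. D (c # cs) (S (?i - 1) \<omega>) * X ?i \<omega> $ c) + rem2 D cs (S (?i - 1) \<omega>) (X ?i \<omega>)) ?Z"
      using j jet_increment[of ?i cs] by (simp add: rem2_def mult.commute)
    also have "\<dots> = (\<Sum>c\<in>UNIV. f c) + r"
      unfolding f_def r_def
      using cs by (subst cov_add_left, auto intro!: bm_intros bm_jet bm_rem) (subst cov_sum_left, auto intro!: bm_intros bm_jet)
    finally have e: "cov \<nu> (\<lambda>\<omega>. D cs (S ?i \<omega>) - D cs (S (?i - 1) \<omega>)) ?Z = (\<Sum>c\<in>UNIV. f c) + r" .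
    have f: "\<bar>f c\<bar> \<le> S3B \<Theta> Q j (k - u)" for c
    proof -
      \<comment> \<open>Taking the covariance with the product centres it, which brings in
        \<open>Zc\<close>.\<close>
      have "f c = expectation (\<lambda>\<omega>. D (c # cs) (S (?i - 1) \<omega>) * X ?i \<omega> $ c * ?Z \<omega> - (D (c # cs) (S (?i - 1) \<omega>) * X ?i \<omega> $ c) * gam b a u k)"
        using cs unfolding f_def by (subst E_diff) (auto intro!: bm_intros bm_jet simp: cov_def gam_def)
      also have "\<dots> = expectation (\<lambda>\<omega>. D (c # cs) (S (?i - 1) \<omega>) * (X ?i \<omega> $ c * Zc b a u k \<omega>))"
        by (intro Bochner_Integration.integral_cong) (auto simp: Zc_def algebra_simps)
      finally have fc: "f c = expectation (\<lambda>\<omega>. D (c # cs) (S (?i - 1) \<omega>) * (X ?i \<omega> $ c * Zc b a u k \<omega>))" .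
      \<comment> \<open>The triple starting at u - j has spread at most J + (k - u); the window Q
        has to exceed it R times.\<close>
      have "R * (k - ?i) \<le> R * (J + (k - u))" using j by (intro mult_left_mono) auto
      then have "R * (k - ?i) \<le> Q" using Q by linarith
      then have "\<bar>f c\<bar> \<le> S3B \<Theta> Q (u - ?i) (k - u)"
        unfolding fc by (intro third_order_triple) (use cs o j \<Theta> in auto)
      then show ?thesis using j by simp
    qed
    have r: "\<bar>r\<bar> \<le> 2 * C * (eM ^ 2 * (K * \<delta> ^ 3)) * psi j (k - u)"
    proof -
      have "\<bar>r\<bar> \<le> 2 * C * (eM ^ 2 * (K * \<delta> ^ 3)) * psi (u - ?i) (k - u)"
        unfolding r_def by (rule cov_pair_bound[OF tame_rem2'[OF cs]]) (use o j in \<open>simp_all add: K_nonneg\<close>)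
      then show ?thesis using j by simp
    qed
    have "\<bar>\<Sum>c\<in>UNIV. f c\<bar> \<le> (\<Sum>c\<in>(UNIV :: 'd set). S3B \<Theta> Q j (k - u))"
      by (rule order_trans[OF sum_abs sum_mono]) (rule f)
    then have "\<bar>(\<Sum>c\<in>UNIV. f c) + r\<bar> \<le> real CARD('d) * S3B \<Theta> Q j (k - u) + 2 * C * (eM ^ 2 * (K * \<delta> ^ 3)) * psi j (k - u)"
      unfolding sum_constant using r by linarith
    then show "\<bar>cov \<nu> (\<lambda>\<omega>. D cs (S (u - j) \<omega>) - D cs (S (u - j - 1) \<omega>)) ?Z\<bar> \<le>
      real CARD('d) * S3B \<Theta> Q j (k - u) + 2 * C * (eM ^ 2 * (K * \<delta> ^ 3)) * psi j (k - u)"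
      unfolding e .
  next
    fix i assume i: "i + J = u" "1 \<le> i"
    have "\<bar>cov \<nu> (\<lambda>\<omega>. (\<lambda>x y. D cs x) (S (i - 1) \<omega>) (X i \<omega>)) ?Z\<bar> \<le> 2 * C * (K * \<delta> ^ 1) * psi (u - i) (k - u)"
      by (rule cov_pair_bound[OF tame_jet']) (use cs o i K_nonneg[of 1] in auto)
    moreover have "psi (u - i) (k - u) = ph J" using i J by (auto simp: psi_def)
    ultimately show "\<bar>cov \<nu> (\<lambda>\<omega>. D cs (S (i - 1) \<omega>)) ?Z\<bar> \<le> 2 * C * (K * \<delta>) * ph J" by simp
  next
    show "continuous_on UNIV (D cs)" using cs by (intro cjet_cont[OF jet]) simp
    show "0 \<le> real CARD('d) * S3B \<Theta> Q j (k - u) + 2 * C * (eM ^ 2 * (K * \<delta> ^ 3)) * psi j (k - u)" for j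
      by (intro add_nonneg_nonneg mult_nonneg_nonneg S3B_nonneg[OF \<Theta>0] psi_nonneg K_nonneg consts_nonneg) (use consts_nonneg in simp_all)
    show "0 \<le> 2 * C * (K * \<delta>) * ph J"
      using cjet_pos[OF jet] consts_nonneg ph_nonneg by simp
  qed
  have "\<bar>expectation (\<lambda>\<omega>. D cs (S (u - 1) \<omega>)) - expectation (\<lambda>\<omega>. D cs (S (k - 1) \<omega>))\<bar> \<le> real (k - u) * (c5 * (K * (\<delta> ^ 3 + \<delta> ^ 2 * ph s)))"
    using second_order_increments[OF cs, of "u - 1" "k - u" s] o by (simp add: abs_minus_commute)
  then have "\<bar>(expectation (\<lambda>\<omega>. D cs (S (u - 1) \<omega>)) - expectation (\<lambda>\<omega>. D cs (S (k - 1) \<omega>))) * gam b a u k\<bar>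
    \<le> (real (k - u) * (c5 * (K * (\<delta> ^ 3 + \<delta> ^ 2 * ph s)))) * (C * ph (k - u))"
    unfolding abs_mult using o cjet_pos[OF jet] consts_nonneg ph_nonneg
    by (intro mult_mono gam_bound) auto
  moreover have "(real (k - u) * (c5 * (K * (\<delta> ^ 3 + \<delta> ^ 2 * ph s)))) * (C * ph (k - u)) = C * c5 * (K * (\<delta> ^ 3 + \<delta> ^ 2 * ph s)) * (real (k - u) * ph (k - u))"
    by (simp add: mult_ac)
  moreover have "expectation (\<lambda>\<omega>. D cs (S (u - 1) \<omega>) * ?Z \<omega>) - expectation (\<lambda>\<omega>. D cs (S (k - 1) \<omega>)) * gam b a u k =
     cov \<nu> (\<lambda>\<omega>. D cs (S (u - 1) \<omega>)) ?Z + (expectation (\<lambda>\<omega>. D cs (S (u - 1) \<omega>)) - expectation (\<lambda>\<omega>. D cs (S (k - 1) \<omega>))) * gam b a u k"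
    by (simp add: cov_def gam_def algebra_simps)
  ultimately show ?thesis using tel by linarith
qed

end

end

section \<open>Assembling one step\<close>

context mixing begin

lemma bm_divide: "bm f \<Longrightarrow> bm (\<lambda>\<omega>. f \<omega> / a)"
  using bm_mult[OF _ bm_const[of "1 / a"]] by simp

text \<open>Coefficient of the second derivative in step k. The diagonal stems from the second-order
  Taylor term with its factor 1/2, the rest from the first-order term decoupled from the last P
  variables. Adding the transpose gives the truncated covariance series.\<close>

definition Gam :: "nat \<Rightarrow> nat \<Rightarrow> 'd \<Rightarrow> 'd \<Rightarrow> real" where
  "Gam P k b a = gam b a k k / 2 + (\<Sum>p = 1..P. gam b a (k - p) k)"

text \<open>Decay rates summed over the windows. The factor j + p in \<open>PS1\<close> is the
  distance over which the mean of a third derivative is moved; \<open>PS3\<close> sums over the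
  telescoping inside the third window.\<close>

definition PS0 :: "nat \<Rightarrow> nat \<Rightarrow> real" where
  "PS0 s J = (\<Sum>p = 0..s. \<Sum>j = 0..J. psi j p)"

definition PS1 :: "nat \<Rightarrow> nat \<Rightarrow> real" where
  "PS1 s J = (\<Sum>p = 0..s. \<Sum>j = 0..J. real (j + p) * psi j p)"

definition PS3 :: "nat \<Rightarrow> nat \<Rightarrow> nat \<Rightarrow> real" where
  "PS3 s J Q = (\<Sum>p = 0..s. \<Sum>j = 0..J. \<Sum>q = 1..Q. psi3 q j p)"

text \<open>Error of one step per unit of K. The first summand collects the terms of size
  \<open>\<delta>^3\<close> inside the windows; the others are the covariances at the ends of the
  windows s, J and Q, with derivatives of order 1, 2 and 3.\<close>

definition ERR :: "real \<Rightarrow> nat \<Rightarrow> nat \<Rightarrow> nat \<Rightarrow> real" where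
  "ERR \<delta> s J Q = \<delta> ^ 3 * (1 + PS0 s J + PS1 s J + PS3 s J Q) + ph s + \<delta> * (real s + 1) * ph J
     + \<delta> ^ 2 * ((real s + 1) * (real J + 1)) * ph Q"

definition c6 :: real where
  "c6 = real CARD('d) * (C * eM ^ 3 * W0 + C) + real CARD('d) ^ 2 * (C * c5 * W0 + 2 * C * eM ^ 2 + 2 * C)
     + real CARD('d) ^ 3 * (2 * (cG * eM + cG + eM * C + C) + C * c4 * W0) + eM ^ 4"

lemma PS_nonneg: "0 \<le> PS0 s J" "0 \<le> PS1 s J" "0 \<le> PS3 s J Q"
  by (auto simp: PS0_def PS1_def PS3_def intro!: sum_nonneg mult_nonneg_nonneg psi_nonneg)

context
  fixes K \<delta> :: real and D :: "'d list \<Rightarrow> real ^ 'd \<Rightarrow> real"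
  assumes jet: "cjet K \<delta> D"
begin

text \<open>X k is centred, so the term is a covariance and telescopes over the past s variables;
  the minimum with k - 1 stops at time 0. The increments are expanded up to third derivatives, since
  a fourth derivative already has the admissible size \<open>\<delta>^3\<close>.\<close>

lemma first_order:
  assumes k: "1 \<le> k"
  shows "\<bar>expectation (\<lambda>\<omega>. D [a] (S (k - 1) \<omega>) * X k \<omega> $ a) -
     (\<Sum>p = 1..min s (k - 1). (\<Sum>b\<in>UNIV. expectation (\<lambda>\<omega>. D [b, a] (S (k - p - 1) \<omega>) * (X (k - p) \<omega> $ b * X k \<omega> $ a)))
       + (\<Sum>b\<in>UNIV. \<Sum>c\<in>UNIV. expectation (\<lambda>\<omega>. D [c, b, a] (S (k - p - 1) \<omega>) * (X (k - p) \<omega> $ b * (X (k - p) \<omega> $ c * X k \<omega> $ a)))) / 2)\<bar>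
    \<le> C * (eM ^ 3 * (K * \<delta> ^ 3)) * W0 + C * K * ph s"
proof -
  let ?P = "min s (k - 1)"
  let ?W = "\<lambda>\<omega>. X k \<omega> $ a"
  define m where "m p = (\<Sum>b\<in>UNIV. expectation (\<lambda>\<omega>. D [b, a] (S (k - p - 1) \<omega>) * (X (k - p) \<omega> $ b * X k \<omega> $ a)))
       + (\<Sum>b\<in>UNIV. \<Sum>c\<in>UNIV. expectation (\<lambda>\<omega>. D [c, b, a] (S (k - p - 1) \<omega>) * (X (k - p) \<omega> $ b * (X (k - p) \<omega> $ c * X k \<omega> $ a)))) / 2" for p
  define r where "r p = expectation (\<lambda>\<omega>. rem3 D [a] (S (k - p - 1) \<omega>) (X (k - p) \<omega>) * ?W \<omega>)" for p
  define t where "t = cov \<nu> (\<lambda>\<omega>. D [a] (S (k - ?P - 1) \<omega>)) ?W"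
  have c: "cov \<nu> (\<lambda>\<omega>. D [a] (S (k - p) \<omega>) - D [a] (S (k - p - 1) \<omega>)) ?W = m p + r p" if p: "p < k" for p
  proof -
    have "cov \<nu> (\<lambda>\<omega>. D [a] (S (k - p) \<omega>) - D [a] (S (k - p - 1) \<omega>)) ?W =
      expectation (\<lambda>\<omega>. (D [a] (S (k - p) \<omega>) - D [a] (S (k - p - 1) \<omega>)) * ?W \<omega>)"
      by (rule cov_mean_zero[OF EX])
    also have "\<dots> = expectation (\<lambda>\<omega>. ((\<Sum>b\<in>UNIV. D [b, a] (S (k - p - 1) \<omega>) * (X (k - p) \<omega> $ b * X k \<omega> $ a))
       + (\<Sum>b\<in>UNIV. \<Sum>c\<in>UNIV. D [c, b, a] (S (k - p - 1) \<omega>) * (X (k - p) \<omega> $ b * (X (k - p) \<omega> $ c * X k \<omega> $ a))) * (1 / 2))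
       + rem3 D [a] (S (k - p - 1) \<omega>) (X (k - p) \<omega>) * ?W \<omega>)"
    proof (intro Bochner_Integration.integral_cong refl)
      fix \<omega>
      have "D [a] (S (k - p) \<omega>) - D [a] (S (k - p - 1) \<omega>) = rem1 D [a] (S (k - p - 1) \<omega>) (X (k - p) \<omega>)"
        using p by (intro jet_increment[OF jet]) simp
      moreover have "(\<Sum>b\<in>UNIV. D [b, a] (S (k - p - 1) \<omega>) * (X (k - p) \<omega> $ b * X k \<omega> $ a)) =
        (\<Sum>b\<in>UNIV. X (k - p) \<omega> $ b * D [b, a] (S (k - p - 1) \<omega>)) * ?W \<omega>"
        unfolding sum_distrib_right by (simp add: mult_ac)
      moreover have "(\<Sum>b\<in>UNIV. \<Sum>c\<in>UNIV. D [c, b, a] (S (k - p - 1) \<omega>) * (X (k - p) \<omega> $ b * (X (k - p) \<omega> $ c * X k \<omega> $ a))) =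
        (\<Sum>b\<in>UNIV. \<Sum>c\<in>UNIV. X (k - p) \<omega> $ b * X (k - p) \<omega> $ c * D [c, b, a] (S (k - p - 1) \<omega>)) * ?W \<omega>"
        unfolding sum_distrib_right by (simp add: mult_ac)
      ultimately show "(D [a] (S (k - p) \<omega>) - D [a] (S (k - p - 1) \<omega>)) * ?W \<omega> =
        ((\<Sum>b\<in>UNIV. D [b, a] (S (k - p - 1) \<omega>) * (X (k - p) \<omega> $ b * X k \<omega> $ a))
       + (\<Sum>b\<in>UNIV. \<Sum>c\<in>UNIV. D [c, b, a] (S (k - p - 1) \<omega>) * (X (k - p) \<omega> $ b * (X (k - p) \<omega> $ c * X k \<omega> $ a))) * (1 / 2))
       + rem3 D [a] (S (k - p - 1) \<omega>) (X (k - p) \<omega>) * ?W \<omega>"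
        unfolding rem3_def rem2_def by (simp only: left_diff_distrib)
    qed
    also have "\<dots> = m p + r p"
      unfolding m_def r_def
      by (subst E_add, (intro bm_intros bm_jet[OF jet] bm_rem[OF jet]; simp)+,
        subst E_add, (intro bm_intros bm_jet[OF jet]; simp)+, subst E_sum, (intro bm_intros bm_jet[OF jet]; simp)+, simp add: E_sum bm_intros bm_jet[OF jet])
    finally show ?thesis .
  qed
  have r: "\<bar>r p\<bar> \<le> C * (eM ^ 3 * (K * \<delta> ^ 3)) * ph p" if p: "p < k" for p
  proof -
    have "r p = cov \<nu> (\<lambda>\<omega>. rem3 D [a] (S (k - p - 1) \<omega>) (X (k - p) \<omega>)) ?W"
      unfolding r_def by (rule cov_mean_zero[OF EX, symmetric])
    also have "\<bar>\<dots>\<bar> \<le> C * (eM ^ 3 * (K * \<delta> ^ 3)) * ph (k - (k - p))"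
      by (rule cov_single_bound[OF tame_rem3'[OF jet]]) (use p in auto)
    finally show ?thesis using p by simp
  qed
  have t: "\<bar>t\<bar> \<le> C * K * ph s"
  proof (cases "s < k - 1")
    case True
    have "\<bar>cov \<nu> (\<lambda>\<omega>. (\<lambda>x y. D [a] x) (S (k - s - 1) \<omega>) (X (k - s) \<omega>)) ?W\<bar> \<le> C * (K * \<delta> ^ 0) * ph (k - (k - s))"
      by (rule cov_single_bound[OF tame_jet'[OF jet]]) (use True in auto)
    then show ?thesis using True by (simp add: t_def)
  next
    case False
    \<comment> \<open>Time 0 is reached within the window, and S 0 is constant.\<close>
    then have "t = 0" using k by (simp add: t_def cov_const_left)
    then show ?thesis using consts_nonneg ph_nonneg cjet_pos[OF jet] by simp
  qed
  have "expectation (\<lambda>\<omega>. D [a] (S (k - 1) \<omega>) * ?W \<omega>) = cov \<nu> (\<lambda>\<omega>. D [a] (S (k - 1) \<omega>)) ?W"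
    by (rule cov_mean_zero[OF EX, symmetric])
  also have "\<dots> = (\<Sum>p = 1..?P. cov \<nu> (\<lambda>\<omega>. D [a] (S (k - p) \<omega>) - D [a] (S (k - p - 1) \<omega>)) ?W) + t"
    unfolding t_def by (rule telescope_sum[OF cjet_cont[OF jet] bm_X]) simp
  also have "(\<Sum>p = 1..?P. cov \<nu> (\<lambda>\<omega>. D [a] (S (k - p) \<omega>) - D [a] (S (k - p - 1) \<omega>)) ?W) = (\<Sum>p = 1..?P. m p + r p)"
    by (intro sum.cong refl c) (use k in auto)
  finally have "expectation (\<lambda>\<omega>. D [a] (S (k - 1) \<omega>) * ?W \<omega>) - (\<Sum>p = 1..?P. m p) = (\<Sum>p = 1..?P. r p) + t"
    by (simp add: sum.distrib)
  moreover have "\<bar>\<Sum>p = 1..?P. r p\<bar> \<le> C * (eM ^ 3 * (K * \<delta> ^ 3)) * W0"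
  proof -
    have "\<bar>\<Sum>p = 1..?P. r p\<bar> \<le> (\<Sum>p = 1..?P. C * (eM ^ 3 * (K * \<delta> ^ 3)) * ph p)"
      by (rule order_trans[OF sum_abs sum_mono], rule r) (use k in auto)
    also have "\<dots> \<le> C * (eM ^ 3 * (K * \<delta> ^ 3)) * W0"
      unfolding sum_distrib_left[symmetric] using cjet_pos[OF jet] consts_nonneg
      by (intro mult_left_mono sum_ph_le mult_nonneg_nonneg) auto
    finally show ?thesis .
  qed
  ultimately show ?thesis using t unfolding m_def by linarith
qed

text \<open>The Taylor formula at S (k - 1) gives the terms of lag 0, and its first-order part
  contributes the terms of lag p >= 1 through \<open>first_order\<close>. All second-order terms are
  compared with the mean of D^2 at the common time k - 1, where they add up to
  \<open>Gam\<close>.\<close>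

lemma step_bound_raw:
  assumes k: "1 \<le> k" and sJ: "R * s \<le> J" and JQ: "R * (J + s) \<le> Q"
    and \<Theta>: "\<And>a b c. \<bar>expectation (\<lambda>\<omega>. D [c, b, a] (S (k - 1) \<omega>))\<bar> \<le> \<Theta>"
  defines "B2 \<equiv> \<lambda>p. C * c5 * (K * (\<delta> ^ 3 + \<delta> ^ 2 * ph s)) * (real p * ph p)
      + (\<Sum>j = 1..J. real CARD('d) * S3B K \<delta> \<Theta> Q j p + 2 * C * (eM ^ 2 * (K * \<delta> ^ 3)) * psi j p)
      + 2 * C * (K * \<delta>) * ph J"
    and "B3 \<equiv> \<lambda>p. S3B K \<delta> \<Theta> Q 0 p + C * c4 * (K * (\<delta> ^ 3 + \<delta> ^ 2 * ph s)) * ph p"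
  shows "\<bar>expectation (\<lambda>\<omega>. D [] (S k \<omega>)) - expectation (\<lambda>\<omega>. D [] (S (k - 1) \<omega>))
     - (\<Sum>a\<in>UNIV. \<Sum>b\<in>UNIV. expectation (\<lambda>\<omega>. D [b, a] (S (k - 1) \<omega>)) * Gam (min s (k - 1)) k b a)\<bar>
    \<le> real CARD('d) * (C * (eM ^ 3 * (K * \<delta> ^ 3)) * W0 + C * K * ph s)
      + real CARD('d) ^ 2 * (\<Sum>p = 0..s. B2 p) + real CARD('d) ^ 3 * (\<Sum>p = 0..s. B3 p) + eM ^ 4 * (K * \<delta> ^ 3)"
proof -
  let ?P = "min s (k - 1)"
  let ?E1 = "\<lambda>a. expectation (\<lambda>\<omega>. D [a] (S (k - 1) \<omega>) * X k \<omega> $ a)"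
  define E2 where "E2 p b a = expectation (\<lambda>\<omega>. D [b, a] (S (k - p - 1) \<omega>) * (X (k - p) \<omega> $ b * X k \<omega> $ a))" for p b a
  define E3 where "E3 p c b a = expectation (\<lambda>\<omega>. D [c, b, a] (S (k - p - 1) \<omega>) * (X (k - p) \<omega> $ b * (X (k - p) \<omega> $ c * X k \<omega> $ a)))" for p c b a
  define H where "H b a = expectation (\<lambda>\<omega>. D [b, a] (S (k - 1) \<omega>))" for b a
  define e2 where "e2 p b a = E2 p b a - H b a * gam b a (k - p) k" for p b a
  define r1 where "r1 a = ?E1 a - (\<Sum>p = 1..?P. (\<Sum>b\<in>UNIV. E2 p b a) + (\<Sum>b\<in>UNIV. \<Sum>c\<in>UNIV. E3 p c b a) / 2)" for a
  define r4 where "r4 = expectation (\<lambda>\<omega>. rem4 D [] (S (k - 1) \<omega>) (X k \<omega>))"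
  have \<Theta>0: "0 \<le> \<Theta>" using \<Theta>[of undefined undefined undefined] by linarith
  have B2: "0 \<le> B2 p" for p
    unfolding B2_def using consts_nonneg cjet_pos[OF jet] ph_nonneg psi_nonneg
    by (intro add_nonneg_nonneg sum_nonneg mult_nonneg_nonneg S3B_nonneg[OF jet \<Theta>0] zero_le_power) auto
  have B3: "0 \<le> B3 p" for p
    unfolding B3_def using consts_nonneg cjet_pos[OF jet] ph_nonneg
    by (intro add_nonneg_nonneg mult_nonneg_nonneg S3B_nonneg[OF jet \<Theta>0] zero_le_power) auto
  have e2: "\<bar>e2 p b a\<bar> \<le> B2 p" if "p \<le> ?P" for p b a
  proof -
    have kp: "k - (k - p) = p" "1 \<le> k - p" "k - p \<le> k" using that k by auto
    have "R * p \<le> R * s" "R * (J + p) \<le> R * (J + s)" using that by (auto simp del: mult_le_cancel1 intro!: mult_left_mono)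
    then have "R * p \<le> J" "R * (J + p) \<le> Q" using sJ JQ by linarith+
    then show ?thesis
      using second_order_pair[OF jet _ kp(2,3), of "[b, a]" J Q \<Theta> b a s] \<Theta>
      unfolding kp(1) e2_def E2_def H_def B2_def by simp
  qed
  have E3: "\<bar>E3 p c b a\<bar> \<le> B3 p" if "p \<le> ?P" for p c b a
  proof -
    have kp: "k - (k - p) = p" "1 \<le> k - p" "k - p \<le> k" using that k by auto
    have "R * p \<le> R * (J + s)" using that by (intro mult_left_mono) auto
    then have "R * p \<le> Q" using JQ by linarith
    then show ?thesis
      using third_order_diagonal[OF jet _ kp(2,3), of "[c, b, a]" Q \<Theta> b c a s] \<Theta>
      unfolding kp(1) E3_def B3_def by simp
  qed
  have r1: "\<bar>r1 a\<bar> \<le> C * (eM ^ 3 * (K * \<delta> ^ 3)) * W0 + C * K * ph s" for a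
    using first_order[OF k, of a s] unfolding r1_def E2_def E3_def .
  have r4: "\<bar>r4\<bar> \<le> eM ^ 4 * (K * \<delta> ^ 3)"
    unfolding r4_def using rem4_bound[OF jet _ X_bound consts_nonneg(2), of "[]"]
    by (intro abs_expectation_le) (simp add: eM_def)
  have bm4: "bm (\<lambda>\<omega>. rem4 D [] (S (k - 1) \<omega>) (X k \<omega>))"
    unfolding rem4_def by (intro bm_intros bm_divide bm_rem[OF jet] bm_jet[OF jet]; simp)+
  have inc: "expectation (\<lambda>\<omega>. D [] (S k \<omega>)) - expectation (\<lambda>\<omega>. D [] (S (k - 1) \<omega>)) =
    (\<Sum>a\<in>UNIV. ?E1 a) + (\<Sum>a\<in>UNIV. \<Sum>b\<in>UNIV. E2 0 b a) / 2 + (\<Sum>a\<in>UNIV. \<Sum>b\<in>UNIV. \<Sum>c\<in>UNIV. E3 0 c b a) / 6 + r4"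
  proof -
    have "expectation (\<lambda>\<omega>. D [] (S k \<omega>)) - expectation (\<lambda>\<omega>. D [] (S (k - 1) \<omega>)) =
      expectation (\<lambda>\<omega>. D [] (S k \<omega>) - D [] (S (k - 1) \<omega>))"
      by (simp add: E_diff bm_jet[OF jet])
    also have "\<dots> = expectation (\<lambda>\<omega>. (((\<Sum>a\<in>UNIV. D [a] (S (k - 1) \<omega>) * X k \<omega> $ a)
        + (\<Sum>a\<in>UNIV. \<Sum>b\<in>UNIV. D [b, a] (S (k - 1) \<omega>) * (X k \<omega> $ b * X k \<omega> $ a)) * (1 / 2))
        + (\<Sum>a\<in>UNIV. \<Sum>b\<in>UNIV. \<Sum>c\<in>UNIV. D [c, b, a] (S (k - 1) \<omega>) * (X k \<omega> $ b * (X k \<omega> $ c * X k \<omega> $ a))) * (1 / 6))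
        + rem4 D [] (S (k - 1) \<omega>) (X k \<omega>))"
      using jet_increment[OF jet k, of "[]"] unfolding rem4_def rem3_def rem2_def
      by (intro Bochner_Integration.integral_cong refl) (simp add: mult_ac sum_divide_distrib)
    also have "\<dots> = ((expectation (\<lambda>\<omega>. \<Sum>a\<in>UNIV. D [a] (S (k - 1) \<omega>) * X k \<omega> $ a)
        + expectation (\<lambda>\<omega>. \<Sum>a\<in>UNIV. \<Sum>b\<in>UNIV. D [b, a] (S (k - 1) \<omega>) * (X k \<omega> $ b * X k \<omega> $ a)) * (1 / 2))
        + expectation (\<lambda>\<omega>. \<Sum>a\<in>UNIV. \<Sum>b\<in>UNIV. \<Sum>c\<in>UNIV. D [c, b, a] (S (k - 1) \<omega>) * (X k \<omega> $ b * (X k \<omega> $ c * X k \<omega> $ a))) * (1 / 6))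
        + r4"
      unfolding r4_def
      by (subst E_add, (intro bm_intros bm_jet[OF jet] bm4; simp)+, subst E_add, (intro bm_intros bm_jet[OF jet]; simp)+,
          subst E_add, (intro bm_intros bm_jet[OF jet]; simp)+) simp
    also have "expectation (\<lambda>\<omega>. \<Sum>a\<in>UNIV. D [a] (S (k - 1) \<omega>) * X k \<omega> $ a) = (\<Sum>a\<in>UNIV. ?E1 a)"
      by (simp add: E_sum bm_intros bm_jet[OF jet])
    also have "expectation (\<lambda>\<omega>. \<Sum>a\<in>UNIV. \<Sum>b\<in>UNIV. D [b, a] (S (k - 1) \<omega>) * (X k \<omega> $ b * X k \<omega> $ a)) = (\<Sum>a\<in>UNIV. \<Sum>b\<in>UNIV. E2 0 b a)"
      unfolding E2_def by (simp add: E_sum bm_intros bm_jet[OF jet])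
    also have "expectation (\<lambda>\<omega>. \<Sum>a\<in>UNIV. \<Sum>b\<in>UNIV. \<Sum>c\<in>UNIV. D [c, b, a] (S (k - 1) \<omega>) * (X k \<omega> $ b * (X k \<omega> $ c * X k \<omega> $ a))) =
       (\<Sum>a\<in>UNIV. \<Sum>b\<in>UNIV. \<Sum>c\<in>UNIV. E3 0 c b a)"
      unfolding E3_def by (simp add: E_sum bm_intros bm_jet[OF jet])
    finally show ?thesis by simp
  qed
  \<comment> \<open>At lag 0 the weights are the Taylor coefficients 1/2 and 1/6; at positive lags
    one derivative is spent on the decoupling, and the weights are 1 and 1/2.\<close>
  define x2 where "x2 b a = e2 0 b a / 2 + (\<Sum>p = 1..?P. e2 p b a)" for b a
  define x3 where "x3 c b a = E3 0 c b a / 6 + (\<Sum>p = 1..?P. E3 p c b a) / 2" for c b a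
  have split0: "{0..s} = insert 0 {1..s}" by auto
  have x2: "\<bar>x2 b a\<bar> \<le> (\<Sum>p = 0..s. B2 p)" for b a
  proof -
    have "\<bar>\<Sum>p = 1..?P. e2 p b a\<bar> \<le> (\<Sum>p = 1..?P. B2 p)"
      by (rule order_trans[OF sum_abs sum_mono], rule e2) auto
    also have "\<dots> \<le> (\<Sum>p = 1..s. B2 p)" by (intro sum_mono2 B2) auto
    finally show ?thesis using e2[of 0 b a] B2[of 0] unfolding x2_def split0 by simp
  qed
  have x3: "\<bar>x3 c b a\<bar> \<le> (\<Sum>p = 0..s. B3 p)" for c b a
  proof -
    have "\<bar>\<Sum>p = 1..?P. E3 p c b a\<bar> \<le> (\<Sum>p = 1..?P. B3 p)"
      by (rule order_trans[OF sum_abs sum_mono], rule E3) auto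
    also have "\<dots> \<le> (\<Sum>p = 1..s. B3 p)" by (intro sum_mono2 B3) auto
    finally have "\<bar>\<Sum>p = 1..?P. E3 p c b a\<bar> \<le> (\<Sum>p = 1..s. B3 p)" .
    then show ?thesis using E3[of 0 c b a] B3[of 0] unfolding x3_def split0 by simp
  qed
  have "expectation (\<lambda>\<omega>. D [] (S k \<omega>)) - expectation (\<lambda>\<omega>. D [] (S (k - 1) \<omega>))
     - (\<Sum>a\<in>UNIV. \<Sum>b\<in>UNIV. H b a * Gam ?P k b a) =
     (\<Sum>a\<in>UNIV. r1 a) + (\<Sum>a\<in>UNIV. \<Sum>b\<in>UNIV. x2 b a) + (\<Sum>a\<in>UNIV. \<Sum>b\<in>UNIV. \<Sum>c\<in>UNIV. x3 c b a) + r4"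
  proof -
    have s2: "(\<Sum>p = 1..?P. \<Sum>b\<in>UNIV. E2 p b a) = (\<Sum>b\<in>UNIV. \<Sum>p = 1..?P. E2 p b a)" for a by (rule sum.swap)
    have s3: "(\<Sum>p = 1..?P. \<Sum>b\<in>UNIV. \<Sum>c\<in>UNIV. E3 p c b a) = (\<Sum>b\<in>UNIV. \<Sum>c\<in>UNIV. \<Sum>p = 1..?P. E3 p c b a)" for a
      by (subst sum.swap) (intro sum.cong refl sum.swap)
    have "(\<Sum>a\<in>UNIV. r1 a) = (\<Sum>a\<in>UNIV. ?E1 a) - (\<Sum>a\<in>UNIV. \<Sum>b\<in>UNIV. \<Sum>p = 1..?P. E2 p b a)
        - (\<Sum>a\<in>UNIV. \<Sum>b\<in>UNIV. \<Sum>c\<in>UNIV. \<Sum>p = 1..?P. E3 p c b a) / 2"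
      unfolding r1_def by (simp only: sum.distrib sum_subtractf s2 s3 sum_divide_distrib[symmetric] diff_diff_eq)
    moreover have "(\<Sum>a\<in>UNIV. \<Sum>b\<in>UNIV. x2 b a) = (\<Sum>a\<in>UNIV. \<Sum>b\<in>UNIV. E2 0 b a) / 2 + (\<Sum>a\<in>UNIV. \<Sum>b\<in>UNIV. \<Sum>p = 1..?P. E2 p b a)
        - (\<Sum>a\<in>UNIV. \<Sum>b\<in>UNIV. H b a * Gam ?P k b a)"
      unfolding x2_def e2_def Gam_def
      by (simp add: sum.distrib sum_subtractf distrib_left sum_distrib_left diff_divide_distrib sum_divide_distrib)
    moreover have "(\<Sum>a\<in>UNIV. \<Sum>b\<in>UNIV. \<Sum>c\<in>UNIV. x3 c b a) = (\<Sum>a\<in>UNIV. \<Sum>b\<in>UNIV. \<Sum>c\<in>UNIV. E3 0 c b a) / 6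
        + (\<Sum>a\<in>UNIV. \<Sum>b\<in>UNIV. \<Sum>c\<in>UNIV. \<Sum>p = 1..?P. E3 p c b a) / 2"
      unfolding x3_def by (simp add: sum.distrib sum_divide_distrib)
    ultimately show ?thesis unfolding inc by linarith
  qed
  moreover have "\<bar>\<Sum>a\<in>UNIV. r1 a\<bar> \<le> real CARD('d) * (C * (eM ^ 3 * (K * \<delta> ^ 3)) * W0 + C * K * ph s)"
  proof -
    have "\<bar>\<Sum>a\<in>UNIV. r1 a\<bar> \<le> (\<Sum>a\<in>(UNIV :: 'd set). C * (eM ^ 3 * (K * \<delta> ^ 3)) * W0 + C * K * ph s)"
      by (rule order_trans[OF sum_abs sum_mono], rule r1)
    then show ?thesis unfolding sum_constant .
  qed
  moreover have "\<bar>\<Sum>a\<in>UNIV. \<Sum>b\<in>UNIV. x2 b a\<bar> \<le> real CARD('d) ^ 2 * (\<Sum>p = 0..s. B2 p)"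
  proof -
    have "\<bar>\<Sum>a\<in>UNIV. \<Sum>b\<in>UNIV. x2 b a\<bar> \<le> (\<Sum>a\<in>(UNIV :: 'd set). \<Sum>b\<in>(UNIV :: 'd set). (\<Sum>p = 0..s. B2 p))"
      by (rule order_trans[OF sum_abs sum_mono], rule order_trans[OF sum_abs sum_mono], rule x2)
    then show ?thesis unfolding sum_constant by (simp only: power2_eq_square mult.assoc)
  qed
  moreover have "\<bar>\<Sum>a\<in>UNIV. \<Sum>b\<in>UNIV. \<Sum>c\<in>UNIV. x3 c b a\<bar> \<le> real CARD('d) ^ 3 * (\<Sum>p = 0..s. B3 p)"
  proof -
    have "\<bar>\<Sum>a\<in>UNIV. \<Sum>b\<in>UNIV. \<Sum>c\<in>UNIV. x3 c b a\<bar> \<le> (\<Sum>a\<in>(UNIV :: 'd set). \<Sum>b\<in>(UNIV :: 'd set). \<Sum>c\<in>(UNIV :: 'd set). (\<Sum>p = 0..s. B3 p))"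
      by (rule order_trans[OF sum_abs sum_mono], rule order_trans[OF sum_abs sum_mono], rule order_trans[OF sum_abs sum_mono], rule x3)
    then show ?thesis unfolding sum_constant by (simp only: power3_eq_cube mult.assoc)
  qed
  ultimately show ?thesis using r4 unfolding H_def by linarith
qed

lemma sum_S3B:
  "(\<Sum>p = 0..s. \<Sum>j = 0..J. S3B K \<delta> \<Theta> Q j p) = cG * eM * (K * \<delta> ^ 3 * PS3 s J Q)
    + cG * (K * \<delta> ^ 2 * ((real s + 1) * (real J + 1)) * ph Q) + eM * C * (K * \<delta> ^ 3 * PS1 s J) + C * (\<Theta> * PS0 s J)"
proof -
  have "S3B K \<delta> \<Theta> Q j p = cG * eM * (K * \<delta> ^ 3) * (\<Sum>q = 1..Q. psi3 q j p) + cG * (K * \<delta> ^ 2) * ph Q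
    + eM * C * (K * \<delta> ^ 3) * (real (j + p) * psi j p) + C * \<Theta> * psi j p" for j p
    unfolding S3B_def[OF jet] by (simp add: algebra_simps)
  then show ?thesis
    by (simp only: sum.distrib sum_distrib_left[symmetric] PS0_def[symmetric] PS1_def[symmetric] PS3_def[symmetric])
      (simp add: algebra_simps)
qed

text \<open>The third derivatives are not estimated by their supremum: this would give \<open>\<Sum>\<^sub>m 1 / m\<close> and an extra
  logarithm. Their expectations \<open>\<Theta>\<close> are controlled by the induction hypothesis instead.\<close>

lemma step_bound:
  assumes k: "1 \<le> k" and sJ: "R * s \<le> J" and JQ: "R * (J + s) \<le> Q"
    and \<Theta>: "\<And>a b c. \<bar>expectation (\<lambda>\<omega>. D [c, b, a] (S (k - 1) \<omega>))\<bar> \<le> \<Theta>"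
  shows "\<bar>expectation (\<lambda>\<omega>. D [] (S k \<omega>)) - expectation (\<lambda>\<omega>. D [] (S (k - 1) \<omega>))
     - (\<Sum>a\<in>UNIV. \<Sum>b\<in>UNIV. expectation (\<lambda>\<omega>. D [b, a] (S (k - 1) \<omega>)) * Gam (min s (k - 1)) k b a)\<bar>
    \<le> c6 * (K * ERR \<delta> s J Q + \<Theta> * PS0 s J)"
proof -
  have \<Theta>0: "0 \<le> \<Theta>" using \<Theta>[of undefined undefined undefined] by linarith
  note pos = cjet_pos[OF jet] consts_nonneg ph_nonneg PS_nonneg \<Theta>0
  let ?d = "real CARD('d)"
  define Y where "Y = K * ERR \<delta> s J Q + \<Theta> * PS0 s J"
  \<comment> \<open>The eight summands of \<open>Y\<close>. Each error is bounded by constants times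
    these, so that all constants can be gathered in \<open>c6\<close>.\<close>
  define x0 where "x0 = K * \<delta> ^ 3"
  define x1 where "x1 = K * \<delta> ^ 3 * PS0 s J"
  define x2 where "x2 = K * \<delta> ^ 3 * PS1 s J"
  define x3 where "x3 = K * \<delta> ^ 3 * PS3 s J Q"
  define x4 where "x4 = K * ph s"
  define x5 where "x5 = K * \<delta> * (real s + 1) * ph J"
  define x6 where "x6 = K * \<delta> ^ 2 * ((real s + 1) * (real J + 1)) * ph Q"
  define x7 where "x7 = \<Theta> * PS0 s J"
  define y where "y = K * (\<delta> ^ 3 + \<delta> ^ 2 * ph s)"
  have x: "0 \<le> x0" "0 \<le> x1" "0 \<le> x2" "0 \<le> x3" "0 \<le> x4" "0 \<le> x5" "0 \<le> x6" "0 \<le> x7"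
    unfolding x0_def x1_def x2_def x3_def x4_def x5_def x6_def x7_def
    using pos by (auto intro!: mult_nonneg_nonneg)
  have Y: "Y = x0 + x1 + x2 + x3 + x4 + x5 + x6 + x7"
    unfolding Y_def ERR_def x0_def x1_def x2_def x3_def x4_def x5_def x6_def x7_def by (simp add: algebra_simps)
  have y: "y \<le> x0 + x4"
  proof -
    have "\<delta> ^ 2 * ph s \<le> 1 * ph s" using pos by (intro mult_right_mono power_le_one) auto
    then show ?thesis using mult_left_mono[of "\<delta> ^ 2 * ph s" "ph s" K] pos
      unfolding y_def x0_def x4_def by (simp add: distrib_left)
  qed
  have y0: "0 \<le> y" unfolding y_def using pos by (auto intro!: mult_nonneg_nonneg add_nonneg_nonneg)
  define SS where "SS = (\<Sum>p = 0..s. \<Sum>j = 0..J. S3B K \<delta> \<Theta> Q j p)"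
  have S3: "0 \<le> S3B K \<delta> \<Theta> Q j p" for j p by (rule S3B_nonneg[OF jet \<Theta>0])
  have SS: "SS \<le> (cG * eM + cG + eM * C + C) * Y"
  proof -
    have "SS = cG * eM * x3 + cG * x6 + eM * C * x2 + C * x7"
      unfolding SS_def sum_S3B x3_def x6_def x2_def x7_def ..
    also have "\<dots> \<le> cG * eM * Y + cG * Y + eM * C * Y + C * Y"
      using pos x by (intro add_mono mult_left_mono) (auto simp: Y)
    finally show ?thesis by (simp add: algebra_simps)
  qed
  have W: "(\<Sum>p = 0..s. real p * ph p) \<le> W0" "(\<Sum>p = 0..s. ph p) \<le> W0"
    using sum_weighted_le[of "{0..s}"] sum_ph_le[of "{0..s}"] sum_mono[of "{0..s}" "\<lambda>p. real p * ph p" "\<lambda>p. (real p + 1) * ph p"] ph_nonneg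
    by (auto simp: algebra_simps)
  have t1: "(\<Sum>p = 0..s. C * c5 * (K * (\<delta> ^ 3 + \<delta> ^ 2 * ph s)) * (real p * ph p)
      + (\<Sum>j = 1..J. ?d * S3B K \<delta> \<Theta> Q j p + 2 * C * (eM ^ 2 * (K * \<delta> ^ 3)) * psi j p)
      + 2 * C * (K * \<delta>) * ph J) \<le> (C * c5 * W0 + 2 * C * eM ^ 2 + 2 * C) * Y + ?d * SS"
  proof -
    have "(\<Sum>p = 0..s. \<Sum>j = 1..J. S3B K \<delta> \<Theta> Q j p) \<le> SS"
      unfolding SS_def by (intro sum_mono sum_mono2 S3) auto
    moreover have "(\<Sum>p = 0..s. \<Sum>j = 1..J. psi j p) \<le> PS0 s J"
      unfolding PS0_def by (intro sum_mono sum_mono2 psi_nonneg) auto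
    ultimately have "C * c5 * y * (\<Sum>p = 0..s. real p * ph p) + ?d * (\<Sum>p = 0..s. \<Sum>j = 1..J. S3B K \<delta> \<Theta> Q j p)
        + 2 * C * (eM ^ 2 * x0) * (\<Sum>p = 0..s. \<Sum>j = 1..J. psi j p) + 2 * C * x5
      \<le> C * c5 * y * W0 + ?d * SS + 2 * C * (eM ^ 2 * x0) * PS0 s J + 2 * C * x5"
      using pos x y0 W by (intro add_mono mult_left_mono mult_nonneg_nonneg) auto
    also have "\<dots> = (C * c5 * W0) * y + ?d * SS + (2 * C * eM ^ 2) * x1 + 2 * C * x5"
      unfolding x0_def x1_def by (simp add: mult_ac)
    also have "\<dots> \<le> (C * c5 * W0) * Y + ?d * SS + (2 * C * eM ^ 2) * Y + 2 * C * Y"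
      using pos x y by (intro add_mono mult_left_mono mult_nonneg_nonneg order_refl) (auto simp: Y)
    finally show ?thesis
      unfolding sum.distrib sum_distrib_left[symmetric] y_def x0_def x5_def
      by (simp add: algebra_simps)
  qed
  have t2: "(\<Sum>p = 0..s. S3B K \<delta> \<Theta> Q 0 p + C * c4 * (K * (\<delta> ^ 3 + \<delta> ^ 2 * ph s)) * ph p) \<le> SS + (C * c4 * W0) * Y"
  proof -
    have "(\<Sum>p = 0..s. S3B K \<delta> \<Theta> Q 0 p) \<le> SS"
      unfolding SS_def by (intro sum_mono member_le_sum S3) auto
    moreover have "C * c4 * y * (\<Sum>p = 0..s. ph p) \<le> C * c4 * Y * W0"
      using pos x y y0 W by (intro mult_mono mult_nonneg_nonneg sum_nonneg) (auto simp: Y)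
    ultimately show ?thesis
      unfolding sum.distrib sum_distrib_left[symmetric] y_def by (simp add: mult_ac)
  qed
  have t0: "?d * (C * (eM ^ 3 * (K * \<delta> ^ 3)) * W0 + C * K * ph s) \<le> ?d * (C * eM ^ 3 * W0 + C) * Y"
  proof -
    have "?d * (C * (eM ^ 3 * (K * \<delta> ^ 3)) * W0 + C * K * ph s) = ?d * (C * eM ^ 3 * W0) * x0 + ?d * C * x4"
      unfolding x0_def x4_def by (simp add: algebra_simps)
    also have "\<dots> \<le> ?d * (C * eM ^ 3 * W0) * Y + ?d * C * Y"
      using pos x by (intro add_mono mult_left_mono mult_nonneg_nonneg zero_le_power) (auto simp: Y)
    finally show ?thesis by (simp add: algebra_simps)
  qed
  have t4: "eM ^ 4 * (K * \<delta> ^ 3) \<le> eM ^ 4 * Y"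
    using pos x by (intro mult_left_mono zero_le_power) (auto simp: Y x0_def[symmetric])
  have "\<bar>expectation (\<lambda>\<omega>. D [] (S k \<omega>)) - expectation (\<lambda>\<omega>. D [] (S (k - 1) \<omega>))
     - (\<Sum>a\<in>UNIV. \<Sum>b\<in>UNIV. expectation (\<lambda>\<omega>. D [b, a] (S (k - 1) \<omega>)) * Gam (min s (k - 1)) k b a)\<bar>
    \<le> ?d * (C * eM ^ 3 * W0 + C) * Y + ?d ^ 2 * ((C * c5 * W0 + 2 * C * eM ^ 2 + 2 * C) * Y + ?d * SS)
      + ?d ^ 3 * (SS + (C * c4 * W0) * Y) + eM ^ 4 * Y"
    by (rule order_trans[OF step_bound_raw[OF k sJ JQ \<Theta>]]) (intro add_mono mult_left_mono t0 t1 t2 t4, auto)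
  also have "\<dots> = ?d * (C * eM ^ 3 * W0 + C) * Y + ?d ^ 2 * ((C * c5 * W0 + 2 * C * eM ^ 2 + 2 * C) * Y)
      + ?d ^ 3 * (2 * SS + (C * c4 * W0) * Y) + eM ^ 4 * Y"
    by (simp add: algebra_simps power2_eq_square power3_eq_cube)
  also have "\<dots> \<le> ?d * (C * eM ^ 3 * W0 + C) * Y + ?d ^ 2 * ((C * c5 * W0 + 2 * C * eM ^ 2 + 2 * C) * Y)
      + ?d ^ 3 * (2 * ((cG * eM + cG + eM * C + C) * Y) + (C * c4 * W0) * Y) + eM ^ 4 * Y"
    using SS by (intro add_mono mult_left_mono order_refl) auto
  also have "\<dots> = c6 * Y" unfolding c6_def by (simp add: algebra_simps)
  finally show ?thesis unfolding Y_def .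
qed

end

end

section \<open>Summation over the steps\<close>

lemma sum_inverse_squares:
  assumes "1 \<le> n"
  shows "(\<Sum>t = n..T. 1 / real t ^ 2) \<le> 2 / real n"
proof (cases "n \<le> T")
  case True
  \<comment> \<open>The term - 1 / T makes the claim inductive, because 1 / (T + 1)^2 <= 1 / T - 1 /
    (T + 1).\<close>
  then have "(\<Sum>t = n..T. 1 / real t ^ 2) \<le> 2 / real n - 1 / real T"
  proof (induction T rule: dec_induct)
    case base
    have "1 / real n ^ 2 \<le> 1 / real n" using assms by (simp add: field_simps power2_eq_square)
    then show ?case by simp
  next
    case (step T)
    have T: "1 \<le> real T" using assms step by simp
    have "1 / real (Suc T) ^ 2 \<le> 1 / (real T * real (Suc T))"
      using T by (intro divide_left_mono) (auto simp: power2_eq_square mult_right_mono)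
    also have "\<dots> = 1 / real T - 1 / real (Suc T)" using T by (simp add: field_simps)
    finally show ?case using step by simp
  qed
  then show ?thesis by (smt (verit) divide_nonneg_nonneg of_nat_0_le_iff)
qed simp

text \<open>The sum starts near g / a. The factor 4, rather than 2, absorbs the rounding and the
  case g < a.\<close>

lemma sum_inverse_squares_multiple:
  assumes a: "1 \<le> a"
  shows "(\<Sum>t | t \<in> {1..T} \<and> g \<le> a * t. 1 / real t ^ 2) \<le> 4 * real a / (real g + 1)"
proof -
  define n where "n = max 1 (g div a)"
  have n: "1 \<le> n" by (simp add: n_def)
  have "{t. t \<in> {1..T} \<and> g \<le> a * t} \<subseteq> {n..T}"
  proof safe
    fix t assume t: "t \<in> {1..T}" "g \<le> a * t"
    have "g div a \<le> (a * t) div a" using t by (intro div_le_mono)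
    then show "t \<in> {n..T}" using t a by (auto simp: n_def)
  qed
  then have "(\<Sum>t | t \<in> {1..T} \<and> g \<le> a * t. 1 / real t ^ 2) \<le> (\<Sum>t = n..T. 1 / real t ^ 2)"
    by (intro sum_mono2) auto
  also have "\<dots> \<le> 2 / real n" by (rule sum_inverse_squares[OF n])
  also have "\<dots> \<le> 4 * real a / (real g + 1)"
  proof -
    have "g < Suc (g div a) * a" using a by (simp add: dividend_less_div_times)
    moreover have "Suc (g div a) * a \<le> 2 * n * a" unfolding n_def by (intro mult_right_mono) auto
    ultimately have "g + 1 \<le> 2 * n * a" by linarith
    then have "real g + 1 \<le> 2 * real n * real a" by (metis of_nat_1 of_nat_add of_nat_le_iff of_nat_mult of_nat_numeral)
    then show ?thesis using n by (simp add: field_simps)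
  qed
  finally show ?thesis .
qed

text \<open>The value t is attained at most 2 t + 1 <= 3 t times. A sum over steps of quantities
  living at the scale of the square root thus becomes a sum over scales with weight t, the weight
  that a first moment can pay.\<close>

lemma sum_floor_sqrt_le:
  fixes h :: "nat \<Rightarrow> real"
  assumes h: "\<And>t. 0 \<le> h t" and t0: "1 \<le> t0"
  shows "(\<Sum>m<n. h (floor_sqrt (m + t0\<^sup>2))) \<le> 3 * (\<Sum>t = t0..n + t0\<^sup>2. real t * h t)"
proof -
  let ?s = "\<lambda>m. floor_sqrt (m + t0\<^sup>2)"
  have s: "t0 \<le> ?s m" "?s m \<le> m + t0\<^sup>2" for m
  proof -
    show "t0 \<le> ?s m" by (simp add: le_floor_sqrt_iff)
    show "?s m \<le> m + t0\<^sup>2" by (rule floor_sqrt_le)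
  qed
  have "(\<Sum>m<n. h (?s m)) = (\<Sum>t\<in>?s ` {..<n}. \<Sum>m | m \<in> {..<n} \<and> ?s m = t. h (?s m))"
    by (rule sum.image_gen) simp
  also have "\<dots> = (\<Sum>t\<in>?s ` {..<n}. real (card {m. m \<in> {..<n} \<and> ?s m = t}) * h t)"
    by (intro sum.cong refl) simp
  also have "\<dots> \<le> (\<Sum>t\<in>?s ` {..<n}. 3 * (real t * h t))"
  proof (intro sum_mono)
    fix t assume "t \<in> ?s ` {..<n}"
    then have t: "1 \<le> t" using s t0 order_trans by blast
    have "{m. m \<in> {..<n} \<and> ?s m = t} \<subseteq> {t\<^sup>2 - t0\<^sup>2..<(Suc t)\<^sup>2 - t0\<^sup>2}"
    proof
      fix m assume "m \<in> {m. m \<in> {..<n} \<and> ?s m = t}"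
      then have st: "t = ?s m" by simp
      have "t\<^sup>2 \<le> m + t0\<^sup>2" unfolding st by (rule floor_sqrt_power2_le)
      moreover have "m + t0\<^sup>2 < (Suc t)\<^sup>2" unfolding st by (rule Suc_floor_sqrt_power2_gt)
      ultimately show "m \<in> {t\<^sup>2 - t0\<^sup>2..<(Suc t)\<^sup>2 - t0\<^sup>2}" by (simp only: atLeastLessThan_iff) linarith
    qed
    then have "card {m. m \<in> {..<n} \<and> ?s m = t} \<le> card {t\<^sup>2 - t0\<^sup>2..<(Suc t)\<^sup>2 - t0\<^sup>2}"
      by (intro card_mono) auto
    also have "\<dots> \<le> 2 * t + 1"
      by (simp add: power2_eq_square)
    finally have "card {m. m \<in> {..<n} \<and> ?s m = t} \<le> 3 * t" using t by linarith
    then have "real (card {m. m \<in> {..<n} \<and> ?s m = t}) \<le> 3 * real t" by linarith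
    then show "real (card {m. m \<in> {..<n} \<and> ?s m = t}) * h t \<le> 3 * (real t * h t)"
      using mult_right_mono[OF _ h] by (simp add: mult.assoc[symmetric])
  qed
  also have "\<dots> \<le> (\<Sum>t = t0..n + t0\<^sup>2. 3 * (real t * h t))"
  proof (rule sum_mono2)
    show "?s ` {..<n} \<subseteq> {t0..n + t0\<^sup>2}"
    proof (rule image_subsetI)
      fix m assume "m \<in> {..<n}"
      then show "?s m \<in> {t0..n + t0\<^sup>2}" using s[of m] by auto
    qed
  qed (auto simp: h)
  finally show ?thesis by (simp add: sum_distrib_left)
qed

section \<open>Mixing coefficients summed over the windows\<close>

context mixing begin

text \<open>Truncated second moment of the mixing coefficients. It may grow without bound, but it
  occurs only divided by a power of the cut-off.\<close>

definition U :: "nat \<Rightarrow> real" where "U G = (\<Sum>g = 0..G. (real g + 1) ^ 2 * ph g)"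
text \<open>Ratio of the longest window to the shortest: with s = t and J = R t, the requirement R
  (J + s) <= Q holds with equality at Q = QR t.\<close>

definition QR :: nat where "QR = R * (R + 1)"
definition tail :: "nat \<Rightarrow> real" where "tail t = (\<Sum>p. if t < p then ph p else 0)"

lemma U_mono: "G \<le> H \<Longrightarrow> U G \<le> U H"
  unfolding U_def by (intro sum_mono2) (auto simp: ph_nonneg)

lemma U_ge: "1 \<le> U G"
proof -
  have "U 0 \<le> U G" by (rule U_mono) simp
  then show ?thesis by (simp add: U_def ph_0)
qed

lemma le_R_mult: "p \<le> R * p"
  using R_ge by simp

text \<open>Sort the pairs by the gap that determines \<open>psi\<close>: for given j at most j + 1
  values of p satisfy R p <= j, and for given p at most R p values of j violate it. Both counts
  leave a first moment.\<close>

lemma PS0_le: "PS0 s J \<le> (1 + real R) * W0"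
proof -
  have "PS0 s J \<le> (\<Sum>p = 0..s. \<Sum>j = 0..J. (if R * p \<le> j then ph j else 0) + (if R * p \<le> j then 0 else ph p))"
    unfolding PS0_def psi_def by (intro sum_mono) auto
  also have "\<dots> = (\<Sum>j = 0..J. \<Sum>p = 0..s. if R * p \<le> j then ph j else 0) + (\<Sum>p = 0..s. \<Sum>j = 0..J. if R * p \<le> j then 0 else ph p)"
    unfolding sum.distrib by (subst sum.swap) simp
  also have "\<dots> \<le> (\<Sum>j = 0..J. (real j + 1) * ph j) + (\<Sum>p = 0..s. real R * ((real p + 1) * ph p))"
  proof (intro add_mono sum_mono)
    fix j
    have "(\<Sum>p = 0..s. if R * p \<le> j then ph j else 0) = real (card ({0..s} \<inter> {p. R * p \<le> j})) * ph j"
      by (simp add: sum.If_cases)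
    also have "\<dots> \<le> (real j + 1) * ph j"
    proof (intro mult_right_mono ph_nonneg)
      have "{0..s} \<inter> {p. R * p \<le> j} \<subseteq> {0..j}" by (auto intro: order_trans[OF le_R_mult])
      then have "card ({0..s} \<inter> {p. R * p \<le> j}) \<le> card {0..j}" by (intro card_mono) auto
      then show "real (card ({0..s} \<inter> {p. R * p \<le> j})) \<le> real j + 1" by simp
    qed
    finally show "(\<Sum>p = 0..s. if R * p \<le> j then ph j else 0) \<le> (real j + 1) * ph j" .
  next
    fix p
    have "(\<Sum>j = 0..J. if R * p \<le> j then 0 else ph p) = real (card ({0..J} \<inter> - {j. R * p \<le> j})) * ph p"
      by (simp add: sum.If_cases)
    also have "\<dots> \<le> real R * (real p + 1) * ph p"
    proof (intro mult_right_mono ph_nonneg)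
      have "{0..J} \<inter> - {j. R * p \<le> j} \<subseteq> {0..<R * p}" by auto
      then have "card ({0..J} \<inter> - {j. R * p \<le> j}) \<le> card {0..<R * p}" by (intro card_mono) auto
      then have "real (card ({0..J} \<inter> - {j. R * p \<le> j})) \<le> real R * real p"
        by (simp flip: of_nat_mult)
      then show "real (card ({0..J} \<inter> - {j. R * p \<le> j})) \<le> real R * (real p + 1)" by (simp add: distrib_left)
    qed
    finally show "(\<Sum>j = 0..J. if R * p \<le> j then 0 else ph p) \<le> real R * ((real p + 1) * ph p)" by (simp add: mult.assoc)
  qed
  also have "\<dots> \<le> W0 + real R * W0"
    unfolding sum_distrib_left[symmetric] by (intro add_mono mult_left_mono sum_weighted_le) auto
  finally show ?thesis by (simp add: algebra_simps)
qed

text \<open>Same count as in \<open>PS0_le\<close>. The factor j + p is at most a multiple of the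
  deciding gap plus one and raises the moment to the second, hence the truncation.\<close>

lemma PS1_le:
  assumes "s \<le> J"
  shows "PS1 s J \<le> (2 + real R * (real R + 1)) * U J"
proof -
  have "PS1 s J = (\<Sum>p = 0..s. \<Sum>j = 0..J. (if R * p \<le> j then real (j + p) * ph j else 0) + (if R * p \<le> j then 0 else real (j + p) * ph p))"
    unfolding PS1_def psi_def by (intro sum.cong) auto
  also have "\<dots> = (\<Sum>j = 0..J. \<Sum>p = 0..s. if R * p \<le> j then real (j + p) * ph j else 0) + (\<Sum>p = 0..s. \<Sum>j = 0..J. if R * p \<le> j then 0 else real (j + p) * ph p)"
    unfolding sum.distrib by (subst sum.swap) simp
  also have "\<dots> \<le> (\<Sum>j = 0..J. 2 * ((real j + 1) ^ 2 * ph j)) + (\<Sum>p = 0..s. real R * (real R + 1) * ((real p + 1) ^ 2 * ph p))"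
  proof (intro add_mono sum_mono)
    fix j
    have "(\<Sum>p = 0..s. if R * p \<le> j then real (j + p) * ph j else 0) \<le> (\<Sum>p = 0..s. if R * p \<le> j then (2 * (real j + 1)) * ph j else 0)"
    proof (intro sum_mono)
      fix p
      have "real (j + p) \<le> 2 * (real j + 1)" if "R * p \<le> j"
        using order_trans[OF le_R_mult that] by simp
      then show "(if R * p \<le> j then real (j + p) * ph j else 0) \<le> (if R * p \<le> j then (2 * (real j + 1)) * ph j else 0)"
        using ph_nonneg by (auto intro: mult_right_mono)
    qed
    also have "\<dots> = real (card ({0..s} \<inter> {p. R * p \<le> j})) * ((2 * (real j + 1)) * ph j)"
      by (simp add: sum.If_cases)
    also have "\<dots> \<le> (real j + 1) * ((2 * (real j + 1)) * ph j)"
    proof (intro mult_right_mono mult_nonneg_nonneg ph_nonneg)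
      have "{0..s} \<inter> {p. R * p \<le> j} \<subseteq> {0..j}" by (auto intro: order_trans[OF le_R_mult])
      then have "card ({0..s} \<inter> {p. R * p \<le> j}) \<le> card {0..j}" by (intro card_mono) auto
      then show "real (card ({0..s} \<inter> {p. R * p \<le> j})) \<le> real j + 1" by simp
    qed auto
    finally show "(\<Sum>p = 0..s. if R * p \<le> j then real (j + p) * ph j else 0) \<le> 2 * ((real j + 1) ^ 2 * ph j)"
      by (simp only: power2_eq_square mult_ac)
  next
    fix p
    have "(\<Sum>j = 0..J. if R * p \<le> j then 0 else real (j + p) * ph p) \<le> (\<Sum>j = 0..J. if R * p \<le> j then 0 else ((real R + 1) * (real p + 1)) * ph p)"
    proof (intro sum_mono)
      fix j
      have "real (j + p) \<le> (real R + 1) * (real p + 1)" if "\<not> R * p \<le> j"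
      proof -
        have "real j \<le> real R * real p" using that by (simp flip: of_nat_mult)
        then show ?thesis by (simp add: algebra_simps)
      qed
      then show "(if R * p \<le> j then 0 else real (j + p) * ph p) \<le> (if R * p \<le> j then 0 else ((real R + 1) * (real p + 1)) * ph p)"
        using ph_nonneg by (auto intro: mult_right_mono)
    qed
    also have "\<dots> = real (card ({0..J} \<inter> - {j. R * p \<le> j})) * (((real R + 1) * (real p + 1)) * ph p)"
      by (simp add: sum.If_cases)
    also have "\<dots> \<le> (real R * (real p + 1)) * (((real R + 1) * (real p + 1)) * ph p)"
    proof (intro mult_right_mono mult_nonneg_nonneg ph_nonneg)
      have "{0..J} \<inter> - {j. R * p \<le> j} \<subseteq> {0..<R * p}" by auto
      then have "card ({0..J} \<inter> - {j. R * p \<le> j}) \<le> card {0..<R * p}" by (intro card_mono) auto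
      then have "real (card ({0..J} \<inter> - {j. R * p \<le> j})) \<le> real R * real p"
        by (simp flip: of_nat_mult)
      then show "real (card ({0..J} \<inter> - {j. R * p \<le> j})) \<le> real R * (real p + 1)" by (simp add: distrib_left)
    qed auto
    finally show "(\<Sum>j = 0..J. if R * p \<le> j then 0 else real (j + p) * ph p) \<le> real R * (real R + 1) * ((real p + 1) ^ 2 * ph p)"
      by (simp add: power2_eq_square mult_ac)
  qed
  also have "\<dots> = 2 * U J + real R * (real R + 1) * U s"
    by (simp add: U_def sum_distrib_left)
  also have "\<dots> \<le> 2 * U J + real R * (real R + 1) * U J"
    by (intro add_mono mult_left_mono U_mono assms) auto
  finally show ?thesis by (simp add: algebra_simps)
qed

text \<open>If q decides, at most (q + 1)^2 pairs (j, p) lie below it. Otherwise q < R (j + p), so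
  the same \<open>psi j p\<close> is counted at most R (j + p) times.\<close>

lemma PS3_le: "PS3 s J Q \<le> U Q + real R * PS1 s J"
proof -
  have "PS3 s J Q \<le> (\<Sum>p = 0..s. \<Sum>j = 0..J. (\<Sum>q = 0..Q. if R * (j + p) \<le> q then ph q else 0) + real R * (real (j + p) * psi j p))"
    unfolding PS3_def
  proof (intro sum_mono)
    fix p j
    have "(\<Sum>q = 1..Q. psi3 q j p) \<le> (\<Sum>q = 0..Q. psi3 q j p)"
      by (intro sum_mono2) (auto simp: psi_nonneg)
    also have "\<dots> = (\<Sum>q = 0..Q. if R * (j + p) \<le> q then ph q else 0) + (\<Sum>q = 0..Q. if R * (j + p) \<le> q then 0 else psi j p)"
      unfolding sum.distrib[symmetric] psi3_def by (intro sum.cong) auto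
    also have "(\<Sum>q = 0..Q. if R * (j + p) \<le> q then 0 else psi j p) \<le> real R * (real (j + p) * psi j p)"
    proof -
      have "(\<Sum>q = 0..Q. if R * (j + p) \<le> q then 0 else psi j p) = real (card ({0..Q} \<inter> - {q. R * (j + p) \<le> q})) * psi j p"
        by (simp add: sum.If_cases)
      also have "\<dots> \<le> (real R * real (j + p)) * psi j p"
      proof (intro mult_right_mono psi_nonneg)
        have "{0..Q} \<inter> - {q. R * (j + p) \<le> q} \<subseteq> {0..<R * (j + p)}" by auto
        then have "card ({0..Q} \<inter> - {q. R * (j + p) \<le> q}) \<le> card {0..<R * (j + p)}" by (intro card_mono) auto
        then show "real (card ({0..Q} \<inter> - {q. R * (j + p) \<le> q})) \<le> real R * real (j + p)"
          by (simp flip: of_nat_mult del: of_nat_add)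
      qed
      finally show ?thesis by (simp add: mult.assoc)
    qed
    finally show "(\<Sum>q = 1..Q. psi3 q j p) \<le> (\<Sum>q = 0..Q. if R * (j + p) \<le> q then ph q else 0) + real R * (real (j + p) * psi j p)"
      by simp
  qed
  also have "\<dots> = (\<Sum>p = 0..s. \<Sum>j = 0..J. \<Sum>q = 0..Q. if R * (j + p) \<le> q then ph q else 0) + real R * PS1 s J"
    unfolding PS1_def by (simp only: sum.distrib sum_distrib_left)
  also have "(\<Sum>p = 0..s. \<Sum>j = 0..J. \<Sum>q = 0..Q. if R * (j + p) \<le> q then ph q else 0) =
     (\<Sum>p = 0..s. \<Sum>q = 0..Q. \<Sum>j = 0..J. if R * (j + p) \<le> q then ph q else 0)"
    by (intro sum.cong refl sum.swap)
  also have "\<dots> = (\<Sum>q = 0..Q. \<Sum>p = 0..s. \<Sum>j = 0..J. if R * (j + p) \<le> q then ph q else 0)"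
    by (rule sum.swap)
  also have "\<dots> \<le> (\<Sum>q = 0..Q. (real q + 1) ^ 2 * ph q)"
  proof (intro sum_mono)
    fix q
    have "(\<Sum>p = 0..s. \<Sum>j = 0..J. if R * (j + p) \<le> q then ph q else 0) \<le> (\<Sum>p = 0..s. if p \<le> q then (real q + 1) * ph q else 0)"
    proof (intro sum_mono)
      fix p
      have "(\<Sum>j = 0..J. if R * (j + p) \<le> q then ph q else 0) = real (card ({0..J} \<inter> {j. R * (j + p) \<le> q})) * ph q"
        by (simp add: sum.If_cases)
      also have "\<dots> \<le> (if p \<le> q then (real q + 1) else 0) * ph q"
      proof (intro mult_right_mono ph_nonneg)
        have "{0..J} \<inter> {j. R * (j + p) \<le> q} \<subseteq> (if p \<le> q then {0..q} else {})"
        proof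
          fix j assume "j \<in> {0..J} \<inter> {j. R * (j + p) \<le> q}"
          then have "j + p \<le> q" using order_trans[OF le_R_mult] by blast
          then show "j \<in> (if p \<le> q then {0..q} else {})" by simp
        qed
        then have "card ({0..J} \<inter> {j. R * (j + p) \<le> q}) \<le> card (if p \<le> q then {0..q} else {})"
          by (intro card_mono) auto
        then show "real (card ({0..J} \<inter> {j. R * (j + p) \<le> q})) \<le> (if p \<le> q then (real q + 1) else 0)"
          by (auto split: if_splits)
      qed
      finally show "(\<Sum>j = 0..J. if R * (j + p) \<le> q then ph q else 0) \<le> (if p \<le> q then (real q + 1) * ph q else 0)"
        by (auto split: if_splits)
    qed
    also have "\<dots> = real (card ({0..s} \<inter> {p. p \<le> q})) * ((real q + 1) * ph q)"
      by (simp add: sum.If_cases)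
    also have "\<dots> \<le> (real q + 1) * ((real q + 1) * ph q)"
    proof (intro mult_right_mono mult_nonneg_nonneg ph_nonneg)
      have "card ({0..s} \<inter> {p. p \<le> q}) \<le> card {0..q}" by (intro card_mono) auto
      then show "real (card ({0..s} \<inter> {p. p \<le> q})) \<le> real q + 1" by simp
    qed auto
    finally show "(\<Sum>p = 0..s. \<Sum>j = 0..J. if R * (j + p) \<le> q then ph q else 0) \<le> (real q + 1) ^ 2 * ph q"
      by (simp add: power2_eq_square mult.assoc)
  qed
  finally show ?thesis by (simp add: U_def)
qed

definition c7 :: real where "c7 = 2 + (1 + real R) * W0 + (1 + real R) * (2 + real R * (real R + 1))"

text \<open>All windows are multiples of t = 1 / \<delta>, so the window lengths in the boundary
  terms cancel the powers of \<delta>.\<close>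

lemma ERR_le:
  assumes t: "1 \<le> t"
  shows "ERR (1 / real t) t (R * t) (QR * t) \<le> c7 * (U (QR * t) / real t ^ 3) + ph t + 2 * ph (R * t) + 4 * real R * ph (QR * t)"
proof -
  have RQ: "R * t \<le> QR * t" unfolding QR_def by (intro mult_right_mono) auto
  have UJ: "U (R * t) \<le> U (QR * t)" by (rule U_mono[OF RQ])
  have P1: "PS1 t (R * t) \<le> (2 + real R * (real R + 1)) * U (QR * t)"
    by (rule order_trans[OF PS1_le[OF le_R_mult]]) (intro mult_left_mono UJ, auto)
  have "1 + PS0 t (R * t) + PS1 t (R * t) + PS3 t (R * t) (QR * t) \<le>
      1 * U (QR * t) + ((1 + real R) * W0) * U (QR * t) + PS1 t (R * t) + (U (QR * t) + real R * PS1 t (R * t))"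
  proof (intro add_mono PS3_le order_refl)
    show "1 \<le> 1 * U (QR * t)" using U_ge by simp
    have "(1 + real R) * W0 * 1 \<le> (1 + real R) * W0 * U (QR * t)"
      using consts_nonneg by (intro mult_left_mono U_ge) auto
    then show "PS0 t (R * t) \<le> (1 + real R) * W0 * U (QR * t)" using PS0_le[of t "R * t"] by linarith
  qed
  also have "\<dots> = (2 + (1 + real R) * W0) * U (QR * t) + (1 + real R) * PS1 t (R * t)" by (simp add: algebra_simps)
  also have "\<dots> \<le> (2 + (1 + real R) * W0) * U (QR * t) + (1 + real R) * ((2 + real R * (real R + 1)) * U (QR * t))"
    by (intro add_mono order_refl mult_left_mono P1) auto
  also have "\<dots> = c7 * U (QR * t)" by (simp add: c7_def algebra_simps)
  finally have 1: "(1 / real t) ^ 3 * (1 + PS0 t (R * t) + PS1 t (R * t) + PS3 t (R * t) (QR * t)) \<le> c7 * (U (QR * t) / real t ^ 3)"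
    using t by (simp add: power_divide divide_right_mono)
  have 2: "1 / real t * (real t + 1) * ph (R * t) \<le> 2 * ph (R * t)"
    using t by (intro mult_right_mono ph_nonneg) (simp add: field_simps)
  have 3: "(1 / real t) ^ 2 * ((real t + 1) * (real (R * t) + 1)) * ph (QR * t) \<le> 4 * real R * ph (QR * t)"
  proof (intro mult_right_mono ph_nonneg)
    have "1 \<le> R * t" using t R_ge by simp
    then have "real (R * t) + 1 \<le> 2 * (real R * real t)" by (simp flip: of_nat_mult)
    then have "(real t + 1) * (real (R * t) + 1) \<le> (2 * real t) * (2 * (real R * real t))"
      using t by (intro mult_mono) auto
    then show "(1 / real t) ^ 2 * ((real t + 1) * (real (R * t) + 1)) \<le> 4 * real R"
      using t by (simp add: field_simps power2_eq_square)
  qed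
  show ?thesis unfolding ERR_def using 1 2 3 by linarith
qed

text \<open>Dilation by a is injective, so this is part of the series of the first moment.\<close>

lemma sum_dilated: 
  assumes "1 \<le> a"
  shows "(\<Sum>t = t0..T. real t * ph (a * t)) \<le> W0"
proof -
  have "(\<Sum>t = t0..T. real t * ph (a * t)) \<le> (\<Sum>t = t0..T. (real (a * t) + 1) * ph (a * t))"
  proof (intro sum_mono mult_right_mono ph_nonneg)
    fix t
    have "t \<le> a * t" using assms by simp
    then show "real t \<le> real (a * t) + 1" by (metis add_increasing2 of_nat_le_iff zero_le_one)
  qed
  also have "\<dots> = (\<Sum>p\<in>(\<lambda>t. a * t) ` {t0..T}. (real p + 1) * ph p)"
    using assms by (subst sum.reindex) (auto simp: inj_on_def)
  also have "\<dots> \<le> W0" by (rule sum_weighted_le) simp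
  finally show ?thesis .
qed

text \<open>After interchanging the sums, (g + 1)^2 ph g is multiplied by the sum of 1 / t^2 over t
  >= g / a, which is of order 1 / (g + 1). One power is gained, so the first moment suffices
  although \<open>U\<close> is a second moment.\<close>

lemma sum_U_le:
  assumes a: "1 \<le> a" and t0: "1 \<le> t0"
  shows "(\<Sum>t = t0..T. real t * (U (a * t) / real t ^ 3)) \<le> 4 * real a * W0"
proof -
  have "(\<Sum>t = t0..T. real t * (U (a * t) / real t ^ 3)) \<le> (\<Sum>t = 1..T. U (a * t) / real t ^ 2)"
  proof (rule order_trans[OF _ sum_mono2])
    show "(\<Sum>t = t0..T. real t * (U (a * t) / real t ^ 3)) \<le> (\<Sum>t = t0..T. U (a * t) / real t ^ 2)"
      using t0 by (intro sum_mono) (simp add: power2_eq_square power3_eq_cube)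
    show "0 \<le> U (a * t) / (real t)\<^sup>2" for t using U_ge[of "a * t"] by simp
  qed (use t0 in auto)
  also have "\<dots> \<le> (\<Sum>t = 1..T. \<Sum>g = 0..a * T. if g \<le> a * t then (real g + 1) ^ 2 * ph g * (1 / real t ^ 2) else 0)"
  proof (intro sum_mono)
    fix t assume "t \<in> {1..T}"
    then have le: "a * t \<le> a * T" by simp
    have "{0..a * T} \<inter> {g. g \<le> a * t} = {0..a * t}" by (auto intro: order_trans[OF _ le])
    then show "U (a * t) / real t ^ 2 \<le> (\<Sum>g = 0..a * T. if g \<le> a * t then (real g + 1) ^ 2 * ph g * (1 / real t ^ 2) else 0)"
      by (simp add: U_def sum_divide_distrib sum.If_cases)
  qed
  also have "\<dots> = (\<Sum>g = 0..a * T. \<Sum>t = 1..T. if g \<le> a * t then (real g + 1) ^ 2 * ph g * (1 / real t ^ 2) else 0)"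
    by (rule sum.swap)
  also have "\<dots> \<le> (\<Sum>g = 0..a * T. 4 * real a * ((real g + 1) * ph g))"
  proof (intro sum_mono)
    fix g
    have "(\<Sum>t = 1..T. if g \<le> a * t then (real g + 1) ^ 2 * ph g * (1 / real t ^ 2) else 0) =
       (real g + 1) ^ 2 * ph g * (\<Sum>t | t \<in> {1..T} \<and> g \<le> a * t. 1 / real t ^ 2)"
      unfolding sum_distrib_left by (rule sum.inter_filter[symmetric]) simp
    also have "\<dots> \<le> (real g + 1) ^ 2 * ph g * (4 * real a / (real g + 1))"
      by (intro mult_left_mono sum_inverse_squares_multiple a mult_nonneg_nonneg ph_nonneg) auto
    also have "\<dots> = 4 * real a * ((real g + 1) * ph g)"
      by (simp add: power2_eq_square field_simps)
    finally show "(\<Sum>t = 1..T. if g \<le> a * t then (real g + 1) ^ 2 * ph g * (1 / real t ^ 2) else 0) \<le> 4 * real a * ((real g + 1) * ph g)" .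
  qed
  also have "\<dots> \<le> 4 * real a * W0"
    unfolding sum_distrib_left[symmetric] by (intro mult_left_mono sum_weighted_le) auto
  finally show ?thesis .
qed

definition c8 :: real where "c8 = c7 * (4 * real QR * W0) + W0 + 2 * W0 + 4 * real R * W0"

lemma QR_ge: "1 \<le> QR"
  using R_ge by (simp add: QR_def)

lemma c7_nonneg: "0 \<le> c7"
  using consts_nonneg by (simp add: c7_def)

lemma sum_ERR_le:
  assumes t0: "1 \<le> t0"
  shows "(\<Sum>t = t0..T. real t * ERR (1 / real t) t (R * t) (QR * t)) \<le> c8"
proof -
  have "(\<Sum>t = t0..T. real t * ERR (1 / real t) t (R * t) (QR * t)) \<le>
    (\<Sum>t = t0..T. real t * (c7 * (U (QR * t) / real t ^ 3) + ph t + 2 * ph (R * t) + 4 * real R * ph (QR * t)))"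
    using t0 by (intro sum_mono mult_left_mono ERR_le) auto
  also have "\<dots> = c7 * (\<Sum>t = t0..T. real t * (U (QR * t) / real t ^ 3)) + (\<Sum>t = t0..T. real t * ph (1 * t))
      + 2 * (\<Sum>t = t0..T. real t * ph (R * t)) + 4 * real R * (\<Sum>t = t0..T. real t * ph (QR * t))"
    by (simp add: sum_distrib_left sum.distrib algebra_simps)
  also have "\<dots> \<le> c8"
    unfolding c8_def
    by (intro add_mono mult_left_mono sum_U_le sum_dilated QR_ge R_ge t0 c7_nonneg) auto
  finally show ?thesis .
qed

lemma tail_summable: "summable (\<lambda>p. if t < p then ph p else 0)"
proof (rule summable_comparison_test'[OF summable_W0, of 0])
  fix p :: nat
  have "0 \<le> real p * ph p" using ph_nonneg by simp
  then show "norm (if t < p then ph p else 0) \<le> (real p + 1) * ph p"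
    using ph_nonneg[of p] by (auto simp: algebra_simps)
qed

lemma tail_nonneg: "0 \<le> tail t"
  unfolding tail_def by (intro suminf_nonneg tail_summable) (auto simp: ph_nonneg)

text \<open>Interchanging the sums counts each p at most once for every t < p, which is a first
  moment.\<close>

lemma sum_tail_le: "(\<Sum>t = t0..T. tail t) \<le> W0"
proof -
  have "(\<Sum>t = t0..T. tail t) = (\<Sum>p. \<Sum>t = t0..T. if t < p then ph p else 0)"
    unfolding tail_def by (rule suminf_sum[symmetric]) (rule tail_summable)
  also have "\<dots> \<le> W0"
    unfolding W0_def
  proof (rule suminf_le)
    show "summable (\<lambda>p. \<Sum>t = t0..T. if t < p then ph p else 0)"
      by (intro summable_sum tail_summable)
    fix p
    have "(\<Sum>t = t0..T. if t < p then ph p else 0) = real (card ({t0..T} \<inter> {t. t < p})) * ph p"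
      by (simp add: sum.If_cases)
    also have "\<dots> \<le> (real p + 1) * ph p"
    proof (intro mult_right_mono ph_nonneg)
      have "card ({t0..T} \<inter> {t. t < p}) \<le> card {..<p}" by (intro card_mono) auto
      then show "real (card ({t0..T} \<inter> {t. t < p})) \<le> real p + 1" by simp
    qed
    finally show "(\<Sum>t = t0..T. if t < p then ph p else 0) \<le> (real p + 1) * ph p" .
  qed (rule summable_W0)
  finally show ?thesis .
qed

end

section \<open>The limiting covariance and the sum over all steps\<close>

context mixing begin

definition gm :: "'d \<Rightarrow> 'd \<Rightarrow> nat \<Rightarrow> real" where "gm b a p = gam b a 1 (1 + p)"

text \<open>One-sided half of the covariance series, the limit of \<open>Gam\<close>. It need not be
  symmetric, but against a symmetric second derivative it acts like \<open>Sg\<close> / 2.\<close>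

definition GI :: "'d \<Rightarrow> 'd \<Rightarrow> real" where
  "GI b a = gm b a 0 / 2 + (\<Sum>p. if 0 < p then gm b a p else 0)"

definition Sg :: "'d \<Rightarrow> 'd \<Rightarrow> real" where "Sg a b = GI b a + GI a b"

lemma gam_gm: "1 \<le> u \<Longrightarrow> u \<le> k \<Longrightarrow> gam b a u k = gm b a (k - u)"
  using stat[of 1 "u - 1" b "1 + (k - u)" a] by (simp add: gam_def gm_def)

lemma gm_bound: "\<bar>gm b a p\<bar> \<le> C * ph p"
  using gam_bound[of 1 "1 + p" b a] by (simp add: gm_def)

lemma gm_tail_summable: "summable (\<lambda>p. if t < p then gm b a p else 0)"
  by (rule summable_comparison_test'[OF summable_mult[OF tail_summable[of t], of C], of 0])
    (use gm_bound in auto)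

lemma gm_tail_bound: "\<bar>\<Sum>p. if t < p then gm b a p else 0\<bar> \<le> C * tail t"
proof -
  have n: "norm (if t < p then gm b a p else 0) \<le> C * (if t < p then ph p else 0)" for p
    using gm_bound by auto
  have s: "summable (\<lambda>p. C * (if t < p then ph p else 0))" by (intro summable_mult tail_summable)
  have "norm (\<Sum>p. if t < p then gm b a p else 0) \<le> (\<Sum>p. C * (if t < p then ph p else 0))"
    by (rule norm_suminf_le[OF n s])
  then show ?thesis unfolding tail_def by (simp add: suminf_mult[OF tail_summable])
qed

lemma Gam_tail:
  assumes "1 \<le> k" "P \<le> k - 1"
  shows "\<bar>Gam P k b a - GI b a\<bar> \<le> C * tail P"
proof -
  have "(\<Sum>p = 1..P. gam b a (k - p) k) = (\<Sum>p\<in>{1..P}. gm b a p)"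
    using assms by (intro sum.cong refl) (auto simp: gam_gm)
  moreover have "gam b a k k = gm b a 0" using assms by (simp add: gam_gm)
  moreover have "(\<Sum>p. if 0 < p then gm b a p else 0) = (\<Sum>p\<in>{1..P}. gm b a p) + (\<Sum>p. if P < p then gm b a p else 0)"
  proof -
    have "(\<lambda>p. if p \<in> {1..P} then gm b a p else 0) sums (\<Sum>p\<in>{1..P}. gm b a p)"
      by (rule sums_If_finite_set) simp
    then have "(\<lambda>p. (if p \<in> {1..P} then gm b a p else 0) + (if P < p then gm b a p else 0)) sums
       ((\<Sum>p\<in>{1..P}. gm b a p) + (\<Sum>p. if P < p then gm b a p else 0))"
      by (intro sums_add summable_sums gm_tail_summable)
    moreover have eq: "(\<lambda>p. (if p \<in> {1..P} then gm b a p else 0) + (if P < p then gm b a p else 0)) = (\<lambda>p. if 0 < p then gm b a p else 0)"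
      by auto
    ultimately have "(\<lambda>p. if 0 < p then gm b a p else 0) sums
       ((\<Sum>p\<in>{1..P}. gm b a p) + (\<Sum>p. if P < p then gm b a p else 0))"
      by (simp only: eq)
    then show ?thesis by (rule sums_unique[symmetric])
  qed
  ultimately have "Gam P k b a - GI b a = - (\<Sum>p. if P < p then gm b a p else 0)"
    by (simp add: Gam_def GI_def)
  then show ?thesis using gm_tail_bound[of P b a] by simp
qed

text \<open>Keeps the two causes of truncation apart, the window s and the start of the sequence,
  because their tails are summed over the steps in different ways.\<close>

lemma Gam_tail_min:
  assumes "1 \<le> k"
  shows "\<bar>Gam (min s (k - 1)) k b a - GI b a\<bar> \<le> C * (tail s + tail (k - 1))"
proof -
  have "tail (min s (k - 1)) \<le> tail s + tail (k - 1)"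
    using tail_nonneg[of s] tail_nonneg[of "k - 1"] by (auto simp: min_def)
  then have "C * tail (min s (k - 1)) \<le> C * (tail s + tail (k - 1))" using consts_nonneg by (intro mult_left_mono)
  then show ?thesis using Gam_tail[OF assms, of "min s (k - 1)" b a] by linarith
qed

lemma second_moment_increment:
  "expectation (\<lambda>\<omega>. S (Suc n) \<omega> $ a * S (Suc n) \<omega> $ b) =
    expectation (\<lambda>\<omega>. S n \<omega> $ a * S n \<omega> $ b) + Gam n (Suc n) a b + Gam n (Suc n) b a"
proof -
  have bS: "bm (\<lambda>\<omega>. S n \<omega> $ a)" for a n by (intro bm_S continuous_intros)
  have cross: "expectation (\<lambda>\<omega>. S n \<omega> $ a * X (Suc n) \<omega> $ b) = (\<Sum>p = 1..n. gam a b (Suc n - p) (Suc n))" for a b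
  proof -
    have "expectation (\<lambda>\<omega>. S n \<omega> $ a * X (Suc n) \<omega> $ b) = (\<Sum>k = 1..n. gam a b k (Suc n))"
      unfolding partial_sum_def sum_component sum_distrib_right gam_def
      by (rule E_sum) (intro bm_intros)
    also have "\<dots> = (\<Sum>p = 1..n. gam a b (Suc n - p) (Suc n))"
      by (rule sum.reindex_bij_witness[of _ "\<lambda>p. Suc n - p" "\<lambda>p. Suc n - p"]) auto
    finally show ?thesis .
  qed
  have "expectation (\<lambda>\<omega>. S (Suc n) \<omega> $ a * S (Suc n) \<omega> $ b) =
    expectation (\<lambda>\<omega>. ((S n \<omega> $ a * S n \<omega> $ b + S n \<omega> $ a * X (Suc n) \<omega> $ b) + S n \<omega> $ b * X (Suc n) \<omega> $ a) + X (Suc n) \<omega> $ a * X (Suc n) \<omega> $ b)"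
    by (simp add: S_Suc algebra_simps)
  also have "\<dots> = expectation (\<lambda>\<omega>. S n \<omega> $ a * S n \<omega> $ b) + expectation (\<lambda>\<omega>. S n \<omega> $ a * X (Suc n) \<omega> $ b)
      + expectation (\<lambda>\<omega>. S n \<omega> $ b * X (Suc n) \<omega> $ a) + gam a b (Suc n) (Suc n)"
    unfolding gam_def
    by (subst E_add, (intro bm_intros bS)+, subst E_add, (intro bm_intros bS)+, subst E_add, (intro bm_intros bS)+, simp)
  also have "gam a b (Suc n) (Suc n) = gam a b (Suc n) (Suc n) / 2 + gam b a (Suc n) (Suc n) / 2"
    unfolding gam_def by (simp add: mult.commute)
  finally show ?thesis unfolding cross Gam_def by simp
qed

text \<open>Each increment of the second moment differs from \<open>Sg\<close> by tails of a series
  whose tails are summable. The total error is therefore bounded in n; the degenerate directions are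
  controlled by exactly this.\<close>

lemma second_moment:
  "\<bar>expectation (\<lambda>\<omega>. S n \<omega> $ a * S n \<omega> $ b) - real n * Sg a b\<bar> \<le> 2 * C * W0"
proof -
  have "\<bar>expectation (\<lambda>\<omega>. S n \<omega> $ a * S n \<omega> $ b) - real n * Sg a b\<bar> \<le> 2 * C * (\<Sum>t<n. tail t)"
  proof (induction n)
    case (Suc n)
    have "\<bar>Gam n (Suc n) a b - GI a b\<bar> \<le> C * tail n" "\<bar>Gam n (Suc n) b a - GI b a\<bar> \<le> C * tail n"
      using Gam_tail[of "Suc n" n] by auto
    then show ?case
      using Suc unfolding second_moment_increment Sg_def by (simp add: algebra_simps)
  qed simp
  also have "\<dots> \<le> 2 * C * W0"
  proof (intro mult_left_mono)
    have "(\<Sum>t<n. tail t) \<le> (\<Sum>t = 0..n. tail t)" by (intro sum_mono2) (auto simp: tail_nonneg)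
    also have "\<dots> \<le> W0" by (rule sum_tail_le)
    finally show "(\<Sum>t<n. tail t) \<le> W0" .
  qed (use consts_nonneg in simp)
  finally show ?thesis .
qed

definition c11 :: real where "c11 = c6 * ((1 + real R) * W0)"
text \<open>The argument c is the constant of the assumption \<open>heat\<close> in
  \<open>lindeberg_sum\<close>; 6 bounds the sum of \<open>\<delta>^3\<close> over all
  steps.\<close>

definition c10 :: "real \<Rightarrow> real" where "c10 c = 3 * c6 * c8 + 4 * (real CARD('d))\<^sup>2 * C * W0 + 6 * c"

lemma c6_nonneg: "0 \<le> c6"
  unfolding c6_def using consts_nonneg by (intro add_nonneg_nonneg mult_nonneg_nonneg zero_le_power) auto

lemma c11_nonneg: "0 \<le> c11"
  unfolding c11_def using consts_nonneg c6_nonneg by simp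

lemma abs_chain: "\<bar>x - y - u\<bar> \<le> A \<Longrightarrow> \<bar>u - v\<bar> \<le> B \<Longrightarrow> \<bar>z - y - v\<bar> \<le> E \<Longrightarrow> \<bar>x - z\<bar> \<le> A + B + E"
  for x :: real
  by linarith

text \<open>Here \<open>D m []\<close> stands for the test function smoothed at variance \<open>m + t0\<^sup>2\<close>. The square root of the variance serves
  both as the scale of the derivatives and as the length of the windows in \<open>step_bound\<close>.\<close>

lemma lindeberg_sum:
  fixes D :: "nat \<Rightarrow> 'd list \<Rightarrow> real ^ 'd \<Rightarrow> real"
  assumes t0: "1 \<le> t0" and K: "0 \<le> K" and c: "0 \<le> c"
    and jet: "\<And>m. m < n \<Longrightarrow> cjet K (1 / real (floor_sqrt (m + t0\<^sup>2))) (D m)"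
    and heat: "\<And>m x. m < n \<Longrightarrow> \<bar>D (Suc m) [] x - D m [] x - (\<Sum>a\<in>UNIV. \<Sum>b\<in>UNIV. D m [b, a] x * GI b a)\<bar>
        \<le> c * (K * (1 / real (floor_sqrt (m + t0\<^sup>2))) ^ 3)"
    and \<Theta>: "\<And>m a b c. m < n \<Longrightarrow> \<bar>expectation (\<lambda>\<omega>. D m [c, b, a] (S (n - m - 1) \<omega>))\<bar> \<le> \<Theta> m"
  shows "\<bar>expectation (\<lambda>\<omega>. D 0 [] (S n \<omega>)) - D n [] 0\<bar> \<le> c10 c * K + c11 * (\<Sum>m<n. \<Theta> m)"
proof -
  define s where "s m = floor_sqrt (m + t0\<^sup>2)" for m
  define \<delta> where "\<delta> m = 1 / real (s m)" for m
  have s1: "1 \<le> s m" for m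
    unfolding s_def le_floor_sqrt_iff using t0 by (simp add: trans_le_add2)
  have d0: "0 \<le> \<delta> m" "\<delta> m \<le> 1" for m using s1[of m] by (auto simp: \<delta>_def)
  have jet': "cjet K (\<delta> m) (D m)" if "m < n" for m using jet[OF that] by (simp add: \<delta>_def s_def)
  let ?d = "real CARD('d)"
  have step: "\<bar>expectation (\<lambda>\<omega>. D m [] (S (n - m) \<omega>)) - expectation (\<lambda>\<omega>. D (Suc m) [] (S (n - Suc m) \<omega>))\<bar>
     \<le> c6 * (K * ERR (\<delta> m) (s m) (R * s m) (QR * s m)) + c11 * \<Theta> m
       + ?d\<^sup>2 * (K * C) * (\<delta> m * tail (s m) + tail (n - Suc m)) + c * K * \<delta> m ^ 3" (is "_ \<le> ?rhs")
    if m: "m < n" for m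
  proof -
    let ?k = "n - m"
    let ?H = "\<lambda>b a. expectation (\<lambda>\<omega>. D m [b, a] (S (?k - 1) \<omega>))"
    note j = jet'[OF m]
    have k: "1 \<le> ?k" using m by simp
    have km: "n - Suc m = ?k - 1" by simp
    have \<Theta>0: "0 \<le> \<Theta> m" using \<Theta>[OF m, of undefined undefined undefined] by linarith
    have "\<bar>expectation (\<lambda>\<omega>. D m [] (S ?k \<omega>)) - expectation (\<lambda>\<omega>. D m [] (S (?k - 1) \<omega>))
       - (\<Sum>a\<in>UNIV. \<Sum>b\<in>UNIV. ?H b a * Gam (min (s m) (?k - 1)) ?k b a)\<bar>
      \<le> c6 * (K * ERR (\<delta> m) (s m) (R * s m) (QR * s m) + \<Theta> m * PS0 (s m) (R * s m))"
      by (rule step_bound[OF j k]) (use \<Theta>[OF m] in \<open>auto simp: QR_def algebra_simps\<close>)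
    also have "\<dots> \<le> c6 * (K * ERR (\<delta> m) (s m) (R * s m) (QR * s m) + \<Theta> m * ((1 + real R) * W0))"
      by (intro mult_left_mono add_left_mono PS0_le \<Theta>0 c6_nonneg)
    also have "\<dots> = c6 * (K * ERR (\<delta> m) (s m) (R * s m) (QR * s m)) + c11 * \<Theta> m"
      by (simp add: c11_def algebra_simps)
    finally have 1: "\<bar>expectation (\<lambda>\<omega>. D m [] (S ?k \<omega>)) - expectation (\<lambda>\<omega>. D m [] (S (?k - 1) \<omega>))
       - (\<Sum>a\<in>UNIV. \<Sum>b\<in>UNIV. ?H b a * Gam (min (s m) (?k - 1)) ?k b a)\<bar> \<le> c6 * (K * ERR (\<delta> m) (s m) (R * s m) (QR * s m)) + c11 * \<Theta> m" .
    have H: "\<bar>?H b a\<bar> \<le> K * \<delta> m" for a b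
      using cjet_bound[OF j, of "[b, a]"] by (intro abs_expectation_le) simp
    have "\<bar>(\<Sum>a\<in>UNIV. \<Sum>b\<in>UNIV. ?H b a * Gam (min (s m) (?k - 1)) ?k b a) - (\<Sum>a\<in>UNIV. \<Sum>b\<in>UNIV. ?H b a * GI b a)\<bar> =
      \<bar>\<Sum>a\<in>UNIV. \<Sum>b\<in>UNIV. ?H b a * (Gam (min (s m) (?k - 1)) ?k b a - GI b a)\<bar>"
      by (simp add: sum_subtractf right_diff_distrib)
    also have "\<dots> \<le> (\<Sum>a\<in>(UNIV :: 'd set). \<Sum>b\<in>(UNIV :: 'd set). (K * \<delta> m) * (C * (tail (s m) + tail (?k - 1))))"
      by (rule order_trans[OF sum_abs sum_mono], rule order_trans[OF sum_abs sum_mono], subst abs_mult)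
        (intro mult_mono H Gam_tail_min k abs_ge_zero mult_nonneg_nonneg K d0)
    also have "\<dots> = ?d\<^sup>2 * (K * C) * (\<delta> m * tail (s m) + \<delta> m * tail (?k - 1))"
      by (simp add: power2_eq_square algebra_simps)
    \<comment> \<open>The second tail is summable over the steps without help, so its factor
      \<delta> is dropped. The first tail keeps it, to compensate the weight t of
      \<open>sum_floor_sqrt_le\<close>.\<close>
    also have "\<dots> \<le> ?d\<^sup>2 * (K * C) * (\<delta> m * tail (s m) + 1 * tail (?k - 1))"
      using K consts_nonneg by (intro mult_left_mono add_left_mono mult_right_mono d0 tail_nonneg mult_nonneg_nonneg) auto
    finally have 2: "\<bar>(\<Sum>a\<in>UNIV. \<Sum>b\<in>UNIV. ?H b a * Gam (min (s m) (?k - 1)) ?k b a) - (\<Sum>a\<in>UNIV. \<Sum>b\<in>UNIV. ?H b a * GI b a)\<bar>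
      \<le> ?d\<^sup>2 * (K * C) * (\<delta> m * tail (s m) + tail (?k - 1))" by simp
    \<comment> \<open>Jets are available for indices below n only. In the last step D n occurs at
      time 0, where the composition is constant.\<close>
    have bm1: "bm (\<lambda>\<omega>. D (Suc m) [] (S (?k - 1) \<omega>))"
    proof (cases "Suc m < n")
      case True
      then show ?thesis by (intro bm_jet[OF jet']) auto
    next
      case False
      then have "?k - 1 = 0" using m by simp
      then show ?thesis by (simp add: bm_const)
    qed
    have "expectation (\<lambda>\<omega>. D (Suc m) [] (S (?k - 1) \<omega>)) - expectation (\<lambda>\<omega>. D m [] (S (?k - 1) \<omega>)) - (\<Sum>a\<in>UNIV. \<Sum>b\<in>UNIV. ?H b a * GI b a) =
      expectation (\<lambda>\<omega>. D (Suc m) [] (S (?k - 1) \<omega>) - D m [] (S (?k - 1) \<omega>) - (\<Sum>a\<in>UNIV. \<Sum>b\<in>UNIV. D m [b, a] (S (?k - 1) \<omega>) * GI b a))"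
      by (subst E_diff, (intro bm_intros bm1 bm_jet[OF j]; simp)+, subst E_diff, (intro bm_intros bm1 bm_jet[OF j]; simp)+)
       (simp add: E_sum bm_intros bm_jet[OF j])
    also have "\<bar>\<dots>\<bar> \<le> c * (K * \<delta> m ^ 3)"
      using heat[OF m] by (intro abs_expectation_le) (simp add: \<delta>_def s_def)
    finally have 3: "\<bar>expectation (\<lambda>\<omega>. D (Suc m) [] (S (?k - 1) \<omega>)) - expectation (\<lambda>\<omega>. D m [] (S (?k - 1) \<omega>)) - (\<Sum>a\<in>UNIV. \<Sum>b\<in>UNIV. ?H b a * GI b a)\<bar>
      \<le> c * K * \<delta> m ^ 3" by (simp add: mult.assoc)
    show ?thesis unfolding km by (rule abs_chain[OF 1 2 3])
  qed
  \<comment> \<open>Consecutive steps share an end point: step m ends with smoothing index m + 1 at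
    time n - m - 1.\<close>
  have "expectation (\<lambda>\<omega>. D 0 [] (S n \<omega>)) - D n [] 0 =
    (\<Sum>m<n. expectation (\<lambda>\<omega>. D m [] (S (n - m) \<omega>)) - expectation (\<lambda>\<omega>. D (Suc m) [] (S (n - Suc m) \<omega>)))"
    using sum_lessThan_telescope'[of "\<lambda>m. expectation (\<lambda>\<omega>. D m [] (S (n - m) \<omega>))" n] by (simp add: prob_space)
  then have "\<bar>expectation (\<lambda>\<omega>. D 0 [] (S n \<omega>)) - D n [] 0\<bar> \<le>
    (\<Sum>m<n. \<bar>expectation (\<lambda>\<omega>. D m [] (S (n - m) \<omega>)) - expectation (\<lambda>\<omega>. D (Suc m) [] (S (n - Suc m) \<omega>))\<bar>)"
    by (simp only: sum_abs)
  also have "\<dots> \<le> (\<Sum>m<n. c6 * (K * ERR (\<delta> m) (s m) (R * s m) (QR * s m)) + c11 * \<Theta> m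
       + ?d\<^sup>2 * (K * C) * (\<delta> m * tail (s m) + tail (n - Suc m)) + c * K * \<delta> m ^ 3)"
    by (intro sum_mono step) simp
  also have "\<dots> = c6 * K * (\<Sum>m<n. ERR (\<delta> m) (s m) (R * s m) (QR * s m)) + c11 * (\<Sum>m<n. \<Theta> m)
      + ?d\<^sup>2 * (K * C) * ((\<Sum>m<n. \<delta> m * tail (s m)) + (\<Sum>m<n. tail (n - Suc m))) + c * K * (\<Sum>m<n. \<delta> m ^ 3)"
    by (simp only: distrib_left sum.distrib sum_distrib_left mult.assoc add.assoc)
  also have "\<dots> \<le> c6 * K * (3 * c8) + c11 * (\<Sum>m<n. \<Theta> m) + ?d\<^sup>2 * (K * C) * (3 * W0 + W0) + c * K * 6"
  proof (intro add_mono mult_left_mono order_refl)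
    have EN: "0 \<le> ERR (1 / real t) t (R * t) (QR * t)" for t
      unfolding ERR_def using PS_nonneg ph_nonneg
      by (intro add_nonneg_nonneg mult_nonneg_nonneg zero_le_power) auto
    have "(\<Sum>m<n. ERR (\<delta> m) (s m) (R * s m) (QR * s m)) \<le> 3 * (\<Sum>t = t0..n + t0\<^sup>2. real t * ERR (1 / real t) t (R * t) (QR * t))"
      unfolding \<delta>_def s_def by (rule sum_floor_sqrt_le[OF EN t0])
    then show "(\<Sum>m<n. ERR (\<delta> m) (s m) (R * s m) (QR * s m)) \<le> 3 * c8"
      using sum_ERR_le[OF t0, of "n + t0\<^sup>2"] by linarith
    have "(\<Sum>m<n. \<delta> m * tail (s m)) \<le> 3 * (\<Sum>t = t0..n + t0\<^sup>2. real t * (1 / real t * tail t))"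
      unfolding \<delta>_def s_def by (rule sum_floor_sqrt_le[OF _ t0]) (simp add: tail_nonneg)
    also have "(\<Sum>t = t0..n + t0\<^sup>2. real t * (1 / real t * tail t)) = (\<Sum>t = t0..n + t0\<^sup>2. tail t)"
      using t0 by (intro sum.cong) auto
    finally show "(\<Sum>m<n. \<delta> m * tail (s m)) \<le> 3 * W0" using sum_tail_le[of t0 "n + t0\<^sup>2"] by linarith
    have "(\<Sum>m<n. tail (n - Suc m)) = (\<Sum>m<n. tail m)" by (rule sum.nat_diff_reindex)
    also have "\<dots> \<le> (\<Sum>m = 0..n. tail m)" by (intro sum_mono2) (auto simp: tail_nonneg)
    finally show "(\<Sum>m<n. tail (n - Suc m)) \<le> W0" using sum_tail_le[of 0 n] by linarith
    have "(\<Sum>m<n. \<delta> m ^ 3) \<le> 3 * (\<Sum>t = t0..n + t0\<^sup>2. real t * (1 / real t) ^ 3)"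
      unfolding \<delta>_def s_def by (rule sum_floor_sqrt_le[OF _ t0]) simp
    also have "(\<Sum>t = t0..n + t0\<^sup>2. real t * (1 / real t) ^ 3) = (\<Sum>t = t0..n + t0\<^sup>2. 1 / real t ^ 2)"
      using t0 by (intro sum.cong) (auto simp: power2_eq_square power3_eq_cube)
    also have "\<dots> \<le> 2 / real t0" by (rule sum_inverse_squares[OF t0])
    also have "\<dots> \<le> 2" using t0 by (simp add: divide_le_eq)
    finally show "(\<Sum>m<n. \<delta> m ^ 3) \<le> 6" by simp
  qed (use K c c6_nonneg c11_nonneg consts_nonneg in auto)
  also have "\<dots> = c10 c * K + c11 * (\<Sum>m<n. \<Theta> m)"
    by (simp add: c10_def algebra_simps)
  finally show ?thesis .
qed

end

section \<open>Degenerate covariance matrices\<close>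

text \<open>Stated for a bare form because it is applied to the residual forms in the factorization
  below.\<close>

lemma psd_cauchy_schwarz:
  fixes B :: "'a::real_vector \<Rightarrow> 'a \<Rightarrow> real"
  assumes add: "\<And>x y z. B (x + y) z = B x z + B y z" and scale: "\<And>r x z. B (r *\<^sub>R x) z = r * B x z"
    and sym: "\<And>x y. B x y = B y x" and psd: "\<And>x. 0 \<le> B x x"
  shows "(B x y)\<^sup>2 \<le> B x x * B y y"
proof -
  have ex: "B (x + t *\<^sub>R y) (x + t *\<^sub>R y) = B x x + 2 * t * B x y + t\<^sup>2 * B y y" for t
  proof -
    have addr: "B z (x + y) = B z x + B z y" for x y z using add[of x y z] by (simp only: sym[of z])
    have scaler: "B z (r *\<^sub>R x) = r * B z x" for r x z using scale[of r x z] by (simp only: sym[of z])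
    show ?thesis by (simp add: add scale addr scaler sym[of y x] power2_eq_square algebra_simps)
  qed
  show ?thesis
  proof (cases "B y y = 0")
    case True
    have "B x y = 0"
    proof (rule ccontr)
      assume n: "B x y \<noteq> 0"
      \<comment> \<open>As B y y = 0, the quadratic polynomial is linear in t; the chosen t makes it
        equal to - 1.\<close>
      have "0 \<le> B x x + 2 * (- (B x x + 1) / (2 * B x y)) * B x y + 0"
        using psd[of "x + (- (B x x + 1) / (2 * B x y)) *\<^sub>R y"] unfolding ex True by simp
      then show False using n by (simp add: field_simps)
    qed
    then show ?thesis by (simp add: psd)
  next
    case False
    then have p: "0 < B y y" using psd[of y] by simp
    \<comment> \<open>The minimum of the quadratic polynomial.\<close>
    have "0 \<le> B x x + 2 * (- B x y / B y y) * B x y + (- B x y / B y y)\<^sup>2 * B y y"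
      using psd[of "x + (- B x y / B y y) *\<^sub>R y"] unfolding ex .
    also have "\<dots> = B x x - (B x y)\<^sup>2 / B y y" using p by (simp add: power2_eq_square field_simps)
    finally show ?thesis using p by (simp add: field_simps)
  qed
qed

text \<open>Cholesky factorization. For each basis vector c a rank-one form is subtracted;
  Cauchy-Schwarz keeps the rest positive semidefinite, and its row c vanishes. If the pivot
  \<open>B' c c\<close> is 0, that row vanishes already by Cauchy-Schwarz, and \<open>lc\<close> is
  0 through division by 0.\<close>

lemma psd_factorization:
  fixes B :: "'a::euclidean_space \<Rightarrow> 'a \<Rightarrow> real"
  assumes add: "\<And>x y z. B (x + y) z = B x z + B y z" and scale: "\<And>r x z. B (r *\<^sub>R x) z = r * B x z"
    and sym: "\<And>x y. B x y = B y x" and psd: "\<And>x. 0 \<le> B x x"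
  obtains T :: "'a \<Rightarrow> 'a" where "linear T" "\<And>x y. B x y = T x \<bullet> T y"
proof -
  have "\<exists>l :: 'a \<Rightarrow> 'a \<Rightarrow> real. (\<forall>b\<in>F. linear (l b)) \<and> (\<forall>x. 0 \<le> B x x - (\<Sum>b\<in>F. l b x * l b x)) \<and>
      (\<forall>b\<in>F. \<forall>x. B b x - (\<Sum>c\<in>F. l c b * l c x) = 0)" if "finite F" for F :: "'a set"
    using that
  proof (induction F)
    case empty
    then show ?case using psd by auto
  next
    case (insert c F)
    obtain l where "(\<forall>b\<in>F. linear (l b)) \<and> (\<forall>x. 0 \<le> B x x - (\<Sum>b\<in>F. l b x * l b x)) \<and>
      (\<forall>b\<in>F. \<forall>x. B b x - (\<Sum>c\<in>F. l c b * l c x) = 0)"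
      using insert(3) by (rule exE)
    then have l: "\<And>b. b \<in> F \<Longrightarrow> linear (l b)" "\<And>x. 0 \<le> B x x - (\<Sum>b\<in>F. l b x * l b x)"
      "\<And>b x. b \<in> F \<Longrightarrow> B b x - (\<Sum>c\<in>F. l c b * l c x) = 0" by simp_all
    define B' where "B' x y = B x y - (\<Sum>b\<in>F. l b x * l b y)" for x y
    have a': "B' (x + y) z = B' x z + B' y z" for x y z
    proof -
      have "(\<Sum>b\<in>F. l b (x + y) * l b z) = (\<Sum>b\<in>F. l b x * l b z) + (\<Sum>b\<in>F. l b y * l b z)"
        unfolding sum.distrib[symmetric] by (intro sum.cong refl) (simp add: linear_add[OF l(1)] algebra_simps)
      then show ?thesis by (simp add: B'_def add)
    qed
    have s': "B' (r *\<^sub>R x) z = r * B' x z" for r x z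
    proof -
      have "(\<Sum>b\<in>F. l b (r *\<^sub>R x) * l b z) = r * (\<Sum>b\<in>F. l b x * l b z)"
        unfolding sum_distrib_left by (intro sum.cong refl) (simp add: linear_cmul[OF l(1)])
      then show ?thesis by (simp add: B'_def scale right_diff_distrib)
    qed
    have y': "B' x y = B' y x" for x y by (simp add: B'_def sym[of x y] mult.commute)
    have p': "0 \<le> B' x x" for x using l(2) by (simp add: B'_def)
    note cs = psd_cauchy_schwarz[of B', OF a' s' y' p']
    define lc where "lc x = B' c x / sqrt (B' c c)" for x
    have ar: "B' c (x + y) = B' c x + B' c y" for x y
      using a'[of x y c] y'[of c "x + y"] y'[of c x] y'[of c y] by linarith
    have sr: "B' c (r *\<^sub>R x) = r * B' c x" for r x
      unfolding y'[of c "r *\<^sub>R x"] y'[of c x] by (rule s')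
    have lin: "linear lc"
      by (rule linearI) (simp_all add: lc_def ar sr add_divide_distrib)
    have lcc: "lc x * lc y = B' c x * B' c y / B' c c" for x y
      using p'[of c] by (simp add: lc_def)
    have zero: "B' c x = 0" if "B' c c = 0" for x using cs[of c x] that by simp
    define l' where "l' b = (if b = c then lc else l b)" for b
    have sum': "B x y - (\<Sum>b\<in>insert c F. l' b x * l' b y) = B' x y - lc x * lc y" for x y
    proof -
      have "(\<Sum>b\<in>F. l' b x * l' b y) = (\<Sum>b\<in>F. l b x * l b y)"
        using insert(2) by (intro sum.cong refl) (auto simp: l'_def)
      then show ?thesis using insert(1,2) by (simp add: B'_def l'_def)
    qed
    show ?case
    proof (intro exI[of _ l'] conjI ballI allI)
      show "linear (l' b)" if "b \<in> insert c F" for b using that l(1) lin by (auto simp: l'_def)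
      show "0 \<le> B x x - (\<Sum>b\<in>insert c F. l' b x * l' b x)" for x
      proof (cases "B' c c = 0")
        case True
        then show ?thesis unfolding sum' lcc by (simp add: p')
      next
        case False
        then have "0 < B' c c" using p'[of c] by simp
        then have "B' c x * B' c x / B' c c \<le> B' x x"
          using cs[of c x] by (simp add: divide_le_eq power2_eq_square mult.commute)
        then show ?thesis unfolding sum' lcc by simp
      qed
      show "B b x - (\<Sum>ca\<in>insert c F. l' ca b * l' ca x) = 0" if "b \<in> insert c F" for b x
      proof (cases "b = c")
        case True
        show ?thesis unfolding sum' lcc True by (cases "B' c c = 0") (simp_all add: zero)
      next
        case False
        then have "b \<in> F" using that by simp
        then have "B' b x = 0" for x using l(3) by (simp add: B'_def)
        then show ?thesis unfolding sum' lcc using y'[of c b] by simp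
      qed
    qed
  qed
  from this[OF finite_Basis] obtain l :: "'a \<Rightarrow> 'a \<Rightarrow> real" where
    "(\<forall>b\<in>Basis. linear (l b)) \<and> (\<forall>x. 0 \<le> B x x - (\<Sum>b\<in>Basis. l b x * l b x)) \<and>
      (\<forall>b\<in>Basis. \<forall>x. B b x - (\<Sum>c\<in>Basis. l c b * l c x) = 0)" by (rule exE)
  then have l: "\<And>b. b \<in> Basis \<Longrightarrow> linear (l b)"
    "\<And>b x. b \<in> Basis \<Longrightarrow> B b x - (\<Sum>c\<in>Basis. l c b * l c x) = 0" by simp_all
  define T where "T x = (\<Sum>b\<in>Basis. l b x *\<^sub>R b)" for x
  have linT: "linear T"
    unfolding T_def by (intro linear_compose_sum ballI) (rule linearI, simp_all add: linear_add[OF l(1)] linear_cmul[OF l(1)] scaleR_add_left)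
  have TT: "T x \<bullet> T y = (\<Sum>c\<in>Basis. l c x * l c y)" for x y
    unfolding T_def by (simp add: inner_sum_left inner_sum_right inner_Basis if_distrib sum.If_cases mult.commute cong: if_cong)
  have Bb: "B b y = T b \<bullet> T y" if "b \<in> Basis" for b y
    using l(2)[OF that, of y] unfolding TT by simp
  have linB: "linear (\<lambda>x. B x y)" for y by (rule linearI) (simp_all add: add scale)
  have linTT: "linear (\<lambda>x. T x \<bullet> T y)" for y
    by (rule linearI) (simp_all add: linear_add[OF linT] linear_cmul[OF linT] inner_add_left)
  have "B x y = T x \<bullet> T y" for x y
    using linear_eq_stdbasis[OF linB linTT] Bb by (metis (no_types, lifting))
  with linT show ?thesis by (rule that)
qed

section \<open>Smoothing along the range of a linear map\<close>

lemma axis_expansion: "(h :: real ^ 'd) = (\<Sum>c\<in>UNIV. h $ c *\<^sub>R axis c 1)"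
  by (simp add: vec_eq_iff axis_def if_distrib cong: if_cong)

lemma cjet_lipschitz:
  fixes D :: "'d::finite list \<Rightarrow> real ^ 'd \<Rightarrow> real"
  assumes jet: "cjet K \<delta> D" and cs: "length cs \<le> 4"
  shows "(real CARD('d) * (K * \<delta> ^ length cs))-lipschitz_on UNIV (D cs)"
proof (rule lipschitz_onI')
  show "0 \<le> real CARD('d) * (K * \<delta> ^ length cs)" using cjet_pos[OF jet] by simp
  fix x y :: "real ^ 'd"
  have "\<bar>rem1 D cs y (x - y)\<bar> \<le> real CARD('d) * norm (x - y) * (K * \<delta> ^ length cs)"
    by (rule rem1_bound[OF jet cs]) (rule component_le_norm_cart)
  then show "\<bar>D cs x - D cs y\<bar> \<le> real CARD('d) * (K * \<delta> ^ length cs) * norm (x - y)"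
    by (simp add: rem1_def mult_ac)
qed

text \<open>Derivatives are unique, so an identity between jets has to be checked for the
  undifferentiated functions only.\<close>

lemma jets_eq:
  fixes f g :: "'a::euclidean_space list \<Rightarrow> 'a \<Rightarrow> real"
  assumes "\<And>vs x. length vs < j \<Longrightarrow> (f vs has_derivative (\<lambda>v. f (v # vs) x)) (at x)"
    and "\<And>vs x. length vs < j \<Longrightarrow> (g vs has_derivative (\<lambda>v. g (v # vs) x)) (at x)"
    and "f [] = g []" and "length vs \<le> j"
  shows "f vs = g vs"
  using assms(4)
proof (induction vs)
  case (Cons v vs)
  then have IH: "f vs = g vs" by simp
  have "f (v # vs) x = g (v # vs) x" for x
    using has_derivative_unique[OF assms(1)[of vs x, unfolded IH] assms(2)[of vs x]] Cons.prems by (auto dest: fun_cong)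
  then show ?case by auto
qed (rule assms(3))

lemma lipschitz_compose_linear:
  fixes \<psi> :: "'a::euclidean_space \<Rightarrow> real" and A :: "'b::euclidean_space \<Rightarrow> 'a"
  assumes "L-lipschitz_on UNIV \<psi>" "linear A"
  shows "(L * onorm A)-lipschitz_on UNIV (\<lambda>x. \<psi> (A x))"
proof (rule lipschitz_onI')
  have bl: "bounded_linear A" using assms(2) by (simp add: linear_conv_bounded_linear)
  have L: "0 \<le> L" using assms(1) by (rule lipschitz_on_nonneg)
  then show "0 \<le> L * onorm A" using onorm_pos_le[OF bl] by simp
  fix x y
  have "\<bar>\<psi> (A x) - \<psi> (A y)\<bar> \<le> L * norm (A x - A y)" by (rule lipschitz_onD'[OF assms(1)])
  also have "A x - A y = A (x - y)" by (rule linear_diff[OF assms(2), symmetric])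
  also have "L * norm (A (x - y)) \<le> L * (onorm A * norm (x - y))" by (intro mult_left_mono onorm[OF bl] L)
  finally show "\<bar>\<psi> (A x) - \<psi> (A y)\<bar> \<le> L * onorm A * norm (x - y)" by (simp add: mult.assoc)
qed

lemma gsm_close:
  fixes u :: "'a::euclidean_space \<Rightarrow> real"
  assumes s: "0 < s" and u: "L-lipschitz_on UNIV u"
  shows "\<bar>gsm s u x - u x\<bar> \<le> L * (s * (\<integral>z. norm z \<partial>(gauss 1 :: 'a measure)))"
proof -
  interpret prob_space "gauss s :: 'a measure" by (rule prob_space_gauss[OF s])
  note i = integrable_gauss_lipschitz(1)[OF s u, of x]
  have "gsm s u x - u x = (\<integral>z. u (x + z) - u x \<partial>gauss s)"
    using i by (simp add: gsm_def prob_space[unfolded space_gauss])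
  also have "\<bar>\<dots>\<bar> \<le> (\<integral>z. \<bar>u (x + z) - u x\<bar> \<partial>gauss s)" by (rule integral_abs_bound)
  also have "\<dots> \<le> (\<integral>z. L * norm z \<partial>(gauss s :: 'a measure))"
  proof (rule integral_mono)
    show "\<bar>u (x + z) - u x\<bar> \<le> L * norm z" for z using lipschitz_onD'[OF u, of "x + z" x] by simp
  qed (use i integrable_gauss_inner(4)[OF s] in auto)
  also have "\<dots> = L * (\<integral>z. norm z \<partial>distr (gauss 1 :: 'a measure) borel (\<lambda>z. s *\<^sub>R z))"
    using gauss_scale[OF s zero_less_one, where 'a = 'a] by simp
  also have "(\<integral>z. norm z \<partial>distr (gauss 1 :: 'a measure) borel (\<lambda>z. s *\<^sub>R z)) = s * (\<integral>z. norm z \<partial>(gauss 1 :: 'a measure))"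
    using s by (subst integral_distr) auto
  finally show ?thesis .
qed

text \<open>\<open>W\<close> is a generalized inverse of \<open>A\<close>, so that \<open>x \<mapsto> A (W x)\<close> projects onto the range of \<open>A\<close>. Smoothing
  \<open>\<psi>\<close> along this range only copes with degenerate covariance matrices \<open>A A\<^sup>T\<close>.\<close>

locale smoothing =
  fixes A W :: "real ^ 'd \<Rightarrow> real ^ 'd" and \<psi> :: "real ^ 'd \<Rightarrow> real" and L :: real
  assumes linA: "linear A" and linW: "linear W" and AWA: "\<And>z. A (W (A z)) = A z"
    and lip: "L-lipschitz_on UNIV \<psi>"
begin

definition u :: "real ^ 'd \<Rightarrow> real" where "u y = \<psi> (A y)"
text \<open>Six smoothings of scale s / sqrt 6 compose to one of scale s and provide for the five
  derivatives that \<open>cjet\<close> bounds.\<close>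

definition Dv :: "real \<Rightarrow> (real ^ 'd) list \<Rightarrow> real ^ 'd \<Rightarrow> real" where "Dv s = gjet 6 (s / sqrt 6) u"
text \<open>\<open>W\<close> leads back to the original space: without directions this is the mean
  of \<psi> (A (W x) + A z) over a centred Gaussian z of scale s.\<close>

definition Dc :: "real \<Rightarrow> 'd list \<Rightarrow> real ^ 'd \<Rightarrow> real" where "Dc s cs x = Dv s (map (\<lambda>c. W (axis c 1)) cs) (W x)"
text \<open>36 is sqrt 6 to the power 4, from at most four factors sqrt 6 / s; the fifth power comes
  from at most five directions, each the image of a unit vector under W.\<close>

definition k0 :: real where "k0 = onorm A * (max 1 (onorm W)) ^ 5 * 36"

lemma u_lipschitz: "(L * onorm A)-lipschitz_on UNIV u"
  unfolding u_def by (rule lipschitz_compose_linear[OF lip linA])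

lemma L_nonneg: "0 \<le> L" using lip by (rule lipschitz_on_nonneg)

lemma onorm_nonneg: "0 \<le> onorm A"
  using linA by (simp add: onorm_pos_le linear_conv_bounded_linear)

lemma Dv_Nil: "0 < s \<Longrightarrow> Dv s [] = gsm s u"
  unfolding Dv_def by (subst gjet_Nil[OF _ u_lipschitz]) auto

lemma Dv_deriv: "0 < s \<Longrightarrow> length vs < 6 \<Longrightarrow> (Dv s vs has_derivative (\<lambda>v. Dv s (v # vs) x)) (at x)"
  unfolding Dv_def by (rule gjet_has_derivative[OF _ u_lipschitz]) auto

lemma Dv_lipschitz: "0 < s \<Longrightarrow> length vs \<le> 6 \<Longrightarrow>
    (L * onorm A * prod_list (map norm vs) / (s / sqrt 6) ^ length vs)-lipschitz_on UNIV (Dv s vs)"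
  unfolding Dv_def by (rule gjet_lipschitz[OF _ u_lipschitz]) auto

text \<open>Since A W A = A, a shift by W (A z) has the same effect on u as a shift by z, hence on
  all its smoothed derivatives. This lets a Gaussian vector A z added in the original space act as
  further smoothing.\<close>

lemma Dv_range: "0 < s \<Longrightarrow> length vs \<le> 6 \<Longrightarrow> Dv s vs (y + W (A z)) = Dv s vs (y + z)"
proof -
  assume s: "0 < s" and len: "length vs \<le> 6"
  have sh: "((\<lambda>y. Dv s vs (y + a)) has_derivative (\<lambda>v. Dv s (v # vs) (x + a))) (at x)" if "length vs < 6" for vs a x
    by (rule has_derivative_eq_rhs[OF has_derivative_compose[of "\<lambda>y. y + a" "\<lambda>v. v" x UNIV "Dv s vs"]])
      (auto intro!: derivative_eq_intros Dv_deriv[OF s that])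
  have "(\<lambda>y. Dv s vs (y + W (A z))) = (\<lambda>y. Dv s vs (y + z))"
  proof (rule jets_eq[where f = "\<lambda>vs y. Dv s vs (y + W (A z))" and g = "\<lambda>vs y. Dv s vs (y + z)" and j = 6])
    have "u (y + W (A z) + w) = u (y + z + w)" for y w
      by (simp add: u_def linear_add[OF linA] AWA)
    then show "(\<lambda>y. Dv s [] (y + W (A z))) = (\<lambda>y. Dv s [] (y + z))"
      by (simp add: Dv_Nil[OF s] gsm_def)
  qed (use sh len in auto)
  then show ?thesis by (rule fun_cong)
qed

text \<open>For the function itself this is the semigroup property; for the derivatives it follows
  because smoothing commutes with differentiation.\<close>

lemma Dv_conv:
  assumes s: "0 < s" and t: "0 < t" and len: "length vs \<le> 5"
  shows "gsm t (Dv s vs) = Dv (sqrt (s\<^sup>2 + t\<^sup>2)) vs"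
proof (rule jets_eq[where f = "\<lambda>vs. gsm t (Dv s vs)" and j = 5])
  let ?r = "sqrt (s\<^sup>2 + t\<^sup>2)"
  have r: "0 < ?r" using s t by (simp add: add_pos_pos)
  show "(Dv ?r vs has_derivative (\<lambda>v. Dv ?r (v # vs) x)) (at x)" if "length vs < 5" for vs x
    using Dv_deriv[OF r] that by simp
  show "gsm t (Dv s []) = Dv ?r []"
    using gsm_gsm[OF s t u_lipschitz] by (auto simp: Dv_Nil[OF s] Dv_Nil[OF r] gsm_def)
  show "(gsm t (Dv s vs) has_derivative (\<lambda>v. gsm t (Dv s (v # vs)) x)) (at x)" if "length vs < 5" for vs x
  proof (rule gsm_has_derivative_inside[where u' = "\<lambda>v. Dv s (v # vs)"
      and K = "L * onorm A * prod_list (map norm vs) / (s / sqrt 6) ^ Suc (length vs)", OF t Dv_lipschitz[OF s] Dv_deriv[OF s]])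
    show "(L * onorm A * prod_list (map norm vs) / (s / sqrt 6) ^ Suc (length vs) * norm v)-lipschitz_on UNIV (Dv s (v # vs))" for v
      using Dv_lipschitz[OF s, of "v # vs"] that by (simp add: mult_ac)
  qed (use that in auto)
qed (rule len)

text \<open>Chain rule through W. Of the at most five directions one is paid by the Lipschitz
  constant, and each of the others costs sqrt 6 / s, where 1 / s is at most \<delta>.\<close>

lemma Dc_cjet:
  assumes \<delta>: "0 < \<delta>" "\<delta> \<le> 1" and s: "1 / s \<le> \<delta>" "0 < s"
  shows "cjet (L * k0) \<delta> (Dc s)"
  unfolding cjet_def
proof (intro conjI allI impI)
  let ?w = "max 1 (onorm W)"
  let ?e = "\<lambda>c. W (axis c (1::real))"
  have blW: "bounded_linear W" using linW by (simp add: linear_conv_bounded_linear)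
  show "0 \<le> L * k0" using L_nonneg onorm_nonneg by (simp add: k0_def)
  show "0 < \<delta>" "\<delta> \<le> 1" by fact+
  show "(Dc s cs has_derivative (\<lambda>h. \<Sum>c\<in>UNIV. h $ c * Dc s (c # cs) x)) (at x)" if len: "length cs \<le> 4" for cs x
  proof -
    have d: "(Dv s (map ?e cs) has_derivative (\<lambda>v. Dv s (v # map ?e cs) (W x))) (at (W x))"
      by (rule Dv_deriv) (use s len in auto)
    have lin: "linear (\<lambda>v. Dv s (v # map ?e cs) (W x))" by (rule has_derivative_linear[OF d])
    have "((\<lambda>x. Dv s (map ?e cs) (W x)) has_derivative (\<lambda>h. Dv s (W h # map ?e cs) (W x))) (at x)"
      by (rule has_derivative_compose[where f = W and f' = W and g = "Dv s (map ?e cs)" and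
          g' = "\<lambda>v. Dv s (v # map ?e cs) (W x)"])
        (rule bounded_linear_imp_has_derivative[OF blW], rule d)
    moreover have "Dv s (W h # map ?e cs) (W x) = (\<Sum>c\<in>UNIV. h $ c * Dc s (c # cs) x)" for h
    proof -
      have "W h = (\<Sum>c\<in>UNIV. h $ c *\<^sub>R ?e c)"
        by (subst axis_expansion[of h]) (simp add: linear_sum[OF linW] linear_cmul[OF linW])
      then show ?thesis
        by (simp add: linear_sum[OF lin] linear_cmul[OF lin] Dc_def)
    qed
    ultimately have "((\<lambda>x. Dv s (map ?e cs) (W x)) has_derivative (\<lambda>h. \<Sum>c\<in>UNIV. h $ c * Dc s (c # cs) x)) (at x)"
      by (simp only:)
    moreover have "Dc s cs = (\<lambda>x. Dv s (map ?e cs) (W x))" by (simp add: Dc_def fun_eq_iff)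
    ultimately show ?thesis by (simp only:)
  qed
  show "\<bar>Dc s cs x\<bar> \<le> L * k0 * \<delta> ^ (length cs - 1)" if len: "1 \<le> length cs \<and> length cs \<le> 5" for cs x
  proof -
    obtain c ds where cs: "cs = c # ds" using len by (cases cs) auto
    have ne: "norm (?e c) \<le> ?w" for c
      using onorm[OF blW, of "axis c 1"] by (simp add: norm_axis_1)
    have pl: "prod_list (map norm (map ?e ds)) \<le> ?w ^ length ds"
    proof (induction ds)
      case (Cons a ds)
      have nn: "0 \<le> prod_list (map norm (map ?e ds))" by (rule prod_list_nonneg) auto
      show ?case using mult_mono[OF ne[of a] Cons] nn by simp
    qed simp
    have pn: "0 \<le> prod_list (map norm (map ?e ds))" by (rule prod_list_nonneg) auto
    have Ln: "0 \<le> L * onorm A" using L_nonneg onorm_nonneg by simp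
    have "\<bar>Dc s cs x\<bar> \<le> L * onorm A * prod_list (map norm (map ?e ds)) / (s / sqrt 6) ^ length ds * norm (?e c)"
      unfolding Dc_def Dv_def cs list.map using gjet_bound[OF _ u_lipschitz, of "s / sqrt 6" "map ?e ds" 6 "?e c" "W x"] s len cs by simp
    also have "\<dots> = (L * onorm A) * (prod_list (map norm (map ?e ds)) * norm (?e c)) * ((1 / s) ^ length ds * sqrt 6 ^ length ds)"
      by (simp add: power_divide)
    also have "\<dots> \<le> (L * onorm A) * (?w ^ length ds * ?w) * (\<delta> ^ length ds * 36)"
    proof -
      have "sqrt 6 ^ length ds \<le> sqrt 6 ^ 4" using len cs by (intro power_increasing) auto
      also have "sqrt 6 ^ 4 = (sqrt 6 * sqrt 6) * (sqrt 6 * sqrt 6 :: real)" by (simp only: power4_eq_xxxx mult.assoc)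
      finally have 1: "sqrt 6 ^ length ds \<le> 36" by simp
      have 2: "(1 / s) ^ length ds \<le> \<delta> ^ length ds" using s by (intro power_mono) auto
      have 3: "(1 / s) ^ length ds * sqrt 6 ^ length ds \<le> \<delta> ^ length ds * 36"
        using \<delta> by (intro mult_mono 1 2) auto
      have 4: "prod_list (map norm (map ?e ds)) * norm (?e c) \<le> ?w ^ length ds * ?w"
        by (intro mult_mono pl ne) auto
      have 5: "(L * onorm A) * (prod_list (map norm (map ?e ds)) * norm (?e c)) \<le> (L * onorm A) * (?w ^ length ds * ?w)"
        by (rule mult_left_mono[OF 4 Ln])
      have 6: "0 \<le> (1 / s) ^ length ds * sqrt 6 ^ length ds" using s by simp
      have "0 \<le> prod_list (map norm (map ?e ds)) * norm (?e c)" using pn by simp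
      then have 7: "0 \<le> (L * onorm A) * (?w ^ length ds * ?w)"
        using mult_nonneg_nonneg[OF Ln order_trans[OF _ 4]] by simp
      show ?thesis by (rule mult_mono[OF 5 3 7 6])
    qed
    also have "\<dots> = (L * onorm A * 36) * ?w ^ Suc (length ds) * \<delta> ^ length ds" by simp
    also have "\<dots> \<le> (L * onorm A * 36) * ?w ^ 5 * \<delta> ^ length ds"
      using len cs Ln \<delta> by (intro mult_right_mono mult_left_mono power_increasing) auto
    finally show ?thesis by (simp add: k0_def cs mult_ac)
  qed
  show "Dc s (c # d # cs) x = Dc s (d # c # cs) x" if "length cs \<le> 3" for c d cs x
    unfolding Dc_def Dv_def list.map using s that by (intro gjet_symmetric[OF _ u_lipschitz]) auto
qed

end

section \<open>A square root of the limiting covariance\<close>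

context mixing begin

lemma bm_component: "bm (\<lambda>\<omega>. S n \<omega> $ a)"
  by (intro bm_S continuous_intros)

lemma quadratic_form_moment:
  "expectation (\<lambda>\<omega>. (\<Sum>a\<in>UNIV. x a * S n \<omega> $ a)\<^sup>2) = (\<Sum>a\<in>UNIV. \<Sum>b\<in>UNIV. x a * x b * expectation (\<lambda>\<omega>. S n \<omega> $ a * S n \<omega> $ b))"
proof -
  have "expectation (\<lambda>\<omega>. (\<Sum>a\<in>UNIV. x a * S n \<omega> $ a)\<^sup>2) = expectation (\<lambda>\<omega>. \<Sum>a\<in>UNIV. \<Sum>b\<in>UNIV. x a * x b * (S n \<omega> $ a * S n \<omega> $ b))"
    unfolding power2_eq_square sum_product by (simp add: mult_ac)
  also have "\<dots> = (\<Sum>a\<in>UNIV. \<Sum>b\<in>UNIV. expectation (\<lambda>\<omega>. x a * x b * (S n \<omega> $ a * S n \<omega> $ b)))"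
    by (simp add: E_sum bm_intros bm_component)
  finally show ?thesis by simp
qed

lemma quadratic_form_bound:
  "\<bar>expectation (\<lambda>\<omega>. (\<Sum>a\<in>UNIV. x a * S n \<omega> $ a)\<^sup>2) - real n * (\<Sum>a\<in>UNIV. \<Sum>b\<in>UNIV. x a * x b * Sg a b)\<bar>
    \<le> (\<Sum>a\<in>UNIV. \<Sum>b\<in>UNIV. \<bar>x a * x b\<bar> * (2 * C * W0))"
proof -
  have "expectation (\<lambda>\<omega>. (\<Sum>a\<in>UNIV. x a * S n \<omega> $ a)\<^sup>2) - real n * (\<Sum>a\<in>UNIV. \<Sum>b\<in>UNIV. x a * x b * Sg a b) =
    (\<Sum>a\<in>UNIV. \<Sum>b\<in>UNIV. (x a * x b) * (expectation (\<lambda>\<omega>. S n \<omega> $ a * S n \<omega> $ b) - real n * Sg a b))"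
    unfolding quadratic_form_moment by (simp add: sum_distrib_left sum_subtractf right_diff_distrib mult_ac)
  also have "\<bar>\<dots>\<bar> \<le> (\<Sum>a\<in>UNIV. \<Sum>b\<in>UNIV. \<bar>x a * x b\<bar> * (2 * C * W0))"
    by (rule order_trans[OF sum_abs], rule sum_mono, rule order_trans[OF sum_abs], rule sum_mono, subst abs_mult)
      (intro mult_left_mono second_moment, simp)
  finally show ?thesis .
qed

text \<open>n times the form stays within a bounded distance of an expectation of squares, so a
  negative value would be contradicted for large n.\<close>

lemma Sg_psd: "0 \<le> (\<Sum>a\<in>UNIV. \<Sum>b\<in>UNIV. x a * x b * Sg a b)"
proof (rule ccontr)
  let ?q = "\<Sum>a\<in>UNIV. \<Sum>b\<in>UNIV. x a * x b * Sg a b"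
  let ?e = "\<Sum>a\<in>UNIV. \<Sum>b\<in>UNIV. \<bar>x a * x b\<bar> * (2 * C * W0)"
  assume "\<not> 0 \<le> ?q"
  then have "0 < - ?q" by simp
  then obtain n where "?e < real n * - ?q" using reals_Archimedean3 by blast
  moreover have "0 \<le> expectation (\<lambda>\<omega>. (\<Sum>a\<in>UNIV. x a * S n \<omega> $ a)\<^sup>2)" by simp
  ultimately show False using quadratic_form_bound[of x n] by linarith
qed

lemma Sg_sym: "Sg a b = Sg b a"
  by (simp add: Sg_def)

text \<open>A is the adjoint of the factor T of the form, so that the coordinates of A z are the
  linear forms of z in the directions T e_i, whose covariances are the entries of \<open>Sg\<close>.
  W is a linear right inverse of A on its range.\<close>

lemma Sg_factor:
  obtains A W :: "real ^ 'd \<Rightarrow> real ^ 'd" where "linear A" "linear W" "\<And>z. A (W (A z)) = A z"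
    "\<And>i j. (\<integral>z. A z $ i * A z $ j \<partial>gauss 1) = Sg i j"
proof -
  define B :: "real ^ 'd \<Rightarrow> real ^ 'd \<Rightarrow> real" where "B x y = (\<Sum>a\<in>UNIV. \<Sum>b\<in>UNIV. x $ a * y $ b * Sg a b)" for x y
  have "B x y = B y x" for x y
    unfolding B_def by (subst sum.swap) (simp add: mult_ac Sg_sym)
  moreover have "B (x + y) z = B x z + B y z" "B (r *\<^sub>R x) z = r * B x z" for x y z r
    by (simp_all add: B_def sum.distrib[symmetric] sum_distrib_left algebra_simps)
  moreover have "0 \<le> B x x" for x unfolding B_def by (rule Sg_psd)
  ultimately obtain T :: "real ^ 'd \<Rightarrow> real ^ 'd" where T: "linear T" "\<And>x y. B x y = T x \<bullet> T y"
    using psd_factorization[of B] by metis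
  define A where "A = adjoint T"
  have linA: "linear A" unfolding A_def by (rule adjoint_linear[OF T(1)])
  obtain W where W: "linear W" "\<And>v. v \<in> range A \<Longrightarrow> A (W v) = v"
    using linear_exists_right_inverse_on[OF linA subspace_UNIV] by auto
  have "A z $ i = T (axis i 1) \<bullet> z" for z i
  proof -
    have "A z $ i = axis i 1 \<bullet> A z" by (simp add: inner_axis')
    also have "\<dots> = T (axis i 1) \<bullet> z" unfolding A_def by (rule adjoint_works[OF T(1)])
    finally show ?thesis .
  qed
  then have "(\<integral>z. A z $ i * A z $ j \<partial>gauss 1) = B (axis i 1) (axis j 1)" for i j
    by (simp add: gauss_second_moment T(2))
  moreover have "B (axis i 1) (axis j 1) = Sg i j" for i j
  proof -
    have "B (axis i 1) (axis j 1) = (\<Sum>a\<in>UNIV. \<Sum>b\<in>UNIV. if a = i then if b = j then Sg a b else 0 else 0)"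
      unfolding B_def by (intro sum.cong refl) (auto simp: axis_def)
    also have "\<dots> = (\<Sum>a\<in>UNIV. if a = i then Sg a j else 0)"
      by (intro sum.cong refl) auto
    finally show ?thesis by simp
  qed
  ultimately show ?thesis using that[OF linA W(1)] W(2) by simp
qed

end

locale clt = mixing \<nu> X C M R ph
  for \<nu> :: "'w measure" and X :: "nat \<Rightarrow> 'w \<Rightarrow> real ^ 'd" and C M :: real and R :: nat and ph :: "nat \<Rightarrow> real" +
  fixes A W :: "real ^ 'd \<Rightarrow> real ^ 'd"
  assumes linA: "linear A" and linW: "linear W" and AWA: "\<And>z. A (W (A z)) = A z"
    and covA: "\<And>i j. (\<integral>z. A z $ i * A z $ j \<partial>gauss 1) = Sg i j"
begin

abbreviation G :: "real \<Rightarrow> (real ^ 'd) measure" where "G \<equiv> gauss"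

lemma smoothing: "L-lipschitz_on UNIV \<psi> \<Longrightarrow> smoothing A W \<psi> L"
  by (rule smoothing.intro[OF linA linW AWA])

definition e1 :: real where "e1 = (\<integral>z. norm z \<partial>G 1)"
definition k0 :: real where "k0 = onorm A * (max 1 (onorm W)) ^ 5 * 36"
text \<open>Fourth moment of the Gaussian vector, from the fourth-order remainder in
  \<open>heat_step\<close>.\<close>

definition c9 :: real where "c9 = real CARD('d) ^ 4 * (\<integral>z. norm (A z) ^ 4 \<partial>G 1)"
definition c12 :: real where "c12 = (\<Sum>i\<in>(UNIV :: 'd set). 1 + (\<Sum>a\<in>UNIV. \<Sum>b\<in>UNIV.
  \<bar>(axis a 1 - A (W (axis a 1))) $ i * (axis b 1 - A (W (axis b 1))) $ i\<bar> * (2 * C * W0)))"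

lemma e1_nonneg: "0 \<le> e1" by (simp add: e1_def)
lemma blA: "bounded_linear A" using linA by (simp add: linear_conv_bounded_linear)
lemma onormA: "0 \<le> onorm A" by (rule onorm_pos_le[OF blA])
lemma k0_nonneg: "0 \<le> k0" using onormA by (simp add: k0_def)
lemma c9_nonneg: "0 \<le> c9" by (simp add: c9_def)
lemma c12_nonneg: "0 \<le> c12"
  unfolding c12_def using consts_nonneg by (intro sum_nonneg add_nonneg_nonneg mult_nonneg_nonneg) auto

lemma contA: "continuous_on UNIV A" by (rule linear_continuous_on[OF blA])

lemma A_meas [measurable]: "A \<in> borel_measurable borel"
  by (rule borel_measurable_continuous_onI[OF contA])

lemma A_comp_meas [measurable]: "(\<lambda>z. A z $ i) \<in> borel_measurable borel"
  by (intro borel_measurable_continuous_onI continuous_intros contA)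

lemma A_comp_integrable:
  "integrable (G 1) (\<lambda>z. A z $ i)" "integrable (G 1) (\<lambda>z. A z $ i * A z $ j)"
  "integrable (G 1) (\<lambda>z. A z $ i * A z $ j * A z $ k)" "integrable (G 1) (\<lambda>z. norm (A z) ^ 4)"
proof -
  have b: "\<bar>A z $ i\<bar> \<le> onorm A * norm z" for z i
    by (rule order_trans[OF component_le_norm_cart onorm[OF blA]])
  have b2: "\<bar>A z $ i * A z $ j\<bar> \<le> onorm A ^ 2 * norm z ^ 2" for z i j
    using mult_mono[OF b[of z i] b[of z j]] onormA by (simp add: abs_mult power2_eq_square mult_ac)
  have b3: "\<bar>A z $ i * A z $ j * A z $ k\<bar> \<le> onorm A ^ 3 * norm z ^ 3" for z i j k
    using mult_mono[OF b2[of z i j] b[of z k]] onormA by (simp add: abs_mult power2_eq_square power3_eq_cube mult_ac)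
  have b4: "\<bar>norm (A z) ^ 4\<bar> \<le> onorm A ^ 4 * norm z ^ 4" for z
    using power_mono[OF onorm[OF blA, of z], of 4] by (simp add: power_mult_distrib)
  show "integrable (G 1) (\<lambda>z. A z $ i)"
    by (rule integrable_gauss_growth[of _ _ 0 "onorm A" 1]) (use b in auto)
  show "integrable (G 1) (\<lambda>z. A z $ i * A z $ j)"
    by (rule integrable_gauss_growth[of _ _ 0 "onorm A ^ 2" 2]) (use b2 in auto)
  show "integrable (G 1) (\<lambda>z. A z $ i * A z $ j * A z $ k)"
    by (rule integrable_gauss_growth[of _ _ 0 "onorm A ^ 3" 3]) (use b3 in auto)
  show "integrable (G 1) (\<lambda>z. norm (A z) ^ 4)"
    by (rule integrable_gauss_growth[of _ _ 0 "onorm A ^ 4" 4]) (use b4 in auto)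
qed

lemma A_comp_odd: "(\<integral>z. A z $ i \<partial>G 1) = 0" "(\<integral>z. A z $ i * A z $ j * A z $ k \<partial>G 1) = 0"
  by (intro gauss_odd; simp add: linear_neg[OF linA])+

text \<open>The coordinates of x - A (W x) are linear forms that vanish on the range of A. Their
  quadratic form with \<open>Sg\<close>, the covariance of A z, is 0, so
  \<open>quadratic_form_bound\<close> has no term growing with n. The inequality |x| <= 1 + x^2
  passes from second to first moments.\<close>

lemma residual:
  "expectation (\<lambda>\<omega>. norm (S n \<omega> - A (W (S n \<omega>)))) \<le> c12"
proof -
  define p where "p i a = (axis a 1 - A (W (axis a 1))) $ i" for i a
  have exp: "(x - A (W x)) $ i = (\<Sum>a\<in>UNIV. p i a * x $ a)" for x i
  proof -
    have "linear (\<lambda>x. x - A (W x))"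
      by (rule linearI) (simp_all add: linear_add[OF linA] linear_add[OF linW] linear_cmul[OF linA] linear_cmul[OF linW] scaleR_diff_right)
    then have "x - A (W x) = (\<Sum>a\<in>UNIV. x $ a *\<^sub>R (axis a 1 - A (W (axis a 1))))"
      using linear_sum[of "\<lambda>x. x - A (W x)"] linear_cmul[of "\<lambda>x. x - A (W x)"] axis_expansion[of x]
      by (metis (no_types, lifting) sum.cong)
    then have "(x - A (W x)) $ i = (\<Sum>a\<in>UNIV. x $ a *\<^sub>R (axis a 1 - A (W (axis a 1)))) $ i" by simp
    then show ?thesis by (simp add: p_def mult.commute del: vector_minus_component)
  qed
  have q0: "(\<Sum>a\<in>UNIV. \<Sum>b\<in>UNIV. p i a * p i b * Sg a b) = 0" for i
  proof -
    have "0 = (\<integral>z. (\<Sum>a\<in>UNIV. p i a * A z $ a) * (\<Sum>b\<in>UNIV. p i b * A z $ b) \<partial>G 1)"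
      unfolding exp[symmetric] AWA by simp
    also have "\<dots> = (\<integral>z. (\<Sum>a\<in>UNIV. \<Sum>b\<in>UNIV. p i a * p i b * (A z $ a * A z $ b)) \<partial>G 1)"
      unfolding sum_product by (simp add: mult_ac)
    also have "\<dots> = (\<Sum>a\<in>UNIV. \<Sum>b\<in>UNIV. p i a * p i b * Sg a b)"
      by (subst Bochner_Integration.integral_sum, simp add: A_comp_integrable)
        (intro sum.cong refl, subst Bochner_Integration.integral_sum, auto simp: A_comp_integrable covA)
    finally show ?thesis by simp
  qed
  let ?P = "\<lambda>i \<omega>. \<Sum>a\<in>UNIV. p i a * S n \<omega> $ a"
  have bP: "bm (\<lambda>\<omega>. ?P i \<omega>)" for i by (intro bm_intros bm_component)
  have "expectation (\<lambda>\<omega>. norm (S n \<omega> - A (W (S n \<omega>)))) \<le> expectation (\<lambda>\<omega>. \<Sum>i\<in>(UNIV :: 'd set). 1 + (?P i \<omega>)\<^sup>2)"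
  proof (rule integral_mono)
    show "integrable \<nu> (\<lambda>\<omega>. norm (S n \<omega> - A (W (S n \<omega>))))"
      using linW by (intro bm_integrable bm_S continuous_intros continuous_on_compose2[OF contA] linear_continuous_on) (auto simp: linear_conv_bounded_linear)
    show "integrable \<nu> (\<lambda>\<omega>. \<Sum>i\<in>(UNIV :: 'd set). 1 + (?P i \<omega>)\<^sup>2)"
      by (intro bm_integrable bm_intros bm_component)
    fix \<omega>
    have "norm (S n \<omega> - A (W (S n \<omega>))) \<le> (\<Sum>i\<in>UNIV. \<bar>?P i \<omega>\<bar>)"
      unfolding exp[symmetric] by (rule norm_le_l1_cart)
    also have "\<dots> \<le> (\<Sum>i\<in>UNIV. 1 + (?P i \<omega>)\<^sup>2)"
    proof (intro sum_mono)
      fix i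
      have "0 \<le> (\<bar>?P i \<omega>\<bar> - 1)\<^sup>2" by simp
      then have "2 * \<bar>?P i \<omega>\<bar> \<le> 1 + (?P i \<omega>)\<^sup>2" by (simp add: power2_eq_square algebra_simps)
      then show "\<bar>?P i \<omega>\<bar> \<le> 1 + (?P i \<omega>)\<^sup>2" using abs_ge_zero[of "?P i \<omega>"] by linarith
    qed
    finally show "norm (S n \<omega> - A (W (S n \<omega>))) \<le> (\<Sum>i\<in>UNIV. 1 + (?P i \<omega>)\<^sup>2)" .
  qed
  also have "\<dots> = (\<Sum>i\<in>(UNIV :: 'd set). 1 + expectation (\<lambda>\<omega>. (?P i \<omega>)\<^sup>2))"
    by (subst E_sum, intro bm_intros bm_component, intro sum.cong refl, subst E_add, intro bm_const, intro bm_intros bm_component)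
      (simp add: prob_space)
  also have "\<dots> \<le> c12"
    unfolding c12_def p_def[symmetric]
    using quadratic_form_bound[of "p _" n] q0 by (intro sum_mono add_left_mono) (simp add: abs_le_iff)
  finally show ?thesis .
qed

end

section \<open>Bound in the Wasserstein distance\<close>

lemma abs_chain4:
  "\<bar>a - b\<bar> \<le> x \<Longrightarrow> \<bar>a - c\<bar> \<le> y \<Longrightarrow> \<bar>c - p\<bar> \<le> z \<Longrightarrow> \<bar>b - q\<bar> \<le> w \<Longrightarrow> e = x + y + z + w \<Longrightarrow> \<bar>p - q\<bar> \<le> e"
  for e :: real
  by linarith

context clt begin

lemma integrable_lipschitz_A:
  fixes g :: "real ^ 'd \<Rightarrow> real"
  assumes "L-lipschitz_on UNIV g" "0 < s"
  shows "integrable (G s) (\<lambda>z. g (x + A z))"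
proof -
  have "L-lipschitz_on UNIV (\<lambda>y. g (x + y))"
    using lipschitz_onD'[OF assms(1), of "x + _" "x + _"] lipschitz_on_nonneg[OF assms(1)] by (intro lipschitz_onI') auto
  from integrable_gauss_lipschitz(1)[OF assms(2) lipschitz_compose_linear[OF this linA], of 0]
  show ?thesis by simp
qed

text \<open>Gaussian counterpart of a Lindeberg step. Moments of odd order vanish by symmetry, and
  the second-order coefficient \<open>Sg\<close> / 2 acts like \<open>GI\<close> because D^2 is
  symmetric. It is thus the limit of \<open>Gam\<close>, and the second-order terms of both steps
  cancel.\<close>

lemma heat_step:
  assumes jet: "cjet K \<delta> D"
  shows "\<bar>(\<integral>z. D [] (x + A z) \<partial>G 1) - D [] x - (\<Sum>a\<in>UNIV. \<Sum>b\<in>UNIV. D [b, a] x * GI b a)\<bar> \<le> c9 * (K * \<delta> ^ 3)"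
proof -
  interpret G1: prob_space "G 1" by (rule prob_space_gauss) simp
  have K: "0 \<le> K * \<delta> ^ 3" using cjet_pos[OF jet] by simp
  note i = integrable_lipschitz_A[OF cjet_lipschitz[OF jet], of "[]" 1 x, simplified]
  let ?l1 = "\<lambda>z. \<Sum>c\<in>UNIV. A z $ c * D [c] x"
  let ?l2 = "\<lambda>z. (\<Sum>c\<in>UNIV. \<Sum>d\<in>UNIV. A z $ c * A z $ d * D [d, c] x) / 2"
  let ?l3 = "\<lambda>z. (\<Sum>c\<in>UNIV. \<Sum>d\<in>UNIV. \<Sum>e\<in>UNIV. A z $ c * A z $ d * A z $ e * D [e, d, c] x) / 6"
  have l: "integrable (G 1) ?l1" "integrable (G 1) ?l2" "integrable (G 1) ?l3"
    by (intro A_comp_integrable integrable_mult_left integrable_divide Bochner_Integration.integrable_sum)+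
  have e: "D [] (x + A z) - D [] x = ?l1 z + ?l2 z + ?l3 z + rem4 D [] x (A z)" for z
    by (simp add: rem4_def rem3_def rem2_def rem1_def)
  have r: "rem4 D [] x (A z) = D [] (x + A z) - D [] x - ?l1 z - ?l2 z - ?l3 z" for z
    using e[of z] by simp
  have ir: "integrable (G 1) (\<lambda>z. rem4 D [] x (A z))"
    unfolding r by (intro Bochner_Integration.integrable_diff i l) simp
  have "(\<integral>z. D [] (x + A z) \<partial>G 1) - D [] x = (\<integral>z. D [] (x + A z) - D [] x \<partial>G 1)"
    using i by (simp add: G1.prob_space[unfolded space_gauss])
  also have "\<dots> = (\<integral>z. ?l1 z \<partial>G 1) + (\<integral>z. ?l2 z \<partial>G 1) + (\<integral>z. ?l3 z \<partial>G 1) + (\<integral>z. rem4 D [] x (A z) \<partial>G 1)"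
    unfolding e by (simp only: Bochner_Integration.integral_add Bochner_Integration.integrable_add l ir)
  also have "(\<integral>z. ?l1 z \<partial>G 1) = 0"
    by (simp add: A_comp_integrable A_comp_odd)
  also have "(\<integral>z. ?l3 z \<partial>G 1) = 0"
    by (simp add: A_comp_integrable A_comp_odd)
  also have "(\<integral>z. ?l2 z \<partial>G 1) = (\<Sum>c\<in>UNIV. \<Sum>d\<in>UNIV. Sg c d * D [d, c] x) / 2"
    by (simp add: A_comp_integrable covA)
  also have "\<dots> = (\<Sum>a\<in>UNIV. \<Sum>b\<in>UNIV. D [b, a] x * GI b a)"
  proof -
    have "(\<Sum>c\<in>UNIV. \<Sum>d\<in>UNIV. GI c d * D [d, c] x) = (\<Sum>c\<in>UNIV. \<Sum>d\<in>UNIV. GI d c * D [d, c] x)"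
      by (subst sum.swap) (simp add: cjet_sym[OF jet, of "[]"])
    then have "(\<Sum>c\<in>UNIV. \<Sum>d\<in>UNIV. Sg c d * D [d, c] x) = 2 * (\<Sum>c\<in>UNIV. \<Sum>d\<in>UNIV. GI d c * D [d, c] x)"
      by (simp only: Sg_def distrib_right sum.distrib)
    moreover have "(\<Sum>a\<in>UNIV. \<Sum>b\<in>UNIV. D [b, a] x * GI b a) = (\<Sum>a\<in>UNIV. \<Sum>b\<in>UNIV. GI b a * D [b, a] x)"
      by (simp only: mult.commute)
    ultimately show ?thesis by simp
  qed
  finally have "(\<integral>z. D [] (x + A z) \<partial>G 1) - D [] x - (\<Sum>a\<in>UNIV. \<Sum>b\<in>UNIV. D [b, a] x * GI b a) = (\<integral>z. rem4 D [] x (A z) \<partial>G 1)"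
    by simp
  also have "\<bar>\<dots>\<bar> \<le> (\<integral>z. \<bar>rem4 D [] x (A z)\<bar> \<partial>G 1)" by (rule integral_abs_bound)
  also have "\<dots> \<le> (\<integral>z. (real CARD('d) ^ 4 * (K * \<delta> ^ 3)) * norm (A z) ^ 4 \<partial>G 1)"
  proof (rule integral_mono)
    fix z
    have "\<bar>rem4 D [] x (A z)\<bar> \<le> (real CARD('d) * norm (A z)) ^ 4 * (K * \<delta> ^ (length ([] :: 'd list) + 3))"
      by (rule rem4_bound[OF jet _ component_le_norm_cart]) auto
    then show "\<bar>rem4 D [] x (A z)\<bar> \<le> (real CARD('d) ^ 4 * (K * \<delta> ^ 3)) * norm (A z) ^ 4"
      by (simp add: power_mult_distrib mult_ac)
  qed (use ir A_comp_integrable in auto)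
  also have "\<dots> = c9 * (K * \<delta> ^ 3)" by (simp add: c9_def)
  finally show ?thesis .
qed

definition W1 :: "nat \<Rightarrow> real \<Rightarrow> bool" where
  "W1 n B \<longleftrightarrow> (\<forall>\<psi> L. L-lipschitz_on UNIV \<psi> \<longrightarrow>
     \<bar>expectation (\<lambda>\<omega>. \<psi> (S n \<omega>)) - (\<integral>z. \<psi> (sqrt (real n) *\<^sub>R A z) \<partial>G 1)\<bar> \<le> B * L)"

text \<open>The costs free of the induction hypothesis: projection onto the range of A, smoothing at
  scale t0 on both sides, the Lindeberg sum, and the Gaussian third derivatives.\<close>

definition c13 :: "nat \<Rightarrow> real" where
  "c13 t0 = c12 + 2 * onorm A * (real t0 * e1) + c10 c9 * k0 + 4 * c11 * k0"

lemma gauss_scaled_integral: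
  fixes g :: "real ^ 'd \<Rightarrow> real"
  assumes [measurable]: "g \<in> borel_measurable borel" and t: "0 < t"
  shows "(\<integral>z. g (A z) \<partial>G t) = (\<integral>z. g (t *\<^sub>R A z) \<partial>G 1)"
proof -
  have "(\<integral>z. g (A z) \<partial>G t) = (\<integral>z. g (A z) \<partial>distr (G 1) borel (\<lambda>z. t *\<^sub>R z))"
    using gauss_scale[OF t zero_less_one, where 'a = "real ^ 'd"] by simp
  also have "\<dots> = (\<integral>z. g (t *\<^sub>R A z) \<partial>G 1)"
    by (subst integral_distr) (auto simp: linear_cmul[OF linA])
  finally show ?thesis .
qed

context
  fixes \<psi> :: "real ^ 'd \<Rightarrow> real" and L :: real
  assumes lip: "L-lipschitz_on UNIV \<psi>"
begin

interpretation sm: smoothing A W \<psi> L by (rule smoothing[OF lip])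

lemma sm_k0: "sm.k0 = k0" by (simp add: sm.k0_def k0_def)

text \<open>The added vector A z enters through W (A z), which \<open>Dv_range\<close> replaces by
  z; then the variances add.\<close>

lemma Dc_semigroup:
  assumes "0 < s" "0 < t" "length cs \<le> 5"
  shows "(\<integral>z. sm.Dc s cs (x + A z) \<partial>G t) = sm.Dc (sqrt (s\<^sup>2 + t\<^sup>2)) cs x"
proof -
  let ?vs = "map (\<lambda>c. W (axis c 1)) cs"
  have "sm.Dc s cs (x + A z) = sm.Dv s ?vs (W x + z)" for z
    unfolding sm.Dc_def linear_add[OF linW] using assms by (intro sm.Dv_range) auto
  then have "(\<integral>z. sm.Dc s cs (x + A z) \<partial>G t) = gsm t (sm.Dv s ?vs) (W x)"
    by (simp add: gsm_def)
  also have "\<dots> = sm.Dc (sqrt (s\<^sup>2 + t\<^sup>2)) cs x"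
    unfolding sm.Dc_def using assms by (subst sm.Dv_conv) auto
  finally show ?thesis .
qed

lemma floor_sqrt_inverse:
  assumes "1 \<le> t0"
  shows "0 < 1 / real (floor_sqrt (m + t0\<^sup>2))" "1 / real (floor_sqrt (m + t0\<^sup>2)) \<le> 1"
    "1 / sqrt (real (m + t0\<^sup>2)) \<le> 1 / real (floor_sqrt (m + t0\<^sup>2))" "0 < sqrt (real (m + t0\<^sup>2))"
proof -
  have s: "t0 \<le> floor_sqrt (m + t0\<^sup>2)" by (simp add: le_floor_sqrt_iff)
  then show "0 < 1 / real (floor_sqrt (m + t0\<^sup>2))" "1 / real (floor_sqrt (m + t0\<^sup>2)) \<le> 1"
    using assms by auto
  show "0 < sqrt (real (m + t0\<^sup>2))" using assms by (simp add: add_nonneg_pos)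
  have "(floor_sqrt (m + t0\<^sup>2))\<^sup>2 \<le> m + t0\<^sup>2" by (rule floor_sqrt_power2_le)
  then have "(real (floor_sqrt (m + t0\<^sup>2)))\<^sup>2 \<le> real (m + t0\<^sup>2)" by (metis of_nat_le_iff of_nat_power)
  then have "real (floor_sqrt (m + t0\<^sup>2)) \<le> sqrt (real (m + t0\<^sup>2))" by (rule real_le_rsqrt)
  then show "1 / sqrt (real (m + t0\<^sup>2)) \<le> 1 / real (floor_sqrt (m + t0\<^sup>2))"
    using s assms by (intro divide_left_mono mult_pos_pos \<open>0 < sqrt (real (m + t0\<^sup>2))\<close>) auto
qed

lemma Dc_cjet':
  "1 \<le> t0 \<Longrightarrow> cjet (L * k0) (1 / real (floor_sqrt (m + t0\<^sup>2))) (sm.Dc (sqrt (real (m + t0\<^sup>2))))"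
  using sm.Dc_cjet[OF floor_sqrt_inverse[of t0 m]] by (simp add: sm_k0)

text \<open>The third derivative is Lipschitz of order \<open>\<delta>^3\<close>, so the claim for n
  - m - 1 replaces S by a Gaussian vector of that variance. The semigroup property raises the
  smoothing index from m to n - 1, and the resulting Gaussian value has size
  \<open>\<delta>^2\<close> at index n - 1, independently of m.\<close>

lemma third_derivative_expectation:
  assumes t0: "1 \<le> t0" and m: "m < n" and w: "W1 (n - m - 1) B" and cs: "length cs = 3"
  shows "\<bar>expectation (\<lambda>\<omega>. sm.Dc (sqrt (real (m + t0\<^sup>2))) cs (S (n - m - 1) \<omega>))\<bar> \<le>
    B * (real CARD('d) * (L * k0 * (1 / real (floor_sqrt (m + t0\<^sup>2))) ^ 3))
      + L * k0 * (1 / real (floor_sqrt ((n - 1) + t0\<^sup>2))) ^ 2"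
proof -
  let ?s = "sqrt (real (m + t0\<^sup>2))" and ?j = "n - m - 1"
  note jet = Dc_cjet'[OF t0, of m]
  have lp: "(real CARD('d) * (L * k0 * (1 / real (floor_sqrt (m + t0\<^sup>2))) ^ 3))-lipschitz_on UNIV (sm.Dc ?s cs)"
    using cjet_lipschitz[OF jet, of cs] cs by simp
  have s: "0 < ?s" by (rule floor_sqrt_inverse[OF t0])
  have "(\<integral>z. sm.Dc ?s cs (sqrt (real ?j) *\<^sub>R A z) \<partial>G 1) = sm.Dc (sqrt (real ((n - 1) + t0\<^sup>2))) cs 0"
  proof (cases "?j = 0")
    case True
    interpret G1: prob_space "G 1" by (rule prob_space_gauss) simp
    have "n - 1 = m" using True m by simp
    then show ?thesis using True by (simp add: G1.prob_space[unfolded space_gauss])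
  next
    case False
    have "(\<integral>z. sm.Dc ?s cs (sqrt (real ?j) *\<^sub>R A z) \<partial>G 1) = (\<integral>z. sm.Dc ?s cs (0 + A z) \<partial>G (sqrt (real ?j)))"
      using gauss_scaled_integral[OF lipschitz_measurable[OF lp], of "sqrt (real ?j)"] False by simp
    also have "\<dots> = sm.Dc (sqrt (?s\<^sup>2 + (sqrt (real ?j))\<^sup>2)) cs 0"
      using s False cs by (intro Dc_semigroup) auto
    also have "?s\<^sup>2 + (sqrt (real ?j))\<^sup>2 = real ((n - 1) + t0\<^sup>2)" using m by simp
    finally show ?thesis .
  qed
  moreover have "\<bar>sm.Dc (sqrt (real ((n - 1) + t0\<^sup>2))) cs 0\<bar> \<le> L * k0 * (1 / real (floor_sqrt ((n - 1) + t0\<^sup>2))) ^ 2"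
    using cjet_bound[OF Dc_cjet'[OF t0, of "n - 1"], of cs 0] cs by simp
  ultimately show ?thesis using w[unfolded W1_def, rule_format, OF lp] by linarith
qed

text \<open>The test function is changed twice on the side of S n, by projection onto the range of A
  and by smoothing at scale t0. On the Gaussian side A z already lies in the range, and only the
  smoothing has to be undone.\<close>

lemma W1_step:
  assumes t0: "1 \<le> t0" and w: "\<And>j. j < n \<Longrightarrow> W1 j B" and n: "1 \<le> n" and B: "0 \<le> B"
  shows "\<bar>expectation (\<lambda>\<omega>. \<psi> (S n \<omega>)) - (\<integral>z. \<psi> (sqrt (real n) *\<^sub>R A z) \<partial>G 1)\<bar> \<le>
    (c13 t0 + 6 * c11 * real CARD('d) * k0 / real t0 * B) * L"
proof -
  let ?d = "real CARD('d)"
  let ?K = "L * k0"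
  let ?D = "\<lambda>m. sm.Dc (sqrt (real (m + t0\<^sup>2)))"
  let ?\<delta> = "\<lambda>m. 1 / real (floor_sqrt (m + t0\<^sup>2))"
  have L: "0 \<le> L" by (rule sm.L_nonneg)
  have K: "0 \<le> ?K" using L k0_nonneg by simp
  define \<Theta> where "\<Theta> m = B * (?d * (?K * ?\<delta> m ^ 3)) + ?K * ?\<delta> (n - 1) ^ 2" for m
  have "\<bar>expectation (\<lambda>\<omega>. ?D 0 [] (S n \<omega>)) - ?D n [] 0\<bar> \<le> c10 c9 * ?K + c11 * (\<Sum>m<n. \<Theta> m)"
  proof (rule lindeberg_sum[OF t0 K c9_nonneg])
    show "cjet ?K (?\<delta> m) (?D m)" for m by (rule Dc_cjet'[OF t0])
    show "\<bar>?D (Suc m) [] x - ?D m [] x - (\<Sum>a\<in>UNIV. \<Sum>b\<in>UNIV. ?D m [b, a] x * GI b a)\<bar> \<le> c9 * (?K * ?\<delta> m ^ 3)" for m x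
    proof -
      have "(\<integral>z. ?D m [] (x + A z) \<partial>G 1) = ?D (Suc m) [] x"
        using Dc_semigroup[of "sqrt (real (m + t0\<^sup>2))" 1 "[]" x] floor_sqrt_inverse(4)[OF t0, of m]
        by (simp add: add.commute add.left_commute)
      then show ?thesis using heat_step[OF Dc_cjet'[OF t0, of m], of x] by simp
    qed
    show "\<bar>expectation (\<lambda>\<omega>. ?D m [c, b, a] (S (n - m - 1) \<omega>))\<bar> \<le> \<Theta> m" if "m < n" for m a b c
      unfolding \<Theta>_def by (rule third_derivative_expectation[OF t0 that w]) (use n in auto)
  qed
  moreover have "(\<Sum>m<n. \<Theta> m) \<le> B * ?d * ?K * (6 / real t0) + 4 * ?K"
  proof -
    have "(\<Sum>m<n. ?\<delta> m ^ 3) \<le> 3 * (\<Sum>t = t0..n + t0\<^sup>2. real t * (1 / real t) ^ 3)"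
      by (rule sum_floor_sqrt_le[OF _ t0]) simp
    also have "(\<Sum>t = t0..n + t0\<^sup>2. real t * (1 / real t) ^ 3) = (\<Sum>t = t0..n + t0\<^sup>2. 1 / real t ^ 2)"
      using t0 by (intro sum.cong) (auto simp: power2_eq_square power3_eq_cube)
    \<comment> \<open>The sum starts at t0; the resulting factor 1 / t0 stands in front of B and
      closes the induction.\<close>
    also have "\<dots> \<le> 2 / real t0" by (rule sum_inverse_squares[OF t0])
    finally have 1: "(\<Sum>m<n. ?\<delta> m ^ 3) \<le> 6 / real t0" by simp
    let ?f = "floor_sqrt (n - 1 + t0\<^sup>2)"
    have f1: "1 \<le> ?f" unfolding le_floor_sqrt_iff using t0 by (simp add: trans_le_add2)
    \<comment> \<open>\<open>?f\<close> is at least sqrt(n) / 2, so the n Gaussian contributions,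
      each of order \<open>1 / ?f^2\<close>, add up to a constant.\<close>
    have "n - 1 + t0\<^sup>2 < (Suc ?f)\<^sup>2" by (rule Suc_floor_sqrt_power2_gt)
    also have "\<dots> \<le> (2 * ?f)\<^sup>2" using f1 by (intro power_mono) auto
    finally have "n \<le> 4 * ?f\<^sup>2" by (simp add: power_mult_distrib)
    then have "real n \<le> 4 * (real ?f)\<^sup>2" by (metis of_nat_le_iff of_nat_mult of_nat_numeral of_nat_power)
    then have 2: "real n * ?\<delta> (n - 1) ^ 2 \<le> 4" using f1 by (simp add: power_divide divide_le_eq)
    have "(\<Sum>m<n. \<Theta> m) = B * ?d * ?K * (\<Sum>m<n. ?\<delta> m ^ 3) + ?K * (real n * ?\<delta> (n - 1) ^ 2)"
      unfolding \<Theta>_def sum.distrib by (simp only: sum_constant card_lessThan sum_distrib_left mult_ac)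
    also have "\<dots> \<le> B * ?d * ?K * (6 / real t0) + ?K * 4"
      by (intro add_mono mult_left_mono 1 2 mult_nonneg_nonneg B K L k0_nonneg) auto
    finally show ?thesis by (simp add: mult.commute)
  qed
  then have "c11 * (\<Sum>m<n. \<Theta> m) \<le> c11 * (B * ?d * ?K * (6 / real t0) + 4 * ?K)"
    by (intro mult_left_mono c11_nonneg)
  ultimately have 1: "\<bar>expectation (\<lambda>\<omega>. ?D 0 [] (S n \<omega>)) - ?D n [] 0\<bar> \<le> c10 c9 * ?K + c11 * (B * ?d * ?K * (6 / real t0) + 4 * ?K)"
    by linarith
  have t0p: "0 < real t0" using t0 by simp
  have D0: "?D 0 [] x = gsm (real t0) sm.u (W x)" for x
    using sm.Dv_Nil[OF t0p] by (simp add: sm.Dc_def)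
  have c\<psi>: "continuous_on UNIV \<psi>" by (rule lipschitz_on_continuous_on[OF lip])
  have cW: "continuous_on UNIV W" using linW by (intro linear_continuous_on) (simp add: linear_conv_bounded_linear)
  have bAW: "bm (\<lambda>\<omega>. \<psi> (A (W (S n \<omega>))))"
    by (rule bm_S[of "\<lambda>x. \<psi> (A (W x))"])
      (intro continuous_on_compose2[OF c\<psi>] continuous_on_compose2[OF contA] cW, auto)
  have 2: "\<bar>expectation (\<lambda>\<omega>. ?D 0 [] (S n \<omega>)) - expectation (\<lambda>\<omega>. \<psi> (A (W (S n \<omega>))))\<bar> \<le> L * onorm A * (real t0 * e1)"
  proof -
    have "expectation (\<lambda>\<omega>. ?D 0 [] (S n \<omega>)) - expectation (\<lambda>\<omega>. \<psi> (A (W (S n \<omega>)))) =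
      expectation (\<lambda>\<omega>. ?D 0 [] (S n \<omega>) - \<psi> (A (W (S n \<omega>))))"
      by (subst E_diff[OF bm_jet[OF Dc_cjet'[OF t0, of 0]] bAW]) auto
    also have "\<bar>\<dots>\<bar> \<le> L * onorm A * (real t0 * e1)"
      unfolding D0 e1_def
      by (rule abs_expectation_le) (use gsm_close[OF t0p sm.u_lipschitz] in \<open>simp add: sm.u_def\<close>)
    finally show ?thesis .
  qed
  have 3: "\<bar>expectation (\<lambda>\<omega>. \<psi> (A (W (S n \<omega>)))) - expectation (\<lambda>\<omega>. \<psi> (S n \<omega>))\<bar> \<le> L * c12"
  proof -
    have "expectation (\<lambda>\<omega>. \<psi> (A (W (S n \<omega>)))) - expectation (\<lambda>\<omega>. \<psi> (S n \<omega>)) = expectation (\<lambda>\<omega>. \<psi> (A (W (S n \<omega>))) - \<psi> (S n \<omega>))"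
      by (rule E_diff[OF bAW bm_S[OF c\<psi>], symmetric])
    also have "\<bar>\<dots>\<bar> \<le> expectation (\<lambda>\<omega>. \<bar>\<psi> (A (W (S n \<omega>))) - \<psi> (S n \<omega>)\<bar>)" by (rule integral_abs_bound)
    also have "\<dots> \<le> expectation (\<lambda>\<omega>. L * norm (S n \<omega> - A (W (S n \<omega>))))"
    proof (rule integral_mono)
      show "integrable \<nu> (\<lambda>\<omega>. \<bar>\<psi> (A (W (S n \<omega>))) - \<psi> (S n \<omega>)\<bar>)"
        by (intro integrable_abs bm_integrable bm_diff bAW bm_S[OF c\<psi>])
      show "integrable \<nu> (\<lambda>\<omega>. L * norm (S n \<omega> - A (W (S n \<omega>))))"
        by (intro bm_integrable bm_S[of "\<lambda>x. L * norm (x - A (W x))"] continuous_intros continuous_on_compose2[OF contA] cW) auto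
      show "\<bar>\<psi> (A (W (S n \<omega>))) - \<psi> (S n \<omega>)\<bar> \<le> L * norm (S n \<omega> - A (W (S n \<omega>)))" for \<omega>
        using lipschitz_onD'[OF lip, of "A (W (S n \<omega>))" "S n \<omega>"] by (simp add: norm_minus_commute)
    qed
    also have "\<dots> \<le> L * c12" using residual[of n] L by (simp add: mult_left_mono)
    finally show ?thesis .
  qed
  have 4: "\<bar>?D n [] 0 - (\<integral>z. \<psi> (sqrt (real n) *\<^sub>R A z) \<partial>G 1)\<bar> \<le> L * onorm A * (real t0 * e1)"
  proof -
    have rn: "0 < sqrt (real n)" using n by simp
    interpret Gn: prob_space "G (sqrt (real n))" by (rule prob_space_gauss[OF rn])
    \<comment> \<open>The variance is split into n and \<open>t0\<^sup>2\<close>: the smoothed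
      function at 0 is the Gaussian mean, at scale sqrt(n), of u smoothed at scale t0.\<close>
    have "?D n [] 0 = (\<integral>z. gsm (real t0) sm.u (0 + z) \<partial>G (sqrt (real n)))"
      using gsm_gsm[OF t0p rn sm.u_lipschitz, of 0] sm.Dv_Nil[of "sqrt (real (n + t0\<^sup>2))"] floor_sqrt_inverse(4)[OF t0, of n]
      by (simp add: sm.Dc_def linear_0[OF linW] add.commute)
    moreover have "(\<integral>z. \<psi> (sqrt (real n) *\<^sub>R A z) \<partial>G 1) = (\<integral>z. sm.u (0 + z) \<partial>G (sqrt (real n)))"
      using gauss_scaled_integral[OF lipschitz_measurable[OF lip] rn] by (simp add: sm.u_def)
    ultimately have eq: "?D n [] 0 - (\<integral>z. \<psi> (sqrt (real n) *\<^sub>R A z) \<partial>G 1) = (\<integral>z. gsm (real t0) sm.u (0 + z) - sm.u (0 + z) \<partial>G (sqrt (real n)))"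
      using integrable_gauss_lipschitz(1)[OF rn sm.u_lipschitz, of 0] integrable_gauss_lipschitz(1)[OF rn lipschitz_gsm[OF t0p sm.u_lipschitz], of 0]
      by simp
    have "\<bar>?D n [] 0 - (\<integral>z. \<psi> (sqrt (real n) *\<^sub>R A z) \<partial>G 1)\<bar> \<le> (\<integral>z. \<bar>gsm (real t0) sm.u (0 + z) - sm.u (0 + z)\<bar> \<partial>G (sqrt (real n)))"
      unfolding eq by (rule integral_abs_bound)
    also have "\<dots> \<le> L * onorm A * (real t0 * e1)"
    proof (rule Gn.integral_le_const)
      show "integrable (G (sqrt (real n))) (\<lambda>z. \<bar>gsm (real t0) sm.u (0 + z) - sm.u (0 + z)\<bar>)"
        using integrable_gauss_lipschitz(1)[OF rn sm.u_lipschitz, of 0] integrable_gauss_lipschitz(1)[OF rn lipschitz_gsm[OF t0p sm.u_lipschitz], of 0]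
        by simp
      show "AE z in G (sqrt (real n)). \<bar>gsm (real t0) sm.u (0 + z) - sm.u (0 + z)\<bar> \<le> L * onorm A * (real t0 * e1)"
        unfolding e1_def by (intro always_eventually allI gsm_close[OF t0p sm.u_lipschitz])
    qed
    finally show ?thesis .
  qed
  have "(c13 t0 + 6 * c11 * ?d * k0 / real t0 * B) * L = (c10 c9 * ?K + c11 * (B * ?d * ?K * (6 / real t0) + 4 * ?K))
      + L * onorm A * (real t0 * e1) + L * c12 + L * onorm A * (real t0 * e1)"
    unfolding c13_def by (simp add: algebra_simps)
  then show ?thesis by (rule abs_chain4[OF 1 2 3 4])
qed

end

text \<open>A large initial smoothing \<open>t0\<close> makes the contribution of the induction hypothesis at most \<open>B / 2\<close>.\<close>

lemma W1_bound: "\<exists>B\<ge>0. \<forall>n. W1 n B"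
proof -
  let ?c = "12 * c11 * real CARD('d) * k0"
  obtain t0 :: nat where t0': "max 1 ?c \<le> real t0" using real_arch_simple by blast
  have t0: "1 \<le> t0" "?c \<le> real t0" using t0' by auto
  have c13: "0 \<le> c13 t0"
    unfolding c13_def c10_def using c12_nonneg onormA e1_nonneg k0_nonneg c11_nonneg c9_nonneg c6_nonneg consts_nonneg
    by (intro add_nonneg_nonneg mult_nonneg_nonneg) (auto simp: c8_def c7_nonneg)
  \<comment> \<open>With a factor at most 1/2 in front of the old constant, c13 + B / 2 <= B holds
    for this B.\<close>
  define B where "B = 2 * c13 t0"
  have B: "0 \<le> B" using c13 by (simp add: B_def)
  have "W1 n B" for n
  proof (induction n rule: less_induct)
    case (less n)
    show ?case
    proof (cases "n = 0")
      case True
      interpret G1: prob_space "G 1" by (rule prob_space_gauss) simp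
      show ?thesis unfolding W1_def True
        using B lipschitz_on_nonneg by (auto simp: prob_space G1.prob_space[unfolded space_gauss] intro!: mult_nonneg_nonneg)
    next
      case False
      have "c13 t0 + 6 * c11 * real CARD('d) * k0 / real t0 * B \<le> B"
      proof -
        have "6 * c11 * real CARD('d) * k0 / real t0 \<le> 1 / 2" using t0 by (simp add: divide_le_eq)
        then have "6 * c11 * real CARD('d) * k0 / real t0 * B \<le> 1 / 2 * B" by (rule mult_right_mono[OF _ B])
        then show ?thesis by (simp add: B_def)
      qed
      then have "(c13 t0 + 6 * c11 * real CARD('d) * k0 / real t0 * B) * L \<le> B * L" if "0 \<le> L" for L
        using that by (rule mult_right_mono)
      moreover have "1 \<le> n" using False by simp
      ultimately show ?thesis
        unfolding W1_def using W1_step[OF _ t0(1) less _ B] lipschitz_on_nonneg by (meson order_trans)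
    qed
  qed
  then show ?thesis using B by blast
qed

end

section \<open>Conclusion\<close>

text \<open>Pasch-Hausdorff envelope: for bounded f and k >= 0 the largest k-Lipschitz minorant of
  f, tending to f at points of continuity as k grows.\<close>

definition inf_convolution :: "('a::real_normed_vector \<Rightarrow> real) \<Rightarrow> real \<Rightarrow> 'a \<Rightarrow> real" where
  "inf_convolution f k x = (INF y. f y + k * norm (x - y))"

context
  fixes f :: "'a::euclidean_space \<Rightarrow> real" and B :: real
  assumes B: "\<And>x. \<bar>f x\<bar> \<le> B"
begin

lemma inf_convolution_bdd: "0 \<le> k \<Longrightarrow> bdd_below (range (\<lambda>y. f y + k * norm (x - y)))"
proof (rule bdd_belowI2[of _ "- B"])
  fix y assume "0 \<le> k"
  then have "0 \<le> k * norm (x - y)" by simp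
  then show "- B \<le> f y + k * norm (x - y)" using B[of y] by linarith
qed

lemma inf_convolution_le: "0 \<le> k \<Longrightarrow> inf_convolution f k x \<le> f y + k * norm (x - y)"
  unfolding inf_convolution_def by (rule cINF_lower[OF inf_convolution_bdd]) auto

lemma inf_convolution_abs: "0 \<le> k \<Longrightarrow> \<bar>inf_convolution f k x\<bar> \<le> B"
proof -
  assume k: "0 \<le> k"
  have "- B \<le> inf_convolution f k x"
    unfolding inf_convolution_def
  proof (rule cINF_greatest)
    show "- B \<le> f y + k * norm (x - y)" for y
      using B[of y] mult_nonneg_nonneg[OF k norm_ge_zero[of "x - y"]] by linarith
  qed simp
  moreover have "inf_convolution f k x \<le> B"
    using inf_convolution_le[OF k, of x x] B[of x] by simp
  ultimately show ?thesis by linarith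
qed

lemma inf_convolution_lipschitz: "0 \<le> k \<Longrightarrow> k-lipschitz_on UNIV (inf_convolution f k)"
proof -
  assume k: "0 \<le> k"
  have le: "inf_convolution f k x - k * norm (x - x') \<le> inf_convolution f k x'" for x x'
    unfolding inf_convolution_def[of f k x']
  proof (rule cINF_greatest)
    fix y
    have "norm (x - y) \<le> norm (x - x') + norm (x' - y)" using norm_triangle_ineq[of "x - x'" "x' - y"] by simp
    then have "k * norm (x - y) \<le> k * norm (x - x') + k * norm (x' - y)"
      using k by (metis distrib_left mult_left_mono)
    then show "inf_convolution f k x - k * norm (x - x') \<le> f y + k * norm (x' - y)"
      using inf_convolution_le[OF k, of x y] by linarith
  qed simp
  show ?thesis
  proof (rule lipschitz_onI'[OF _ k])
    show "\<bar>inf_convolution f k x - inf_convolution f k y\<bar> \<le> k * norm (x - y)" for x y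
      using le[of x y] le[of y x] by (simp add: norm_minus_commute abs_le_iff)
  qed
qed

lemma inf_convolution_tendsto:
  assumes cont: "isCont f x"
  shows "(\<lambda>k. inf_convolution f (real k) x) \<longlonglongrightarrow> f x"
proof (rule LIMSEQ_I)
  fix e :: real assume e: "0 < e"
  obtain d where d: "0 < d" "\<And>y. dist y x < d \<Longrightarrow> dist (f y) (f x) < e / 2"
    using cont e unfolding continuous_at_eps_delta by (meson half_gt_zero)
  obtain K :: nat where K: "2 * B / d \<le> real K" using real_arch_simple by blast
  show "\<exists>no. \<forall>n\<ge>no. norm (inf_convolution f (real n) x - f x) < e"
  proof (intro exI allI impI)
    fix n assume n: "K \<le> n"
    have "f x - e / 2 \<le> inf_convolution f (real n) x"
      unfolding inf_convolution_def
    proof (rule cINF_greatest)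
      fix y
      show "f x - e / 2 \<le> f y + real n * norm (x - y)"
      proof (cases "dist y x < d")
        case True
        have "0 \<le> real n * norm (x - y)" by simp
        then show ?thesis using d(2)[OF True] unfolding dist_real_def by linarith
      next
        case False
        \<comment> \<open>At distance at least d the penalty outweighs the oscillation of f, which
          is at most 2 B.\<close>
        have "2 * B \<le> real K * d" using K d by (simp add: divide_le_eq)
        also have "\<dots> \<le> real n * norm (x - y)"
          using n d False by (intro mult_mono) (auto simp: dist_norm norm_minus_commute)
        finally show ?thesis using B[of x] B[of y] e by linarith
      qed
    qed simp
    moreover have "inf_convolution f (real n) x \<le> f x" using inf_convolution_le[of "real n" x x] by simp
    ultimately show "norm (inf_convolution f (real n) x - f x) < e" using e by simp
  qed
qed

end

text \<open>Lipschitz minorants yield a lower bound for the integrals of f in the limit; the same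
  bound for - f gives convergence.\<close>

lemma weak_convergence_from_lipschitz:
  fixes Y :: "nat \<Rightarrow> 'w \<Rightarrow> 'a::euclidean_space" and N :: "'v \<Rightarrow> 'a" and f :: "'a \<Rightarrow> real"
  assumes M: "prob_space M" and P: "prob_space P"
    and [measurable]: "\<And>n. Y n \<in> borel_measurable M" "N \<in> borel_measurable P"
    and lim: "\<And>(g :: 'a \<Rightarrow> real) L. L-lipschitz_on UNIV g \<Longrightarrow> (\<lambda>n. \<integral>\<omega>. g (Y n \<omega>) \<partial>M) \<longlonglongrightarrow> (\<integral>\<omega>. g (N \<omega>) \<partial>P)"
    and f: "continuous_on UNIV f" and bd: "bounded (range f)"
  shows "(\<lambda>n. \<integral>\<omega>. f (Y n \<omega>) \<partial>M) \<longlonglongrightarrow> (\<integral>\<omega>. f (N \<omega>) \<partial>P)"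
proof -
  interpret M: prob_space M by (rule M)
  interpret P: prob_space P by (rule P)
  obtain B where B: "\<And>x. \<bar>f x\<bar> \<le> B" using bd by (auto simp: bounded_iff)
  have lower: "\<forall>\<^sub>F n in sequentially. (\<integral>\<omega>. f (N \<omega>) \<partial>P) - e < (\<integral>\<omega>. f (Y n \<omega>) \<partial>M)"
    if e: "0 < e" and f: "continuous_on UNIV f" and B: "\<And>x. \<bar>f x\<bar> \<le> B" for e and f :: "'a \<Rightarrow> real"
  proof -
    note [measurable] = borel_measurable_continuous_onI[OF f]
    let ?g = "\<lambda>k. inf_convolution f (real k)"
    have gl: "(real k)-lipschitz_on UNIV (?g k)" for k by (rule inf_convolution_lipschitz[of f B, OF B]) simp_all
    note [measurable] = lipschitz_measurable[OF gl]
    have "(\<lambda>k. \<integral>\<omega>. ?g k (N \<omega>) \<partial>P) \<longlonglongrightarrow> (\<integral>\<omega>. f (N \<omega>) \<partial>P)"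
    proof (rule integral_dominated_convergence[where w = "\<lambda>_. B"])
      show "AE \<omega> in P. (\<lambda>k. ?g k (N \<omega>)) \<longlonglongrightarrow> f (N \<omega>)"
        using f by (intro always_eventually allI inf_convolution_tendsto[of f B, OF B]) (simp add: continuous_on_eq_continuous_at)
      show "AE \<omega> in P. norm (?g k (N \<omega>)) \<le> B" for k
        using inf_convolution_abs[of f B, OF B, of "real k"] by simp
    qed auto
    then have "\<forall>\<^sub>F k in sequentially. (\<integral>\<omega>. f (N \<omega>) \<partial>P) - e / 2 < (\<integral>\<omega>. ?g k (N \<omega>) \<partial>P)"
      by (rule order_tendstoD) (use e in simp)
    then obtain k where k: "(\<integral>\<omega>. f (N \<omega>) \<partial>P) - e / 2 < (\<integral>\<omega>. ?g k (N \<omega>) \<partial>P)"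
      by (auto simp: eventually_sequentially)
    have "\<forall>\<^sub>F n in sequentially. (\<integral>\<omega>. ?g k (N \<omega>) \<partial>P) - e / 2 < (\<integral>\<omega>. ?g k (Y n \<omega>) \<partial>M)"
      by (rule order_tendstoD(1)[OF lim[OF gl]]) (use e in simp)
    then show ?thesis
    proof eventually_elim
      case (elim n)
      have "(\<integral>\<omega>. ?g k (Y n \<omega>) \<partial>M) \<le> (\<integral>\<omega>. f (Y n \<omega>) \<partial>M)"
      proof (rule integral_mono)
        show "integrable M (\<lambda>\<omega>. ?g k (Y n \<omega>))"
          using inf_convolution_abs[of f B, OF B, of "real k"] by (intro M.integrable_const_bound[of _ B]) auto
        show "integrable M (\<lambda>\<omega>. f (Y n \<omega>))"
          using B by (intro M.integrable_const_bound[of _ B]) auto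
        show "?g k (Y n \<omega>) \<le> f (Y n \<omega>)" for \<omega>
          using inf_convolution_le[of f B, OF B, of "real k" "Y n \<omega>" "Y n \<omega>"] by simp
      qed
      then show ?case using k elim by linarith
    qed
  qed
  show ?thesis
  proof (rule tendstoI)
    fix e :: real assume e: "0 < e"
    have "continuous_on UNIV (\<lambda>x. - f x)" by (intro continuous_intros f)
    from lower[OF e this] B have "\<forall>\<^sub>F n in sequentially. (\<integral>\<omega>. f (Y n \<omega>) \<partial>M) < (\<integral>\<omega>. f (N \<omega>) \<partial>P) + e"
      by (auto elim!: eventually_mono)
    with lower[OF e f B] show "\<forall>\<^sub>F n in sequentially. dist (\<integral>\<omega>. f (Y n \<omega>) \<partial>M) (\<integral>\<omega>. f (N \<omega>) \<partial>P) < e"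
      by eventually_elim (simp add: dist_real_def abs_less_iff)
  qed
qed

text \<open>The Euclidean norm dominates the supremum norm, so a Lipschitz constant for the latter
  serves for the former.\<close>

lemma lipschitz_infnorm_constant:
  fixes \<psi> :: "real ^ 'd \<Rightarrow> real"
  assumes "lipschitz_infnorm \<psi>"
  shows "(lipschitz_constant \<psi>)-lipschitz_on UNIV \<psi>"
proof -
  let ?Q = "{\<bar>\<psi> x - \<psi> y\<bar> / infnorm (x - y) | x y. x \<noteq> y}"
  obtain L where L: "\<And>x y. \<bar>\<psi> x - \<psi> y\<bar> \<le> L * infnorm (x - y)"
    using assms by (auto simp: lipschitz_infnorm_def)
  have bdd: "bdd_above ?Q"
  proof (rule bdd_aboveI)
    fix q assume "q \<in> ?Q"
    then obtain x y where "q = \<bar>\<psi> x - \<psi> y\<bar> / infnorm (x - y)" "x \<noteq> y" by blast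
    then show "q \<le> L" using L[of x y] infnorm_pos_lt[of "x - y"] by (simp add: divide_le_eq)
  qed
  have c: "\<bar>\<psi> x - \<psi> y\<bar> / infnorm (x - y) \<le> lipschitz_constant \<psi>" if "x \<noteq> y" for x y
    unfolding lipschitz_constant_def by (rule cSup_upper[OF _ bdd]) (use that in blast)
  \<comment> \<open>A nonzero vector shows that the supremum is taken over a nonempty set of
    nonnegative quotients.\<close>
  have "(axis undefined 1 :: real ^ 'd) \<noteq> 0" by (simp add: axis_eq_0_iff)
  then have nn: "0 \<le> lipschitz_constant \<psi>"
    using c[of "axis undefined 1" 0] infnorm_pos_le[of "axis undefined 1 - 0 :: real ^ 'd"]
    by (meson abs_ge_zero divide_nonneg_nonneg order_trans)
  show ?thesis
  proof (rule lipschitz_onI'[OF _ nn])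
    fix x y
    show "\<bar>\<psi> x - \<psi> y\<bar> \<le> lipschitz_constant \<psi> * norm (x - y)"
    proof (cases "x = y")
      case False
      then have "\<bar>\<psi> x - \<psi> y\<bar> \<le> lipschitz_constant \<psi> * infnorm (x - y)"
        using c[OF False] infnorm_pos_lt[of "x - y"] by (simp add: divide_le_eq)
      also have "\<dots> \<le> lipschitz_constant \<psi> * norm (x - y)" by (intro mult_left_mono infnorm_le_norm nn)
      finally show ?thesis .
    qed simp
  qed
qed

section \<open>Limit of the covariances and the case of limit zero\<close>

context mixing begin

definition Sigma2 :: "real ^ 'd ^ 'd" where "Sigma2 = (\<chi> i j. Sg i j)"

lemma covariance_limit:
  "(\<lambda>n. (1 / real n) *\<^sub>R matrix_expectation \<nu> (\<lambda>\<omega>. outer_square (S n \<omega>))) \<longlonglongrightarrow> Sigma2"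
proof (intro vec_tendstoI)
  fix i j
  have "(\<lambda>n. (1 / real n) * expectation (\<lambda>\<omega>. S n \<omega> $ i * S n \<omega> $ j) - Sg i j) \<longlonglongrightarrow> 0"
  proof (rule Lim_null_comparison)
    show "\<forall>\<^sub>F n in sequentially. norm ((1 / real n) * expectation (\<lambda>\<omega>. S n \<omega> $ i * S n \<omega> $ j) - Sg i j) \<le> (2 * C * W0) / real n"
      using eventually_gt_at_top[of 0]
    proof eventually_elim
      case (elim n)
      have "(1 / real n) * expectation (\<lambda>\<omega>. S n \<omega> $ i * S n \<omega> $ j) - Sg i j = (expectation (\<lambda>\<omega>. S n \<omega> $ i * S n \<omega> $ j) - real n * Sg i j) / real n"
        using elim by (simp add: field_simps)
      then show ?case using second_moment[of n i j] by (simp add: abs_divide divide_right_mono)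
    qed
    show "(\<lambda>n. (2 * C * W0) / real n) \<longlonglongrightarrow> 0" by (rule lim_const_over_n)
  qed
  then have "(\<lambda>n. (1 / real n) * expectation (\<lambda>\<omega>. S n \<omega> $ i * S n \<omega> $ j)) \<longlonglongrightarrow> Sg i j"
    by (simp add: LIM_zero_iff)
  then show "(\<lambda>n. ((1 / real n) *\<^sub>R matrix_expectation \<nu> (\<lambda>\<omega>. outer_square (S n \<omega>))) $ i $ j) \<longlonglongrightarrow> Sigma2 $ i $ j"
    by (simp add: Sigma2_def matrix_expectation_def outer_square_def)
qed

lemma infnorm_sq_le: "(infnorm (x :: real ^ 'd))\<^sup>2 \<le> (\<Sum>a\<in>UNIV. x $ a * x $ a)"
proof -
  have "(infnorm x)\<^sup>2 \<le> (norm x)\<^sup>2" by (intro power_mono infnorm_le_norm infnorm_pos_le)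
  also have "\<dots> = (\<Sum>a\<in>UNIV. x $ a * x $ a)" by (simp add: power2_norm_eq_inner inner_vec_def)
  finally show ?thesis .
qed

text \<open>With \<open>Sg\<close> = 0 the linear term in \<open>second_moment\<close> disappears
  and the bound is uniform in n.\<close>

lemma L2_bounded_if_Sigma2_zero:
  assumes "Sigma2 = 0"
  shows "L2_bounded \<nu> S"
proof -
  have Sg0: "Sg a b = 0" for a b
    using arg_cong[OF assms, of "\<lambda>m. m $ a $ b"] by (simp add: Sigma2_def)
  have ci: "continuous_on UNIV (\<lambda>x :: real ^ 'd. (infnorm x)\<^sup>2)"
    by (intro continuous_intros)
  have i: "integrable \<nu> (\<lambda>\<omega>. (infnorm (S n \<omega>))\<^sup>2)" for n
    by (rule bm_integrable[OF bm_S[OF ci]])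
  have "expectation (\<lambda>\<omega>. (infnorm (S n \<omega>))\<^sup>2) \<le> real CARD('d) * (2 * C * W0)" for n
  proof -
    have "expectation (\<lambda>\<omega>. (infnorm (S n \<omega>))\<^sup>2) \<le> expectation (\<lambda>\<omega>. \<Sum>a\<in>UNIV. S n \<omega> $ a * S n \<omega> $ a)"
      by (intro integral_mono i bm_integrable bm_intros bm_component infnorm_sq_le)
    also have "\<dots> = (\<Sum>a\<in>UNIV. expectation (\<lambda>\<omega>. S n \<omega> $ a * S n \<omega> $ a))"
      by (rule E_sum) (intro bm_intros bm_component)
    also have "\<dots> \<le> (\<Sum>a\<in>(UNIV :: 'd set). 2 * C * W0)"
      using second_moment[of n] Sg0 by (intro sum_mono) (auto simp: abs_le_iff)
    finally show ?thesis by simp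
  qed
  then have "sqrt (expectation (\<lambda>\<omega>. (infnorm (S n \<omega>))\<^sup>2)) \<le> sqrt (real CARD('d) * (2 * C * W0))" for n by simp
  with i show ?thesis unfolding L2_bounded_def by blast
qed

end

section \<open>The Gaussian limit\<close>

context clt begin

text \<open>A linear form of A z is a linear form of z in the adjoint direction; the law is Dirac
  exactly when that direction is 0.\<close>

lemma gaussian_rv_A: "gaussian_rv (G 1) A"
  unfolding gaussian_rv_def
proof (intro conjI allI)
  fix \<beta> :: "real ^ 'd"
  let ?v = "adjoint A \<beta>"
  have e: "\<beta> \<bullet> A z = ?v \<bullet> z" for z
    using adjoint_works[OF linA, of z \<beta>] by (simp add: inner_commute)
  show "(\<exists>m \<sigma>. 0 < \<sigma> \<and> distributed (G 1) lborel (\<lambda>\<omega>. \<beta> \<bullet> A \<omega>) (\<lambda>x. ennreal (normal_density m \<sigma> x))) \<or>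
          (\<exists>m. distr (G 1) borel (\<lambda>\<omega>. \<beta> \<bullet> A \<omega>) = return borel m)"
  proof (cases "?v = 0")
    case True
    interpret G1: prob_space "G 1" by (rule prob_space_gauss) simp
    have "distr (G 1) borel (\<lambda>\<omega>. 0 :: real) = return borel 0"
      by (rule G1.distr_const) simp
    then show ?thesis unfolding e True by auto
  next
    case False
    have "distributed (G 1) lborel (\<lambda>z. ?v \<bullet> z) (\<lambda>x. ennreal (normal_density 0 (1 * norm ?v) x))"
      by (rule distributed_gauss_inner[OF _ False]) simp
    then show ?thesis unfolding e using False by (intro disjI1 exI[of _ 0] exI[of _ "norm ?v"]) auto
  qed
qed simp

lemma mean_A: "(\<integral>z. A z \<partial>G 1) = 0"
proof -
  have i: "integrable (G 1) A"
  proof (rule Bochner_Integration.integrable_bound[of _ "\<lambda>z. onorm A * norm z"])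
    show "integrable (G 1) (\<lambda>z. onorm A * norm z)" by (intro integrable_mult_right integrable_gauss_inner) simp
    have "norm (A z) \<le> onorm A * norm z" for z by (rule onorm[OF blA])
    then show "AE z in G 1. norm (A z) \<le> norm (onorm A * norm z)"
      using onormA by (intro always_eventually) auto
  qed simp
  have "(\<integral>z. A z \<partial>G 1) $ j = 0" for j
    using integral_bounded_linear[OF bounded_linear_vec_nth i, of j] A_comp_odd(1)[of j] by simp
  then show ?thesis by (simp add: vec_eq_iff)
qed

lemma covariance_A: "covariance_matrix (G 1) A = Sigma2"
  by (simp add: covariance_matrix_def cov_def A_comp_odd covA Sigma2_def)

text \<open>Composing the test function with the scaling divides its Lipschitz constant by sqrt(n),
  while the constant in \<open>W1\<close> does not depend on n.\<close>

lemma rate: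
  assumes w: "W1 n B" and n: "1 \<le> n" and lip: "L-lipschitz_on UNIV \<psi>"
  shows "\<bar>expectation (\<lambda>\<omega>. \<psi> ((1 / sqrt (real n)) *\<^sub>R S n \<omega>)) - (\<integral>z. \<psi> (A z) \<partial>G 1)\<bar> \<le> B * L / sqrt (real n)"
proof -
  have L: "0 \<le> L" using lip by (rule lipschitz_on_nonneg)
  have "(L * (1 / sqrt (real n)))-lipschitz_on UNIV (\<lambda>x. \<psi> ((1 / sqrt (real n)) *\<^sub>R x))"
  proof (rule lipschitz_onI')
    fix x y
    have "\<bar>\<psi> ((1 / sqrt (real n)) *\<^sub>R x) - \<psi> ((1 / sqrt (real n)) *\<^sub>R y)\<bar> \<le> L * norm ((1 / sqrt (real n)) *\<^sub>R x - (1 / sqrt (real n)) *\<^sub>R y)"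
      by (rule lipschitz_onD'[OF lip])
    then show "\<bar>\<psi> ((1 / sqrt (real n)) *\<^sub>R x) - \<psi> ((1 / sqrt (real n)) *\<^sub>R y)\<bar> \<le> L * (1 / sqrt (real n)) * norm (x - y)"
      by (simp add: scaleR_diff_right[symmetric])
  qed (use L in simp)
  from w[unfolded W1_def, rule_format, OF this] show ?thesis using n by simp
qed

lemma weak_convergence: "converges_in_distribution \<nu> (\<lambda>n \<omega>. (1 / sqrt (real n)) *\<^sub>R S n \<omega>) (G 1) A"
  unfolding converges_in_distribution_def
proof (intro allI impI)
  fix f :: "real ^ 'd \<Rightarrow> real" assume f: "continuous_on UNIV f" "bounded (range f)"
  obtain B where B: "0 \<le> B" "\<And>n. W1 n B" using W1_bound by blast
  show "(\<lambda>n. \<integral>\<omega>. f ((1 / sqrt (real n)) *\<^sub>R S n \<omega>) \<partial>\<nu>) \<longlonglongrightarrow> (\<integral>z. f (A z) \<partial>G 1)"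
  proof (rule weak_convergence_from_lipschitz[OF prob_space_axioms prob_space_gauss _ _ _ f])
    fix g :: "real ^ 'd \<Rightarrow> real" and L assume g: "L-lipschitz_on UNIV g"
    have "(\<lambda>n. (\<integral>\<omega>. g ((1 / sqrt (real n)) *\<^sub>R S n \<omega>) \<partial>\<nu>) - (\<integral>z. g (A z) \<partial>G 1)) \<longlonglongrightarrow> 0"
    proof (rule Lim_null_comparison)
      show "\<forall>\<^sub>F n in sequentially. norm ((\<integral>\<omega>. g ((1 / sqrt (real n)) *\<^sub>R S n \<omega>) \<partial>\<nu>) - (\<integral>z. g (A z) \<partial>G 1)) \<le> B * L / sqrt (real n)"
        using eventually_ge_at_top[of 1] by eventually_elim (simp only: real_norm_def rate[OF B(2) _ g])
      show "(\<lambda>n. B * L / sqrt (real n)) \<longlonglongrightarrow> 0"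
        by (rule real_tendsto_divide_at_top[OF tendsto_const filterlim_compose[OF sqrt_at_top filterlim_real_sequentially]])
    qed
    then show "(\<lambda>n. \<integral>\<omega>. g ((1 / sqrt (real n)) *\<^sub>R S n \<omega>) \<partial>\<nu>) \<longlonglongrightarrow> (\<integral>z. g (A z) \<partial>G 1)"
      by (simp add: LIM_zero_iff)
  qed auto
qed

end

context mixing begin

lemma gaussian_limit:
  "\<exists>(P :: (real ^ 'd) measure) (N :: real ^ 'd \<Rightarrow> real ^ 'd).
    prob_space P \<and> gaussian_rv P N \<and> (\<integral>\<omega>. N \<omega> \<partial>P) = 0 \<and> covariance_matrix P N = Sigma2 \<and>
    converges_in_distribution \<nu> (\<lambda>n \<omega>. (1 / sqrt (real n)) *\<^sub>R S n \<omega>) P N \<and>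
    (\<exists>B > 0. \<forall>n \<ge> 1. \<forall>\<psi> :: real ^ 'd \<Rightarrow> real. lipschitz_infnorm \<psi> \<longrightarrow>
       \<bar>(\<integral>\<omega>. \<psi> ((1 / sqrt (real n)) *\<^sub>R S n \<omega>) \<partial>\<nu>) - (\<integral>\<omega>. \<psi> (N \<omega>) \<partial>P)\<bar>
         \<le> B * lipschitz_constant \<psi> / sqrt (real n))"
proof -
  obtain A W :: "real ^ 'd \<Rightarrow> real ^ 'd" where "linear A" "linear W" "\<And>z. A (W (A z)) = A z"
    "\<And>i j. (\<integral>z. A z $ i * A z $ j \<partial>gauss 1) = Sg i j" by (rule Sg_factor, rule that)
  then interpret clt \<nu> X C M R ph A W by (intro clt.intro mixing_axioms clt_axioms.intro)
  obtain B where B: "0 \<le> B" "\<And>n. W1 n B" using W1_bound by blast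
  \<comment> \<open>\<open>W1_bound\<close> gives a nonnegative constant; adding 1 makes it
    positive.\<close>
  have B1: "W1 n (B + 1)" for n
    unfolding W1_def
  proof (intro allI impI)
    fix \<psi> :: "real ^ 'd \<Rightarrow> real" and L assume l: "L-lipschitz_on UNIV \<psi>"
    then have "0 \<le> L" by (rule lipschitz_on_nonneg)
    then show "\<bar>expectation (\<lambda>\<omega>. \<psi> (S n \<omega>)) - (\<integral>z. \<psi> (sqrt (real n) *\<^sub>R A z) \<partial>G 1)\<bar> \<le> (B + 1) * L"
      using B(2)[of n, unfolded W1_def, rule_format, OF l] by (simp add: distrib_right)
  qed
  show ?thesis
  proof (intro exI[of _ "G 1"] exI[of _ A] conjI gaussian_rv_A mean_A covariance_A weak_convergence)
    show "prob_space (G 1)" by (rule prob_space_gauss) simp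
    show "\<exists>B > 0. \<forall>n \<ge> 1. \<forall>\<psi> :: real ^ 'd \<Rightarrow> real. lipschitz_infnorm \<psi> \<longrightarrow>
       \<bar>(\<integral>\<omega>. \<psi> ((1 / sqrt (real n)) *\<^sub>R S n \<omega>) \<partial>\<nu>) - (\<integral>\<omega>. \<psi> (A \<omega>) \<partial>G 1)\<bar>
         \<le> B * lipschitz_constant \<psi> / sqrt (real n)"
      using B(1) by (intro exI[of _ "B + 1"] conjI allI impI rate[OF B1] lipschitz_infnorm_constant) auto
  qed
qed

end

section \<open>Admissible test functions on the cube\<close>

definition approachable :: "'a::euclidean_space set \<Rightarrow> 'a \<Rightarrow> bool" where
  "approachable S x \<longleftrightarrow> (\<forall>i\<in>Basis. \<forall>e>0. \<exists>d. 0 < \<bar>d\<bar> \<and> \<bar>d\<bar> < e \<and> x + d *\<^sub>R i \<in> S)"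

lemma approachable_UNIV: "approachable UNIV x"
  unfolding approachable_def
proof (intro ballI allI impI)
  fix e :: real assume "0 < e"
  then show "\<exists>d. 0 < \<bar>d\<bar> \<and> \<bar>d\<bar> < e \<and> x + d *\<^sub>R i \<in> UNIV" for i by (intro exI[of _ "e / 2"]) auto
qed

lemma approachable_Times:
  assumes "approachable S x" "x \<in> S" "approachable T y" "y \<in> T"
  shows "approachable (S \<times> T) (x, y)"
  unfolding approachable_def
proof (intro ballI allI impI)
  fix i :: "'a \<times> 'b" and e :: real assume i: "i \<in> Basis" and e: "0 < e"
  then consider u where "u \<in> Basis" "i = (u, 0)" | v where "v \<in> Basis" "i = (0, v)"
    by (auto simp: Basis_prod_def)
  then show "\<exists>d. 0 < \<bar>d\<bar> \<and> \<bar>d\<bar> < e \<and> (x, y) + d *\<^sub>R i \<in> S \<times> T"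
  proof cases
    case 1
    then obtain d where "0 < \<bar>d\<bar>" "\<bar>d\<bar> < e" "x + d *\<^sub>R u \<in> S" using assms(1) e unfolding approachable_def by blast
    then show ?thesis using 1 assms by (intro exI[of _ d]) auto
  next
    case 2
    then obtain d where "0 < \<bar>d\<bar>" "\<bar>d\<bar> < e" "y + d *\<^sub>R v \<in> T" using assms(3) e unfolding approachable_def by blast
    then show ?thesis using 2 assms by (intro exI[of _ d]) auto
  qed
qed

lemma approachable_cube:
  assumes M: "1 \<le> M" and y: "y \<in> cube M"
  shows "approachable (cube M) (y :: real ^ 'd)"
  unfolding approachable_def
proof (intro ballI allI impI)
  fix i :: "real ^ 'd" and e :: real assume "i \<in> Basis" and e: "0 < e"
  then obtain c where i: "i = axis c 1" by (auto simp: Basis_vec_def)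
  have yc: "\<bar>y $ a\<bar> \<le> M" for a using y by (simp add: mem_cube)
  \<comment> \<open>The coordinate moves towards the centre, where M >= 1 leaves room for a step of
    length at most 1.\<close>
  define d where "d = (if y $ c \<le> 0 then 1 else - 1) * min (e / 2) 1"
  have d: "0 < \<bar>d\<bar>" "\<bar>d\<bar> < e" using e by (auto simp: d_def abs_mult min_def)
  have "\<bar>y $ c + d\<bar> \<le> M"
    using yc[of c] M e unfolding d_def by (auto simp: abs_le_iff min_def)
  then have "y + d *\<^sub>R i \<in> cube M"
    using yc by (auto simp: mem_cube i axis_def)
  then show "\<exists>d. 0 < \<bar>d\<bar> \<and> \<bar>d\<bar> < e \<and> y + d *\<^sub>R i \<in> cube M" using d by blast
qed

text \<open>Derivatives within a set are unique at points that the set approaches along every axis.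
  The test domain does so also at its boundary, hence the derivative taken within it is the full
  derivative.\<close>

lemma test_function_bounds:
  fixes F :: "(real ^ 'd) \<times> (real ^ 'd) \<times> (real ^ 'd) \<times> (real ^ 'd) \<Rightarrow> real"
  assumes M: "1 \<le> M" and d: "\<And>q. (F has_derivative F' q) (at q)"
    and b: "\<And>q. q \<in> test_domain M \<Longrightarrow> \<bar>F q\<bar> \<le> K"
    and b': "\<And>q v. q \<in> test_domain M \<Longrightarrow> v \<in> Basis \<Longrightarrow> \<bar>F' q v\<bar> \<le> K"
  shows "admissible_test M F" "sup_norm_on (test_domain M) F \<le> K"
    "sup_norm_on (test_domain M) (jacobian_max F (test_domain M)) \<le> K"
proof -
  let ?D = "test_domain M :: ((real ^ 'd) \<times> (real ^ 'd) \<times> (real ^ 'd) \<times> (real ^ 'd)) set"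
  have fd: "frechet_derivative F (at q within ?D) = F' q" if q: "q \<in> ?D" for q
  proof (rule frechet_derivative_unique_within)
    have "F differentiable (at q within ?D)" using d differentiableI has_derivative_at_withinI by blast
    then show "(F has_derivative frechet_derivative F (at q within ?D)) (at q within ?D)"
      by (simp add: frechet_derivative_works)
    show "(F has_derivative F' q) (at q within ?D)" by (rule has_derivative_at_withinI[OF d])
    obtain x y z w where xyzw: "q = (x, y, z, w)" "y \<in> cube M" "z \<in> cube M" "w \<in> cube M"
      using q by (auto simp: test_domain_def)
    have "approachable ?D q"
      unfolding test_domain_def xyzw(1)
      by (intro approachable_Times approachable_UNIV approachable_cube M) (use xyzw in auto)
    then show "\<exists>d. 0 < \<bar>d\<bar> \<and> \<bar>d\<bar> < e \<and> q + d *\<^sub>R i \<in> ?D" if "i \<in> Basis" "0 < e" for i e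
      using that unfolding approachable_def by blast
  qed
  have jac: "0 \<le> jacobian_max F ?D q" "jacobian_max F ?D q \<le> K" if q: "q \<in> ?D" for q
  proof -
    have "\<bar>F' q (SOME i. i \<in> Basis)\<bar> \<le> jacobian_max F ?D q"
      unfolding jacobian_max_def fd[OF q] by (rule Max_ge) (auto simp: SOME_Basis)
    then show "0 \<le> jacobian_max F ?D q" by (rule order_trans[OF abs_ge_zero])
    show "jacobian_max F ?D q \<le> K"
      unfolding jacobian_max_def fd[OF q] by (subst Max_le_iff) (auto intro: b'[OF q])
  qed
  have ne: "(0, 0, 0, 0) \<in> ?D" using M by (auto simp: test_domain_def mem_cube)
  show "admissible_test M F"
    unfolding admissible_test_def
  proof (intro conjI)
    show "bounded (F ` ?D)" unfolding bounded_iff using b by (intro exI[of _ K]) auto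
    show "F differentiable_on ?D"
      unfolding differentiable_on_def using d differentiableI has_derivative_at_withinI by blast
    show "bounded (jacobian_max F ?D ` ?D)" unfolding bounded_iff using jac by (intro exI[of _ K]) auto
  qed
  show "sup_norm_on ?D F \<le> K"
    unfolding sup_norm_on_def by (rule cSUP_least) (use ne b in auto)
  show "sup_norm_on ?D (jacobian_max F ?D) \<le> K"
    unfolding sup_norm_on_def by (rule cSUP_least) (use ne jac in auto)
qed

text \<open>The powers are at most 1 and M >= 1, so on the domain both additional factors and their
  partial derivatives are at most M. Function and gradient share the bound
  \<open>K * M\<^sup>2\<close>.\<close>

lemma tame_test_function:
  fixes A :: "real ^ 'd \<Rightarrow> real ^ 'd \<Rightarrow> real" and j1 j2 :: 'd
  assumes A: "tame M K A" and M: "1 \<le> M" and e: "e \<le> 1" "e' \<le> 1"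
  defines "F \<equiv> \<lambda>q. A (fst q) (fst (snd q)) * (fst (snd (snd q)) $ j1) ^ e * (snd (snd (snd q)) $ j2) ^ e'"
  shows "admissible_test M F" "sup_norm_on (test_domain M) F \<le> K * M\<^sup>2"
    "sup_norm_on (test_domain M) (jacobian_max F (test_domain M)) \<le> K * M\<^sup>2"
    "continuous_on UNIV F"
proof -
  obtain Ax Ay where der: "\<And>x y. ((\<lambda>p. A (fst p) (snd p)) has_derivative
      (\<lambda>h. (\<Sum>c\<in>UNIV. fst h $ c * Ax c x y) + (\<Sum>c\<in>UNIV. snd h $ c * Ay c x y))) (at (x, y))"
    and bd: "\<And>x y. y \<in> cube M \<Longrightarrow> \<bar>A x y\<bar> \<le> K" "\<And>x y c. y \<in> cube M \<Longrightarrow> \<bar>Ax c x y\<bar> \<le> K"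
      "\<And>x y c. y \<in> cube M \<Longrightarrow> \<bar>Ay c x y\<bar> \<le> K"
    using A unfolding tame_def by blast
  have K: "0 \<le> K" using bd(1)[of 0 0] M by (auto simp: mem_cube intro: order_trans[OF abs_ge_zero])
  define A' where "A' q h = (\<Sum>c\<in>UNIV. fst h $ c * Ax c (fst q) (fst (snd q))) + (\<Sum>c\<in>UNIV. fst (snd h) $ c * Ay c (fst q) (fst (snd q)))"
    for q h :: "(real ^ 'd) \<times> (real ^ 'd) \<times> (real ^ 'd) \<times> (real ^ 'd)"
  \<comment> \<open>Derivative of t^n in direction h, in the form in which the power rule produces
    it.\<close>
  define P where "P n t h = real n * (h :: real) * t ^ (n - 1)" for n :: nat and t h :: real
  define F' where "F' q h = A (fst q) (fst (snd q)) * (fst (snd (snd q)) $ j1) ^ e * P e' (snd (snd (snd q)) $ j2) (snd (snd (snd h)) $ j2)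
      + (A (fst q) (fst (snd q)) * P e (fst (snd (snd q)) $ j1) (fst (snd (snd h)) $ j1) + A' q h * (fst (snd (snd q)) $ j1) ^ e) * (snd (snd (snd q)) $ j2) ^ e'"
    for q h :: "(real ^ 'd) \<times> (real ^ 'd) \<times> (real ^ 'd) \<times> (real ^ 'd)"
  have dA: "((\<lambda>q. A (fst q) (fst (snd q))) has_derivative A' q) (at q)" for q
  proof -
    have "((\<lambda>q. (fst q, fst (snd q))) has_derivative (\<lambda>h. (fst h, fst (snd h)))) (at q)"
      by (auto intro!: derivative_eq_intros)
    from has_derivative_compose[OF this der[of "fst q" "fst (snd q)"]]
    show ?thesis by (simp add: A'_def[abs_def])
  qed
  have dz: "((\<lambda>q. fst (snd (snd q)) $ j) has_derivative (\<lambda>h. fst (snd (snd h)) $ j)) (at q)"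
    "((\<lambda>q. snd (snd (snd q)) $ j) has_derivative (\<lambda>h. snd (snd (snd h)) $ j)) (at q)"
    for j and q :: "(real ^ 'd) \<times> (real ^ 'd) \<times> (real ^ 'd) \<times> (real ^ 'd)"
    by (intro bounded_linear_imp_has_derivative bounded_linear_compose[OF bounded_linear_vec_nth]
      bounded_linear_compose[OF bounded_linear_fst] bounded_linear_compose[OF bounded_linear_snd] bounded_linear_snd)+
  have dF: "(F has_derivative F' q) (at q)" for q
    unfolding F_def F'_def P_def
    by (intro has_derivative_mult dA has_derivative_power[OF dz(1)] has_derivative_power[OF dz(2)])
  have pw: "\<bar>t ^ n\<bar> \<le> M" if "\<bar>t\<bar> \<le> M" "n \<le> 1" for t :: real and n :: nat
    using that M by (cases n) auto
  have pP: "\<bar>P n t h\<bar> \<le> M" if "\<bar>h\<bar> \<le> 1" "n \<le> 1" for t h n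
    using that M by (cases n) (auto simp: P_def)
  have P0: "P n t 0 = 0" for n t by (simp add: P_def)
  have prod3: "\<bar>a * b * c\<bar> \<le> K * M\<^sup>2" if "\<bar>a\<bar> \<le> K" "\<bar>b\<bar> \<le> M" "\<bar>c\<bar> \<le> M" for a b c
  proof -
    have "\<bar>a * b * c\<bar> = \<bar>a\<bar> * \<bar>b\<bar> * \<bar>c\<bar>" by (simp add: abs_mult)
    also have "\<dots> \<le> K * M * M" using that K M by (intro mult_mono) auto
    finally show ?thesis by (simp add: power2_eq_square)
  qed
  have bF: "\<bar>F q\<bar> \<le> K * M\<^sup>2" if q: "q \<in> test_domain M" for q
    unfolding F_def using q e by (intro prod3 bd pw) (auto simp: test_domain_def mem_cube)
  have bF': "\<bar>F' q v\<bar> \<le> K * M\<^sup>2" if q: "q \<in> test_domain M" and v: "v \<in> Basis" for q v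
  proof -
    have q': "fst (snd q) \<in> cube M" "\<And>j. \<bar>fst (snd (snd q)) $ j\<bar> \<le> M" "\<And>j. \<bar>snd (snd (snd q)) $ j\<bar> \<le> M"
      using q by (auto simp: test_domain_def mem_cube)
    have ax: "(\<Sum>a\<in>UNIV. axis c (1::real) $ a * f a) = f c" for c and f :: "'d \<Rightarrow> real"
    proof -
      have "(\<Sum>a\<in>UNIV. axis c (1::real) $ a * f a) = (\<Sum>a\<in>UNIV. if a = c then f a else 0)"
        by (intro sum.cong) (auto simp: axis_def)
      then show ?thesis by simp
    qed
    have ax1: "\<bar>axis c (1::real) $ a\<bar> \<le> 1" for c a :: 'd by (simp add: axis_def)
    consider c where "v = (axis c 1, 0, 0, 0)" | c where "v = (0, axis c 1, 0, 0)"
      | c where "v = (0, 0, axis c 1, 0)" | c where "v = (0, 0, 0, axis c 1)"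
      using v by (auto simp: Basis_prod_def Basis_vec_def zero_prod_def)
    then show ?thesis
    proof cases
      case 1
      then have "F' q v = Ax c (fst q) (fst (snd q)) * (fst (snd (snd q)) $ j1) ^ e * (snd (snd (snd q)) $ j2) ^ e'"
        by (simp add: F'_def A'_def P0 ax)
      then show ?thesis using q' e by (auto intro!: prod3 bd pw)
    next
      case 2
      then have "F' q v = Ay c (fst q) (fst (snd q)) * (fst (snd (snd q)) $ j1) ^ e * (snd (snd (snd q)) $ j2) ^ e'"
        by (simp add: F'_def A'_def P0 ax)
      then show ?thesis using q' e by (auto intro!: prod3 bd pw)
    next
      case 3
      then have "F' q v = A (fst q) (fst (snd q)) * P e (fst (snd (snd q)) $ j1) (axis c 1 $ j1) * (snd (snd (snd q)) $ j2) ^ e'"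
        by (simp add: F'_def A'_def P0)
      then show ?thesis using q' e ax1 by (auto intro!: prod3 bd pw pP)
    next
      case 4
      then have "F' q v = A (fst q) (fst (snd q)) * (fst (snd (snd q)) $ j1) ^ e * P e' (snd (snd (snd q)) $ j2) (axis c 1 $ j2)"
        by (simp add: F'_def A'_def P0)
      then show ?thesis using q' e ax1 by (auto intro!: prod3 bd pw pP)
    qed
  qed
  show "admissible_test M F" "sup_norm_on (test_domain M) F \<le> K * M\<^sup>2"
    "sup_norm_on (test_domain M) (jacobian_max F (test_domain M)) \<le> K * M\<^sup>2"
    using test_function_bounds[OF M dF bF bF'] by auto
  show "continuous_on UNIV F"
    using has_derivative_continuous[OF dF] by (simp add: continuous_on_eq_continuous_at)
qed

lemma stationary_expectation:
  fixes X :: "nat \<Rightarrow> 'w \<Rightarrow> real ^ 'd" and g :: "(nat \<Rightarrow> real ^ 'd) \<Rightarrow> real"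
  assumes st: "stationary \<nu> X" and [measurable]: "\<And>k. X k \<in> borel_measurable \<nu>"
    and [measurable]: "g \<in> borel_measurable (PiM UNIV (\<lambda>_. borel))"
  shows "(\<integral>\<omega>. g (\<lambda>k. X (k + m) \<omega>) \<partial>\<nu>) = (\<integral>\<omega>. g (\<lambda>k. X k \<omega>) \<partial>\<nu>)"
proof -
  have m: "(\<lambda>\<omega> k. X (k + m) \<omega>) \<in> measurable \<nu> (PiM UNIV (\<lambda>_. borel))" for m
    by (rule measurable_PiM_single') auto
  have "(\<integral>\<omega>. g (\<lambda>k. X (k + m) \<omega>) \<partial>\<nu>) = (\<integral>f. g f \<partial>distr \<nu> (PiM UNIV (\<lambda>_. borel)) (\<lambda>\<omega> k. X (k + m) \<omega>))"
    by (rule integral_distr[OF m, symmetric]) measurable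
  also have "\<dots> = (\<integral>f. g f \<partial>distr \<nu> (PiM UNIV (\<lambda>_. borel)) (\<lambda>\<omega> k. X (k + 0) \<omega>))"
    using st by (simp add: stationary_def)
  also have "\<dots> = (\<integral>\<omega>. g (\<lambda>k. X (k + 0) \<omega>) \<partial>\<nu>)"
    by (rule integral_distr[OF m]) measurable
  finally show ?thesis by simp
qed

lemma closed_cube: "closed (cube M)" by (simp add: cube_def closed_cbox)

lemma closed_test_domain: "closed (test_domain M)"
  unfolding test_domain_def by (intro closed_Times closed_UNIV closed_cube)

lemma sup_norm_on_nonneg:
  assumes "bounded (f ` D)" "D \<noteq> {}"
  shows "0 \<le> sup_norm_on D f"
proof -
  obtain x where x: "x \<in> D" using assms(2) by blast
  obtain B where "\<And>x. x \<in> D \<Longrightarrow> \<bar>f x\<bar> \<le> B" using assms(1) by (auto simp: bounded_iff)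
  then have "\<bar>f x\<bar> \<le> sup_norm_on D f"
    unfolding sup_norm_on_def by (intro cSUP_upper x bdd_aboveI2)
  then show ?thesis by (rule order_trans[OF abs_ge_zero])
qed

lemma test_domain_nonempty: "1 \<le> M \<Longrightarrow> test_domain M \<noteq> {}"
proof -
  assume "1 \<le> M"
  then have "(0, 0, 0, 0) \<in> test_domain M" by (auto simp: test_domain_def mem_cube)
  then show ?thesis by blast
qed

theorem theorem1p1:
  fixes \<nu> :: "'w measure"
    and X :: "nat \<Rightarrow> 'w \<Rightarrow> real ^ 'd"
    and C M :: real
    and r :: nat
    and \<phi> :: "nat \<Rightarrow> nat \<Rightarrow> real"
  assumes "prob_space \<nu>"
    and "\<And>k. X k \<in> borel_measurable \<nu>"
    and "stationary \<nu> X"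
    and "\<And>k. \<exists>K. AE \<omega> in \<nu>. infnorm (X k \<omega>) \<le> K"
    and "\<And>k. (\<integral>\<omega>. X k \<omega> \<partial>\<nu>) = 0"
    and "C \<ge> 1"
    and "ereal M \<ge> max 1 (esssup \<nu> (\<lambda>\<omega>. ereal (infnorm (X 0 \<omega>))))"
    and "\<And>p l. \<bar>\<phi> p l\<bar> \<le> 1"
    and "(\<lambda>p. real p * Max (\<phi> p ` {0..p div (r + 1)})) summable_on {1..}"
    and "\<And>(a::nat) (b::nat) (c::nat) (i::nat) (j::nat) (k::nat) (p::nat) (q::nat) (l::nat)
            (i1::'d) (i2::'d) (i3::'d)
            (F :: (real ^ 'd) \<times> (real ^ 'd) \<times> (real ^ 'd) \<times> (real ^ 'd) \<Rightarrow> real).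
          \<lbrakk>1 \<le> a + b + c; a + b + c \<le> 3;
           1 \<le> i; i \<le> j; j \<le> k; k \<le> k + p; k + p \<le> k + p + q; k + p + q \<le> k + p + l;
           admissible_test M F\<rbrakk> \<Longrightarrow>
          \<bar>cov \<nu>
             (\<lambda>\<omega>. zero_off (test_domain M) F (partial_sum X (i - 1) \<omega>, X i \<omega>, X j \<omega>, X k \<omega>))
             (\<lambda>\<omega>. (X (k + p) \<omega> $ i1) ^ a * (X (k + p + q) \<omega> $ i2) ^ b * (X (k + p + l) \<omega> $ i3) ^ c)\<bar>
          \<le> C * (sup_norm_on (test_domain M) F
                 + sup_norm_on (test_domain M) (jacobian_max F (test_domain M))) * \<phi> p l"
  shows "\<exists>\<Sigma>2 :: real ^ 'd ^ 'd.
      (\<lambda>n. (1 / real n) *\<^sub>R matrix_expectation \<nu> (\<lambda>\<omega>. outer_square (partial_sum X n \<omega>)))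
        \<longlonglongrightarrow> \<Sigma>2 \<and>
      (\<Sigma>2 = 0 \<longrightarrow> L2_bounded \<nu> (partial_sum X)) \<and>
      (\<Sigma>2 \<noteq> 0 \<longrightarrow>
        (\<exists>(P :: (real ^ 'd) measure) (N :: real ^ 'd \<Rightarrow> real ^ 'd).
          prob_space P \<and> gaussian_rv P N \<and>
          (\<integral>\<omega>. N \<omega> \<partial>P) = 0 \<and> covariance_matrix P N = \<Sigma>2 \<and>
          converges_in_distribution \<nu> (\<lambda>n \<omega>. (1 / sqrt (real n)) *\<^sub>R partial_sum X n \<omega>) P N \<and>
          (\<exists>B > 0. \<forall>n \<ge> 1. \<forall>\<psi> :: real ^ 'd \<Rightarrow> real. lipschitz_infnorm \<psi> \<longrightarrow>
             \<bar>(\<integral>\<omega>. \<psi> ((1 / sqrt (real n)) *\<^sub>R partial_sum X n \<omega>) \<partial>\<nu>) - (\<integral>\<omega>. \<psi> (N \<omega>) \<partial>P)\<bar>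
               \<le> B * lipschitz_constant \<psi> / sqrt (real n))))"
proof -
  note prob = assms(1) and meas [measurable] = assms(2) and stat = assms(3) and mean = assms(5)
    and C1 = assms(6) and esup = assms(7) and \<phi>1 = assms(8) and summ = assms(9) and mixing = assms(10)
  interpret prob_space \<nu> by (rule prob)
  have M1: "1 \<le> M" using esup by simp
  \<comment> \<open>The variables lie in the cube only almost surely, whereas the locale asks for
    bounds everywhere. Truncation changes them on a null set, and as the same map acts at all times,
    stationarity is preserved.\<close>
  define cl :: "real ^ 'd \<Rightarrow> real ^ 'd" where "cl x = (if x \<in> cube M then x else 0)" for x
  define Y where "Y k \<omega> = cl (X k \<omega>)" for k \<omega>
  \<comment> \<open>The summability hypothesis starts at p = 1, so the value at 0 is set to the
    largest possible one. The maximum with 0 is taken because the given coefficients may be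
    negative.\<close>
  define ph where "ph p = (if p = 0 then 1 else max 0 (Max (\<phi> p ` {0..p div (r + 1)})))" for p
  have [measurable]: "cube M \<in> sets borel" for M :: real by (rule borel_closed[OF closed_cube])
  have cl_meas [measurable]: "cl \<in> borel_measurable borel" unfolding cl_def[abs_def] by measurable
  have Y_meas [measurable]: "Y k \<in> borel_measurable \<nu>" for k unfolding Y_def[abs_def] by measurable
  have Y_bound: "\<bar>Y k \<omega> $ a\<bar> \<le> M" for k \<omega> a using M1 by (auto simp: Y_def cl_def mem_cube)
  have X0: "AE \<omega> in \<nu>. X 0 \<omega> \<in> cube M"
  proof -
    have "AE \<omega> in \<nu>. ereal (infnorm (X 0 \<omega>)) \<le> esssup \<nu> (\<lambda>\<omega>. ereal (infnorm (X 0 \<omega>)))" by (rule esssup_AE)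
    then show ?thesis
    proof eventually_elim
      case (elim \<omega>)
      have "esssup \<nu> (\<lambda>\<omega>. ereal (infnorm (X 0 \<omega>))) \<le> ereal M" using esup by simp
      with elim have "ereal (infnorm (X 0 \<omega>)) \<le> ereal M" by (rule order_trans)
      then show ?case by (auto simp: mem_cube intro: order_trans[OF component_le_infnorm_cart])
    qed
  qed
  \<comment> \<open>M is compared with X 0 only; stationarity carries the bound to all
    times.\<close>
  have Xk: "AE \<omega> in \<nu>. X k \<omega> \<in> cube M" for k
  proof -
    have pr: "(\<integral>\<omega>. indicator (cube M) (X j \<omega>) \<partial>\<nu>) = prob {\<omega> \<in> space \<nu>. X j \<omega> \<in> cube M}" for j
    proof -
      have "(\<integral>\<omega>. indicator (cube M) (X j \<omega>) \<partial>\<nu>) = (\<integral>\<omega>. indicator {\<omega> \<in> space \<nu>. X j \<omega> \<in> cube M} \<omega> \<partial>\<nu> :: real)"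
        by (intro Bochner_Integration.integral_cong) (auto simp: indicator_def)
      then show ?thesis by simp
    qed
    have "(\<integral>\<omega>. indicator (cube M) (X (0 + k) \<omega>) \<partial>\<nu>) = (\<integral>\<omega>. indicator (cube M) (X 0 \<omega>) \<partial>\<nu> :: real)"
      by (rule stationary_expectation[OF stat meas, of "\<lambda>f. indicator (cube M) (f 0)"]) measurable
    moreover have "prob {\<omega> \<in> space \<nu>. X 0 \<omega> \<in> cube M} = 1" using X0 by (subst prob_Collect_eq_1) auto
    ultimately have "prob {\<omega> \<in> space \<nu>. X k \<omega> \<in> cube M} = 1" by (simp add: pr)
    then show ?thesis by (subst (asm) prob_Collect_eq_1) auto
  qed
  have "AE \<omega> in \<nu>. \<forall>k. X k \<omega> \<in> cube M" using Xk by (simp add: AE_all_countable)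
  then have XY: "AE \<omega> in \<nu>. \<forall>k. X k \<omega> = Y k \<omega>" by eventually_elim (simp add: Y_def cl_def)
  then have SS: "AE \<omega> in \<nu>. \<forall>n. partial_sum X n \<omega> = partial_sum Y n \<omega>"
    by eventually_elim (simp add: partial_sum_def)
  have S_meas [measurable]: "partial_sum X n \<in> borel_measurable \<nu>" "partial_sum Y n \<in> borel_measurable \<nu>" for n
    unfolding partial_sum_def[abs_def] by measurable
  have cov_cong: "cov \<nu> f g = cov \<nu> f' g'" if "AE \<omega> in \<nu>. f \<omega> = f' \<omega>" "AE \<omega> in \<nu>. g \<omega> = g' \<omega>"
    and [measurable]: "f \<in> borel_measurable \<nu>" "f' \<in> borel_measurable \<nu>" "g \<in> borel_measurable \<nu>" "g' \<in> borel_measurable \<nu>"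
    for f f' g g' :: "'w \<Rightarrow> real"
  proof -
    have "(\<integral>\<omega>. f \<omega> * g \<omega> \<partial>\<nu>) = (\<integral>\<omega>. f' \<omega> * g' \<omega> \<partial>\<nu>)"
    proof (rule integral_cong_AE)
      show "AE \<omega> in \<nu>. f \<omega> * g \<omega> = f' \<omega> * g' \<omega>" using that(1,2) by eventually_elim simp
    qed measurable
    moreover have "(\<integral>\<omega>. f \<omega> \<partial>\<nu>) = (\<integral>\<omega>. f' \<omega> \<partial>\<nu>)" "(\<integral>\<omega>. g \<omega> \<partial>\<nu>) = (\<integral>\<omega>. g' \<omega> \<partial>\<nu>)"
      by (intro integral_cong_AE that; measurable)+
    ultimately show ?thesis by (simp add: cov_def)
  qed
  have comp [measurable]: "(\<lambda>x :: real ^ 'd. x $ a) \<in> borel_measurable borel" for a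
    by (intro borel_measurable_continuous_onI continuous_intros)
  have compX [measurable]: "(\<lambda>\<omega>. X k \<omega> $ a) \<in> borel_measurable \<nu>" "(\<lambda>\<omega>. Y k \<omega> $ a) \<in> borel_measurable \<nu>" for k a
    by (rule measurable_compose[OF _ comp], measurable)+
  \<comment> \<open>In the constant, 2 counts the function and its gradient, and the factor
    \<open>M\<^sup>2\<close> comes from \<open>tame_test_function\<close>. The ratio r + 1 is the
    one in the range of the maximum.\<close>
  interpret mixing \<nu> Y "2 * C * M\<^sup>2" M "r + 1" ph
  proof
    show "Y k \<in> borel_measurable \<nu>" for k by (rule Y_meas)
    show "\<bar>Y k \<omega> $ a\<bar> \<le> M" for k \<omega> a by (rule Y_bound)
    show "1 \<le> M" by (rule M1)
    have "1 * 1 \<le> C * M\<^sup>2" using C1 M1 by (intro mult_mono) auto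
    then show "1 \<le> 2 * C * M\<^sup>2" by linarith
    show "1 \<le> r + 1" by simp
    show "0 \<le> ph p" for p by (simp add: ph_def)
    show "ph p \<le> 1" for p using \<phi>1 by (auto simp: ph_def abs_le_iff)
    show "ph 0 = 1" by (simp add: ph_def)
    show "expectation (\<lambda>\<omega>. Y k \<omega> $ a) = 0" for k a
    proof -
      have "integrable \<nu> (X k)"
      proof (rule integrable_const_bound)
        show "AE \<omega> in \<nu>. norm (X k \<omega>) \<le> real CARD('d) * M"
          using Xk[of k]
        proof eventually_elim
          case (elim \<omega>)
          have "norm (X k \<omega>) \<le> (\<Sum>a\<in>UNIV. \<bar>X k \<omega> $ a\<bar>)" by (rule norm_le_l1_cart)
          also have "\<dots> \<le> (\<Sum>a\<in>(UNIV :: 'd set). M)" using elim by (intro sum_mono) (simp add: mem_cube)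
          finally show ?case by simp
        qed
      qed measurable
      then have "expectation (\<lambda>\<omega>. X k \<omega> $ a) = (\<integral>\<omega>. X k \<omega> \<partial>\<nu>) $ a"
        by (rule integral_bounded_linear[OF bounded_linear_vec_nth])
      moreover have "expectation (\<lambda>\<omega>. X k \<omega> $ a) = expectation (\<lambda>\<omega>. Y k \<omega> $ a)"
      proof (rule integral_cong_AE)
        show "AE \<omega> in \<nu>. X k \<omega> $ a = Y k \<omega> $ a" using XY by eventually_elim simp
      qed measurable
      ultimately show ?thesis by (simp add: mean)
    qed
    show "summable (\<lambda>p. real p * ph p)"
    proof -
      \<comment> \<open>Unordered summability of reals is absolute, so it passes to the nonnegative
        parts.\<close>
      have "(\<lambda>p. \<bar>real p * Max (\<phi> p ` {0..p div (r + 1)})\<bar>) summable_on {1..}"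
        using summ summable_on_iff_abs_summable_on_real[of "\<lambda>p. real p * Max (\<phi> p ` {0..p div (r + 1)})"] by simp
      then have "(\<lambda>p. real p * ph p) summable_on {1..}"
        by (rule summable_on_comparison_test) (auto simp: ph_def max_def abs_mult)
      then have "(\<lambda>p. real p * ph p) summable_on UNIV"
        by (rule summable_on_cong_neutral[THEN iffD1, rotated -1]) (auto simp: not_le)
      then show ?thesis by (rule summable_on_imp_summable)
    qed
    show "expectation (\<lambda>\<omega>. Y (u + m) \<omega> $ b * Y (k + m) \<omega> $ a) = expectation (\<lambda>\<omega>. Y u \<omega> $ b * Y k \<omega> $ a)" for u k m a b
      unfolding Y_def by (rule stationary_expectation[OF stat meas, of "\<lambda>f. cl (f u) $ b * cl (f k) $ a"]) measurable
    fix K :: real and A :: "real ^ 'd \<Rightarrow> real ^ 'd \<Rightarrow> real" and i j k e e' p q l a b c :: nat and i1 i2 i3 j1 j2 :: 'd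
    assume A: "tame M K A" and o: "1 \<le> i" "i \<le> j" "j \<le> k" and Rl: "(r + 1) * l \<le> p" and ql: "q \<le> l"
      and abc: "1 \<le> a + b + c" "a + b + c \<le> 3" and e: "e \<le> 1" "e' \<le> 1"
    define F where "F q = A (fst q) (fst (snd q)) * (fst (snd (snd q)) $ j1) ^ e * (snd (snd (snd q)) $ j2) ^ e'"
      for q :: "(real ^ 'd) \<times> (real ^ 'd) \<times> (real ^ 'd) \<times> (real ^ 'd)"
    note F = tame_test_function[OF A M1 e, of j1 j2, folded F_def]
    let ?D = "test_domain M :: ((real ^ 'd) \<times> (real ^ 'd) \<times> (real ^ 'd) \<times> (real ^ 'd)) set"
    let ?s = "sup_norm_on ?D F + sup_norm_on ?D (jacobian_max F ?D)"
    \<comment> \<open>The sign of the norms is required before the coefficient may be replaced by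
      the larger \<open>ph p\<close>.\<close>
    have s: "0 \<le> ?s" "?s \<le> 2 * (K * M\<^sup>2)"
      using F(2,3) sup_norm_on_nonneg[of F ?D] sup_norm_on_nonneg[of "jacobian_max F ?D" ?D] F(1) M1
      by (auto simp: admissible_test_def test_domain_nonempty)
    have "\<phi> p l \<le> ph p"
    proof (cases "p = 0")
      case True
      then show ?thesis using \<phi>1[of p l] by (simp add: ph_def abs_le_iff)
    next
      case False
      \<comment> \<open>The gap condition of the locale says precisely that l belongs to the range
        of the maximum.\<close>
      have "l \<le> p div (r + 1)" using Rl by (simp add: less_eq_div_iff_mult_less_eq mult.commute)
      then have "\<phi> p l \<le> Max (\<phi> p ` {0..p div (r + 1)})" by (intro Max_ge) auto
      then show ?thesis using False by (simp add: ph_def)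
    qed
    moreover have "0 \<le> ph p" by (simp add: ph_def)
    ultimately have bound: "C * ?s * \<phi> p l \<le> C * (2 * (K * M\<^sup>2)) * ph p"
      using s C1 by (intro order_trans[OF mult_left_mono mult_right_mono]) auto
    have zm: "zero_off ?D F \<in> borel_measurable borel"
    proof -
      have [measurable]: "?D \<in> sets borel" by (rule borel_closed[OF closed_test_domain])
      have [measurable]: "F \<in> borel_measurable borel" by (rule borel_measurable_continuous_onI[OF F(4)])
      show ?thesis unfolding zero_off_def[abs_def] by measurable
    qed
    have "cov \<nu> (\<lambda>\<omega>. zero_off ?D F (partial_sum X (i - 1) \<omega>, X i \<omega>, X j \<omega>, X k \<omega>))
        (\<lambda>\<omega>. (X (k + p) \<omega> $ i1) ^ a * (X (k + p + q) \<omega> $ i2) ^ b * (X (k + p + l) \<omega> $ i3) ^ c) =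
      cov \<nu> (\<lambda>\<omega>. F (partial_sum Y (i - 1) \<omega>, Y i \<omega>, Y j \<omega>, Y k \<omega>))
        (\<lambda>\<omega>. (Y (k + p) \<omega> $ i1) ^ a * (Y (k + p + q) \<omega> $ i2) ^ b * (Y (k + p + l) \<omega> $ i3) ^ c)"
    proof (rule cov_cong)
      have YD: "Y k \<omega> \<in> cube M" for k \<omega> using Y_bound by (simp add: mem_cube)
      show "AE \<omega> in \<nu>. zero_off ?D F (partial_sum X (i - 1) \<omega>, X i \<omega>, X j \<omega>, X k \<omega>) = F (partial_sum Y (i - 1) \<omega>, Y i \<omega>, Y j \<omega>, Y k \<omega>)"
        using XY SS by eventually_elim (simp add: zero_off_def test_domain_def YD)
      show "AE \<omega> in \<nu>. (X (k + p) \<omega> $ i1) ^ a * (X (k + p + q) \<omega> $ i2) ^ b * (X (k + p + l) \<omega> $ i3) ^ c =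
        (Y (k + p) \<omega> $ i1) ^ a * (Y (k + p + q) \<omega> $ i2) ^ b * (Y (k + p + l) \<omega> $ i3) ^ c"
        using XY by eventually_elim simp
      show "(\<lambda>\<omega>. zero_off ?D F (partial_sum X (i - 1) \<omega>, X i \<omega>, X j \<omega>, X k \<omega>)) \<in> borel_measurable \<nu>"
        by (rule measurable_compose[OF _ zm]) (intro borel_measurable_Pair S_meas meas)
      show "(\<lambda>\<omega>. F (partial_sum Y (i - 1) \<omega>, Y i \<omega>, Y j \<omega>, Y k \<omega>)) \<in> borel_measurable \<nu>"
        by (rule measurable_compose[OF _ borel_measurable_continuous_onI[OF F(4)]]) (intro borel_measurable_Pair S_meas Y_meas)
    qed measurable
    moreover have "\<bar>cov \<nu> (\<lambda>\<omega>. zero_off ?D F (partial_sum X (i - 1) \<omega>, X i \<omega>, X j \<omega>, X k \<omega>))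
        (\<lambda>\<omega>. (X (k + p) \<omega> $ i1) ^ a * (X (k + p + q) \<omega> $ i2) ^ b * (X (k + p + l) \<omega> $ i3) ^ c)\<bar> \<le> C * ?s * \<phi> p l"
      by (rule mixing[OF abc o _ _ _ F(1)]) (use ql in auto)
    ultimately show "\<bar>cov \<nu> (\<lambda>\<omega>. A (partial_sum Y (i - 1) \<omega>) (Y i \<omega>) * (Y j \<omega> $ j1) ^ e * (Y k \<omega> $ j2) ^ e')
          (\<lambda>\<omega>. (Y (k + p) \<omega> $ i1) ^ a * (Y (k + p + q) \<omega> $ i2) ^ b * (Y (k + p + l) \<omega> $ i3) ^ c)\<bar>
        \<le> 2 * C * M\<^sup>2 * K * ph p"
      using bound by (simp add: F_def mult_ac)
  qed
  \<comment> \<open>The conclusion depends on the sums only through integrals of continuous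
    functions, which the truncation leaves unchanged.\<close>
  have transfer: "(\<integral>\<omega>. g (partial_sum X n \<omega>) \<partial>\<nu>) = (\<integral>\<omega>. g (partial_sum Y n \<omega>) \<partial>\<nu>)"
    "integrable \<nu> (\<lambda>\<omega>. g (partial_sum X n \<omega>)) \<longleftrightarrow> integrable \<nu> (\<lambda>\<omega>. g (partial_sum Y n \<omega>))"
    if g: "continuous_on UNIV g" for g :: "real ^ 'd \<Rightarrow> real" and n
  proof -
    note [measurable] = borel_measurable_continuous_onI[OF g]
    have ae: "AE \<omega> in \<nu>. g (partial_sum X n \<omega>) = g (partial_sum Y n \<omega>)" using SS by eventually_elim simp
    show "(\<integral>\<omega>. g (partial_sum X n \<omega>) \<partial>\<nu>) = (\<integral>\<omega>. g (partial_sum Y n \<omega>) \<partial>\<nu>)"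
      by (rule integral_cong_AE[OF _ _ ae]) measurable
    show "integrable \<nu> (\<lambda>\<omega>. g (partial_sum X n \<omega>)) \<longleftrightarrow> integrable \<nu> (\<lambda>\<omega>. g (partial_sum Y n \<omega>))"
      by (rule integrable_cong_AE[OF _ _ ae]) measurable
  qed
  have mat: "matrix_expectation \<nu> (\<lambda>\<omega>. outer_square (partial_sum X n \<omega>)) = matrix_expectation \<nu> (\<lambda>\<omega>. outer_square (partial_sum Y n \<omega>))" for n
    unfolding matrix_expectation_def outer_square_def
    by (simp add: vec_eq_iff) (intro allI transfer(1) continuous_intros)
  have L2: "L2_bounded \<nu> (partial_sum X) = L2_bounded \<nu> (partial_sum Y)"
  proof -
    have c: "continuous_on UNIV (\<lambda>x :: real ^ 'd. (infnorm x)\<^sup>2)" by (intro continuous_intros)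
    show ?thesis unfolding L2_bounded_def by (simp only: transfer[OF c])
  qed
  have scaled: "(\<integral>\<omega>. f ((1 / sqrt (real n)) *\<^sub>R partial_sum X n \<omega>) \<partial>\<nu>) = (\<integral>\<omega>. f ((1 / sqrt (real n)) *\<^sub>R partial_sum Y n \<omega>) \<partial>\<nu>)"
    if f: "continuous_on UNIV f" for f :: "real ^ 'd \<Rightarrow> real" and n
    by (rule transfer(1)[of "\<lambda>x. f ((1 / sqrt (real n)) *\<^sub>R x)"])
      (intro continuous_on_compose2[OF f] continuous_intros, auto)
  obtain P :: "(real ^ 'd) measure" and N :: "real ^ 'd \<Rightarrow> real ^ 'd" and B :: real where
    PN: "prob_space P" "gaussian_rv P N" "(\<integral>\<omega>. N \<omega> \<partial>P) = 0" "covariance_matrix P N = Sigma2"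
    and conv: "converges_in_distribution \<nu> (\<lambda>n \<omega>. (1 / sqrt (real n)) *\<^sub>R partial_sum Y n \<omega>) P N"
    and B: "0 < B" "\<And>n \<psi>. 1 \<le> n \<Longrightarrow> lipschitz_infnorm \<psi> \<Longrightarrow>
       \<bar>(\<integral>\<omega>. \<psi> ((1 / sqrt (real n)) *\<^sub>R partial_sum Y n \<omega>) \<partial>\<nu>) - (\<integral>\<omega>. \<psi> (N \<omega>) \<partial>P)\<bar>
         \<le> B * lipschitz_constant \<psi> / sqrt (real n)"
    using gaussian_limit by blast
  have conv': "converges_in_distribution \<nu> (\<lambda>n \<omega>. (1 / sqrt (real n)) *\<^sub>R partial_sum X n \<omega>) P N"
    using conv by (simp add: converges_in_distribution_def scaled)
  have rate': "\<bar>(\<integral>\<omega>. \<psi> ((1 / sqrt (real n)) *\<^sub>R partial_sum X n \<omega>) \<partial>\<nu>) - (\<integral>\<omega>. \<psi> (N \<omega>) \<partial>P)\<bar>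
         \<le> B * lipschitz_constant \<psi> / sqrt (real n)" if "1 \<le> n" "lipschitz_infnorm \<psi>" for n \<psi>
    using B(2)[OF that] scaled[OF lipschitz_on_continuous_on[OF lipschitz_infnorm_constant[OF that(2)]]] by simp
  show ?thesis
  proof (intro exI[of _ Sigma2] conjI impI)
    show "(\<lambda>n. (1 / real n) *\<^sub>R matrix_expectation \<nu> (\<lambda>\<omega>. outer_square (partial_sum X n \<omega>))) \<longlonglongrightarrow> Sigma2"
      unfolding mat by (rule covariance_limit)
    show "L2_bounded \<nu> (partial_sum X)" if "Sigma2 = 0"
      unfolding L2 by (rule L2_bounded_if_Sigma2_zero[OF that])
    show "\<exists>(P :: (real ^ 'd) measure) (N :: real ^ 'd \<Rightarrow> real ^ 'd).
          prob_space P \<and> gaussian_rv P N \<and> (\<integral>\<omega>. N \<omega> \<partial>P) = 0 \<and> covariance_matrix P N = Sigma2 \<and>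
          converges_in_distribution \<nu> (\<lambda>n \<omega>. (1 / sqrt (real n)) *\<^sub>R partial_sum X n \<omega>) P N \<and>
          (\<exists>B > 0. \<forall>n \<ge> 1. \<forall>\<psi> :: real ^ 'd \<Rightarrow> real. lipschitz_infnorm \<psi> \<longrightarrow>
             \<bar>(\<integral>\<omega>. \<psi> ((1 / sqrt (real n)) *\<^sub>R partial_sum X n \<omega>) \<partial>\<nu>) - (\<integral>\<omega>. \<psi> (N \<omega>) \<partial>P)\<bar>
               \<le> B * lipschitz_constant \<psi> / sqrt (real n))"
      using PN conv' B(1) rate' by blast
  qed
qed

end
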